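(* Let $T>0$, $\Omega_T=[0,T]\times[0,1]$, let $\gamma:[0,1]\to[0,1]$ be measurable and $H\in C^{0,1}(\Omega_T)$. For every $\alpha,\beta\ge0$, the initial value problem $$\begin{cases}\partial_t\rho_t(x)=\Delta\rho_t(x)-\alpha\nabla\big(2\sigma(\rho_t(x))\nabla H_t(x)\big), & (t,x)\in\Omega_T,\\ \nabla\rho_t(0)-2\alpha\,\sigma(\rho_t(0))\nabla H_t(0)=-\beta F^-(\rho_t(0))-\alpha\,\mathfrak p^-(\rho_t(0),H_t(0)), & t\in[0,T],\\ \nabla\rho_t(1)-2\alpha\,\sigma(\rho_t(1))\nabla H_t(1)=\beta F^+(\rho_t(1))+\alpha\,\mathfrak p^+(\rho_t(1),H_t(1)), & t\in[0,T],\\ \rho_0(x)=\gamma(x), & x\in[0,1],\end{cases}$$ has a unique weak solution $\rho$ in $L^2([0,T];H^1([0,1]))$.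
   Context: $\nabla$ and $\Delta$ are the first and second space derivatives. $\sigma(a)=a(1-a)$ for $a\in[0,1]$. Fix $l\in\mathbb N$ and functions $R^\pm:\{0,1\}^l\times\{0,1\}^l\to[0,\infty)$; $\nu_a$ is the Bernoulli product measure on $\{0,1\}^l$ with density $a\in[0,1]$, and, for $a\in[0,1]$, $M\in\mathbb R$, $$F^\pm(a)=\mathbb E_{\nu_a}\Big[\sum_{\xi\in\{0,1\}^l}R^\pm(\eta,\xi)\sum_{x=1}^l(\xi(x)-\eta(x))\Big],$$ $$\mathfrak p^\pm(a,M)=\mathbb E_{\nu_a}\Big[\sum_{\xi\in\{0,1\}^l}R^\pm(\eta,\xi)\Big(\sum_{y=1}^l(\xi(y)-\eta(y))\Big)e^{M\sum_{x=1}^l(\xi(x)-\eta(x))}\Big].$$ $C^{m,n}(\Omega_T)$ is the set of functions $m$ times continuously differentiable in time and $n$ times in space, extended continuously to the boundary. A weak solution is a function $\rho\in L^2([0,T];H^1([0,1]))$ with $0\le\rho\le1$ a.e. such that for every $t\in[0,T]$ and every $G\in C^{1,2}(\Omega_T)$, $$\int_0^1\Big[\rho_tG_t-\gamma G_0-\int_0^t\rho_s\partial_sG_s\,ds\Big]dx=\int_0^t\!\!\int_0^1\{-\nabla\rho_s\nabla G_s+2\alpha\,\sigma(\rho_s)\nabla H_s\nabla G_s\}\,dx\,ds$$ $$\qquad+\int_0^t\big\{[\beta F^-(\rho_s(0))+\alpha\,\mathfrak p^-(\rho_s(0),H_s(0))]G_s(0)+[\beta F^+(\rho_s(1))+\alpha\,\mathfrak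 p^+(\rho_s(1),H_s(1))]G_s(1)\big\}\,ds.$$ *)

theory Defs
  imports "HOL-Probability.Probability"
begin

section \<open>Boundary dynamics\<close>

text \<open>
  The configuration space \<open>{0,1}\<^sup>l\<close>: a configuration is a map from sites to occupation variables,
  where only the sites \<open>1, \<dots>, l\<close> count (the value is \<open>False\<close> at all other sites).
\<close>

type_synonym config = "nat \<Rightarrow> bool"

definition configs :: "nat \<Rightarrow> config set" where
  "configs l = PiE_dflt {1..l} False (\<lambda>_. UNIV)"

definition bernoulli_product :: "nat \<Rightarrow> real \<Rightarrow> config pmf" where
  "bernoulli_product l a = Pi_pmf {1..l} False (\<lambda>_. bernoulli_pmf a)"

definition mass_change :: "nat \<Rightarrow> config \<Rightarrow> config \<Rightarrow> real" where
  "mass_change l \<eta> \<xi> = (\<Sum>x = 1..l. of_bool (\<xi> x) - of_bool (\<eta> x))"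

definition bdry_F :: "nat \<Rightarrow> (config \<Rightarrow> config \<Rightarrow> real) \<Rightarrow> real \<Rightarrow> real" where
  "bdry_F l R a =
     measure_pmf.expectation (bernoulli_product l a)
       (\<lambda>\<eta>. \<Sum>\<xi> \<in> configs l. R \<eta> \<xi> * mass_change l \<eta> \<xi>)"

definition bdry_p :: "nat \<Rightarrow> (config \<Rightarrow> config \<Rightarrow> real) \<Rightarrow> real \<Rightarrow> real \<Rightarrow> real" where
  "bdry_p l R a M =
     measure_pmf.expectation (bernoulli_product l a)
       (\<lambda>\<eta>. \<Sum>\<xi> \<in> configs l. R \<eta> \<xi> * mass_change l \<eta> \<xi> * exp (M * mass_change l \<eta> \<xi>))"

definition mobility :: "real \<Rightarrow> real" where
  "mobility a = a * (1 - a)"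


section \<open>Smooth functions on the space-time cylinder\<close>

text \<open>Functions of time and space are curried, time first.\<close>

definition Omega :: "real \<Rightarrow> (real \<times> real) set" where
  "Omega T = {0..T} \<times> {0..1}"

definition dt :: "(real \<Rightarrow> real \<Rightarrow> real) \<Rightarrow> real \<Rightarrow> real \<Rightarrow> real" where
  "dt f t x = deriv (\<lambda>s. f s x) t"

definition dx :: "(real \<Rightarrow> real \<Rightarrow> real) \<Rightarrow> real \<Rightarrow> real \<Rightarrow> real" where
  "dx f t x = deriv (\<lambda>y. f t y) x"

text \<open>
  \<open>C\<^sup>m\<^sup>,\<^sup>n\<close>: the time derivatives of order at most \<open>m\<close> and the space derivatives of order at most
  \<open>n\<close> exist in the open cylinder and extend continuously to the closed one.  \<open>Dt i\<close> and \<open>Dx j\<close>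
  are these extensions; no mixed derivatives are required.
\<close>

definition C_mn :: "real \<Rightarrow> nat \<Rightarrow> nat \<Rightarrow> (real \<Rightarrow> real \<Rightarrow> real) \<Rightarrow> bool" where
  "C_mn T m n f \<longleftrightarrow>
     (\<exists>Dt Dx :: nat \<Rightarrow> real \<Rightarrow> real \<Rightarrow> real.
        Dt 0 = f \<and> Dx 0 = f \<and>
        (\<forall>i\<le>m. continuous_on (Omega T) (\<lambda>(t, x). Dt i t x)) \<and>
        (\<forall>j\<le>n. continuous_on (Omega T) (\<lambda>(t, x). Dx j t x)) \<and>
        (\<forall>i<m. \<forall>t\<in>{0<..<T}. \<forall>x\<in>{0<..<1}.
           ((\<lambda>s. Dt i s x) has_real_derivative Dt (Suc i) t x) (at t)) \<and>
        (\<forall>j<n. \<forall>t\<in>{0<..<T}. \<forall>x\<in>{0<..<1}.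
           ((\<lambda>y. Dx j t y) has_real_derivative Dx (Suc j) t x) (at x)))"


section \<open>The Sobolev space on the unit interval\<close>

definition test_function :: "(real \<Rightarrow> real) \<Rightarrow> bool" where
  "test_function \<phi> \<longleftrightarrow>
     (\<forall>k x. (deriv ^^ k) \<phi> field_differentiable (at x)) \<and>
     (\<exists>a b. 0 < a \<and> b < 1 \<and> (\<forall>x. x \<notin> {a..b} \<longrightarrow> \<phi> x = 0))"

definition L2 :: "(real \<Rightarrow> real) \<Rightarrow> bool" where
  "L2 f \<longleftrightarrow> f \<in> borel_measurable (lebesgue_on {0..1}) \<and>
            set_integrable lebesgue {0..1} (\<lambda>x. (f x)\<^sup>2)"

definition is_weak_derivative :: "(real \<Rightarrow> real) \<Rightarrow> (real \<Rightarrow> real) \<Rightarrow> bool" where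
  "is_weak_derivative f g \<longleftrightarrow>
     (\<forall>\<phi>. test_function \<phi> \<longrightarrow>
        (LINT x:{0..1}|lebesgue. f x * deriv \<phi> x) = - (LINT x:{0..1}|lebesgue. g x * \<phi> x))"

definition H1 :: "(real \<Rightarrow> real) \<Rightarrow> bool" where
  "H1 f \<longleftrightarrow> L2 f \<and> (\<exists>g. L2 g \<and> is_weak_derivative f g)"

text \<open>The weak gradient is unique up to null sets; we pick a representative.\<close>

definition weak_grad :: "(real \<Rightarrow> real) \<Rightarrow> real \<Rightarrow> real" where
  "weak_grad f = (SOME g. L2 g \<and> is_weak_derivative f g)"

definition H1_norm :: "(real \<Rightarrow> real) \<Rightarrow> real" where
  "H1_norm f = sqrt ((LINT x:{0..1}|lebesgue. (f x)\<^sup>2) + (LINT x:{0..1}|lebesgue. (weak_grad f x)\<^sup>2))"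

text \<open>
  Point values of an \<open>H\<^sup>1\<close> function, in particular its values at the end points \<open>0\<close> and \<open>1\<close>,
  are those of its (unique) continuous representative.
\<close>

definition H1_value :: "(real \<Rightarrow> real) \<Rightarrow> real \<Rightarrow> real" where
  "H1_value f x =
     (THE v. \<exists>h. continuous_on {0..1} h \<and> (AE y in lebesgue_on {0..1}. h y = f y) \<and> h x = v)"

text \<open>
  \<open>L\<^sup>2([0,T]; H\<^sup>1([0,1]))\<close>: square integrable measurable maps from \<open>[0,T]\<close> to \<open>H\<^sup>1\<close>, defined almost
  everywhere.  As \<open>H\<^sup>1\<close> is separable, strong measurability amounts to the measurability of the
  preimages of balls, that is, of the distance to any fixed element.  Elements are represented by
  functions that are also jointly measurable on the cylinder (every equivalence class contains
  such a function), so that statements about almost every \<open>(t, x)\<close> and integrals over time at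
  fixed \<open>x\<close> make sense.
\<close>

definition L2_H1 :: "real \<Rightarrow> (real \<Rightarrow> real \<Rightarrow> real) \<Rightarrow> bool" where
  "L2_H1 T \<rho> \<longleftrightarrow>
     (\<lambda>(t, x). \<rho> t x) \<in> borel_measurable (lebesgue_on (Omega T)) \<and>
     (AE t in lebesgue_on {0..T}. H1 (\<rho> t)) \<and>
     (\<forall>f. H1 f \<longrightarrow> (\<lambda>t. H1_norm (\<lambda>x. \<rho> t x - f x)) \<in> borel_measurable (lebesgue_on {0..T})) \<and>
     set_integrable lebesgue {0..T} (\<lambda>t. (H1_norm (\<rho> t))\<^sup>2)"


section \<open>Weak solutions\<close>

text \<open>
  The weak formulation evaluates \<open>\<rho>\<close> at every time \<open>t\<close>, so \<open>\<rho> t\<close> is required to be integrable for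
  every \<open>t\<close>, not only for almost every one; otherwise its integral would be a dummy value.
  The rates \<open>Rm\<close> and \<open>Rp\<close> act at the left and at the right end point, respectively.
\<close>

definition weak_solution ::
  "real \<Rightarrow> nat \<Rightarrow> (config \<Rightarrow> config \<Rightarrow> real) \<Rightarrow> (config \<Rightarrow> config \<Rightarrow> real) \<Rightarrow> real \<Rightarrow> real
   \<Rightarrow> (real \<Rightarrow> real) \<Rightarrow> (real \<Rightarrow> real \<Rightarrow> real) \<Rightarrow> (real \<Rightarrow> real \<Rightarrow> real) \<Rightarrow> bool" where
  "weak_solution T l Rm Rp \<alpha> \<beta> \<gamma> H \<rho> \<longleftrightarrow>
     L2_H1 T \<rho> \<and>
     (AE (t, x) in lebesgue_on (Omega T). 0 \<le> \<rho> t x \<and> \<rho> t x \<le> 1) \<and>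
     (\<forall>t\<in>{0..T}. set_integrable lebesgue {0..1} (\<rho> t)) \<and>
     (\<forall>t\<in>{0..T}. \<forall>G. C_mn T 1 2 G \<longrightarrow>
        (LINT x:{0..1}|lebesgue.
           \<rho> t x * G t x - \<gamma> x * G 0 x - (LINT s:{0..t}|lebesgue. \<rho> s x * dt G s x))
        = (LINT s:{0..t}|lebesgue. (LINT x:{0..1}|lebesgue.
             - weak_grad (\<rho> s) x * dx G s x
             + 2 * \<alpha> * mobility (\<rho> s x) * dx H s x * dx G s x))
        + (LINT s:{0..t}|lebesgue.
             (\<beta> * bdry_F l Rm (H1_value (\<rho> s) 0) + \<alpha> * bdry_p l Rm (H1_value (\<rho> s) 0) (H s 0)) * G s 0
           + (\<beta> * bdry_F l Rp (H1_value (\<rho> s) 1) + \<alpha> * bdry_p l Rp (H1_value (\<rho> s) 1) (H s 1)) * G s 1))"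

end

theory Submission
  imports Defs
begin

text \<open>
  Everything is done on cosine coefficients.  Testing the weak formulation with
  \<open>exp (- (k \<pi>)\<^sup>2 (t - s)) cos (k \<pi> x)\<close> turns it into the Duhamel formula for the \<open>k\<close>-th coefficient, whose
  forcing consists of the sine coefficient of the bulk flux and of the two boundary currents.  By
  Bessel's inequality and the decay of the kernel, the Duhamel operator maps bounded fluxes to
  absolutely convergent cosine series and is a contraction in a time-weighted supremum norm, for
  Lipschitz fluxes.  This gives uniqueness, and existence of a mild solution once the fluxes have been
  extended to all real densities by clipping.  An energy estimate puts the mild solution into
  \<open>L\<^sup>2([0,T]; H\<^sup>1)\<close>.  Finally it takes values in \<open>[0,1]\<close>, where clipping changes nothing: a convex
  penalty for leaving \<open>[0,1]\<close> cannot grow, since there the mobility vanishes and the boundary currents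
  point inwards (no particle can leave an empty boundary or enter a full one).
\<close>

section \<open>Square integrable functions on the unit interval\<close>

text \<open>Test functions carry no boundary condition, so cosines are admissible, and the nonlinear
  boundary condition enters each coefficient equation as a point source at \<open>0\<close> and
  \<open>1\<close>. Gradients are expanded in sines, which vanish at the end points and leave no
  boundary terms. The obstacle is that neither the point sources nor \<open>k\<close> times the sine
  coefficients of a square integrable flux are summable over \<open>k\<close>; summability must come
  from the heat kernel, at the price of a singularity in the lag. A power
  \<open>\<tau> powr (- \<theta>)\<close> gives summable weights, via Bessel, for
  \<open>\<theta> > 3/4\<close> and is integrable for \<open>\<theta> < 1\<close>; the exponent
  \<open>7/8\<close> is the midpoint. As \<open>\<gamma>\<close> is only measurable, the heat part
  has in general no continuous extension to time \<open>0\<close>, so the unknown of the fixed point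
  problem is the Duhamel part alone. For the bounds \<open>0\<close> and \<open>1\<close>, the
  regularity at hand does not allow differentiating the penalty of the solution in time; this is
  done for the partial sums, and the energy estimate, proved beforehand for the clipped fluxes,
  makes the truncation errors vanish.\<close>

abbreviation I01 :: "real measure" where "I01 \<equiv> lebesgue_on {0..1}"

lemma prob_space_I01: "prob_space I01"
  by (auto intro!: prob_spaceI simp: emeasure_restrict_space)

interpretation I01: prob_space I01
  by (rule prob_space_I01)

lemma space_I01 [simp]: "space I01 = {0..1}"
  by simp

definition ip :: "(real \<Rightarrow> real) \<Rightarrow> (real \<Rightarrow> real) \<Rightarrow> real" where
  "ip f g = (LINT x|I01. f x * g x)"

lemma set_integrable_01: "set_integrable lebesgue {0..1} (f :: real \<Rightarrow> real) \<longleftrightarrow> integrable I01 f"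
  by (simp add: set_integrable_def integrable_restrict_space)

lemma LINT_01: "(LINT x:{0..1}|lebesgue. (f x :: real)) = (LINT x|I01. f x)"
  by (simp add: set_lebesgue_integral_def integral_restrict_space)

lemma set_integrable_Icc: "set_integrable lebesgue {a..b :: real} (f :: real \<Rightarrow> real) \<longleftrightarrow> integrable (lebesgue_on {a..b}) f"
  by (simp add: set_integrable_def integrable_restrict_space)

lemma LINT_Icc: "(LINT x:{a..b :: real}|lebesgue. (f x :: real)) = (LINT x|lebesgue_on {a..b}. f x)"
  by (simp add: set_lebesgue_integral_def integral_restrict_space)

lemma L2_iff: "L2 f \<longleftrightarrow> f \<in> borel_measurable I01 \<and> integrable I01 (\<lambda>x. (f x)\<^sup>2)"
  by (simp add: L2_def set_integrable_01)

lemma L2_measurable [measurable_dest]: "L2 f \<Longrightarrow> f \<in> borel_measurable I01"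
  by (simp add: L2_iff)

lemma L2_mult_integrable:
  assumes "L2 f" "L2 g"
  shows "integrable I01 (\<lambda>x. f x * g x)"
proof (rule Bochner_Integration.integrable_bound)
  show "integrable I01 (\<lambda>x. (f x)\<^sup>2 + (g x)\<^sup>2)" using assms by (simp add: L2_iff)
  show "(\<lambda>x. f x * g x) \<in> borel_measurable I01"
    using assms by (intro borel_measurable_times) (auto simp: L2_iff)
  have "\<bar>a * b\<bar> \<le> a\<^sup>2 + b\<^sup>2" for a b :: real
  proof -
    have "2 * \<bar>a\<bar> * \<bar>b\<bar> \<le> a\<^sup>2 + b\<^sup>2" using sum_squares_bound[of "\<bar>a\<bar>" "\<bar>b\<bar>"] by simp
    moreover have "0 \<le> \<bar>a\<bar> * \<bar>b\<bar>" by simp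
    ultimately show ?thesis unfolding abs_mult by linarith
  qed
  then show "AE x in I01. norm (f x * g x) \<le> norm ((f x)\<^sup>2 + (g x)\<^sup>2)"
    by simp
qed

lemma L2_bounded:
  assumes "f \<in> borel_measurable I01" "AE x in I01. \<bar>f x\<bar> \<le> B"
  shows "L2 f"
proof -
  have "integrable I01 (\<lambda>x. (f x)\<^sup>2)"
  proof (rule I01.integrable_const_bound[where B = "B\<^sup>2"])
    show "AE x in I01. norm ((f x)\<^sup>2) \<le> B\<^sup>2"
      using assms(2) by eventually_elim (simp add: power2_le_iff_abs_le)
  qed (use assms in simp)
  then show ?thesis using assms by (simp add: L2_iff)
qed

lemma continuous_on_measurable_01:
  assumes "continuous_on {0..1} (f :: real \<Rightarrow> real)"
  shows "f \<in> borel_measurable I01"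
  using assms by (intro continuous_imp_measurable_on_sets_lebesgue) auto

lemma continuous_on_bounded_01:
  assumes "continuous_on {a..b} (f :: real \<Rightarrow> real)"
  obtains B where "B > 0" "\<And>x. x \<in> {a..b} \<Longrightarrow> \<bar>f x\<bar> \<le> B"
proof -
  have "bounded (f ` {a..b})"
    by (intro compact_imp_bounded compact_continuous_image assms) auto
  then show ?thesis using that by (auto simp: bounded_pos)
qed

lemma L2_continuous:
  assumes "continuous_on {0..1} f"
  shows "L2 f"
proof -
  obtain B where "\<And>x. x \<in> {0..1} \<Longrightarrow> \<bar>f x\<bar> \<le> B" using continuous_on_bounded_01[OF assms] by metis
  then show ?thesis
    by (intro L2_bounded continuous_on_measurable_01 assms AE_I2) auto
qed

lemma L2_add: "L2 f \<Longrightarrow> L2 g \<Longrightarrow> L2 (\<lambda>x. f x + g x)"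
  using L2_mult_integrable[of f g] by (auto simp: L2_iff power2_sum mult.assoc)

lemma L2_cmult: "L2 f \<Longrightarrow> L2 (\<lambda>x. c * f x)"
  by (auto simp: L2_iff power_mult_distrib)

lemma L2_diff: "L2 f \<Longrightarrow> L2 g \<Longrightarrow> L2 (\<lambda>x. f x - g x)"
  using L2_add[of f "\<lambda>x. -1 * g x"] L2_cmult[of g "-1"] by simp

lemma L2_sum: "finite K \<Longrightarrow> (\<And>k. k \<in> K \<Longrightarrow> L2 (f k)) \<Longrightarrow> L2 (\<lambda>x. \<Sum>k\<in>K. f k x)"
  by (induction K rule: finite_induct) (auto intro: L2_add L2_continuous)

lemma L2_integrable: "L2 f \<Longrightarrow> integrable I01 f"
  using L2_mult_integrable[of f "\<lambda>_. 1"] L2_continuous[of "\<lambda>_. 1"] by simp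

lemma L2_mult_bounded:
  assumes "L2 f" "g \<in> borel_measurable I01" "AE x in I01. \<bar>g x\<bar> \<le> B"
  shows "L2 (\<lambda>x. f x * g x)"
proof -
  have "integrable I01 (\<lambda>x. (f x * g x)\<^sup>2)"
  proof (rule Bochner_Integration.integrable_bound)
    show "integrable I01 (\<lambda>x. B\<^sup>2 * (f x)\<^sup>2)" using assms by (simp add: L2_iff)
    show "(\<lambda>x. (f x * g x)\<^sup>2) \<in> borel_measurable I01"
      using assms by (intro borel_measurable_power borel_measurable_times) (auto simp: L2_iff)
    show "AE x in I01. norm ((f x * g x)\<^sup>2) \<le> norm (B\<^sup>2 * (f x)\<^sup>2)"
      using assms(3)
    proof eventually_elim
      case (elim x)
      then have "(g x)\<^sup>2 \<le> B\<^sup>2" by (simp add: power2_le_iff_abs_le)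
      then show ?case by (simp add: power_mult_distrib mult.commute[of "(f x)\<^sup>2"] mult_right_mono)
    qed
  qed
  moreover have "(\<lambda>x. f x * g x) \<in> borel_measurable I01"
    using assms by (intro borel_measurable_times) (auto simp: L2_iff)
  ultimately show ?thesis by (simp add: L2_iff)
qed

text \<open>Completeness of Lebesgue measure. This is how traces, norms and inner products that
  depend on time become measurable: each agrees almost everywhere with a measurable
  expression.\<close>

lemma measurable_01_AE:
  assumes "f \<in> borel_measurable (lebesgue_on {a..b})" "AE x in lebesgue_on {a..b}. f x = (g x :: real)"
  shows "g \<in> borel_measurable (lebesgue_on {a..b :: real})"
proof -
  have "(\<lambda>x. indicator {a..b} x *\<^sub>R f x) \<in> borel_measurable lebesgue"
    using assms(1) by (subst (asm) borel_measurable_restrict_space_iff) auto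
  moreover have "AE x in lebesgue. indicator {a..b} x *\<^sub>R f x = indicator {a..b} x *\<^sub>R g x"
    using assms(2) by (subst (asm) AE_restrict_space_iff) (auto simp: indicator_def elim!: eventually_mono)
  ultimately have "(\<lambda>x. indicator {a..b} x *\<^sub>R g x) \<in> borel_measurable lebesgue"
    by (rule borel_measurable_AE)
  then show ?thesis by (subst borel_measurable_restrict_space_iff) auto
qed

text \<open>No measurability is assumed: if one integrand is not measurable, neither is the other, and both integrals are \<open>0\<close>.\<close>

lemma integral_cong_AE_Icc:
  fixes f g :: "real \<Rightarrow> real"
  assumes ae: "AE s in lebesgue_on {a..b}. f s = g s"
  shows "(LINT s|lebesgue_on {a..b}. f s) = (LINT s|lebesgue_on {a..b}. g s)"
proof (cases "f \<in> borel_measurable (lebesgue_on {a..b})")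
  case True
  then show ?thesis by (rule integral_cong_AE[OF _ measurable_01_AE[OF True ae] ae])
next
  case False
  have "AE s in lebesgue_on {a..b}. g s = f s" using ae by eventually_elim simp
  then have "g \<notin> borel_measurable (lebesgue_on {a..b})" using False measurable_01_AE by blast
  then show ?thesis using False by (metis borel_measurable_integrable not_integrable_integral_eq)
qed

lemma ip_commute: "ip f g = ip g f"
  by (simp add: ip_def mult.commute)

lemma ip_cmult_left [simp]: "ip (\<lambda>x. c * f x) g = c * ip f g"
  by (simp add: ip_def mult.assoc)

lemma ip_cmult_right [simp]: "ip f (\<lambda>x. c * g x) = c * ip f g"
  using ip_cmult_left ip_commute by metis

lemma ip_add_left: "L2 f \<Longrightarrow> L2 g \<Longrightarrow> L2 h \<Longrightarrow> ip (\<lambda>x. f x + g x) h = ip f h + ip g h"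
  by (simp add: ip_def algebra_simps L2_mult_integrable)

lemma ip_diff_left: "L2 f \<Longrightarrow> L2 g \<Longrightarrow> L2 h \<Longrightarrow> ip (\<lambda>x. f x - g x) h = ip f h - ip g h"
  by (simp add: ip_def algebra_simps L2_mult_integrable)

lemma ip_add_right: "L2 f \<Longrightarrow> L2 g \<Longrightarrow> L2 h \<Longrightarrow> ip h (\<lambda>x. f x + g x) = ip h f + ip h g"
  using ip_add_left ip_commute by metis

lemma ip_diff_right: "L2 f \<Longrightarrow> L2 g \<Longrightarrow> L2 h \<Longrightarrow> ip h (\<lambda>x. f x - g x) = ip h f - ip h g"
  using ip_diff_left ip_commute by metis

lemma ip_sum_right:
  assumes "finite K" "L2 f" "\<And>k. k \<in> K \<Longrightarrow> L2 (g k)"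
  shows "ip f (\<lambda>x. \<Sum>k\<in>K. g k x) = (\<Sum>k\<in>K. ip f (g k))"
  unfolding ip_def sum_distrib_left
  by (rule Bochner_Integration.integral_sum) (use assms L2_mult_integrable in auto)

lemma ip_sum_left:
  assumes "finite K" "L2 f" "\<And>k. k \<in> K \<Longrightarrow> L2 (g k)"
  shows "ip (\<lambda>x. \<Sum>k\<in>K. g k x) f = (\<Sum>k\<in>K. ip (g k) f)"
  using ip_sum_right[OF assms] by (simp add: ip_commute)

lemma ip_self_nonneg [simp]: "ip f f \<ge> 0"
  by (simp add: ip_def)

lemma ip_cong_AE:
  assumes "f \<in> borel_measurable I01" "f' \<in> borel_measurable I01" "g \<in> borel_measurable I01"
    "AE x in I01. f x = f' x"
  shows "ip f g = ip f' g"
  unfolding ip_def using assms by (intro integral_cong_AE) auto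

text \<open>The square norm of \<open>f + c * g\<close> is a nonnegative quadratic in
  \<open>c\<close>; the two cases are whether it degenerates to an affine function.\<close>

lemma ip_CS:
  assumes "L2 f" "L2 g"
  shows "(ip f g)\<^sup>2 \<le> ip f f * ip g g"
proof -
  define A B C where "A = ip f f" and "B = ip f g" and "C = ip g g"
  have *: "0 \<le> A + 2 * c * B + c\<^sup>2 * C" for c
  proof -
    have "ip (\<lambda>x. f x + c * g x) (\<lambda>x. f x + c * g x) = A + 2 * c * B + c\<^sup>2 * C"
      using assms by (simp add: ip_add_left ip_add_right L2_add L2_cmult A_def B_def C_def
        ip_commute[of g f] power2_eq_square algebra_simps)
    then show ?thesis by (metis ip_self_nonneg)
  qed
  show ?thesis
  proof (cases "C = 0")
    case True
    have "B = 0"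
    proof (rule ccontr)
      assume "B \<noteq> 0"
      \<comment> \<open>This \<open>c\<close> makes the affine function equal to
        \<open>-1\<close>.\<close>
      then show False using *[of "-(A + 1) / (2 * B)"] True by (simp add: field_simps)
    qed
    then show ?thesis using A_def B_def C_def True by simp
  next
    case False
    then have "C > 0" using ip_self_nonneg[of g] unfolding C_def by linarith
    \<comment> \<open>The minimiser of the quadratic.\<close>
    have "0 \<le> A + 2 * (- B / C) * B + (- B / C)\<^sup>2 * C" by (rule *)
    also have "\<dots> = (A * C - B\<^sup>2) / C"
      using \<open>C > 0\<close> by (simp add: field_simps power2_eq_square)
    finally show ?thesis using \<open>C > 0\<close> by (simp add: A_def B_def C_def zero_le_divide_iff)
  qed
qed

definition nrm :: "(real \<Rightarrow> real) \<Rightarrow> real" where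
  "nrm f = sqrt (ip f f)"

lemma nrm_nonneg [simp]: "nrm f \<ge> 0"
  by (simp add: nrm_def)

lemma nrm_sq: "(nrm f)\<^sup>2 = ip f f"
  by (simp add: nrm_def)

lemma nrm_sq_integral: "(nrm f)\<^sup>2 = (LINT x|I01. (f x)\<^sup>2)"
  unfolding nrm_sq ip_def by (simp add: power2_eq_square)

lemma ip_abs_le: "L2 f \<Longrightarrow> L2 g \<Longrightarrow> \<bar>ip f g\<bar> \<le> nrm f * nrm g"
  unfolding nrm_def using ip_CS[of f g]
  by (metis real_sqrt_abs real_sqrt_le_mono real_sqrt_mult)

lemma nrm_triangle:
  assumes "L2 f" "L2 g"
  shows "nrm (\<lambda>x. f x + g x) \<le> nrm f + nrm g"
proof -
  have "(nrm (\<lambda>x. f x + g x))\<^sup>2 = (nrm f)\<^sup>2 + 2 * ip f g + (nrm g)\<^sup>2"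
    using assms by (simp add: nrm_sq ip_add_left ip_add_right L2_add ip_commute[of g f])
  also have "\<dots> \<le> (nrm f + nrm g)\<^sup>2"
    using ip_abs_le[OF assms] by (simp add: power2_sum)
  finally show ?thesis by (rule power2_le_imp_le) simp
qed

lemma nrm_diff_triangle:
  assumes "L2 f" "L2 g" "L2 h"
  shows "nrm (\<lambda>x. f x - h x) \<le> nrm (\<lambda>x. f x - g x) + nrm (\<lambda>x. g x - h x)"
  using nrm_triangle[of "\<lambda>x. f x - g x" "\<lambda>x. g x - h x"] assms by (simp add: L2_diff)

lemma nrm_minus_commute: "nrm (\<lambda>x. f x - g x) = nrm (\<lambda>x. g x - f x)"
  unfolding nrm_def ip_def by (metis (no_types, lifting) minus_diff_eq minus_mult_minus)

text \<open>Cauchy-Schwarz against the constant \<open>1\<close>, whose norm is \<open>1\<close>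
  because the interval has length one.\<close>

lemma L1_le_nrm:
  assumes "L2 f"
  shows "(LINT x|I01. \<bar>f x\<bar>) \<le> nrm f"
proof -
  have "L2 (\<lambda>x. \<bar>f x\<bar>)" using assms by (auto simp: L2_iff)
  moreover have "L2 (\<lambda>_. 1)" by (intro L2_continuous) auto
  ultimately have "\<bar>ip (\<lambda>x. \<bar>f x\<bar>) (\<lambda>_. 1)\<bar> \<le> nrm (\<lambda>x. \<bar>f x\<bar>) * nrm (\<lambda>_. 1)"
    by (rule ip_abs_le)
  moreover have "nrm (\<lambda>_. 1) = 1" "nrm (\<lambda>x. \<bar>f x\<bar>) = nrm f"
    using I01.prob_space by (simp_all add: nrm_def ip_def)
  ultimately show ?thesis by (simp add: ip_def)
qed

lemma nrm_le_bound:
  assumes "f \<in> borel_measurable I01" "AE x in I01. \<bar>f x\<bar> \<le> B" "B \<ge> 0"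
  shows "nrm f \<le> B"
proof -
  have "ip f f \<le> (LINT x|I01. B\<^sup>2)"
    unfolding ip_def
  proof (rule integral_mono_AE)
    show "integrable I01 (\<lambda>x. f x * f x)" using L2_mult_integrable L2_bounded assms by blast
    show "AE x in I01. f x * f x \<le> B\<^sup>2"
      using assms(2) by eventually_elim (metis power2_eq_square power2_le_iff_abs_le assms(3))
  qed simp
  also have "\<dots> = B\<^sup>2" using I01.prob_space by simp
  finally show ?thesis unfolding nrm_def using assms(3) by (simp add: real_le_lsqrt)
qed

subsection \<open>Completeness\<close>

text \<open>Along a subsequence with increments below \<open>(1/2)^j\<close> the telescoping series
  converges absolutely almost everywhere, which gives the limit; Fatou's lemma then turns the Cauchy
  bound into convergence of the whole sequence.\<close>

lemma L2_complete:
  assumes S: "\<And>n. L2 (S n)"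
    and Cauchy: "\<And>e. e > 0 \<Longrightarrow> \<exists>N. \<forall>m\<ge>N. \<forall>n\<ge>N. nrm (\<lambda>x. S m x - S n x) < e"
  shows "\<exists>f. L2 f \<and> (\<lambda>n. nrm (\<lambda>x. S n x - f x)) \<longlonglongrightarrow> 0"
proof -
  have "\<exists>r. strict_mono r \<and> (\<forall>j m n. m \<ge> r j \<longrightarrow> n \<ge> r j \<longrightarrow> nrm (\<lambda>x. S m x - S n x) < (1/2)^j)"
  proof -
    have "\<forall>j. \<exists>N. \<forall>m\<ge>N. \<forall>n\<ge>N. nrm (\<lambda>x. S m x - S n x) < (1/2)^j" using Cauchy by simp
    then obtain N where N: "\<And>j m n. m \<ge> N j \<Longrightarrow> n \<ge> N j \<Longrightarrow> nrm (\<lambda>x. S m x - S n x) < (1/2)^j"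
      by metis
    \<comment> \<open>Summing makes the index strictly increasing while it still dominates
      \<open>N j\<close>.\<close>
    define r where "r j = (\<Sum>i\<le>j. Suc (N i))" for j
    have "strict_mono r" unfolding r_def by (rule strict_monoI_Suc) simp
    moreover have "N j \<le> r j" for j
      unfolding r_def by (rule order_trans[OF _ member_le_sum[of j]]) auto
    ultimately show ?thesis using N by (intro exI[of _ r]) (meson order_trans)
  qed
  then obtain r where r: "strict_mono r"
    and rS: "\<And>j m n. m \<ge> r j \<Longrightarrow> n \<ge> r j \<Longrightarrow> nrm (\<lambda>x. S m x - S n x) < (1/2)^j" by blast
  define D where "D j x = S (r (Suc j)) x - S (r j) x" for j x
  have L2D: "L2 (D j)" for j unfolding D_def by (intro L2_diff S)
  have D1: "(LINT x|I01. \<bar>D j x\<bar>) \<le> (1/2)^j" for j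
    using L1_le_nrm[OF L2D[of j]] rS[of j "r (Suc j)" "r j"] strict_monoD[OF r, of j "Suc j"]
    unfolding D_def by force
  have [measurable]: "S n \<in> borel_measurable I01" "D n \<in> borel_measurable I01" for n
    using S L2D by (auto simp: L2_iff)
  have "(\<integral>\<^sup>+x. (\<Sum>j. ennreal \<bar>D j x\<bar>) \<partial>I01) = (\<Sum>j. \<integral>\<^sup>+x. ennreal \<bar>D j x\<bar> \<partial>I01)"
    by (rule nn_integral_suminf) auto
  also have "\<dots> = (\<Sum>j. ennreal (LINT x|I01. \<bar>D j x\<bar>))"
    by (intro suminf_cong nn_integral_eq_integral) (auto intro!: integrable_abs L2_integrable[OF L2D])
  also have "\<dots> \<le> (\<Sum>j. ennreal ((1/2)^j))"
    by (intro suminf_le summableI) (use D1 in \<open>auto intro: ennreal_leI\<close>)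
  also have "\<dots> = ennreal (\<Sum>j. (1/2)^j)"
    by (intro suminf_ennreal2) (auto intro: summable_geometric)
  finally have "(\<integral>\<^sup>+x. (\<Sum>j. ennreal \<bar>D j x\<bar>) \<partial>I01) \<noteq> \<infinity>" by (auto simp: top_unique)
  then have "AE x in I01. (\<Sum>j. ennreal \<bar>D j x\<bar>) \<noteq> \<infinity>"
    by (intro nn_integral_PInf_AE) auto
  then have conv: "AE x in I01. (\<lambda>j. S (r j) x) \<longlonglongrightarrow> lim (\<lambda>j. S (r j) x)"
  proof eventually_elim
    case (elim x)
    have "summable (\<lambda>j. \<bar>D j x\<bar>)" by (rule summable_suminf_not_top) (use elim in auto)
    then have "summable (\<lambda>j. D j x)" by (rule summable_rabs_cancel)
    then have "convergent (\<lambda>n. \<Sum>j<n. D j x)" by (simp add: summable_iff_convergent)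
    moreover have "(\<Sum>j<n. D j x) = S (r n) x - S (r 0) x" for n
      unfolding D_def by (rule sum_lessThan_telescope)
    ultimately have "convergent (\<lambda>n. (S (r n) x - S (r 0) x) + S (r 0) x)"
      by (intro convergent_add convergent_const) simp
    then show ?case by (simp add: convergent_LIMSEQ_iff)
  qed
  \<comment> \<open>\<open>lim\<close> is total, so \<open>f\<close> is measurable also across the
    null set where the subsequence diverges.\<close>
  define f where "f x = lim (\<lambda>j. S (r j) x)" for x
  have f[measurable]: "f \<in> borel_measurable I01" unfolding f_def by measurable
  have bound: "(\<integral>\<^sup>+x. ennreal ((S n x - f x)\<^sup>2) \<partial>I01) \<le> ennreal (((1/2)^i)\<^sup>2)" if "n \<ge> r i" for n i
  proof -
    have "(\<integral>\<^sup>+x. ennreal ((S n x - f x)\<^sup>2) \<partial>I01) = (\<integral>\<^sup>+x. liminf (\<lambda>j. ennreal ((S n x - S (r j) x)\<^sup>2)) \<partial>I01)"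
    proof (rule nn_integral_cong_AE)
      show "AE x in I01. ennreal ((S n x - f x)\<^sup>2) = liminf (\<lambda>j. ennreal ((S n x - S (r j) x)\<^sup>2))"
        using conv
      proof eventually_elim
        case (elim x)
        have "(\<lambda>j. ennreal ((S n x - S (r j) x)\<^sup>2)) \<longlonglongrightarrow> ennreal ((S n x - f x)\<^sup>2)"
          unfolding f_def by (intro tendsto_ennrealI tendsto_intros elim)
        from lim_imp_Liminf[OF sequentially_bot this] show ?case by simp
      qed
    qed
    \<comment> \<open>Fatou's lemma along the subsequence.\<close>
    also have "\<dots> \<le> liminf (\<lambda>j. \<integral>\<^sup>+x. ennreal ((S n x - S (r j) x)\<^sup>2) \<partial>I01)"
      by (rule nn_integral_liminf) auto
    also have "\<dots> \<le> ennreal (((1/2)^i)\<^sup>2)"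
    proof (rule Liminf_le[OF sequentially_bot])
      have "(\<integral>\<^sup>+x. ennreal ((S n x - S (r j) x)\<^sup>2) \<partial>I01) \<le> ennreal (((1/2)^i)\<^sup>2)" if "j \<ge> i" for j
      proof -
        have "L2 (\<lambda>x. S n x - S (r j) x)" by (intro L2_diff S)
        then have "(\<integral>\<^sup>+x. ennreal ((S n x - S (r j) x)\<^sup>2) \<partial>I01) = ennreal ((nrm (\<lambda>x. S n x - S (r j) x))\<^sup>2)"
          by (subst nn_integral_eq_integral) (auto simp: L2_iff nrm_sq_integral)
        also have "\<dots> \<le> ennreal (((1/2)^i)\<^sup>2)"
          using rS[of i n "r j"] \<open>n \<ge> r i\<close> \<open>j \<ge> i\<close> strict_mono_leD[OF r]
          by (intro ennreal_leI power_mono) (auto intro: less_imp_le)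
        finally show ?thesis .
      qed
      then show "\<forall>\<^sub>F j in sequentially. (\<integral>\<^sup>+x. ennreal ((S n x - S (r j) x)\<^sup>2) \<partial>I01) \<le> ennreal (((1/2)^i)\<^sup>2)"
        by (auto simp: eventually_sequentially)
    qed
    finally show ?thesis .
  qed
  have diff: "L2 (\<lambda>x. S n x - f x) \<and> nrm (\<lambda>x. S n x - f x) \<le> (1/2)^i" if "n \<ge> r i" for n i
  proof
    have "integrable I01 (\<lambda>x. (S n x - f x)\<^sup>2)"
      using bound[OF that] by (intro integrableI_bounded) (auto intro: le_less_trans)
    then show L: "L2 (\<lambda>x. S n x - f x)" by (auto simp: L2_iff)
    then have "ennreal ((nrm (\<lambda>x. S n x - f x))\<^sup>2) \<le> ennreal (((1/2)^i)\<^sup>2)"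
      using bound[OF that] by (subst (asm) nn_integral_eq_integral)
        (auto simp: L2_iff nrm_sq_integral)
    then have "(nrm (\<lambda>x. S n x - f x))\<^sup>2 \<le> ((1/2)^i)\<^sup>2" by (subst (asm) ennreal_le_iff) auto
    then show "nrm (\<lambda>x. S n x - f x) \<le> (1/2)^i" by (rule power2_le_imp_le) simp
  qed
  have "L2 f"
    using L2_diff[OF S[of "r 0"] conjunct1[OF diff[of 0 "r 0"]]] by simp
  moreover have "(\<lambda>n. nrm (\<lambda>x. S n x - f x)) \<longlonglongrightarrow> 0"
  proof (rule LIMSEQ_I)
    fix e :: real assume "e > 0"
    then obtain i where i: "(1/2)^i < e" using real_arch_pow_inv[of e "1/2"] by auto
    then show "\<exists>no. \<forall>n\<ge>no. norm (nrm (\<lambda>x. S n x - f x) - 0) < e"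
      using diff[of i] by (intro exI[of _ "r i"]) (auto intro: le_less_trans)
  qed
  ultimately show ?thesis by blast
qed

lemma nrm_diff_ip_tendsto:
  assumes "\<And>n. L2 (S n)" "L2 f" "L2 g" "(\<lambda>n. nrm (\<lambda>x. S n x - f x)) \<longlonglongrightarrow> 0"
  shows "(\<lambda>n. ip (S n) g) \<longlonglongrightarrow> ip f g"
proof -
  have "(\<lambda>n. nrm (\<lambda>x. S n x - f x) * nrm g) \<longlonglongrightarrow> 0"
    using tendsto_mult_left_zero[OF assms(4)] .
  then have "(\<lambda>n. ip (S n) g - ip f g) \<longlonglongrightarrow> 0"
  proof (rule Lim_null_comparison[rotated])
    have "norm (ip (S n) g - ip f g) \<le> nrm (\<lambda>x. S n x - f x) * nrm g" for n
      using ip_abs_le[OF L2_diff[OF assms(1)[of n] assms(2)] assms(3)] assms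
      by (simp add: ip_diff_left)
    then show "\<forall>\<^sub>F n in sequentially. norm (ip (S n) g - ip f g) \<le> nrm (\<lambda>x. S n x - f x) * nrm g" by simp
  qed
  then show ?thesis by (simp add: LIM_zero_iff)
qed

subsection \<open>Orthonormal bases\<close>

text \<open>Completeness is stated as maximality, the form in which it is proved for both
  trigonometric systems; convergence of Fourier series and Parseval's identity are then consequences
  of Riesz-Fischer.\<close>

locale onb =
  fixes e :: "nat \<Rightarrow> real \<Rightarrow> real"
  assumes L2_e: "L2 (e k)"
    and ortho: "ip (e j) (e k) = (if j = k then 1 else 0)"
    and complete: "L2 f \<Longrightarrow> (\<And>k. ip f (e k) = 0) \<Longrightarrow> AE x in I01. f x = 0"
begin

lemma L2_partial: "finite K \<Longrightarrow> L2 (\<lambda>x. \<Sum>k\<in>K. a k * e k x)"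
  by (intro L2_sum L2_cmult L2_e)

lemma ip_partial:
  assumes "finite K"
  shows "ip (\<lambda>x. \<Sum>k\<in>K. a k * e k x) (e j) = (if j \<in> K then a j else 0)"
proof -
  have "ip (\<lambda>x. \<Sum>k\<in>K. a k * e k x) (e j) = (\<Sum>k\<in>K. a k * (if k = j then 1 else 0))"
    using assms by (simp add: ip_sum_left L2_cmult L2_e ortho)
  also have "\<dots> = (if j \<in> K then a j else 0)"
    using assms by (simp add: if_distrib cong: if_cong)
  finally show ?thesis .
qed

lemma ip_partial_self:
  assumes "finite K"
  shows "ip (\<lambda>x. \<Sum>k\<in>K. a k * e k x) (\<lambda>x. \<Sum>k\<in>K. a k * e k x) = (\<Sum>k\<in>K. (a k)\<^sup>2)"
proof -
  have "ip (\<lambda>x. \<Sum>k\<in>K. a k * e k x) (\<lambda>x. \<Sum>k\<in>K. a k * e k x)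
      = (\<Sum>k\<in>K. a k * ip (\<lambda>x. \<Sum>k\<in>K. a k * e k x) (e k))"
    using assms by (subst ip_sum_right) (auto simp: L2_partial L2_cmult L2_e)
  also have "\<dots> = (\<Sum>k\<in>K. (a k)\<^sup>2)"
    using assms by (intro sum.cong) (auto simp: ip_partial power2_eq_square)
  finally show ?thesis .
qed

lemma bessel:
  assumes "L2 f" "finite K"
  shows "(\<Sum>k\<in>K. (ip f (e k))\<^sup>2) \<le> ip f f"
proof -
  let ?S = "\<lambda>x. \<Sum>k\<in>K. ip f (e k) * e k x"
  have S: "L2 ?S" using assms by (intro L2_partial)
  have "ip f ?S = (\<Sum>k\<in>K. (ip f (e k))\<^sup>2)"
    using assms by (subst ip_sum_right) (auto simp: L2_cmult L2_e power2_eq_square)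
  moreover have "ip (\<lambda>x. f x - ?S x) (\<lambda>x. f x - ?S x) = ip f f - 2 * ip f ?S + ip ?S ?S"
    using assms S by (simp add: ip_diff_left ip_diff_right L2_diff ip_commute[of ?S f])
  ultimately have "0 \<le> ip f f - (\<Sum>k\<in>K. (ip f (e k))\<^sup>2)"
    using ip_self_nonneg[of "\<lambda>x. f x - ?S x"] ip_partial_self[OF assms(2), of "\<lambda>k. ip f (e k)"] by simp
  then show ?thesis by simp
qed

lemma summable_sq: "L2 f \<Longrightarrow> summable (\<lambda>k. (ip f (e k))\<^sup>2)"
  by (rule bounded_imp_summable[where B = "ip f f"]) (auto intro!: bessel)

text \<open>By orthonormality the partial sums are Cauchy exactly as the series of squares is; mean
  square convergence carries each coefficient to the limit.\<close>

lemma riesz_fischer: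
  assumes "summable (\<lambda>k. (a k)\<^sup>2)"
  shows "\<exists>f. L2 f \<and> (\<forall>k. ip f (e k) = a k) \<and> (\<lambda>n. nrm (\<lambda>x. (\<Sum>k<n. a k * e k x) - f x)) \<longlonglongrightarrow> 0"
proof -
  define S where "S n x = (\<Sum>k<n. a k * e k x)" for n x
  have L2S: "L2 (S n)" for n unfolding S_def by (intro L2_partial) simp
  have *: "(nrm (\<lambda>x. S m x - S n x))\<^sup>2 = (\<Sum>k=n..<m. (a k)\<^sup>2)" if "n \<le> m" for m n
  proof -
    have "S m x - S n x = (\<Sum>k=n..<m. a k * e k x)" for x
      unfolding S_def using that by (simp add: sum_diff_nat_ivl atLeast0LessThan[symmetric])
    then show ?thesis by (simp add: nrm_sq ip_partial_self)
  qed
  have "\<exists>f. L2 f \<and> (\<lambda>n. nrm (\<lambda>x. S n x - f x)) \<longlonglongrightarrow> 0"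
  proof (rule L2_complete[OF L2S])
    fix d :: real assume "d > 0"
    then obtain N where N: "\<And>m n. m \<ge> N \<Longrightarrow> norm (\<Sum>k=m..<n. (a k)\<^sup>2) < d\<^sup>2"
      using assms[unfolded summable_Cauchy] by (metis zero_less_power)
    have le: "nrm (\<lambda>x. S m x - S n x) < d" if "n \<ge> N" "n \<le> m" for m n
      using N[OF that(1), of m] \<open>d > 0\<close> unfolding *[OF that(2), symmetric]
      by (intro power2_less_imp_less[of _ d]) auto
    show "\<exists>N. \<forall>m\<ge>N. \<forall>n\<ge>N. nrm (\<lambda>x. S m x - S n x) < d"
    proof (intro exI[of _ N] allI impI)
      fix m n assume "N \<le> m" "N \<le> n"
      then show "nrm (\<lambda>x. S m x - S n x) < d"
        using le[of n m] le[of m n] nrm_minus_commute[of "S m" "S n"] by (cases "n \<le> m") auto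
    qed
  qed
  then obtain f where f: "L2 f" "(\<lambda>n. nrm (\<lambda>x. S n x - f x)) \<longlonglongrightarrow> 0" by blast
  have "ip f (e k) = a k" for k
  proof (rule LIMSEQ_unique)
    show "(\<lambda>n. ip (S n) (e k)) \<longlonglongrightarrow> ip f (e k)" by (rule nrm_diff_ip_tendsto[OF L2S f(1) L2_e f(2)])
    have "\<forall>\<^sub>F n in sequentially. ip (S n) (e k) = a k"
      using eventually_gt_at_top[of k]
    proof eventually_elim
      case (elim n)
      have "S n = (\<lambda>x. \<Sum>k<n. a k * e k x)" by (simp add: S_def fun_eq_iff)
      then show ?case using elim by (simp add: ip_partial)
    qed
    then show "(\<lambda>n. ip (S n) (e k)) \<longlonglongrightarrow> a k" by (rule tendsto_eventually)
  qed
  with f show ?thesis unfolding S_def by blast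
qed

lemma eq_AE:
  assumes "L2 f" "L2 g" "\<And>k. ip f (e k) = ip g (e k)"
  shows "AE x in I01. f x = g x"
proof -
  have "AE x in I01. f x - g x = 0"
    by (rule complete) (use assms in \<open>auto simp: L2_diff ip_diff_left L2_e\<close>)
  then show ?thesis by eventually_elim simp
qed

text \<open>The Riesz-Fischer function with the coefficients of \<open>f\<close> has to be
  \<open>f\<close>, by maximality.\<close>

lemma fourier_converges:
  assumes "L2 f"
  shows "(\<lambda>n. nrm (\<lambda>x. (\<Sum>k<n. ip f (e k) * e k x) - f x)) \<longlonglongrightarrow> 0"
proof -
  obtain g where g: "L2 g" "\<And>k. ip g (e k) = ip f (e k)"
    "(\<lambda>n. nrm (\<lambda>x. (\<Sum>k<n. ip f (e k) * e k x) - g x)) \<longlonglongrightarrow> 0"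
    using riesz_fischer[OF summable_sq[OF assms]] by blast
  have [measurable]: "f \<in> borel_measurable I01" "g \<in> borel_measurable I01" "e k \<in> borel_measurable I01" for k
    using assms g L2_e by (auto simp: L2_iff)
  have ae: "AE x in I01. g x = f x" by (rule eq_AE) (use assms g in auto)
  have "nrm (\<lambda>x. (\<Sum>k<n. ip f (e k) * e k x) - f x) = nrm (\<lambda>x. (\<Sum>k<n. ip f (e k) * e k x) - g x)" for n
    unfolding nrm_def ip_def
    by (intro arg_cong[where f = sqrt] integral_cong_AE) (use ae in auto)
  then show ?thesis using g(3) by simp
qed

lemma parseval:
  assumes "L2 f" "L2 g"
  shows "(\<lambda>k. ip f (e k) * ip g (e k)) sums ip f g"
proof -
  have "(\<lambda>n. ip (\<lambda>x. \<Sum>k<n. ip f (e k) * e k x) g) \<longlonglongrightarrow> ip f g"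
    by (rule nrm_diff_ip_tendsto) (use assms in \<open>auto intro: L2_partial fourier_converges\<close>)
  moreover have "ip (\<lambda>x. \<Sum>k<n. ip f (e k) * e k x) g = (\<Sum>k<n. ip f (e k) * ip g (e k))" for n
    using assms by (subst ip_sum_left) (auto simp: L2_cmult L2_e ip_commute[of g])
  ultimately show ?thesis by (simp add: sums_def)
qed

lemma parseval_self: "L2 f \<Longrightarrow> (\<lambda>k. (ip f (e k))\<^sup>2) sums ip f f"
  using parseval[of f f] by (simp add: power2_eq_square)

end

section \<open>The Neumann and Dirichlet eigenfunctions\<close>

definition cs :: "nat \<Rightarrow> real \<Rightarrow> real" where
  "cs k x = (if k = 0 then 1 else sqrt 2 * cos (real k * pi * x))"

text \<open>Indexed so that \<open>cs k\<close> and \<open>sn k\<close> are exchanged by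
  differentiation with the same factor \<open>real k * pi\<close>; the price is that
  \<open>sn 0\<close> is the zero function and the sine basis starts at index
  \<open>1\<close>.\<close>

definition sn :: "nat \<Rightarrow> real \<Rightarrow> real" where
  "sn k x = sqrt 2 * sin (real k * pi * x)"

definition kap :: "nat \<Rightarrow> real" where
  "kap k = (real k * pi)\<^sup>2"

lemma kap_0 [simp]: "kap 0 = 0" and kap_nonneg [simp]: "kap k \<ge> 0"
  by (simp_all add: kap_def)

lemma kap_ge_1: "k > 0 \<Longrightarrow> kap k \<ge> 1"
proof -
  assume "k > 0"
  then have "1 * 1 \<le> real k * pi" by (intro mult_mono) (use pi_ge_two in auto)
  then show ?thesis unfolding kap_def by (metis one_le_power mult_1)
qed

lemma sn_0 [simp]: "sn 0 x = 0" and sn_at_0 [simp]: "sn k 0 = 0" and sn_at_1 [simp]: "sn k 1 = 0"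
  by (simp_all add: sn_def)

lemma DERIV_cs [derivative_intros]:
  "(cs k has_real_derivative - (real k * pi) * sn k x) (at x within A)"
proof (cases "k = 0")
  case True
  then have "cs k = (\<lambda>_. 1)" by (auto simp: cs_def)
  then show ?thesis using True by simp
next
  case False
  then have "cs k = (\<lambda>x. sqrt 2 * cos (real k * pi * x))" by (auto simp: cs_def)
  then show ?thesis unfolding sn_def by (auto intro!: derivative_eq_intros)
qed

lemma DERIV_sn [derivative_intros]:
  "(sn k has_real_derivative (real k * pi) * cs k x) (at x within A)"
proof -
  have "((\<lambda>x. sqrt 2 * sin (real k * pi * x)) has_real_derivative (real k * pi) * cs k x) (at x within A)"
    unfolding cs_def by (auto intro!: derivative_eq_intros)
  then show ?thesis by (simp add: sn_def[abs_def])
qed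

lemma continuous_on_cs [continuous_intros]:
  fixes f :: "'a::metric_space \<Rightarrow> real"
  shows "continuous_on A f \<Longrightarrow> continuous_on A (\<lambda>x. cs k (f x))"
  by (cases "k = 0") (auto simp: cs_def intro!: continuous_intros)

lemma continuous_on_sn [continuous_intros]:
  fixes f :: "'a::metric_space \<Rightarrow> real"
  shows "continuous_on A f \<Longrightarrow> continuous_on A (\<lambda>x. sn k (f x))"
  by (auto simp: sn_def intro!: continuous_intros)

lemma cs_bound: "\<bar>cs k x\<bar> \<le> sqrt 2"
  using mult_left_mono[OF abs_cos_le_one, of "sqrt 2" "real k * pi * x"]
  by (auto simp: cs_def abs_mult)

lemma sn_bound: "\<bar>sn k x\<bar> \<le> sqrt 2"
  using mult_left_mono[OF abs_sin_le_one, of "sqrt 2" "real k * pi * x"]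
  by (auto simp: sn_def abs_mult)

lemma L2_cs [simp]: "L2 (cs k)" and L2_sn [simp]: "L2 (sn k)"
  by (auto intro!: L2_continuous continuous_intros)

lemma FTC_Icc:
  fixes F f :: "real \<Rightarrow> real"
  assumes "a \<le> b" "continuous_on {a..b} F"
    and "\<And>x. x \<in> {a<..<b} \<Longrightarrow> (F has_real_derivative f x) (at x)"
    and "integrable (lebesgue_on {a..b}) f"
  shows "(LINT x|lebesgue_on {a..b}. f x) = F b - F a"
proof -
  have "(f has_integral F b - F a) {a..b}"
    using assms by (intro fundamental_theorem_of_calculus_interior)
      (auto simp: has_real_derivative_iff_has_vector_derivative)
  moreover have "(LINT x|lebesgue_on {a..b}. f x) = integral {a..b} f"
    using assms by (intro lebesgue_integral_eq_integral) auto
  ultimately show ?thesis by (simp add: integral_unique)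
qed

lemma integrable_continuous_Icc:
  assumes "continuous_on {a..b} (f :: real \<Rightarrow> real)"
  shows "integrable (lebesgue_on {a..b}) f"
  using continuous_imp_integrable_real[OF assms] .

lemma by_parts_I01:
  assumes F: "continuous_on {0..1} F" "continuous_on {0..1} F'"
      "\<And>x. x \<in> {0<..<1} \<Longrightarrow> (F has_real_derivative F' x) (at x)"
    and G: "continuous_on {0..1} G" "continuous_on {0..1} G'"
      "\<And>x. x \<in> {0<..<1} \<Longrightarrow> (G has_real_derivative G' x) (at x)"
  shows "ip F' G = F 1 * G 1 - F 0 * G 0 - ip F G'"
proof -
  have "(LINT x|I01. F' x * G x + F x * G' x) = F 1 * G 1 - F 0 * G 0"
    by (rule FTC_Icc[where F = "\<lambda>x. F x * G x"])
      (auto intro!: derivative_eq_intros continuous_intros integrable_continuous_Icc F G simp del: greaterThanLessThan_iff)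
  moreover have "(LINT x|I01. F' x * G x + F x * G' x) = ip F' G + ip F G'"
    unfolding ip_def
    by (intro Bochner_Integration.integral_add L2_mult_integrable L2_continuous F G)
  ultimately show ?thesis by simp
qed

text \<open>The sine coefficients of a function with this property are those of the derivative.\<close>

definition grad_coeff :: "(nat \<Rightarrow> real) \<Rightarrow> (real \<Rightarrow> real) \<Rightarrow> bool" where
  "grad_coeff a h \<longleftrightarrow> L2 h \<and> (\<forall>k. ip h (sn k) = - (real k * pi) * a k)"

text \<open>Sines vanish at both end points, so integration by parts leaves no boundary term
  whatever the boundary values of \<open>g\<close> are.\<close>

lemma grad_coeff_C1:
  assumes "continuous_on {0..1} g" "continuous_on {0..1} g'"
      "\<And>x. x \<in> {0<..<1} \<Longrightarrow> (g has_real_derivative g' x) (at x)"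
  shows "grad_coeff (\<lambda>k. ip g (cs k)) g'"
proof -
  have "ip g' (sn k) = - (real k * pi) * ip g (cs k)" for k
  proof -
    have "ip g' (sn k) = g 1 * sn k 1 - g 0 * sn k 0 - ip g (\<lambda>x. real k * pi * cs k x)"
      by (rule by_parts_I01[OF assms]) (auto intro!: continuous_intros DERIV_sn)
    then show ?thesis by simp
  qed
  then show ?thesis using assms by (auto simp: grad_coeff_def L2_continuous)
qed

lemma integral_cos_int:
  "(LINT x|I01. cos (real_of_int m * pi * x)) = (if m = 0 then 1 else 0)"
proof (cases "m = 0")
  case True
  then show ?thesis using I01.prob_space by simp
next
  case False
  have "(LINT x|I01. cos (real_of_int m * pi * x))
      = sin (real_of_int m * pi * 1) / (real_of_int m * pi) - sin (real_of_int m * pi * 0) / (real_of_int m * pi)"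
    by (rule FTC_Icc) (use False in \<open>auto intro!: derivative_eq_intros continuous_intros integrable_continuous_Icc\<close>)
  also have "\<dots> = 0" using sin_npi_int[of m] by (simp add: mult.commute)
  finally show ?thesis using False by simp
qed

lemma ip_cs: "ip (cs j) (cs k) = (if j = k then 1 else 0)"
proof -
  have *: "ip (cs j) (cs k) = (if j = k then 1 else 0)" if "j \<noteq> 0" "k \<noteq> 0" for j k
  proof -
    have "cs j x * cs k x = cos (real_of_int (int j - int k) * pi * x) + cos (real_of_int (int j + int k) * pi * x)" for x
    proof -
      have "cs j x * cs k x = 2 * (cos (real j * pi * x) * cos (real k * pi * x))"
        using that by (simp add: cs_def)
      then show ?thesis by (simp add: cos_times_cos algebra_simps)
    qed
    then have "ip (cs j) (cs k) = (LINT x|I01. cos (real_of_int (int j - int k) * pi * x)) + (LINT x|I01. cos (real_of_int (int j + int k) * pi * x))"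
      unfolding ip_def by (simp only:) (intro Bochner_Integration.integral_add integrable_continuous_Icc continuous_intros)
    then show ?thesis using that unfolding integral_cos_int by simp
  qed
  have **: "ip (cs 0) (cs k) = (if k = 0 then 1 else 0)" for k
    using integral_cos_int[of "int k"] I01.prob_space by (auto simp: ip_def cs_def)
  show ?thesis
    using *[of j k] **[of k] **[of j] ip_commute[of "cs j" "cs 0"] by (cases "j = 0"; cases "k = 0") auto
qed

lemma ip_sn: "j \<noteq> 0 \<Longrightarrow> k \<noteq> 0 \<Longrightarrow> ip (sn j) (sn k) = (if j = k then 1 else 0)"
proof -
  assume that: "j \<noteq> 0" "k \<noteq> 0"
  have "sn j x * sn k x = cos (real_of_int (int j - int k) * pi * x) - cos (real_of_int (int j + int k) * pi * x)" for x
  proof -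
    have "sn j x * sn k x = 2 * (sin (real j * pi * x) * sin (real k * pi * x))"
      by (simp add: sn_def)
    then show ?thesis by (simp add: sin_times_sin algebra_simps)
  qed
  then have "ip (sn j) (sn k) = (LINT x|I01. cos (real_of_int (int j - int k) * pi * x) - cos (real_of_int (int j + int k) * pi * x))"
    unfolding ip_def by presburger
  also have "\<dots> = (LINT x|I01. cos (real_of_int (int j - int k) * pi * x)) - (LINT x|I01. cos (real_of_int (int j + int k) * pi * x))"
    by (rule Bochner_Integration.integral_diff; rule integrable_continuous_Icc)
      (auto intro!: continuous_on_cos continuous_on_mult continuous_on_const continuous_on_id)
  finally show ?thesis using that unfolding integral_cos_int by simp
qed

lemma AE_I01_interior: "AE x in I01. x \<in> {0<..<1}"
proof -
  have "AE x in lebesgue. x \<notin> {0, 1::real}"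
    by (rule AE_not_in) (simp add: negligible_iff_null_sets[symmetric])
  then have "AE x in lebesgue. x \<in> {0..1} \<longrightarrow> x \<in> {0<..<1::real}"
    by eventually_elim auto
  then show ?thesis
    by (rule AE_restrict_space_iff[THEN iffD2, rotated]) simp
qed

text \<open>The sign of \<open>f\<close> is an almost everywhere limit of continuous functions;
  testing with them and passing to the limit gives that the integral of
  \<open>\<bar>f x\<bar>\<close> is \<open>0\<close>.\<close>

lemma orthogonal_continuous_imp_zero:
  assumes f: "integrable I01 f"
    and orth: "\<And>h :: real \<Rightarrow> real. continuous_on UNIV h \<Longrightarrow> (LINT x|I01. f x * h x) = 0"
  shows "AE x in I01. f x = 0"
proof -
  have [measurable]: "f \<in> borel_measurable I01" using f by auto
  have "(\<lambda>x. sgn (f x)) \<in> borel_measurable I01" by measurable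
  then have "(\<lambda>x. if x \<in> {0..1} then sgn (f x) else 0) \<in> borel_measurable lebesgue"
    by (subst borel_measurable_if) simp_all
  then have "(\<lambda>x. if x \<in> {0..1} then sgn (f x) else 0) measurable_on UNIV"
    by (rule lebesgue_measurable_imp_measurable_on) simp
  then obtain N g where N: "negligible N" and g: "\<And>n. continuous_on UNIV (g n)"
    and lim: "\<And>x. x \<notin> N \<Longrightarrow> (\<lambda>n. g n x) \<longlonglongrightarrow> (if x \<in> {0..1} then sgn (f x) else 0)"
    unfolding measurable_on_def by auto
  \<comment> \<open>Clamping keeps continuity and the limit, since a sign lies in
    \<open>[-1,1]\<close>, and provides the dominating function
    \<open>\<bar>f x\<bar>\<close>.\<close>
  define h where "h n x = max (-1) (min 1 (g n x))" for n x
  have h: "continuous_on UNIV (h n)" for n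
    unfolding h_def by (intro continuous_intros g)
  have [measurable]: "h n \<in> borel_measurable I01" for n
    using h[of n] by (intro continuous_on_measurable_01) (rule continuous_on_subset, auto)
  have "(\<lambda>n. LINT x|I01. f x * h n x) \<longlonglongrightarrow> (LINT x|I01. \<bar>f x\<bar>)"
  proof (rule integral_dominated_convergence[where w = "\<lambda>x. \<bar>f x\<bar>"])
    show "AE x in I01. (\<lambda>n. f x * h n x) \<longlonglongrightarrow> \<bar>f x\<bar>"
    proof -
      have "AE x in lebesgue. x \<notin> N" using N by (simp add: AE_not_in negligible_iff_null_sets)
      then have "AE x in I01. x \<notin> N" by (auto simp: AE_restrict_space_iff elim!: eventually_mono)
      moreover have "AE x in I01. x \<in> {0..1}" by (rule AE_I2) simp
      ultimately show ?thesis
      proof eventually_elim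
        case (elim x)
        have "(\<lambda>n. f x * h n x) \<longlonglongrightarrow> f x * max (-1) (min 1 (sgn (f x)))"
          unfolding h_def using lim[of x] elim by (intro tendsto_intros) auto
        moreover have "f x * max (-1) (min 1 (sgn (f x))) = \<bar>f x\<bar>" by (auto simp: sgn_if)
        ultimately show ?case by simp
      qed
    qed
    show "AE x in I01. norm (f x * h n x) \<le> \<bar>f x\<bar>" for n
      by (rule AE_I2) (auto simp: h_def abs_mult intro!: mult_left_le)
  qed (use f in auto)
  moreover have "(LINT x|I01. f x * h n x) = 0" for n by (rule orth[OF h])
  ultimately have "(LINT x|I01. \<bar>f x\<bar>) = 0" by (simp add: LIMSEQ_const_iff)
  then have "AE x in I01. \<bar>f x\<bar> = 0"
    using integral_nonneg_eq_0_iff_AE[of I01 "\<lambda>x. \<bar>f x\<bar>"] f by simp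
  then show ?thesis by simp
qed

text \<open>A factor \<open>cos (pi * x)\<close> turns the frequency \<open>k\<close> into the mean
  of the frequencies \<open>k - 1\<close> and \<open>k + 1\<close>, so the induction on the power
  runs over all frequencies at once.\<close>

lemma cos_power_orth:
  assumes f: "L2 f" and z: "\<And>k. ip f (cs k) = 0"
  shows "ip f (\<lambda>x. cos (pi * x) ^ n * cos (real k * pi * x)) = 0"
proof (induction n arbitrary: k)
  case 0
  show ?case
  proof (cases "k = 0")
    case True
    then show ?thesis using z[of 0] by (simp add: cs_def[abs_def])
  next
    case False
    then have "cs k = (\<lambda>x. sqrt 2 * cos (real k * pi * x))" by (auto simp: cs_def)
    then have "sqrt 2 * ip f (\<lambda>x. cos (real k * pi * x)) = 0" using z[of k] by simp
    then show ?thesis by simp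
  qed
next
  case (Suc n)
  show ?case
  proof (cases k)
    case 0
    have "cos (pi * x) ^ Suc n * cos (real k * pi * x) = cos (pi * x) ^ n * cos (real 1 * pi * x)" for x
      using 0 by simp
    then show ?thesis using Suc[of 1] by presburger
  next
    case (Suc j)
    have eq: "cos (pi * x) ^ Suc n * cos (real k * pi * x)
      = 1/2 * (cos (pi * x) ^ n * cos (real (Suc k) * pi * x) + cos (pi * x) ^ n * cos (real j * pi * x))" for x
    proof -
      have a: "cos (pi * x) * cos (real k * pi * x) = (cos (real j * pi * x) + cos (real (Suc k) * pi * x)) / 2"
        unfolding cos_times_cos using Suc
        by (subst cos_minus[symmetric]) (simp add: algebra_simps)
      have b: "cos (pi * x) ^ Suc n * cos (real k * pi * x) = cos (pi * x) ^ n * (cos (pi * x) * cos (real k * pi * x))"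
        by simp
      show ?thesis unfolding b a by (simp add: distrib_left add.commute)
    qed
    have "ip f (\<lambda>x. cos (pi * x) ^ n * cos (real (Suc k) * pi * x) + cos (pi * x) ^ n * cos (real j * pi * x))
        = ip f (\<lambda>x. cos (pi * x) ^ n * cos (real (Suc k) * pi * x)) + ip f (\<lambda>x. cos (pi * x) ^ n * cos (real j * pi * x))"
      by (rule ip_add_right) (use f in \<open>auto intro!: L2_continuous continuous_intros\<close>)
    then show ?thesis unfolding eq ip_cmult_right Suc.IH by simp
  qed
qed

text \<open>With \<open>y = cos (pi * x)\<close> a continuous \<open>h\<close> becomes the
  continuous function \<open>h (arccos y / pi)\<close> on \<open>[-1,1]\<close>. Weierstrass
  approximates it by polynomials in \<open>y\<close>, and \<open>f\<close> is orthogonal to all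
  powers of \<open>cos (pi * x)\<close>.\<close>

lemma cs_complete:
  assumes f: "L2 f" and z: "\<And>k. ip f (cs k) = 0"
  shows "AE x in I01. f x = 0"
proof (rule orthogonal_continuous_imp_zero[OF L2_integrable[OF f]])
  fix h :: "real \<Rightarrow> real" assume h: "continuous_on UNIV h"
  define B where "B = (LINT x|I01. \<bar>f x\<bar>)"
  have "B \<ge> 0" unfolding B_def by simp
  have L2h: "L2 h" using h by (intro L2_continuous) (rule continuous_on_subset, auto)
  have le: "\<bar>LINT x|I01. f x * h x\<bar> \<le> e * B" if "e > 0" for e
  proof -
    have "continuous_on {-1..1} (\<lambda>y. h (arccos y / pi))"
      by (intro continuous_on_compose2[OF h] continuous_intros) auto
    then obtain p where p: "real_polynomial_function p"
      and pe: "\<And>y. y \<in> {-1..1} \<Longrightarrow> \<bar>h (arccos y / pi) - p y\<bar> < e"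
      using Stone_Weierstrass_real_polynomial_function[of "{-1..1}" "\<lambda>y. h (arccos y / pi)" e] \<open>e > 0\<close>
      by auto
    obtain a n where an: "p = (\<lambda>x. \<Sum>i\<le>n. a i * x ^ i)"
      using p unfolding real_polynomial_function_iff_sum by blast
    have L2p: "L2 (\<lambda>x. p (cos (pi * x)))"
      unfolding an by (intro L2_continuous continuous_intros)
    have "ip f (\<lambda>x. p (cos (pi * x))) = (\<Sum>i\<le>n. a i * ip f (\<lambda>x. cos (pi * x) ^ i))"
      unfolding an by (subst ip_sum_right) (auto intro!: f L2_continuous continuous_intros)
    also have "\<dots> = 0" using cos_power_orth[OF f z, of _ 0] by simp
    finally have "ip f h = ip f (\<lambda>x. h x - p (cos (pi * x)))"
      using f L2h L2p by (simp add: ip_diff_right)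
    also have "\<bar>\<dots>\<bar> \<le> (LINT x|I01. \<bar>f x * (h x - p (cos (pi * x)))\<bar>)"
      unfolding ip_def by (rule integral_abs_bound)
    also have "\<dots> \<le> (LINT x|I01. e * \<bar>f x\<bar>)"
    proof (rule integral_mono)
      show "integrable I01 (\<lambda>x. \<bar>f x * (h x - p (cos (pi * x)))\<bar>)"
        by (intro integrable_abs L2_mult_integrable f L2_diff L2h L2p)
      show "integrable I01 (\<lambda>x. e * \<bar>f x\<bar>)" using L2_integrable[OF f] by simp
      fix x assume "x \<in> space I01"
      then have x: "x \<in> {0..1}" by simp
      have "arccos (cos (pi * x)) = pi * x" using x by (intro arccos_cos) auto
      then have "\<bar>h x - p (cos (pi * x))\<bar> \<le> e"
        using pe[of "cos (pi * x)"] by simp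
      then show "\<bar>f x * (h x - p (cos (pi * x)))\<bar> \<le> e * \<bar>f x\<bar>"
        by (simp add: abs_mult mult.commute[of e] mult_left_mono)
    qed
    finally show ?thesis by (simp add: ip_def B_def)
  qed
  have "\<bar>LINT x|I01. f x * h x\<bar> \<le> d" if "d > 0" for d
  proof -
    \<comment> \<open>The denominator \<open>B + 1\<close> covers the case
      \<open>B = 0\<close>.\<close>
    have "\<bar>LINT x|I01. f x * h x\<bar> \<le> d / (B + 1) * B" using \<open>B \<ge> 0\<close> that by (intro le) simp
    also have "\<dots> \<le> d" using \<open>B \<ge> 0\<close> that by (simp add: field_simps)
    finally show ?thesis .
  qed
  then have "\<bar>LINT x|I01. f x * h x\<bar> \<le> 0" by (rule field_le_epsilon[of _ 0, simplified])
  then show "(LINT x|I01. f x * h x) = 0" by simp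
qed

interpretation cosb: onb cs
  by unfold_locales (auto simp: ip_cs intro: cs_complete)

text \<open>Reduction to the cosines: by the product formula the cosine coefficients of
  \<open>f x * sin (pi * x)\<close> are combinations of sine coefficients of \<open>f\<close>. The
  factor is positive in the interior and can be divided out.\<close>

lemma sn_complete:
  assumes f: "L2 f" and z: "\<And>k. ip f (sn k) = 0"
  shows "AE x in I01. f x = 0"
proof -
  have L2F: "L2 (\<lambda>x. f x * sin (pi * x))"
    by (rule L2_mult_bounded[where B = 1, OF f])
      (auto intro!: continuous_on_measurable_01 continuous_intros)
  have "ip (\<lambda>x. f x * sin (pi * x)) (cs k) = 0" for k
  proof (cases k)
    case 0
    have "sn 1 = (\<lambda>x. sqrt 2 * sin (pi * x))" by (auto simp: sn_def)
    then have "ip f (sn 1) = sqrt 2 * ip f (\<lambda>x. sin (pi * x))" by simp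
    then show ?thesis using z[of 1] 0 by (simp add: ip_def cs_def)
  next
    case (Suc j)
    have eq: "(f x * sin (pi * x)) * cs k x = f x * (1/2 * (sn (Suc k) x - sn j x))" for x
    proof -
      have a: "sin (pi * x) * cos (real k * pi * x) = (sin (real (Suc k) * pi * x) - sin (real j * pi * x)) / 2"
        using Suc sin_times_cos[of "pi * x" "real k * pi * x"] sin_minus[of "real j * pi * x"]
        by (simp add: algebra_simps)
      have b: "(f x * sin (pi * x)) * cs k x = sqrt 2 * f x * (sin (pi * x) * cos (real k * pi * x))"
        using Suc by (simp add: cs_def)
      show ?thesis unfolding a b sn_def by (simp add: right_diff_distrib)
    qed
    have "ip (\<lambda>x. f x * sin (pi * x)) (cs k) = ip f (\<lambda>x. 1/2 * (sn (Suc k) x - sn j x))"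
      unfolding ip_def eq ..
    also have "\<dots> = 0" unfolding ip_cmult_right using z f by (simp add: ip_diff_right)
    finally show ?thesis .
  qed
  from cs_complete[OF L2F this] AE_I01_interior show ?thesis
  proof eventually_elim
    case (elim x)
    then have "sin (pi * x) > 0" by (intro sin_gt_zero) auto
    then show ?case using elim by simp
  qed
qed

text \<open>The shift by one leaves out \<open>sn 0\<close>, which is zero and would violate
  orthonormality.\<close>

interpretation sinb: onb "\<lambda>k. sn (Suc k)"
proof unfold_locales
  fix f assume f: "L2 f" "\<And>k. ip f (sn (Suc k)) = 0"
  have "ip f (sn k) = 0" for k
    using f(2) by (cases k) (auto simp: ip_def)
  then show "AE x in I01. f x = 0" by (rule sn_complete[OF f(1)])
qed (auto simp: ip_sn)

lemma ip_sn_0 [simp]: "ip f (sn 0) = 0"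
  by (simp add: ip_def)

lemma sn_bessel:
  assumes "L2 f" "finite K"
  shows "(\<Sum>k\<in>K. (ip f (sn k))\<^sup>2) \<le> ip f f"
proof -
  have "(\<Sum>k\<in>K. (ip f (sn k))\<^sup>2) = (\<Sum>k\<in>K - {0}. (ip f (sn k))\<^sup>2)"
    using assms by (intro sum.mono_neutral_right) auto
  also have "\<dots> = (\<Sum>k\<in>(\<lambda>k. k - 1) ` (K - {0}). (ip f (sn (Suc k)))\<^sup>2)"
    by (subst sum.reindex) (auto simp: inj_on_def)
  also have "\<dots> \<le> ip f f" using assms by (intro sinb.bessel) auto
  finally show ?thesis .
qed

lemma sn_parseval:
  assumes "L2 f" "L2 g"
  shows "(\<lambda>k. ip f (sn k) * ip g (sn k)) sums ip f g"
  using sums_Suc[of "\<lambda>k. ip f (sn k) * ip g (sn k)", OF sinb.parseval[OF assms]] by simp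

subsection \<open>Absolutely convergent cosine series\<close>

text \<open>The nonnegative continuous function \<open>\<bar>f x - g x\<bar>\<close> has integral
  \<open>0\<close>. This makes continuous representatives, hence traces, unique.\<close>

lemma continuous_AE_eq:
  fixes f g :: "real \<Rightarrow> real"
  assumes "continuous_on {a..b} f" "continuous_on {a..b} g" "a < b"
    and "AE x in lebesgue_on {a..b}. f x = g x" "x \<in> {a..b}"
  shows "f x = g x"
proof -
  have c: "continuous_on {a..b} (\<lambda>x. \<bar>f x - g x\<bar>)" by (intro continuous_intros assms)
  have "(LINT x|lebesgue_on {a..b}. \<bar>f x - g x\<bar>) = (LINT x|lebesgue_on {a..b}. 0)"
    using assms c by (intro integral_cong_AE) (auto intro!: continuous_imp_measurable_on_sets_lebesgue elim!: eventually_mono)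
  then have "integral {a..b} (\<lambda>x. \<bar>f x - g x\<bar>) = 0"
    using lebesgue_integral_eq_integral[OF integrable_continuous_Icc[OF c]] by simp
  then have "((\<lambda>x. \<bar>f x - g x\<bar>) has_integral 0) (cbox a b)"
    using integrable_integral[OF integrable_continuous_real[OF c]] by simp
  from has_integral_0_cbox_imp_0[OF _ _ this] c assms(3,5) have "\<bar>f x - g x\<bar> = 0" by auto
  then show ?thesis by simp
qed

definition cser :: "(nat \<Rightarrow> real) \<Rightarrow> real \<Rightarrow> real" where
  "cser a x = (\<Sum>k. a k * cs k x)"

lemma cser_term_bound: "\<bar>a k * cs k x\<bar> \<le> sqrt 2 * \<bar>a k\<bar>"
  using mult_left_mono[OF cs_bound, of "\<bar>a k\<bar>" k x] by (simp add: abs_mult mult.commute)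

lemma cser_sums:
  assumes "summable (\<lambda>k. \<bar>a k\<bar>)"
  shows "(\<lambda>k. a k * cs k x) sums cser a x"
  unfolding cser_def
  by (intro summable_sums summable_rabs_cancel[OF summable_comparison_test[OF _ summable_mult[OF assms, of "sqrt 2"]]])
    (auto simp: cser_term_bound)

lemma cser_tail:
  assumes "summable (\<lambda>k. \<bar>a k\<bar>)"
  shows "\<bar>cser a x - (\<Sum>k<n. a k * cs k x)\<bar> \<le> sqrt 2 * (\<Sum>k. \<bar>a (k + n)\<bar>)"
proof -
  have s: "summable (\<lambda>k. \<bar>a (k + n)\<bar>)" using assms by (rule summable_ignore_initial_segment)
  have "cser a x - (\<Sum>k<n. a k * cs k x) = (\<Sum>k. a (k + n) * cs (k + n) x)"
    using suminf_minus_initial_segment[OF sums_summable[OF cser_sums[OF assms, of x]], of n]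
    by (simp add: cser_def)
  also have "\<bar>\<dots>\<bar> \<le> (\<Sum>k. \<bar>a (k + n) * cs (k + n) x\<bar>)"
    by (intro summable_rabs summable_comparison_test[OF _ summable_mult[OF s, of "sqrt 2"]])
      (auto simp: cser_term_bound)
  also have "\<dots> \<le> (\<Sum>k. sqrt 2 * \<bar>a (k + n)\<bar>)"
    by (intro suminf_le summable_comparison_test[OF _ summable_mult[OF s, of "sqrt 2"]] summable_mult s)
      (auto simp: cser_term_bound)
  finally show ?thesis using s by (simp add: suminf_mult)
qed

lemma cser_bound:
  assumes "summable (\<lambda>k. \<bar>a k\<bar>)"
  shows "\<bar>cser a x\<bar> \<le> sqrt 2 * (\<Sum>k. \<bar>a k\<bar>)"
  using cser_tail[OF assms, of x 0] by simp

lemma tail_tendsto_0: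
  assumes "summable (f :: nat \<Rightarrow> real)"
  shows "(\<lambda>n. \<Sum>k. f (k + n)) \<longlonglongrightarrow> 0"
proof -
  have "(\<lambda>n. suminf f - (\<Sum>k<n. f k)) \<longlonglongrightarrow> suminf f - suminf f"
    by (intro tendsto_intros summable_LIMSEQ assms)
  then show ?thesis using suminf_minus_initial_segment[OF assms] by simp
qed

lemma cser_continuous:
  assumes "summable (\<lambda>k. \<bar>a k\<bar>)"
  shows "continuous_on A (cser a)"
proof (rule uniform_limit_theorem)
  show "uniform_limit A (\<lambda>n x. \<Sum>k<n. a k * cs k x) (cser a) sequentially"
    unfolding cser_def[abs_def]
    by (rule Weierstrass_m_test[OF _ summable_mult[OF assms, of "sqrt 2"]]) (auto simp: cser_term_bound)
qed (auto intro!: always_eventually continuous_intros)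

text \<open>The uniform tail bound is in particular a mean square bound, so the coefficients of the
  partial sums pass to the limit.\<close>

lemma cser_coeff:
  assumes "summable (\<lambda>k. \<bar>a k\<bar>)"
  shows "L2 (cser a)" "ip (cser a) (cs k) = a k"
proof -
  show L: "L2 (cser a)" by (intro L2_continuous cser_continuous assms)
  let ?S = "\<lambda>n x. \<Sum>k<n. a k * cs k x"
  have LS: "L2 (?S n)" for n by (intro cosb.L2_partial) simp
  have "(\<lambda>n. nrm (\<lambda>x. ?S n x - cser a x)) \<longlonglongrightarrow> 0"
  proof (rule Lim_null_comparison[rotated])
    show "(\<lambda>n. sqrt 2 * (\<Sum>k. \<bar>a (k + n)\<bar>)) \<longlonglongrightarrow> 0"
      using tendsto_mult_right_zero[OF tail_tendsto_0[OF assms], of "sqrt 2"] .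
    have "nrm (\<lambda>x. ?S n x - cser a x) \<le> sqrt 2 * (\<Sum>k. \<bar>a (k + n)\<bar>)" for n
    proof (rule nrm_le_bound)
      show "(\<lambda>x. ?S n x - cser a x) \<in> borel_measurable I01"
        by (rule L2_measurable[OF L2_diff[OF LS L]])
      show "AE x in I01. \<bar>?S n x - cser a x\<bar> \<le> sqrt 2 * (\<Sum>k. \<bar>a (k + n)\<bar>)"
        by (rule AE_I2, subst abs_minus_commute, rule cser_tail[OF assms])
      show "0 \<le> sqrt 2 * (\<Sum>k. \<bar>a (k + n)\<bar>)"
        using suminf_nonneg[OF summable_ignore_initial_segment[OF assms, of n]] by simp
    qed
    then show "\<forall>\<^sub>F n in sequentially. norm (nrm (\<lambda>x. ?S n x - cser a x)) \<le> sqrt 2 * (\<Sum>k. \<bar>a (k + n)\<bar>)"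
      by simp
  qed
  then have "(\<lambda>n. ip (?S n) (cs k)) \<longlonglongrightarrow> ip (cser a) (cs k)"
    by (intro nrm_diff_ip_tendsto LS L L2_cs)
  moreover have "(\<lambda>n. ip (?S n) (cs k)) \<longlonglongrightarrow> a k"
  proof (rule tendsto_eventually)
    show "\<forall>\<^sub>F n in sequentially. ip (?S n) (cs k) = a k"
      using eventually_gt_at_top[of k] by eventually_elim (simp add: cosb.ip_partial)
  qed
  ultimately show "ip (cser a) (cs k) = a k" by (rule LIMSEQ_unique)
qed

lemma cser_AE_eq:
  assumes "L2 f" "summable (\<lambda>k. \<bar>ip f (cs k)\<bar>)"
  shows "AE x in I01. f x = cser (\<lambda>k. ip f (cs k)) x"
  by (rule cosb.eq_AE) (use assms cser_coeff[OF assms(2)] in auto)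

lemma cser_eq:
  assumes "continuous_on {0..1} f" "summable (\<lambda>k. \<bar>ip f (cs k)\<bar>)" "x \<in> {0..1}"
  shows "cser (\<lambda>k. ip f (cs k)) x = f x"
  using continuous_AE_eq[OF assms(1) cser_continuous[OF assms(2)] _ cser_AE_eq[OF L2_continuous assms(2)]] assms
  by simp

text \<open>The term at \<open>k = 0\<close> is \<open>1 / 0 = 0\<close>, so sums over all modes may
  be written without excluding it.\<close>

lemma summable_inverse_kap: "summable (\<lambda>k. 1 / kap k)"
  using summable_mult[OF inverse_power_summable[of 2, where 'a = real], of "1 / pi\<^sup>2"]
  by (simp add: kap_def power_mult_distrib field_simps)

text \<open>The one-dimensional Sobolev embedding in terms of coefficients: Cauchy-Schwarz between
  the sine coefficients of the gradient and \<open>1 / (real k * pi)\<close>, then Bessel. Mode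
  \<open>0\<close> is invisible to the gradient and has to be excluded.\<close>

lemma grad_coeff_sum_le:
  assumes "grad_coeff a h" "finite K" "0 \<notin> K"
  shows "(\<Sum>k\<in>K. \<bar>a k\<bar>) \<le> nrm h * sqrt (\<Sum>k\<in>K. 1 / kap k)"
proof -
  have h: "L2 h" "\<And>k. ip h (sn k) = - (real k * pi) * a k" using assms(1) by (auto simp: grad_coeff_def)
  have "(\<Sum>k\<in>K. \<bar>a k\<bar>) = (\<Sum>k\<in>K. \<bar>ip h (sn k)\<bar> * \<bar>1 / (real k * pi)\<bar>)"
  proof (rule sum.cong)
    fix k assume "k \<in> K"
    then have "k > 0" using assms by (metis gr0I)
    then show "\<bar>a k\<bar> = \<bar>ip h (sn k)\<bar> * \<bar>1 / (real k * pi)\<bar>" by (simp add: h abs_mult)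
  qed simp
  also have "\<dots> \<le> L2_set (\<lambda>k. ip h (sn k)) K * L2_set (\<lambda>k. 1 / (real k * pi)) K"
    by (rule L2_set_mult_ineq)
  also have "\<dots> \<le> nrm h * sqrt (\<Sum>k\<in>K. 1 / kap k)"
    unfolding L2_set_def nrm_def
    by (intro mult_mono real_sqrt_le_mono sn_bessel h assms) (auto simp: kap_def power_divide sum_nonneg)
  finally show ?thesis .
qed

lemma grad_coeff_summable:
  assumes "grad_coeff a h"
  shows "summable (\<lambda>k. \<bar>a k\<bar>)"
    and "(\<Sum>k<n. \<bar>a k\<bar>) \<le> \<bar>a 0\<bar> + nrm h * sqrt (\<Sum>k. 1 / kap k)"
proof -
  have *: "(\<Sum>k<n. \<bar>a k\<bar>) \<le> \<bar>a 0\<bar> + nrm h * sqrt (\<Sum>k. 1 / kap k)" for n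
  proof -
    have "(\<Sum>k<n. \<bar>a k\<bar>) \<le> (\<Sum>k\<in>insert 0 ({..<n} - {0}). \<bar>a k\<bar>)" by (intro sum_mono2) auto
    also have "\<dots> = \<bar>a 0\<bar> + (\<Sum>k\<in>{..<n} - {0}. \<bar>a k\<bar>)" by (subst sum.insert) auto
    also have "(\<Sum>k\<in>{..<n} - {0}. \<bar>a k\<bar>) \<le> nrm h * sqrt (\<Sum>k\<in>{..<n} - {0}. 1 / kap k)"
      by (rule grad_coeff_sum_le[OF assms]) auto
    also have "\<dots> \<le> nrm h * sqrt (\<Sum>k. 1 / kap k)"
      by (intro mult_left_mono real_sqrt_le_mono sum_le_suminf summable_inverse_kap) auto
    finally show ?thesis by simp
  qed
  show "(\<Sum>k<n. \<bar>a k\<bar>) \<le> \<bar>a 0\<bar> + nrm h * sqrt (\<Sum>k. 1 / kap k)" by (rule *)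
  show "summable (\<lambda>k. \<bar>a k\<bar>)" 
  proof (rule bounded_imp_summable)
    show "(\<Sum>k\<le>n. \<bar>a k\<bar>) \<le> \<bar>a 0\<bar> + nrm h * sqrt (\<Sum>k. 1 / kap k)" for n
      using *[of "Suc n"] by (simp only: lessThan_Suc_atMost)
  qed simp
qed

text \<open>The quantitative form: the tail decays at a rate that depends on the function only
  through the norm of its gradient. The truncation errors of the penalty argument are measured by
  it.\<close>

lemma grad_coeff_tail:
  assumes "grad_coeff a h" "n > 0"
  shows "(\<Sum>k. \<bar>a (k + n)\<bar>) \<le> nrm h * sqrt (\<Sum>k. 1 / kap (k + n))"
proof (rule suminf_le_const)
  show "summable (\<lambda>k. \<bar>a (k + n)\<bar>)"
    using grad_coeff_summable(1)[OF assms(1)] by (rule summable_ignore_initial_segment)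
  have s: "summable (\<lambda>k. 1 / kap (k + n))"
    using summable_inverse_kap by (rule summable_ignore_initial_segment)
  fix m
  have "(\<Sum>k<m. \<bar>a (k + n)\<bar>) = (\<Sum>k\<in>{n..<n+m}. \<bar>a k\<bar>)"
    by (rule sum.reindex_bij_witness[of _ "\<lambda>k. k - n" "\<lambda>k. k + n"]) auto
  also have "\<dots> \<le> nrm h * sqrt (\<Sum>k\<in>{n..<n+m}. 1 / kap k)"
    by (rule grad_coeff_sum_le[OF assms(1)]) (use assms in auto)
  also have "(\<Sum>k\<in>{n..<n+m}. 1 / kap k) = (\<Sum>k<m. 1 / kap (k + n))"
    by (rule sum.reindex_bij_witness[of _ "\<lambda>k. k + n" "\<lambda>k. k - n"]) auto
  also have "nrm h * sqrt \<dots> \<le> nrm h * sqrt (\<Sum>k. 1 / kap (k + n))"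
    by (intro mult_left_mono real_sqrt_le_mono sum_le_suminf) (use s in auto)
  finally show "(\<Sum>k<m. \<bar>a (k + n)\<bar>) \<le> nrm h * sqrt (\<Sum>k. 1 / kap (k + n))" .
qed

section \<open>Weak derivatives and Fourier coefficients\<close>

lemma deriv_closed_imp_smooth:
  fixes X :: "(real \<Rightarrow> real) set"
  assumes "\<And>f. f \<in> X \<Longrightarrow> \<exists>f'\<in>X. \<forall>x. (f has_real_derivative f' x) (at x)" and "f \<in> X"
  shows "(deriv ^^ k) f field_differentiable (at x)"
proof -
  have step: "deriv g \<in> X" if g: "g \<in> X" for g :: "real \<Rightarrow> real"
  proof -
    obtain g' where g': "g' \<in> X" "\<And>x. (g has_real_derivative g' x) (at x)" using assms(1)[OF g] by blast
    then have "deriv g = g'" by (auto intro!: ext DERIV_imp_deriv)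
    then show ?thesis using g' by simp
  qed
  have "(deriv ^^ k) f \<in> X" by (induction k) (use assms(2) step in auto)
  then show ?thesis using assms(1) unfolding field_differentiable_def by blast
qed

text \<open>The standard flat function at \<open>0\<close>, with a polynomial factor in
  \<open>1 / y\<close> so that the family is closed under differentiation.\<close>

definition ee :: "real \<Rightarrow> real poly \<Rightarrow> real \<Rightarrow> real" where
  "ee c p y = (if y \<le> 0 then 0 else poly p (1 / y) * exp (- c / y))"

lemma poly_times_exp_tendsto_0:
  fixes c :: real
  assumes "c > 0"
  shows "((\<lambda>z. poly p z * exp (- c * z)) \<longlongrightarrow> 0) at_top"
proof -
  have mon: "((\<lambda>z. z ^ i * exp (- c * z)) \<longlongrightarrow> 0) at_top" for i
  proof -
    have "filterlim (\<lambda>z::real. c * z) at_top at_top"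
      using assms by (intro filterlim_tendsto_pos_mult_at_top[OF tendsto_const] filterlim_ident)
    then have "((\<lambda>z. (c * z) ^ i / exp (c * z)) \<longlongrightarrow> 0) at_top"
      by (rule filterlim_compose[OF tendsto_power_div_exp_0])
    then have "((\<lambda>z. (1 / c ^ i) * ((c * z) ^ i / exp (c * z))) \<longlongrightarrow> 0) at_top"
      by (rule tendsto_mult_right_zero)
    moreover have "(1 / c ^ i) * ((c * z) ^ i / exp (c * z)) = z ^ i * exp (- c * z)" for z
      using assms by (simp add: power_mult_distrib exp_minus field_simps)
    ultimately show ?thesis by simp
  qed
  have "((\<lambda>z. \<Sum>i\<le>degree p. coeff p i * (z ^ i * exp (- c * z))) \<longlongrightarrow> (\<Sum>i\<le>degree p. coeff p i * 0)) at_top"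
    by (intro tendsto_intros mon)
  then show ?thesis by (simp add: poly_altdef sum_distrib_right mult.assoc)
qed

text \<open>In the variable \<open>z = 1 / y\<close> the derivative in \<open>y\<close> is
  \<open>- z^2\<close> times the derivative in \<open>z\<close>, which maps
  \<open>p z * exp (- c * z)\<close> to
  \<open>z^2 * (c * p z - p' z) * exp (- c * z)\<close>.\<close>

lemma DERIV_ee:
  assumes "c > 0"
  shows "(ee c p has_real_derivative ee c (monom 1 2 * (smult c p - pderiv p)) y) (at y)"
proof -
  consider "y < 0" | "y = 0" | "y > 0" by linarith
  then show ?thesis
  proof cases
    case 1
    have "((\<lambda>_. 0) has_real_derivative 0) (at y)" by simp
    then have "(ee c p has_real_derivative 0) (at y)"
      by (rule has_field_derivative_transform_within_open[of _ _ _ "{..<0}"]) (use 1 in \<open>auto simp: ee_def\<close>)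
    then show ?thesis using 1 by (simp add: ee_def)
  next
    case 3
    have "((\<lambda>y. poly p (1 / y) * exp (- c / y)) has_real_derivative
        ee c (monom 1 2 * (smult c p - pderiv p)) y) (at y)"
      using 3 by (auto intro!: derivative_eq_intros DERIV_chain2[OF poly_DERIV]
        simp: ee_def poly_monom field_simps power2_eq_square)
    then show ?thesis
      by (rule has_field_derivative_transform_within_open[of _ _ _ "{0<..}"]) (use 3 in \<open>auto simp: ee_def\<close>)
  next
    case 2
    have "((\<lambda>h. ee c p h / h) \<longlongrightarrow> 0) (at_right 0)"
      unfolding filterlim_at_right_to_top
    \<comment> \<open>The difference quotient at \<open>y = 1 / z\<close> is
      \<open>z * poly p z * exp (- c * z)\<close>; \<open>pCons 0\<close> supplies the factor
      \<open>z\<close>.\<close>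
    proof (rule Lim_transform_eventually[OF poly_times_exp_tendsto_0[OF assms, of "pCons 0 p"]])
      show "\<forall>\<^sub>F z in at_top. poly (pCons 0 p) z * exp (- c * z) = ee c p (inverse z) / inverse z"
        using eventually_gt_at_top[of 0] by eventually_elim (auto simp: ee_def field_simps)
    qed
    moreover have "((\<lambda>h. ee c p h / h) \<longlongrightarrow> 0) (at_left 0)"
      by (rule tendsto_eventually) (auto simp: ee_def eventually_at_left_field intro!: exI[of _ "-1"])
    ultimately have "((\<lambda>h. ee c p h / h) \<longlongrightarrow> 0) (at 0)" by (rule filterlim_split_at[rotated])
    then show ?thesis using 2 by (simp add: DERIV_def ee_def)
  qed
qed

text \<open>The smallest convenient class that contains \<open>cutoff c x * sn k x\<close> and all
  its derivatives: the polynomials vary, cosine and sine occur together, and the product rule forces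
  closure under sums.\<close>

inductive_set bumps :: "real \<Rightarrow> real \<Rightarrow> (real \<Rightarrow> real) set" for c w where
  base: "(\<lambda>x. ee c p (x - c) * ee c q (1 - c - x) * (A * cos (w * x) + B * sin (w * x))) \<in> bumps c w"
| add: "f \<in> bumps c w \<Longrightarrow> g \<in> bumps c w \<Longrightarrow> (\<lambda>x. f x + g x) \<in> bumps c w"

lemma bumps_deriv:
  assumes "c > 0" "f \<in> bumps c w"
  shows "\<exists>f'\<in>bumps c w. \<forall>x. (f has_real_derivative f' x) (at x)"
  using assms(2)
proof induction
  case (base p q A B)
  let ?p' = "monom 1 2 * (smult c p - pderiv p)" and ?q' = "monom 1 2 * (smult c q - pderiv q)"
  let ?f' = "\<lambda>x. (ee c ?p' (x - c) * ee c q (1 - c - x) * (A * cos (w * x) + B * sin (w * x))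
      + ee c p (x - c) * ee c ?q' (1 - c - x) * ((-A) * cos (w * x) + (-B) * sin (w * x)))
      + ee c p (x - c) * ee c q (1 - c - x) * ((B * w) * cos (w * x) + (- A * w) * sin (w * x))"
  have "?f' \<in> bumps c w" by (intro bumps.intros)
  moreover have "((\<lambda>x. ee c p (x - c) * ee c q (1 - c - x) * (A * cos (w * x) + B * sin (w * x)))
      has_real_derivative ?f' x) (at x)" for x
    by (rule derivative_eq_intros DERIV_chain2[OF DERIV_ee[OF assms(1)]] refl)+ (simp add: algebra_simps)
  ultimately show ?case by (intro bexI[of _ ?f'] allI)
next
  case (add f g)
  then obtain f' g' where "f' \<in> bumps c w" "g' \<in> bumps c w"
    "\<And>x. (f has_real_derivative f' x) (at x)" "\<And>x. (g has_real_derivative g' x) (at x)" by blast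
  then show ?case
    by (intro bexI[of _ "\<lambda>x. f' x + g' x"]) (auto intro: bumps.intros intro!: derivative_intros)
qed

text \<open>The margin \<open>c\<close> is also the scale of the exponentials. Hence the cutoff
  tends to \<open>1\<close> at every interior point as \<open>c\<close> tends to \<open>0\<close>,
  while its derivative stays of the order of the inverse distance to the end points, uniformly in
  \<open>c\<close>.\<close>

definition cutoff :: "real \<Rightarrow> real \<Rightarrow> real" where
  "cutoff c x = ee c 1 (x - c) * ee c 1 (1 - c - x)"

definition cutoff' :: "real \<Rightarrow> real \<Rightarrow> real" where
  "cutoff' c x = ee c (monom c 2) (x - c) * ee c 1 (1 - c - x) - ee c 1 (x - c) * ee c (monom c 2) (1 - c - x)"

lemma DERIV_cutoff:
  assumes "c > 0"
  shows "(cutoff c has_real_derivative cutoff' c x) (at x)"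
proof -
  have eq: "monom 1 2 * (smult c 1 - pderiv 1) = monom c (2 :: nat)"
    by (simp add: smult_monom pderiv_1 mult_monom flip: monom_0 one_pCons)
  have D: "(ee c 1 has_real_derivative ee c (monom c 2) y) (at y)" for y
    using DERIV_ee[OF assms, of 1 y] unfolding eq .
  show ?thesis unfolding cutoff_def[abs_def] cutoff'_def
    by (rule derivative_eq_intros DERIV_chain2[OF D] refl)+ simp
qed

lemma test_function_cutoff_sn:
  assumes "0 < c" "c < 1/2"
  shows "test_function (\<lambda>x. cutoff c x * sn k x)"
  unfolding test_function_def
proof (intro conjI allI)
  have eq: "(\<lambda>x. cutoff c x * sn k x) = (\<lambda>x. ee c 1 (x - c) * ee c 1 (1 - c - x) * (0 * cos (real k * pi * x) + sqrt 2 * sin (real k * pi * x)))"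
    by (simp add: cutoff_def sn_def)
  have "(\<lambda>x. cutoff c x * sn k x) \<in> bumps c (real k * pi)" unfolding eq by (rule bumps.base)
  then show "(deriv ^^ j) (\<lambda>x. cutoff c x * sn k x) field_differentiable (at x)" for j x
    using deriv_closed_imp_smooth[of "bumps c (real k * pi)", OF bumps_deriv[OF assms(1)]] by blast
  show "\<exists>a b. 0 < a \<and> b < 1 \<and> (\<forall>x. x \<notin> {a..b} \<longrightarrow> cutoff c x * sn k x = 0)"
    using assms by (intro exI[of _ c] exI[of _ "1 - c"]) (auto simp: cutoff_def ee_def)
qed

lemma exp_quadratic: "u \<ge> 0 \<Longrightarrow> (u + u\<^sup>2) * exp (- u) \<le> 2" for u :: real
proof -
  assume "u \<ge> 0"
  then have "1 + u + u\<^sup>2 / 2 \<le> exp u" by (rule exp_lower_Taylor_quadratic)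
  then have "u + u\<^sup>2 \<le> 2 * exp u" using \<open>u \<ge> 0\<close> by simp
  then show ?thesis by (simp add: exp_minus field_simps)
qed

text \<open>\<open>ee c (monom c 2)\<close> is the derivative of \<open>ee c 1\<close>. In the last
  bound put \<open>u = c / y\<close>. For the two arguments \<open>x - c\<close> and
  \<open>1 - c - x\<close> of the cutoff, the factor \<open>y + c\<close> is the distance to the end
  point.\<close>

lemma ee_bounds:
  assumes "c > 0"
  shows "0 \<le> ee c 1 y" "ee c 1 y \<le> 1" "0 \<le> ee c (monom c 2) y"
    and "(y + c) * ee c (monom c 2) y \<le> 2"
proof -
  show "0 \<le> ee c 1 y" "ee c 1 y \<le> 1" "0 \<le> ee c (monom c 2) y"
    using assms by (auto simp: ee_def poly_monom)
  show "(y + c) * ee c (monom c 2) y \<le> 2"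
  proof (cases "y \<le> 0")
    case False
    have "(y + c) * ee c (monom c 2) y = (c / y + (c / y)\<^sup>2) * exp (- (c / y))"
      using False by (simp add: ee_def poly_monom field_simps power2_eq_square)
    also have "\<dots> \<le> 2" by (rule exp_quadratic) (use assms False in simp)
    finally show ?thesis .
  qed (simp add: ee_def)
qed

lemma sn_bound_0: "\<bar>sn k x\<bar> \<le> sqrt 2 * (real k * pi) * \<bar>x\<bar>"
  using mult_left_mono[OF abs_sin_x_le_abs_x[of "real k * pi * x"], of "sqrt 2"]
  by (simp add: sn_def abs_mult)

lemma sn_bound_1: "\<bar>sn k x\<bar> \<le> sqrt 2 * (real k * pi) * \<bar>1 - x\<bar>"
proof -
  have "real k * pi * x = real k * pi - real k * pi * (1 - x)" by (simp add: algebra_simps)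
  then have "sin (real k * pi * x) = - cos (real k * pi) * sin (real k * pi * (1 - x))"
    by (simp only: sin_diff) simp
  then have "\<bar>sn k x\<bar> = \<bar>sn k (1 - x)\<bar>" by (simp add: sn_def abs_mult cos_npi)
  then show ?thesis using sn_bound_0[of k "1 - x"] by simp
qed

text \<open>The derivative of the cutoff blows up like the inverse distance to an end point, where
  \<open>sn k\<close> vanishes linearly; the product is bounded independently of
  \<open>c\<close>.\<close>

lemma cutoff_bounds:
  assumes "c > 0"
  shows "\<bar>cutoff c x\<bar> \<le> 1"
    and "\<bar>cutoff' c x * sn k x\<bar> \<le> 4 * sqrt 2 * (real k * pi)"
proof -
  note b = ee_bounds[OF assms]
  show "\<bar>cutoff c x\<bar> \<le> 1" unfolding cutoff_def using b by (simp add: abs_mult mult_le_one)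
  define D where "D = ee c (monom c 2)"
  have D0: "D y \<ge> 0" for y using b unfolding D_def by simp
  have *: "D y * \<bar>y + c\<bar> \<le> 2" for y
  proof (cases "y \<le> 0")
    case True
    then show ?thesis by (simp add: D_def ee_def)
  next
    case False
    then show ?thesis using b(4)[of y] assms by (simp add: D_def mult.commute)
  qed
  define A where "A = sqrt 2 * (real k * pi)"
  have "A \<ge> 0" by (simp add: A_def)
  have t1: "D (x - c) * \<bar>sn k x\<bar> \<le> 2 * A"
  proof -
    have "D (x - c) * \<bar>sn k x\<bar> \<le> D (x - c) * (A * \<bar>x\<bar>)"
      unfolding A_def by (intro mult_left_mono sn_bound_0 D0)
    also have "\<dots> = (D (x - c) * \<bar>(x - c) + c\<bar>) * A" by simp
    also have "\<dots> \<le> 2 * A" by (intro mult_right_mono * \<open>A \<ge> 0\<close>)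
    finally show ?thesis .
  qed
  have t2: "D (1 - c - x) * \<bar>sn k x\<bar> \<le> 2 * A"
  proof -
    have "D (1 - c - x) * \<bar>sn k x\<bar> \<le> D (1 - c - x) * (A * \<bar>1 - x\<bar>)"
      unfolding A_def by (intro mult_left_mono sn_bound_1 D0)
    also have "\<dots> = (D (1 - c - x) * \<bar>(1 - c - x) + c\<bar>) * A" by simp
    also have "\<dots> \<le> 2 * A" by (intro mult_right_mono * \<open>A \<ge> 0\<close>)
    finally show ?thesis .
  qed
  have "cutoff' c x * sn k x = (D (x - c) * sn k x) * ee c 1 (1 - c - x) - (D (1 - c - x) * sn k x) * ee c 1 (x - c)"
    by (simp add: cutoff'_def D_def algebra_simps)
  also have "\<bar>\<dots>\<bar> \<le> \<bar>D (x - c) * sn k x\<bar> * 1 + \<bar>D (1 - c - x) * sn k x\<bar> * 1"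
    using b(1,2)[of "x - c"] b(1,2)[of "1 - c - x"]
    by (intro order_trans[OF abs_triangle_ineq4] add_mono) (auto simp: abs_mult intro!: mult_left_le)
  also have "\<dots> \<le> 2 * A + 2 * A"
    using t1 t2 D0 by (intro add_mono) (auto simp: abs_mult)
  finally show "\<bar>cutoff' c x * sn k x\<bar> \<le> 4 * sqrt 2 * (real k * pi)" by (simp add: A_def mult_ac)
qed

lemma ee_tendsto:
  assumes c: "\<And>n. c n > 0" "c \<longlonglongrightarrow> 0" and y: "y \<longlonglongrightarrow> l" "l > 0"
  shows "(\<lambda>n. ee (c n) 1 (y n)) \<longlonglongrightarrow> 1" "(\<lambda>n. ee (c n) (monom (c n) 2) (y n)) \<longlonglongrightarrow> 0"
proof -
  have ev: "\<forall>\<^sub>F n in sequentially. 0 < y n" using order_tendstoD(1)[OF y] .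
  have "(\<lambda>n. exp (- c n / y n)) \<longlonglongrightarrow> exp (- 0 / l)"
    using y by (intro tendsto_intros c) auto
  moreover have "\<forall>\<^sub>F n in sequentially. exp (- c n / y n) = ee (c n) 1 (y n)"
    using ev by eventually_elim (simp add: ee_def)
  ultimately show "(\<lambda>n. ee (c n) 1 (y n)) \<longlonglongrightarrow> 1" using Lim_transform_eventually by force
  have "(\<lambda>n. (c n * (1 / y n)\<^sup>2) * exp (- c n / y n)) \<longlonglongrightarrow> (0 * (1 / l)\<^sup>2) * exp (- 0 / l)"
    using y by (intro tendsto_intros c) auto
  moreover have "\<forall>\<^sub>F n in sequentially. (c n * (1 / y n)\<^sup>2) * exp (- c n / y n) = ee (c n) (monom (c n) 2) (y n)"
    using ev by eventually_elim (simp add: ee_def poly_monom)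
  ultimately show "(\<lambda>n. ee (c n) (monom (c n) 2) (y n)) \<longlonglongrightarrow> 0" using Lim_transform_eventually by force
qed

lemma cutoff_tendsto:
  assumes c: "\<And>n. c n > 0" "c \<longlonglongrightarrow> 0" and x: "x \<in> {0<..<1}"
  shows "(\<lambda>n. cutoff (c n) x) \<longlonglongrightarrow> 1" "(\<lambda>n. cutoff' (c n) x) \<longlonglongrightarrow> 0"
proof -
  have l: "(\<lambda>n. x - c n) \<longlonglongrightarrow> x" "(\<lambda>n. 1 - c n - x) \<longlonglongrightarrow> 1 - x"
    using tendsto_diff[OF tendsto_const c(2), of x] tendsto_diff[OF tendsto_diff[OF tendsto_const c(2), of 1] tendsto_const, of x]
    by simp_all
  have p: "x > 0" "1 - x > 0" using x by auto
  note t = ee_tendsto[OF c l(1) p(1)] ee_tendsto[OF c l(2) p(2)]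
  show "(\<lambda>n. cutoff (c n) x) \<longlonglongrightarrow> 1"
    unfolding cutoff_def using tendsto_mult[OF t(1) t(3)] by simp
  show "(\<lambda>n. cutoff' (c n) x) \<longlonglongrightarrow> 0"
    unfolding cutoff'_def using tendsto_diff[OF tendsto_mult[OF t(2) t(3)] tendsto_mult[OF t(1) t(4)]] by simp
qed

lemma continuous_on_DERIV:
  "(\<And>x. (f has_real_derivative f' x) (at x)) \<Longrightarrow> continuous_on A f"
  by (meson DERIV_isCont continuous_at_imp_continuous_on)

lemma continuous_cutoff: "c > 0 \<Longrightarrow> continuous_on A (cutoff c)"
  by (rule continuous_on_DERIV[OF DERIV_cutoff])

lemma continuous_ee: "c > 0 \<Longrightarrow> continuous_on A (ee c p)"
  by (rule continuous_on_DERIV[OF DERIV_ee])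

lemma continuous_cutoff': "c > 0 \<Longrightarrow> continuous_on A (cutoff' c)"
  unfolding cutoff'_def
  by (intro continuous_intros continuous_on_compose2[OF continuous_ee[of c UNIV]]) auto

text \<open>The support of \<open>sn k\<close> reaches the end points, so it is multiplied by
  \<open>cutoff c\<close> before testing. As \<open>c\<close> tends to \<open>0\<close>, the term
  with \<open>cutoff'\<close> is bounded and tends to \<open>0\<close> pointwise; dominated
  convergence removes it.\<close>

lemma weak_derivative_coeff:
  assumes f: "L2 f" and g: "L2 g" and w: "is_weak_derivative f g"
  shows "grad_coeff (\<lambda>k. ip f (cs k)) g"
proof -
  have "ip g (sn k) = - (real k * pi) * ip f (cs k)" for k
  proof -
    define c where "c n = 1 / (real n + 4)" for n
    have c: "c n > 0" "c n < 1/2" for n by (auto simp: c_def field_simps)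
    have c0: "c \<longlonglongrightarrow> 0" unfolding c_def
      by (rule real_tendsto_sandwich[OF _ _ tendsto_const LIMSEQ_inverse_real_of_nat])
        (auto simp: eventually_sequentially field_simps)
    have [measurable]: "f \<in> borel_measurable I01" "g \<in> borel_measurable I01" "sn k \<in> borel_measurable I01" "cs k \<in> borel_measurable I01"
      using f g L2_sn L2_cs by (auto simp: L2_iff simp del: L2_sn L2_cs)
    have [measurable]: "cutoff (c n) \<in> borel_measurable I01" "cutoff' (c n) \<in> borel_measurable I01" for n
      by (intro continuous_on_measurable_01 continuous_cutoff continuous_cutoff' c)+
    define P where "P n x = cutoff (c n) x * sn k x" for n x
    define Q where "Q n x = cutoff' (c n) x * sn k x + cutoff (c n) x * (real k * pi * cs k x)" for n x
    have dP: "deriv (P n) = Q n" for n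
      unfolding P_def Q_def
      by (rule ext, rule DERIV_imp_deriv)
        (use DERIV_mult'[OF DERIV_cutoff[OF c(1)] DERIV_sn] in \<open>simp add: add.commute\<close>)
    have test: "test_function (P n)" for n
      unfolding P_def by (rule test_function_cutoff_sn[OF c])
    have eq: "(LINT x|I01. f x * Q n x) = - (LINT x|I01. g x * P n x)" for n
      using w[unfolded is_weak_derivative_def, rule_format, OF test[of n]] by (simp add: LINT_01 dP)
    have "(\<lambda>n. LINT x|I01. f x * Q n x) \<longlonglongrightarrow> (LINT x|I01. f x * (0 * sn k x + 1 * (real k * pi * cs k x)))"
    proof (rule integral_dominated_convergence[where w = "\<lambda>x. \<bar>f x\<bar> * (4 * sqrt 2 * (real k * pi) + real k * pi * sqrt 2)"])
      show "integrable I01 (\<lambda>x. \<bar>f x\<bar> * (4 * sqrt 2 * (real k * pi) + real k * pi * sqrt 2))"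
        using L2_integrable[OF f] by simp
      show "AE x in I01. (\<lambda>n. f x * Q n x) \<longlonglongrightarrow> f x * (0 * sn k x + 1 * (real k * pi * cs k x))"
        using AE_I01_interior unfolding Q_def
        by eventually_elim (intro tendsto_intros cutoff_tendsto[OF c(1) c0])
      show "AE x in I01. norm (f x * Q n x) \<le> \<bar>f x\<bar> * (4 * sqrt 2 * (real k * pi) + real k * pi * sqrt 2)" for n
      proof (rule AE_I2)
        fix x
        have "\<bar>cutoff (c n) x * (real k * pi * cs k x)\<bar> \<le> 1 * (real k * pi * sqrt 2)"
          unfolding abs_mult using cutoff_bounds(1)[OF c(1)[of n], of x] cs_bound[of k x]
          by (intro mult_mono) auto
        then have "\<bar>Q n x\<bar> \<le> 4 * sqrt 2 * (real k * pi) + real k * pi * sqrt 2"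
          using cutoff_bounds(2)[OF c(1)[of n], of x k] unfolding Q_def by linarith
        then show "norm (f x * Q n x) \<le> \<bar>f x\<bar> * (4 * sqrt 2 * (real k * pi) + real k * pi * sqrt 2)"
          by (simp add: abs_mult mult_left_mono)
      qed
    qed (auto simp: Q_def)
    moreover have "(\<lambda>n. - (LINT x|I01. g x * P n x)) \<longlonglongrightarrow> - (LINT x|I01. g x * (1 * sn k x))"
    proof (intro tendsto_minus integral_dominated_convergence[where w = "\<lambda>x. \<bar>g x\<bar> * sqrt 2"])
      show "integrable I01 (\<lambda>x. \<bar>g x\<bar> * sqrt 2)" using L2_integrable[OF g] by simp
      show "AE x in I01. (\<lambda>n. g x * P n x) \<longlonglongrightarrow> g x * (1 * sn k x)"
        using AE_I01_interior unfolding P_def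
        by eventually_elim (intro tendsto_intros cutoff_tendsto[OF c(1) c0])
      show "AE x in I01. norm (g x * P n x) \<le> \<bar>g x\<bar> * sqrt 2" for n
      proof (rule AE_I2)
        fix x
        have "\<bar>P n x\<bar> \<le> 1 * sqrt 2"
          unfolding P_def abs_mult using cutoff_bounds(1)[OF c(1)[of n], of x] sn_bound[of k x]
          by (intro mult_mono) auto
        then show "norm (g x * P n x) \<le> \<bar>g x\<bar> * sqrt 2" by (simp add: abs_mult mult_left_mono)
      qed
    qed (auto simp: P_def)
    ultimately have "(LINT x|I01. f x * (0 * sn k x + 1 * (real k * pi * cs k x))) = - (LINT x|I01. g x * (1 * sn k x))"
      unfolding eq by (rule LIMSEQ_unique)
    moreover have "(LINT x|I01. f x * (0 * sn k x + 1 * (real k * pi * cs k x))) = real k * pi * ip f (cs k)"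
    proof -
      have "(LINT x|I01. f x * (0 * sn k x + 1 * (real k * pi * cs k x))) = ip f (\<lambda>x. real k * pi * cs k x)"
        by (simp add: ip_def del: ip_cmult_right)
      then show ?thesis unfolding ip_cmult_right .
    qed
    ultimately show ?thesis by (simp add: ip_def)
  qed
  then show ?thesis using g by (simp add: grad_coeff_def)
qed

text \<open>Parseval in both bases at once: a test function vanishes at the end points, so the
  cosine coefficients of its derivative are \<open>real k * pi\<close> times its sine
  coefficients.\<close>

lemma coeff_weak_derivative:
  assumes f: "L2 f" and g: "grad_coeff (\<lambda>k. ip f (cs k)) g"
  shows "is_weak_derivative f g"
  unfolding is_weak_derivative_def LINT_01
proof (intro allI impI)
  fix \<phi> assume t: "test_function \<phi>"
  then obtain a b where ab: "0 < a" "b < 1" "\<And>x. x \<notin> {a..b} \<Longrightarrow> \<phi> x = 0"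
    unfolding test_function_def by blast
  then have \<phi>01: "\<phi> 0 = 0" "\<phi> 1 = 0" by auto
  have D: "(\<phi> has_real_derivative deriv \<phi> x) (at x)" "(deriv \<phi> has_real_derivative deriv (deriv \<phi>) x) (at x)" for x
    using t[unfolded test_function_def, THEN conjunct1, rule_format, of 0 x]
      t[unfolded test_function_def, THEN conjunct1, rule_format, of 1 x]
    by (auto simp: DERIV_deriv_iff_field_differentiable)
  have cont: "continuous_on A \<phi>" "continuous_on A (deriv \<phi>)" for A
    by (rule continuous_on_DERIV, rule D)+
  have L2\<phi>: "L2 \<phi>" "L2 (deriv \<phi>)" by (intro L2_continuous cont)+
  have g': "L2 g" "\<And>k. ip g (sn k) = - (real k * pi) * ip f (cs k)" using g by (auto simp: grad_coeff_def)
  have "ip (deriv \<phi>) (cs k) = \<phi> 1 * cs k 1 - \<phi> 0 * cs k 0 - ip \<phi> (\<lambda>x. - (real k * pi) * sn k x)" for k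
    by (rule by_parts_I01[OF cont(1) cont(2) D(1) _ _ DERIV_cs]) (auto intro!: continuous_intros)
  then have c: "ip (deriv \<phi>) (cs k) = real k * pi * ip \<phi> (sn k)" for k
    unfolding \<phi>01 ip_cmult_right by simp
  have "(\<lambda>k. ip f (cs k) * ip (deriv \<phi>) (cs k)) sums ip f (deriv \<phi>)"
    by (rule cosb.parseval[OF f L2\<phi>(2)])
  moreover have "(\<lambda>k. - (ip g (sn k) * ip \<phi> (sn k))) sums - ip g \<phi>"
    by (intro sums_minus sn_parseval g' L2\<phi>)
  moreover have "ip f (cs k) * ip (deriv \<phi>) (cs k) = - (ip g (sn k) * ip \<phi> (sn k))" for k
    by (simp add: c g')
  ultimately have "ip f (deriv \<phi>) = - ip g \<phi>" using sums_unique2 by simp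
  then show "(LINT x|I01. f x * deriv \<phi> x) = - (LINT x|I01. g x * \<phi> x)" by (simp add: ip_def)
qed

lemma H1_iff: "H1 f \<longleftrightarrow> L2 f \<and> (\<exists>g. grad_coeff (\<lambda>k. ip f (cs k)) g)"
  unfolding H1_def using weak_derivative_coeff coeff_weak_derivative grad_coeff_def by blast

lemma weak_grad_coeff:
  assumes "H1 f"
  shows "grad_coeff (\<lambda>k. ip f (cs k)) (weak_grad f)"
proof -
  have "\<exists>g. L2 g \<and> is_weak_derivative f g" "L2 f" using assms by (auto simp: H1_def)
  then show ?thesis unfolding weak_grad_def using weak_derivative_coeff
    by (metis (mono_tags, lifting) someI_ex)
qed

lemma H1_D:
  assumes "H1 f"
  shows "L2 f" "L2 (weak_grad f)" "ip (weak_grad f) (sn k) = - (real k * pi) * ip f (cs k)"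
    "summable (\<lambda>k. \<bar>ip f (cs k)\<bar>)" "AE x in I01. f x = cser (\<lambda>k. ip f (cs k)) x"
  using assms weak_grad_coeff[OF assms] grad_coeff_summable[OF weak_grad_coeff[OF assms]]
    cser_AE_eq[of f] unfolding H1_def grad_coeff_def by auto

text \<open>Riesz-Fischer in the sine basis builds the gradient from its prescribed
  coefficients.\<close>

lemma H1_I:
  assumes "L2 f" "summable (\<lambda>k. kap k * (ip f (cs k))\<^sup>2)"
  shows "H1 f"
proof -
  have "summable (\<lambda>k. (- (real (Suc k) * pi) * ip f (cs (Suc k)))\<^sup>2)"
    using assms(2) by (subst (asm) summable_Suc_iff[symmetric]) (simp only: kap_def power_mult_distrib power2_minus mult_minus_left)
  from sinb.riesz_fischer[OF this] obtain g where g: "L2 g" "\<And>k. ip g (sn (Suc k)) = - (real (Suc k) * pi) * ip f (cs (Suc k))"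
    by blast
  have "ip g (sn k) = - (real k * pi) * ip f (cs k)" for k
    using g(2) by (cases k) auto
  then show ?thesis using assms(1) g(1) by (auto simp: H1_iff grad_coeff_def)
qed

lemma H1_diff:
  assumes "H1 f" "H1 g"
  shows "H1 (\<lambda>x. f x - g x)"
  unfolding H1_iff
proof (intro conjI exI)
  show "L2 (\<lambda>x. f x - g x)" using assms H1_D(1) by (intro L2_diff) auto
  show "grad_coeff (\<lambda>k. ip (\<lambda>x. f x - g x) (cs k)) (\<lambda>x. weak_grad f x - weak_grad g x)"
    unfolding grad_coeff_def using H1_D[OF assms(1)] H1_D[OF assms(2)]
    by (auto simp: ip_diff_left L2_diff algebra_simps)
qed

lemma H1_norm_sq:
  assumes "H1 f"
  shows "(\<lambda>k. (1 + kap k) * (ip f (cs k))\<^sup>2) sums (H1_norm f)\<^sup>2"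
proof -
  have "(H1_norm f)\<^sup>2 = ip f f + ip (weak_grad f) (weak_grad f)"
    unfolding H1_norm_def LINT_01 nrm_sq_integral[symmetric] nrm_sq[symmetric] by simp
  moreover have "(\<lambda>k. (ip f (cs k))\<^sup>2 + kap k * (ip f (cs k))\<^sup>2) sums (ip f f + ip (weak_grad f) (weak_grad f))"
    using sums_add[OF cosb.parseval_self[OF H1_D(1)[OF assms]] sn_parseval[OF H1_D(2)[OF assms] H1_D(2)[OF assms]]]
    by (simp add: H1_D(3)[OF assms] kap_def power2_eq_square mult_ac)
  ultimately show ?thesis by (simp add: algebra_simps)
qed

text \<open>Two continuous representatives agree everywhere, so the definite description in
  \<open>H1_value\<close> is well defined.\<close>

lemma H1_value_eq:
  assumes "continuous_on {0..1} h" "AE x in I01. h x = f x" "x \<in> {0..1}"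
  shows "H1_value f x = h x"
  unfolding H1_value_def
proof (rule the_equality)
  fix v assume "\<exists>g. continuous_on {0..1} g \<and> (AE y in I01. g y = f y) \<and> g x = v"
  then obtain g where g: "continuous_on {0..1} g" "AE y in I01. g y = f y" "g x = v" by blast
  have "AE y in I01. g y = h y" using g(2) assms(2) by eventually_elim simp
  then show "v = h x" using continuous_AE_eq[OF g(1) assms(1) _ _ assms(3)] g(3) by simp
qed (use assms in blast)

lemma H1_value_cser:
  assumes "H1 f" "x \<in> {0..1}"
  shows "H1_value f x = cser (\<lambda>k. ip f (cs k)) x"
proof (rule H1_value_eq[OF _ _ assms(2)])
  show "AE x in I01. cser (\<lambda>k. ip f (cs k)) x = f x" using H1_D(5)[OF assms(1)] by eventually_elim simp
qed (intro cser_continuous H1_D(4)[OF assms(1)])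

section \<open>The boundary currents\<close>

lemma finite_configs [simp]: "finite (configs l)"
  by (auto simp: configs_def intro!: finite_PiE_dflt)

text \<open>The probability of \<open>\<eta>\<close> when \<open>a\<close> lies in
  \<open>[0,1]\<close>, written as a polynomial in \<open>a\<close>.\<close>

definition bern_weight :: "nat \<Rightarrow> config \<Rightarrow> real \<Rightarrow> real" where
  "bern_weight l \<eta> a = (\<Prod>x\<in>{1..l}. if \<eta> x then a else 1 - a)"

lemma expectation_bernoulli_product:
  assumes "a \<in> {0..1}"
  shows "measure_pmf.expectation (bernoulli_product l a) f = (\<Sum>\<eta>\<in>configs l. bern_weight l \<eta> a * f \<eta>)"
proof -
  have "measure_pmf.expectation (bernoulli_product l a) f
      = (\<Sum>\<eta>\<in>configs l. pmf (bernoulli_product l a) \<eta> *\<^sub>R f \<eta>)"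
  proof (rule integral_measure_pmf)
    show "\<eta> \<in> configs l" if "\<eta> \<in> set_pmf (bernoulli_product l a)" for \<eta>
      using that set_Pi_pmf_subset'[of "{1..l}" False "\<lambda>_. bernoulli_pmf a"]
      by (force simp: bernoulli_product_def configs_def PiE_dflt_def)
  qed simp
  also have "\<dots> = (\<Sum>\<eta>\<in>configs l. bern_weight l \<eta> a * f \<eta>)"
  proof (rule sum.cong[OF refl])
    fix \<eta> assume "\<eta> \<in> configs l"
    then have "pmf (bernoulli_product l a) \<eta> = (\<Prod>x\<in>{1..l}. pmf (bernoulli_pmf a) (\<eta> x))"
      unfolding bernoulli_product_def configs_def by (intro pmf_Pi') (auto simp: PiE_dflt_def)
    also have "\<dots> = bern_weight l \<eta> a"
      unfolding bern_weight_def using assms by (intro prod.cong) auto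
    finally show "pmf (bernoulli_product l a) \<eta> *\<^sub>R f \<eta> = bern_weight l \<eta> a * f \<eta>" by simp
  qed
  finally show ?thesis .
qed

text \<open>Both boundary terms of the weak formulation in one current. With the weights in place of
  the measure it is a polynomial in \<open>a\<close>, so continuity and Lipschitz bounds are
  elementary.\<close>

definition bflux :: "nat \<Rightarrow> (config \<Rightarrow> config \<Rightarrow> real) \<Rightarrow> real \<Rightarrow> real \<Rightarrow> real \<Rightarrow> real \<Rightarrow> real" where
  "bflux l R \<alpha> \<beta> a M = (\<Sum>\<eta>\<in>configs l. bern_weight l \<eta> a *
     (\<Sum>\<xi>\<in>configs l. R \<eta> \<xi> * mass_change l \<eta> \<xi> * (\<beta> + \<alpha> * exp (M * mass_change l \<eta> \<xi>))))"

lemma bflux_eq: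
  assumes "a \<in> {0..1}"
  shows "\<beta> * bdry_F l R a + \<alpha> * bdry_p l R a M = bflux l R \<alpha> \<beta> a M"
  unfolding bdry_F_def bdry_p_def expectation_bernoulli_product[OF assms] bflux_def
  by (simp add: sum_distrib_left sum.distrib[symmetric] algebra_simps)

lemma continuous_on_bern_weight [continuous_intros]:
  fixes f :: "'a::metric_space \<Rightarrow> real"
  assumes "continuous_on A f"
  shows "continuous_on A (\<lambda>x. bern_weight l \<eta> (f x))"
proof -
  have "continuous_on A (\<lambda>x. if \<eta> y then f x else 1 - f x)" for y
    using assms by (cases "\<eta> y") (auto intro!: continuous_intros)
  then show ?thesis unfolding bern_weight_def by (intro continuous_intros)
qed

lemma continuous_on_bflux [continuous_intros]:
  fixes f g :: "'a::metric_space \<Rightarrow> real"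
  assumes "continuous_on A f" "continuous_on A g"
  shows "continuous_on A (\<lambda>x. bflux l R \<alpha> \<beta> (f x) (g x))"
  unfolding bflux_def by (intro continuous_intros assms)

lemma bern_weight_01:
  assumes "a \<in> {0..1}"
  shows "0 \<le> bern_weight l \<eta> a" "bern_weight l \<eta> a \<le> 1"
  unfolding bern_weight_def using assms by (auto intro!: prod_nonneg prod_le_1)

text \<open>A product of factors in \<open>[0,1]\<close> changes by at most the sum of the changes
  of its factors, and each of the \<open>l\<close> factors changes by
  \<open>\<bar>a - b\<bar>\<close>.\<close>

lemma bern_weight_lipschitz:
  assumes "a \<in> {0..1}" "b \<in> {0..1}"
  shows "\<bar>bern_weight l \<eta> a - bern_weight l \<eta> b\<bar> \<le> real l * \<bar>a - b\<bar>"
proof -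
  have "norm (bern_weight l \<eta> a - bern_weight l \<eta> b)
      \<le> (\<Sum>x\<in>{1..l}. norm ((if \<eta> x then a else 1 - a) - (if \<eta> x then b else 1 - b)))"
    unfolding bern_weight_def by (rule norm_prod_diff) (use assms in auto)
  also have "\<dots> = (\<Sum>x\<in>{1..l}. \<bar>a - b\<bar>)" by (rule sum.cong) auto
  finally show ?thesis by simp
qed

text \<open>There are finitely many configurations, and the exponential is controlled because
  \<open>M\<close> is confined to a bounded range; \<open>M\<close> will be a boundary value of the
  bounded function \<open>H\<close>.\<close>

lemma bflux_inner_bound:
  fixes \<alpha> \<beta> K :: real
  assumes "\<alpha> \<ge> 0" "\<beta> \<ge> 0"
  obtains Q where "Q \<ge> 0" "\<And>M \<eta>. \<eta> \<in> configs l \<Longrightarrow> \<bar>M\<bar> \<le> K \<Longrightarrow>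
     \<bar>\<Sum>\<xi>\<in>configs l. R \<eta> \<xi> * mass_change l \<eta> \<xi> * (\<beta> + \<alpha> * exp (M * mass_change l \<eta> \<xi>))\<bar> \<le> Q"
proof -
  define q where "q \<eta> = (\<Sum>\<xi>\<in>configs l. \<bar>R \<eta> \<xi> * mass_change l \<eta> \<xi>\<bar> * (\<beta> + \<alpha> * exp (K * \<bar>mass_change l \<eta> \<xi>\<bar>)))" for \<eta>
  have q0: "q \<eta> \<ge> 0" for \<eta> unfolding q_def using assms by (intro sum_nonneg) auto
  show ?thesis
  proof
    show "0 \<le> (\<Sum>\<eta>\<in>configs l. q \<eta>)" by (intro sum_nonneg q0)
    fix M \<eta> assume *: "\<eta> \<in> configs l" "\<bar>M\<bar> \<le> K"
    have "\<bar>\<Sum>\<xi>\<in>configs l. R \<eta> \<xi> * mass_change l \<eta> \<xi> * (\<beta> + \<alpha> * exp (M * mass_change l \<eta> \<xi>))\<bar> \<le> q \<eta>"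
      unfolding q_def
    proof (rule order_trans[OF sum_abs], rule sum_mono)
      fix \<xi>
      have "M * mass_change l \<eta> \<xi> \<le> \<bar>M\<bar> * \<bar>mass_change l \<eta> \<xi>\<bar>" by (metis abs_ge_self abs_mult)
      also have "\<dots> \<le> K * \<bar>mass_change l \<eta> \<xi>\<bar>" using * by (intro mult_right_mono) auto
      finally have "\<beta> + \<alpha> * exp (M * mass_change l \<eta> \<xi>) \<le> \<beta> + \<alpha> * exp (K * \<bar>mass_change l \<eta> \<xi>\<bar>)"
        using assms by (intro add_left_mono mult_left_mono) auto
      moreover have "0 \<le> \<beta> + \<alpha> * exp (M * mass_change l \<eta> \<xi>)" using assms by simp
      ultimately show "\<bar>R \<eta> \<xi> * mass_change l \<eta> \<xi> * (\<beta> + \<alpha> * exp (M * mass_change l \<eta> \<xi>))\<bar>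
          \<le> \<bar>R \<eta> \<xi> * mass_change l \<eta> \<xi>\<bar> * (\<beta> + \<alpha> * exp (K * \<bar>mass_change l \<eta> \<xi>\<bar>))"
        by (subst abs_mult[of "R \<eta> \<xi> * mass_change l \<eta> \<xi>"]) (intro mult_mono, auto)
    qed
    also have "q \<eta> \<le> (\<Sum>\<eta>\<in>configs l. q \<eta>)"
      using * q0 by (intro member_le_sum) auto
    finally show "\<bar>\<Sum>\<xi>\<in>configs l. R \<eta> \<xi> * mass_change l \<eta> \<xi> * (\<beta> + \<alpha> * exp (M * mass_change l \<eta> \<xi>))\<bar>
        \<le> (\<Sum>\<eta>\<in>configs l. q \<eta>)" .
  qed
qed

lemma bflux_lipschitz:
  fixes \<alpha> \<beta> K :: real
  assumes "\<alpha> \<ge> 0" "\<beta> \<ge> 0"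
  obtains B where "B \<ge> 0"
    "\<And>a b M. a \<in> {0..1} \<Longrightarrow> b \<in> {0..1} \<Longrightarrow> \<bar>M\<bar> \<le> K \<Longrightarrow> \<bar>bflux l R \<alpha> \<beta> a M - bflux l R \<alpha> \<beta> b M\<bar> \<le> B * \<bar>a - b\<bar>"
    "\<And>a M. a \<in> {0..1} \<Longrightarrow> \<bar>M\<bar> \<le> K \<Longrightarrow> \<bar>bflux l R \<alpha> \<beta> a M\<bar> \<le> B"
proof -
  obtain Q where Q: "Q \<ge> 0" and Qb: "\<And>M \<eta>. \<eta> \<in> configs l \<Longrightarrow> \<bar>M\<bar> \<le> K \<Longrightarrow>
     \<bar>\<Sum>\<xi>\<in>configs l. R \<eta> \<xi> * mass_change l \<eta> \<xi> * (\<beta> + \<alpha> * exp (M * mass_change l \<eta> \<xi>))\<bar> \<le> Q"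
    using bflux_inner_bound[OF assms, of l K R] by blast
  define N where "N = real (card (configs l)) * Q"
  have N: "N \<ge> 0" using Q by (simp add: N_def)
  show ?thesis
  proof
    show "0 \<le> N * (real l + 1)" using N by simp
    fix a M :: real assume a: "a \<in> {0..1}" and M: "\<bar>M\<bar> \<le> K"
    have "\<bar>bflux l R \<alpha> \<beta> a M\<bar> \<le> (\<Sum>\<eta>\<in>configs l. 1 * Q)"
      unfolding bflux_def
    proof (rule order_trans[OF sum_abs], rule sum_mono)
      fix \<eta> assume "\<eta> \<in> configs l"
      then show "\<bar>bern_weight l \<eta> a * (\<Sum>\<xi>\<in>configs l. R \<eta> \<xi> * mass_change l \<eta> \<xi> * (\<beta> + \<alpha> * exp (M * mass_change l \<eta> \<xi>)))\<bar> \<le> 1 * Q"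
        unfolding abs_mult using bern_weight_01[OF a, of l \<eta>] Qb[OF _ M] by (intro mult_mono) auto
    qed
    also have "\<dots> \<le> N * (real l + 1)" using Q by (simp add: N_def mult_nonneg_nonneg algebra_simps)
    finally show "\<bar>bflux l R \<alpha> \<beta> a M\<bar> \<le> N * (real l + 1)" .
    fix b :: real assume b: "b \<in> {0..1}"
    have "\<bar>bflux l R \<alpha> \<beta> a M - bflux l R \<alpha> \<beta> b M\<bar> \<le> (\<Sum>\<eta>\<in>configs l. real l * \<bar>a - b\<bar> * Q)"
      unfolding bflux_def sum_subtractf[symmetric] left_diff_distrib[symmetric]
    proof (rule order_trans[OF sum_abs], rule sum_mono)
      fix \<eta> assume "\<eta> \<in> configs l"
      then show "\<bar>(bern_weight l \<eta> a - bern_weight l \<eta> b) * (\<Sum>\<xi>\<in>configs l. R \<eta> \<xi> * mass_change l \<eta> \<xi> * (\<beta> + \<alpha> * exp (M * mass_change l \<eta> \<xi>)))\<bar> \<le> real l * \<bar>a - b\<bar> * Q"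
        unfolding abs_mult using bern_weight_lipschitz[OF a b, of l \<eta>] Qb[OF _ M] by (intro mult_mono) auto
    qed
    also have "\<dots> = (N * real l) * \<bar>a - b\<bar>" by (simp add: N_def)
    also have "\<dots> \<le> (N * (real l + 1)) * \<bar>a - b\<bar>"
      using N by (intro mult_right_mono mult_left_mono) auto
    finally show "\<bar>bflux l R \<alpha> \<beta> a M - bflux l R \<alpha> \<beta> b M\<bar> \<le> N * (real l + 1) * \<bar>a - b\<bar>" .
  qed
qed

text \<open>At density \<open>0\<close> only the empty configuration has nonzero weight, and it can
  only gain mass; at density \<open>1\<close> only the full one has, and it can only lose mass. The
  rates and the factor \<open>\<beta> + \<alpha> * exp\<close> are nonnegative.\<close>

lemma bflux_sign:
  assumes "\<alpha> \<ge> 0" "\<beta> \<ge> 0" and R: "\<And>\<eta> \<xi>. \<eta> \<in> configs l \<Longrightarrow> \<xi> \<in> configs l \<Longrightarrow> R \<eta> \<xi> \<ge> 0"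
  shows "0 \<le> bflux l R \<alpha> \<beta> 0 M" "bflux l R \<alpha> \<beta> 1 M \<le> 0"
proof -
  have w: "\<forall>x\<in>{1..l}. \<not> \<eta> x" if "bern_weight l \<eta> 0 \<noteq> 0" for \<eta>
    using that unfolding bern_weight_def by (auto simp: prod_zero_iff split: if_splits)
  show "0 \<le> bflux l R \<alpha> \<beta> 0 M" unfolding bflux_def
  proof (intro sum_nonneg)
    fix \<eta> assume \<eta>: "\<eta> \<in> configs l"
    show "0 \<le> bern_weight l \<eta> 0 * (\<Sum>\<xi>\<in>configs l. R \<eta> \<xi> * mass_change l \<eta> \<xi> * (\<beta> + \<alpha> * exp (M * mass_change l \<eta> \<xi>)))"
    proof (cases "bern_weight l \<eta> 0 = 0")
      case False
      have "mass_change l \<eta> \<xi> \<ge> 0" for \<xi>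
        unfolding mass_change_def using w[OF False] by (intro sum_nonneg) auto
      then show ?thesis using R[OF \<eta>] assms bern_weight_01[of 0 l \<eta>]
        by (intro mult_nonneg_nonneg sum_nonneg add_nonneg_nonneg) auto
    qed simp
  qed
  have w1: "\<forall>x\<in>{1..l}. \<eta> x" if "bern_weight l \<eta> 1 \<noteq> 0" for \<eta>
    using that unfolding bern_weight_def by (auto simp: prod_zero_iff split: if_splits)
  show "bflux l R \<alpha> \<beta> 1 M \<le> 0" unfolding bflux_def
  proof (intro sum_nonpos)
    fix \<eta> assume \<eta>: "\<eta> \<in> configs l"
    show "bern_weight l \<eta> 1 * (\<Sum>\<xi>\<in>configs l. R \<eta> \<xi> * mass_change l \<eta> \<xi> * (\<beta> + \<alpha> * exp (M * mass_change l \<eta> \<xi>))) \<le> 0"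
    proof (cases "bern_weight l \<eta> 1 = 0")
      case False
      have "mass_change l \<eta> \<xi> \<le> 0" for \<xi>
        unfolding mass_change_def using w1[OF False] by (intro sum_nonpos) auto
      then show ?thesis using R[OF \<eta>] assms bern_weight_01[of 1 l \<eta>]
        by (intro mult_nonneg_nonpos sum_nonpos mult_nonpos_nonneg add_nonneg_nonneg) auto
    qed simp
  qed
qed

section \<open>Fubini on the space-time cylinder\<close>

lemma LINT_lebesgue_on_lborel:
  fixes h :: "real \<Rightarrow> real"
  assumes "h \<in> borel_measurable borel" "\<And>x. x \<notin> {a..b} \<Longrightarrow> h x = 0"
  shows "(LINT x|lebesgue_on {a..b}. h x) = (LINT x|lborel. h x)"
proof -
  have "(LINT x|lebesgue_on {a..b}. h x) = (LINT x|lebesgue. indicator {a..b} x *\<^sub>R h x)"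
    by (rule integral_restrict_space) simp
  also have "(\<lambda>x. indicator {a..b} x *\<^sub>R h x) = h"
    using assms(2) by (auto simp: indicator_def fun_eq_iff)
  also have "(LINT x|lebesgue. h x) = (LINT x|lborel. h x)"
    using assms(1) by (intro integral_completion) simp
  finally show ?thesis .
qed

lemma borel_imp_lebesgue_on:
  fixes h :: "real \<Rightarrow> real"
  shows "h \<in> borel_measurable borel \<Longrightarrow> h \<in> borel_measurable (lebesgue_on S)"
  by (intro measurable_restrict_space1) (simp add: measurable_completion)

lemma AE_lborel_lebesgue_on:
  fixes P :: "real \<Rightarrow> bool"
  assumes "AE x in lborel. x \<in> {a..b} \<longrightarrow> P x"
  shows "AE x in lebesgue_on {a..b}. P x"
  using assms by (intro AE_restrict_space_iff[THEN iffD2] AE_completion) auto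

text \<open>Covering the exceptional set by a Borel null set provides the measurability required for
  exchanging the two almost-everywhere quantifiers.\<close>

lemma AE_lborel_pair_sections:
  fixes P :: "real \<times> real \<Rightarrow> bool"
  assumes "AE z in (lborel :: (real \<times> real) measure). P z"
  shows "AE t in lborel. AE x in lborel. P (t, x)" "AE x in lborel. AE t in lborel. P (t, x)"
proof -
  obtain N :: "(real \<times> real) set" where N: "{z \<in> space lborel. \<not> P z} \<subseteq> N" "emeasure lborel N = 0" "N \<in> sets lborel"
    using assms by (rule AE_E)
  have [measurable]: "N \<in> sets (borel \<Otimes>\<^sub>M borel)" unfolding borel_prod using N(3) by simp
  have "AE z in (lborel :: (real \<times> real) measure). z \<notin> N" using N by (intro AE_not_in null_setsI) auto
  then have 1: "AE z in lborel \<Otimes>\<^sub>M lborel. z \<notin> N" unfolding lborel_prod .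
  have a: "AE t in lborel. AE x in lborel. (t, x) \<notin> N" using lborel_pair.AE_pair[OF 1] .
  then have b: "AE x in lborel. AE t in lborel. (t, x) \<notin> N"
  proof (subst (asm) lborel_pair.AE_commute)
    have "- N \<in> sets (borel \<Otimes>\<^sub>M borel)" using \<open>N \<in> sets (borel \<Otimes>\<^sub>M borel)\<close>
      unfolding borel_prod by (rule borel_comp)
    moreover have "{x \<in> space (lborel \<Otimes>\<^sub>M lborel). (fst x, snd x) \<notin> N} = - N" by (auto simp: space_pair_measure)
    moreover have "sets (lborel \<Otimes>\<^sub>M lborel) = sets (borel \<Otimes>\<^sub>M borel :: (real \<times> real) measure)"
      by (rule sets_pair_measure_cong) simp_all
    ultimately show "{x \<in> space (lborel \<Otimes>\<^sub>M lborel). (fst x, snd x) \<notin> N} \<in> sets (lborel \<Otimes>\<^sub>M lborel)"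
      by (simp only:)
  qed
  have P: "(t, x) \<notin> N \<Longrightarrow> P (t, x)" for t x using N(1) by auto
  from a show "AE t in lborel. AE x in lborel. P (t, x)"
    by (rule eventually_mono) (auto elim!: eventually_mono intro: P)
  from b show "AE x in lborel. AE t in lborel. P (t, x)"
    by (rule eventually_mono) (auto elim!: eventually_mono intro: P)
qed

text \<open>Lebesgue measure on the plane is the completion of the product, so product-measure
  arguments need a Borel version. Clamping to \<open>[-C,C]\<close> and setting it to
  \<open>0\<close> off the cylinder make the bounds of that version hold everywhere.\<close>

lemma Omega_borel_version:
  fixes f :: "real \<Rightarrow> real \<Rightarrow> real"
  assumes meas: "(\<lambda>(t, x). f t x) \<in> borel_measurable (lebesgue_on (Omega T))"
    and bdd: "AE (t, x) in lebesgue_on (Omega T). \<bar>f t x\<bar> \<le> C" and "C \<ge> 0"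
  obtains g :: "real \<Rightarrow> real \<Rightarrow> real" where
    "(\<lambda>(t, x). g t x) \<in> borel_measurable borel"
    "\<And>t x. \<bar>g t x\<bar> \<le> C" "\<And>t x. (t, x) \<notin> Omega T \<Longrightarrow> g t x = 0"
    "AE t in lebesgue_on {0..T}. AE x in I01. f t x = g t x"
    "AE x in I01. AE t in lebesgue_on {0..T}. f t x = g t x"
proof -
  have O: "Omega T \<in> sets borel" unfolding Omega_def by (intro borel_closed closed_Times) auto
  have O': "Omega T \<in> sets lebesgue" using O by (simp add: sets_completionI_sets)
  have "(\<lambda>z. indicator (Omega T) z *\<^sub>R (case z of (t, x) \<Rightarrow> f t x)) \<in> borel_measurable lebesgue"
    using meas O' by (subst (asm) borel_measurable_restrict_space_iff) auto
  from completion_ex_borel_measurable_real[of "\<lambda>z. indicator (Omega T) z *\<^sub>R (case z of (t, x) \<Rightarrow> f t x)" lborel] this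
  obtain h where h: "h \<in> borel_measurable (lborel :: (real \<times> real) measure)"
    and hf: "AE z in lborel. indicator (Omega T) z *\<^sub>R (case z of (t, x) \<Rightarrow> f t x) = h z" by auto
  define g where "g t x = (if (t, x) \<in> Omega T then max (- C) (min C (h (t, x))) else 0)" for t x
  have "AE z in lebesgue. z \<in> Omega T \<longrightarrow> (case z of (t, x) \<Rightarrow> \<bar>f t x\<bar> \<le> C)"
    using bdd O' by (subst (asm) AE_restrict_space_iff) auto
  then have "AE z in lborel. z \<in> Omega T \<longrightarrow> (case z of (t, x) \<Rightarrow> \<bar>f t x\<bar> \<le> C)"
    by (simp add: AE_completion_iff)
  with hf have fg: "AE z in lborel. z \<in> Omega T \<longrightarrow> (case z of (t, x) \<Rightarrow> f t x = g t x)"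
    by eventually_elim (auto simp: g_def)
  have S: "AE t in lborel. AE x in lborel. (t, x) \<in> Omega T \<longrightarrow> f t x = g t x"
    "AE x in lborel. AE t in lborel. (t, x) \<in> Omega T \<longrightarrow> f t x = g t x"
    using AE_lborel_pair_sections[OF fg] by auto
  show ?thesis
  proof
    have "(\<lambda>z. if z \<in> Omega T then max (- C) (min C (h z)) else 0) \<in> borel_measurable borel"
      using h O by measurable
    moreover have "(\<lambda>(t, x). g t x) = (\<lambda>z. if z \<in> Omega T then max (- C) (min C (h z)) else 0)"
      by (auto simp: g_def)
    ultimately show "(\<lambda>(t, x). g t x) \<in> borel_measurable borel" by simp
    show "\<bar>g t x\<bar> \<le> C" "(t, x) \<notin> Omega T \<Longrightarrow> g t x = 0" for t x
      using \<open>C \<ge> 0\<close> by (auto simp: g_def)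
    show "AE t in lebesgue_on {0..T}. AE x in I01. f t x = g t x"
    proof (rule AE_lborel_lebesgue_on)
      show "AE t in lborel. t \<in> {0..T} \<longrightarrow> (AE x in I01. f t x = g t x)"
        using S(1)
      proof eventually_elim
        case (elim t)
        show ?case
          by (intro impI AE_lborel_lebesgue_on) (use elim in \<open>auto elim!: eventually_mono simp: Omega_def\<close>)
      qed
    qed
    show "AE x in I01. AE t in lebesgue_on {0..T}. f t x = g t x"
    proof (rule AE_lborel_lebesgue_on)
      show "AE x in lborel. x \<in> {0..1} \<longrightarrow> (AE t in lebesgue_on {0..T}. f t x = g t x)"
        using S(2)
      proof eventually_elim
        case (elim x)
        show ?case
          by (intro impI AE_lborel_lebesgue_on) (use elim in \<open>auto elim!: eventually_mono simp: Omega_def\<close>)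
      qed
    qed
  qed
qed

lemma AE_lebesgue_on_subset:
  fixes P :: "real \<Rightarrow> bool"
  assumes "AE x in lebesgue_on {a..b}. P x" "{c..d} \<subseteq> {a..b}"
  shows "AE x in lebesgue_on {c..d}. P x"
  using assms by (simp add: AE_restrict_space_iff) (auto elim!: eventually_mono)

text \<open>Fubini is applied to the Borel version on the product of two copies of
  \<open>lborel\<close>; almost everywhere equality of the sections, in both orders, brings the
  result back to \<open>f\<close>.\<close>

lemma fubini_Omega:
  fixes f :: "real \<Rightarrow> real \<Rightarrow> real"
  assumes meas: "(\<lambda>(t, x). f t x) \<in> borel_measurable (lebesgue_on (Omega T))"
    and bdd: "AE (t, x) in lebesgue_on (Omega T). \<bar>f t x\<bar> \<le> C" and "C \<ge> 0"
  shows "AE t in lebesgue_on {0..T}. f t \<in> borel_measurable I01 \<and> (AE x in I01. \<bar>f t x\<bar> \<le> C)"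
    and "(\<lambda>t. LINT x|I01. f t x) \<in> borel_measurable (lebesgue_on {0..T})"
    and "t \<in> {0..T} \<Longrightarrow> integrable I01 (\<lambda>x. LINT s|lebesgue_on {0..t}. f s x)"
    and "t \<in> {0..T} \<Longrightarrow> (LINT x|I01. LINT s|lebesgue_on {0..t}. f s x) = (LINT s|lebesgue_on {0..t}. LINT x|I01. f s x)"
proof -
  obtain g where g[measurable]: "(\<lambda>(t, x). g t x) \<in> borel_measurable (borel :: (real \<times> real) measure)"
    and gC: "\<And>t x. \<bar>g t x\<bar> \<le> C" and g0: "\<And>t x. (t, x) \<notin> Omega T \<Longrightarrow> g t x = 0"
    and ae1: "AE t in lebesgue_on {0..T}. AE x in I01. f t x = g t x"
    and ae2: "AE x in I01. AE t in lebesgue_on {0..T}. f t x = g t x"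
    using Omega_borel_version[OF assms] by blast
  have g2[measurable]: "(\<lambda>(t, x). g t x) \<in> borel_measurable (borel \<Otimes>\<^sub>M borel)" using g by (simp add: borel_prod)
  have gs[measurable]: "g t \<in> borel_measurable borel" "(\<lambda>t. g t x) \<in> borel_measurable borel" for t x
    using measurable_Pair2[OF g2, of t] measurable_Pair1[OF g2, of x] by simp_all
  have gI: "g t \<in> borel_measurable I01" "(\<lambda>t. g t x) \<in> borel_measurable (lebesgue_on S)" for t x S
    by (intro borel_imp_lebesgue_on gs)+
  show "AE t in lebesgue_on {0..T}. f t \<in> borel_measurable I01 \<and> (AE x in I01. \<bar>f t x\<bar> \<le> C)"
    using ae1
  proof eventually_elim
    case (elim t)
    then have "AE x in I01. g t x = f t x" by eventually_elim simp
    from measurable_01_AE[OF gI(1) this] have "f t \<in> borel_measurable I01" by simp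
    moreover have "AE x in I01. \<bar>f t x\<bar> \<le> C" using elim gC by (auto elim!: eventually_mono)
    ultimately show ?case by simp
  qed
  have int: "(LINT x|I01. f t x) = (LINT x|I01. g t x)" if "AE x in I01. f t x = g t x" for t
  proof -
    have "AE x in I01. g t x = f t x" using that by eventually_elim simp
    from measurable_01_AE[OF gI(1) this] show ?thesis using that gI by (intro integral_cong_AE) auto
  qed
  have gL: "(LINT x|I01. g t x) = (LINT x|lborel. g t x)" for t
    by (rule LINT_lebesgue_on_lborel) (auto intro: g0 simp: Omega_def)
  have m: "(\<lambda>t. LINT x|lborel. g t x) \<in> borel_measurable borel" by measurable
  show meas1: "(\<lambda>t. LINT x|I01. f t x) \<in> borel_measurable (lebesgue_on {0..T})"
  proof (rule measurable_01_AE[OF borel_imp_lebesgue_on[OF m]])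
    show "AE t in lebesgue_on {0..T}. (LINT x|lborel. g t x) = (LINT x|I01. f t x)"
      using ae1 by eventually_elim (simp add: int gL)
  qed
  assume t: "t \<in> {0..T}"
  define k where "k s x = (if s \<in> {0..t} then g s x else 0)" for s x
  have km: "(\<lambda>(t, x). k t x) \<in> borel_measurable (borel \<Otimes>\<^sub>M borel)" unfolding k_def by measurable
  have kC: "\<bar>k s x\<bar> \<le> C" for s x using gC \<open>C \<ge> 0\<close> by (simp add: k_def)
  have k0: "k s x = 0" if "s \<notin> {0..t} \<or> x \<notin> {0..1}" for s x
    using that g0[of s x] by (auto simp: k_def Omega_def)
  have ks: "k s \<in> borel_measurable borel" "(\<lambda>s. k s x) \<in> borel_measurable borel" for s x
    using measurable_Pair2[OF km, of s] measurable_Pair1[OF km, of x] by simp_all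
  have kint: "integrable (lborel \<Otimes>\<^sub>M lborel) (\<lambda>(s, x). k s x)"
  proof (rule integrableI_bounded_set[where A = "{0..t} \<times> {0..1::real}" and B = C])
    show "(\<lambda>(s, x). k s x) \<in> borel_measurable (lborel \<Otimes>\<^sub>M lborel)" using km by simp
    show "emeasure (lborel \<Otimes>\<^sub>M lborel) ({0..t} \<times> {0..1::real}) < \<infinity>"
      using t by (subst lborel.emeasure_pair_measure_Times) (simp_all add: ennreal_mult_less_top)
    show "{0..t} \<times> {0..1::real} \<in> sets (lborel \<Otimes>\<^sub>M lborel)" by (rule pair_measureI) simp_all
    show "AE x\<in>{0..t} \<times> {0..1::real} in lborel \<Otimes>\<^sub>M lborel. norm (case x of (s, x) \<Rightarrow> k s x) \<le> C"
      using kC by (intro AE_I2) (auto simp: split_beta)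
    show "AE x in lborel \<Otimes>\<^sub>M lborel. x \<notin> {0..t} \<times> {0..1::real} \<longrightarrow> (case x of (s, x) \<Rightarrow> k s x) = 0"
      by (intro AE_I2) (auto simp: split_beta intro!: k0)
  qed
  have sub: "{0..t} \<subseteq> {0..T}" using t by auto
  have inner: "AE x in I01. (LINT s|lebesgue_on {0..t}. f s x) = (LINT s|lborel. k s x)"
    using ae2
  proof eventually_elim
    case (elim x)
    have ae: "AE s in lebesgue_on {0..t}. f s x = g s x" by (rule AE_lebesgue_on_subset[OF elim sub])
    then have "AE s in lebesgue_on {0..t}. g s x = f s x" by eventually_elim simp
    from measurable_01_AE[OF gI(2) this]
    have "(LINT s|lebesgue_on {0..t}. f s x) = (LINT s|lebesgue_on {0..t}. g s x)"
      using ae gI by (intro integral_cong_AE) auto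
    also have "\<dots> = (LINT s|lebesgue_on {0..t}. k s x)"
      by (rule Bochner_Integration.integral_cong) (auto simp: k_def)
    also have "\<dots> = (LINT s|lborel. k s x)"
      by (rule LINT_lebesgue_on_lborel[OF ks(2)]) (auto simp: k0)
    finally show ?case .
  qed
  have mk: "(\<lambda>x. LINT s|lborel. k s x) \<in> borel_measurable borel"
    using lborel_pair.integrable_snd[OF kint] borel_measurable_integrable by simp
  have "integrable lborel (\<lambda>x. LINT s|lborel. k s x)" using lborel_pair.integrable_snd[OF kint] by simp
  then have "integrable lebesgue (\<lambda>x. LINT s|lborel. k s x)"
    using mk by (subst integrable_completion) auto
  then have "integrable I01 (\<lambda>x. LINT s|lborel. k s x)"
    using integrable_mult_indicator[of "{0..1}" lebesgue "\<lambda>x. LINT s|lborel. k s x"]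
    by (simp add: integrable_restrict_space)
  moreover have mf: "(\<lambda>x. LINT s|lebesgue_on {0..t}. f s x) \<in> borel_measurable I01"
  proof (rule measurable_01_AE[OF borel_imp_lebesgue_on[OF mk]])
    show "AE x in I01. (LINT s|lborel. k s x) = (LINT s|lebesgue_on {0..t}. f s x)"
      using inner by eventually_elim simp
  qed
  ultimately show "integrable I01 (\<lambda>x. LINT s|lebesgue_on {0..t}. f s x)"
    using inner borel_imp_lebesgue_on[OF mk] by (subst integrable_cong_AE) auto
  have "(LINT x|I01. LINT s|lebesgue_on {0..t}. f s x) = (LINT x|I01. LINT s|lborel. k s x)"
    using inner mf borel_imp_lebesgue_on[OF mk] by (intro integral_cong_AE) auto
  also have "\<dots> = (LINT x|lborel. LINT s|lborel. k s x)"
    by (rule LINT_lebesgue_on_lborel[OF mk]) (simp add: k0)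
  also have "\<dots> = (LINT s|lborel. LINT x|lborel. k s x)"
    using lborel_pair.Fubini_integral[OF kint] by simp
  also have "\<dots> = (LINT s|lebesgue_on {0..t}. LINT x|lborel. k s x)"
  proof (rule LINT_lebesgue_on_lborel[symmetric])
    show "(\<lambda>s. LINT x|lborel. k s x) \<in> borel_measurable borel" using km by measurable
  qed (simp add: k0)
  also have "\<dots> = (LINT s|lebesgue_on {0..t}. LINT x|I01. f s x)"
  proof (rule integral_cong_AE)
    have "(\<lambda>s. LINT x|lborel. k s x) \<in> borel_measurable borel" using km by measurable
    then show m1: "(\<lambda>s. LINT x|lborel. k s x) \<in> borel_measurable (lebesgue_on {0..t})" by (rule borel_imp_lebesgue_on)
    have "AE s in lebesgue_on {0..t}. s \<in> {0..t}" by (rule AE_I2) simp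
    with AE_lebesgue_on_subset[OF ae1 sub]
    show ae: "AE s in lebesgue_on {0..t}. (LINT x|lborel. k s x) = (LINT x|I01. f s x)"
    proof eventually_elim
      case (elim s)
      then have "k s = g s" by (auto simp: k_def)
      then show ?case using int[OF elim(1)] gL[of s] by simp
    qed
    show "(\<lambda>s. LINT x|I01. f s x) \<in> borel_measurable (lebesgue_on {0..t})"
      by (rule measurable_01_AE[OF m1 ae])
  qed
  finally show "(LINT x|I01. LINT s|lebesgue_on {0..t}. f s x) = (LINT s|lebesgue_on {0..t}. LINT x|I01. f s x)" .
qed

section \<open>The Duhamel integral\<close>

text \<open>What remains of the weak formulation without its diffusion term when tested with
  \<open>cs k\<close>: the flux \<open>W s\<close> is paired with the derivative
  \<open>- (real k * pi) * sn k\<close>, and the currents \<open>p\<close> and \<open>q\<close>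
  enter with the end point values of \<open>cs k\<close>.\<close>

definition forcing :: "(real \<Rightarrow> real \<Rightarrow> real) \<Rightarrow> (real \<Rightarrow> real) \<Rightarrow> (real \<Rightarrow> real) \<Rightarrow> nat \<Rightarrow> real \<Rightarrow> real" where
  "forcing W p q k s = - (real k * pi) * ip (W s) (sn k) + p s * cs k 0 + q s * cs k 1"

definition duhamel :: "(real \<Rightarrow> real) \<Rightarrow> nat \<Rightarrow> real \<Rightarrow> real" where
  "duhamel f k t = (LINT s|lebesgue_on {0..t}. exp (- kap k * (t - s)) * f s)"

text \<open>
  The weights \<open>mu k\<close> are summable.  The kernel estimates below trade the decay of the heat kernel
  for the factor \<open>mu k\<close>, an integrable singularity at lag \<open>\<tau> = 0\<close>, and a negative power of
  \<open>\<omega>\<close>, which makes the Duhamel operator a contraction in the supremum weighted by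
  \<open>exp (- \<omega> * t)\<close> once \<open>\<omega>\<close> is large.
\<close>

definition mu :: "nat \<Rightarrow> real" where
  "mu k = (if k = 0 then 1 else kap k powr (- 5/8))"

lemma mu_nonneg [simp]: "mu k \<ge> 0"
  by (simp add: mu_def)

lemma summable_mu: "summable mu"
proof (rule summable_comparison_test'[where N = 1])
  show "summable (\<lambda>k. real k powr (- 5/4))" by (simp add: summable_real_powr_iff)
  fix k :: nat assume k: "1 \<le> k"
  have "kap k powr (- 5/8) = (real k * pi) powr (- 5/4)"
    using k powr_powr[of "real k * pi" 2 "- 5/8"] by (simp add: kap_def)
  also have "\<dots> \<le> real k powr (- 5/4)"
    using k pi_ge_two by (intro powr_mono2') (auto simp: mult_le_cancel_left1)
  finally show "norm (mu k) \<le> real k powr (- 5/4)" using k by (simp add: mu_def)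
qed

section \<open>Kernel estimates\<close>

lemma exp_le_powr: "y > 0 \<Longrightarrow> exp (- 2 * y) \<le> y powr (- 7/4)" for y :: real
proof -
  assume y: "y > 0"
  have "y powr (7/4) \<le> exp (2 * y)"
  proof (cases "y \<le> 1")
    case True
    then have "y powr (7/4) \<le> 1" using y by (intro powr_le1) auto
    also have "1 \<le> exp (2 * y)" using y by simp
    finally show ?thesis .
  next
    case False
    then have "y powr (7/4) \<le> y powr 2" by (intro powr_mono) auto
    also have "\<dots> = y\<^sup>2" using y by simp
    also have "\<dots> \<le> (exp y)\<^sup>2"
      using y exp_ge_add_one_self[of y] by (intro power_mono) (simp_all del: exp_ge_add_one_self)
    also have "\<dots> = exp (2 * y)" by (simp add: exp_double)
    finally show ?thesis .
  qed
  then have "1 / exp (2 * y) \<le> 1 / y powr (7/4)"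
    using y by (intro divide_left_mono) auto
  then show ?thesis by (simp add: exp_minus powr_minus inverse_eq_divide)
qed

text \<open>Stated for the square of the multiplier because it is used under Cauchy-Schwarz over
  \<open>k\<close>. Of the exponent \<open>7/4\<close>, the part \<open>1\<close> pays for the
  factor \<open>kap k\<close>, \<open>5/8\<close> gives \<open>mu k\<close>, and \<open>1/8\<close>
  gives the power of \<open>\<omega>\<close>.\<close>

lemma kernel_bound_volume:
  assumes "\<omega> \<ge> 1" "\<tau> > 0"
  shows "kap k * exp (- 2 * ((kap k + \<omega>) * \<tau>)) \<le> mu k * (\<omega> powr (- 1/8) * \<tau> powr (- 7/4))"
proof (cases "k = 0")
  case False
  define \<kappa> where "\<kappa> = kap k"
  have \<kappa>: "\<kappa> \<ge> 1" using False kap_ge_1[of k] by (simp add: \<kappa>_def)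
  have "\<kappa> powr (13/8) * \<omega> powr (1/8) \<le> (\<kappa> + \<omega>) powr (13/8) * (\<kappa> + \<omega>) powr (1/8)"
    using \<kappa> assms by (intro mult_mono powr_mono2) auto
  also have "\<dots> = (\<kappa> + \<omega>) powr (7/4)" by (simp flip: powr_add)
  finally have "1 / (\<kappa> + \<omega>) powr (7/4) \<le> 1 / (\<kappa> powr (13/8) * \<omega> powr (1/8))"
    using \<kappa> assms by (intro divide_left_mono) auto
  then have *: "(\<kappa> + \<omega>) powr (- 7/4) \<le> \<kappa> powr (- 13/8) * \<omega> powr (- 1/8)"
    by (simp add: powr_minus inverse_eq_divide)
  have "\<kappa> * exp (- 2 * ((\<kappa> + \<omega>) * \<tau>)) \<le> \<kappa> * ((\<kappa> + \<omega>) * \<tau>) powr (- 7/4)"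
    using \<kappa> assms by (intro mult_left_mono exp_le_powr mult_pos_pos) auto
  also have "\<dots> = \<kappa> * (\<kappa> + \<omega>) powr (- 7/4) * \<tau> powr (- 7/4)"
    using \<kappa> assms by (simp add: powr_mult)
  also have "\<dots> \<le> \<kappa> * (\<kappa> powr (- 13/8) * \<omega> powr (- 1/8)) * \<tau> powr (- 7/4)"
    using \<kappa> * by (intro mult_right_mono mult_left_mono) auto
  also have "\<kappa> * (\<kappa> powr (- 13/8) * \<omega> powr (- 1/8)) = \<kappa> powr (- 5/8) * \<omega> powr (- 1/8)"
    using \<kappa> powr_add[of \<kappa> 1 "- 13/8"] by simp
  finally show ?thesis using False by (simp add: mu_def \<kappa>_def mult.assoc)
qed simp

text \<open>Point sources have coefficients that do not decay, so there is no Cauchy-Schwarz over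
  \<open>k\<close> and the multiplier itself must be summable. The powers of \<open>\<tau>\<close>
  and \<open>\<omega>\<close> are those of the square root of the volume bound, so that both parts
  can be added.\<close>

lemma kernel_bound_boundary:
  assumes "\<omega> \<ge> 1" "\<tau> > 0"
  shows "exp (- ((kap k + \<omega>) * \<tau>)) \<le> mu k * (\<omega> powr (- 1/16) * \<tau> powr (- 7/8))"
proof -
  define \<kappa> where "\<kappa> = kap k"
  have \<kappa>: "\<kappa> \<ge> 0" by (simp add: \<kappa>_def)
  have "(\<kappa> + \<omega>) powr (- 7/8) \<le> mu k * \<omega> powr (- 1/16)"
  proof (cases "k = 0")
    case True
    then show ?thesis using assms by (auto simp: mu_def \<kappa>_def intro!: powr_mono)
  next
    case False
    then have \<kappa>1: "\<kappa> \<ge> 1" using kap_ge_1[of k] by (simp add: \<kappa>_def)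
    have "\<kappa> powr (5/8) * \<omega> powr (1/16) \<le> (\<kappa> + \<omega>) powr (5/8) * (\<kappa> + \<omega>) powr (1/16)"
      using \<kappa> assms by (intro mult_mono powr_mono2) auto
    also have "\<dots> = (\<kappa> + \<omega>) powr (11/16)" by (simp flip: powr_add)
    \<comment> \<open>The surplus \<open>7/8 - 11/16\<close> is given away, as
      \<open>\<kappa> + \<omega> \<ge> 1\<close>.\<close>
    also have "\<dots> \<le> (\<kappa> + \<omega>) powr (7/8)" using \<kappa> assms by (intro powr_mono) auto
    finally have "1 / (\<kappa> + \<omega>) powr (7/8) \<le> 1 / (\<kappa> powr (5/8) * \<omega> powr (1/16))"
      using \<kappa>1 assms by (intro divide_left_mono) auto
    then show ?thesis using False by (simp add: powr_minus inverse_eq_divide mu_def \<kappa>_def)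
  qed
  moreover have "exp (- ((\<kappa> + \<omega>) * \<tau>)) \<le> (\<kappa> + \<omega>) powr (- 7/8) * \<tau> powr (- 7/8)"
  proof -
    define y where "y = (\<kappa> + \<omega>) * \<tau>"
    have y: "y > 0" unfolding y_def using \<kappa> assms by (intro mult_pos_pos) auto
    have "(exp (- y))\<^sup>2 \<le> (y powr (- 7/8))\<^sup>2"
      using exp_le_powr[OF y] y by (simp add: power2_eq_square flip: exp_add powr_add)
    then have "exp (- y) \<le> y powr (- 7/8)" by (rule power2_le_imp_le) simp
    then show ?thesis using \<kappa> assms by (simp add: y_def powr_mult)
  qed
  moreover have "(\<kappa> + \<omega>) powr (- 7/8) * \<tau> powr (- 7/8) \<le> (mu k * \<omega> powr (- 1/16)) * \<tau> powr (- 7/8)"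
    by (intro mult_right_mono calculation) simp
  ultimately show ?thesis unfolding \<kappa>_def mult.assoc by linarith
qed

lemma powr_kernel_integral:
  fixes t :: real
  assumes "t \<ge> 0"
  shows "integrable (lebesgue_on {0..t}) (\<lambda>s. (t - s) powr (- 7/8))"
    and "(LINT s|lebesgue_on {0..t}. (t - s) powr (- 7/8)) = 8 * t powr (1/8)"
proof -
  have "((\<lambda>s. (t - s) powr (- 7/8)) has_integral - 8 * (t - t) powr (1/8) - (- 8 * (t - 0) powr (1/8))) {0..t}"
  proof (rule fundamental_theorem_of_calculus_interior[OF assms])
    show "continuous_on {0..t} (\<lambda>s. - 8 * (t - s) powr (1/8))"
      by (intro continuous_intros continuous_on_powr') auto
    fix s assume "s \<in> {0<..<t}"
    then have "((\<lambda>s. - 8 * (t - s) powr (1/8)) has_real_derivative (t - s) powr (- 7/8)) (at s)"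
      by (auto intro!: derivative_eq_intros)
    then show "((\<lambda>s. - 8 * (t - s) powr (1/8)) has_vector_derivative (t - s) powr (- 7/8)) (at s)"
      by (simp add: has_real_derivative_iff_has_vector_derivative)
  qed
  then have h: "((\<lambda>s. (t - s) powr (- 7/8)) has_integral 8 * t powr (1/8)) {0..t}" by simp
  then have "(\<lambda>s. (t - s) powr (- 7/8)) absolutely_integrable_on {0..t}"
    by (intro nonnegative_absolutely_integrable_1) (auto simp: has_integral_integrable)
  then show i: "integrable (lebesgue_on {0..t}) (\<lambda>s. (t - s) powr (- 7/8))"
    by (simp add: set_integrable_Icc)
  show "(LINT s|lebesgue_on {0..t}. (t - s) powr (- 7/8)) = 8 * t powr (1/8)"
    using lebesgue_integral_eq_integral[OF i] h by (simp add: integral_unique)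
qed

lemma AE_lebesgue_on_ne: "AE s in lebesgue_on {a..b}. s \<noteq> (c :: real)"
proof -
  have "AE x in lebesgue. x \<notin> {c}"
    by (rule AE_not_in) (simp add: negligible_iff_null_sets[symmetric])
  then show ?thesis by (intro AE_restrict_space_iff[THEN iffD2]) (auto elim!: eventually_mono)
qed

lemma AE_lebesgue_on_in: "AE s in lebesgue_on {a..b}. s \<in> {a..b :: real}"
  by (rule AE_I2) simp

text \<open>Writing \<open>exp (- kap k * (t - s))\<close> as
  \<open>exp (\<omega> * (t - s))\<close> times a kernel with rate \<open>kap k + \<omega>\<close>
  merges the weight at time \<open>s\<close> into the weight at time \<open>t\<close>. The flux part
  is summed by Cauchy-Schwarz and Bessel, the boundary part absolutely; the constant
  \<open>3\<close> is an upper bound for \<open>2 * sqrt 2\<close>.\<close>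

lemma forcing_pointwise:
  assumes "finite K" "\<omega> \<ge> 1" "s < t" "L2 (W s)"
    and "nrm (W s) \<le> A * exp (\<omega> * s)" "\<bar>p s\<bar> \<le> A * exp (\<omega> * s)" "\<bar>q s\<bar> \<le> A * exp (\<omega> * s)"
  shows "(\<Sum>k\<in>K. \<bar>exp (- kap k * (t - s)) * forcing W p q k s\<bar>)
    \<le> A * exp (\<omega> * t) * (\<omega> powr (- 1/16) * (sqrt (sum mu K) + 3 * sum mu K)) * (t - s) powr (- 7/8)"
proof -
  define \<tau> where "\<tau> = t - s"
  have \<tau>: "\<tau> > 0" using assms by (simp add: \<tau>_def)
  define E where "E k = exp (- ((kap k + \<omega>) * \<tau>))" for k
  have E0: "E k > 0" for k by (simp add: E_def)
  have exp_eq: "exp (- kap k * (t - s)) = exp (\<omega> * \<tau>) * E k" for k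
    by (simp add: E_def \<tau>_def algebra_simps flip: exp_add)
  define L where "L = \<omega> powr (- 1/16) * \<tau> powr (- 7/8)"
  have L0: "L \<ge> 0" by (simp add: L_def)
  have L2': "L\<^sup>2 = \<omega> powr (- 1/8) * \<tau> powr (- 7/4)"
  proof -
    have sq: "(x powr a)\<^sup>2 = x powr (2 * a)" for x a :: real
      by (simp only: power2_eq_square mult_2 powr_add)
    show ?thesis unfolding L_def power_mult_distrib sq by simp
  qed
  have M0: "sum mu K \<ge> 0" by (intro sum_nonneg) auto
  have A0: "A * exp (\<omega> * s) \<ge> 0" using assms(5) nrm_nonneg[of "W s"] by linarith
  have vol: "(\<Sum>k\<in>K. \<bar>real k * pi * E k\<bar> * \<bar>ip (W s) (sn k)\<bar>) \<le> sqrt (sum mu K) * L * (A * exp (\<omega> * s))"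
  proof -
    have "(\<Sum>k\<in>K. \<bar>real k * pi * E k\<bar> * \<bar>ip (W s) (sn k)\<bar>)
        \<le> L2_set (\<lambda>k. real k * pi * E k) K * L2_set (\<lambda>k. ip (W s) (sn k)) K"
      by (rule L2_set_mult_ineq)
    also have "\<dots> \<le> (sqrt (sum mu K) * L) * nrm (W s)"
    proof (rule mult_mono)
      have "(\<Sum>k\<in>K. (real k * pi * E k)\<^sup>2) \<le> (\<Sum>k\<in>K. mu k * L\<^sup>2)"
      proof (rule sum_mono)
        fix k
        have "(real k * pi * E k)\<^sup>2 = kap k * exp (- 2 * ((kap k + \<omega>) * \<tau>))"
          by (simp add: E_def kap_def power_mult_distrib flip: exp_double)
        also have "\<dots> \<le> mu k * L\<^sup>2" unfolding L2' by (rule kernel_bound_volume[OF assms(2) \<tau>])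
        finally show "(real k * pi * E k)\<^sup>2 \<le> mu k * L\<^sup>2" .
      qed
      then have "L2_set (\<lambda>k. real k * pi * E k) K \<le> sqrt (sum mu K * L\<^sup>2)"
        unfolding L2_set_def by (simp add: sum_distrib_right)
      then show "L2_set (\<lambda>k. real k * pi * E k) K \<le> sqrt (sum mu K) * L"
        using L0 by (simp add: real_sqrt_mult)
      show "L2_set (\<lambda>k. ip (W s) (sn k)) K \<le> nrm (W s)"
        unfolding L2_set_def nrm_def by (intro real_sqrt_le_mono sn_bessel assms)
    qed (auto simp: L0 M0)
    also have "\<dots> \<le> (sqrt (sum mu K) * L) * (A * exp (\<omega> * s))"
      using assms L0 M0 by (intro mult_left_mono) auto
    finally show ?thesis .
  qed
  have bdy: "(\<Sum>k\<in>K. E k * \<bar>p s * cs k 0 + q s * cs k 1\<bar>) \<le> 3 * sum mu K * L * (A * exp (\<omega> * s))"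
  proof -
    have "\<bar>p s * cs k 0 + q s * cs k 1\<bar> \<le> 3 * (A * exp (\<omega> * s))" for k
    proof -
      have "\<bar>p s * cs k 0 + q s * cs k 1\<bar> \<le> \<bar>p s\<bar> * \<bar>cs k 0\<bar> + \<bar>q s\<bar> * \<bar>cs k 1\<bar>"
        by (metis abs_mult abs_triangle_ineq)
      also have "\<dots> \<le> (A * exp (\<omega> * s)) * sqrt 2 + (A * exp (\<omega> * s)) * sqrt 2"
        using assms A0 by (intro add_mono mult_mono cs_bound) auto
      also have "\<dots> = (2 * sqrt 2) * (A * exp (\<omega> * s))" by simp
      also have "\<dots> \<le> 3 * (A * exp (\<omega> * s))"
      proof (rule mult_right_mono[OF _ A0])
        have "sqrt 2 \<le> 3/2" by (rule real_le_lsqrt) (auto simp: power2_eq_square)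
        then show "2 * sqrt 2 \<le> 3" by simp
      qed
      finally show ?thesis .
    qed
    then have "(\<Sum>k\<in>K. E k * \<bar>p s * cs k 0 + q s * cs k 1\<bar>) \<le> (\<Sum>k\<in>K. (mu k * L) * (3 * (A * exp (\<omega> * s))))"
    proof (intro sum_mono mult_mono)
      show "E k \<le> mu k * L" for k
        unfolding E_def L_def by (rule kernel_bound_boundary[OF assms(2) \<tau>])
    qed (use L0 in auto)
    also have "\<dots> = 3 * sum mu K * L * (A * exp (\<omega> * s))"
      by (simp add: mult.assoc sum_distrib_right[symmetric])
    finally show ?thesis .
  qed
  have "(\<Sum>k\<in>K. \<bar>exp (- kap k * (t - s)) * forcing W p q k s\<bar>)
      \<le> (\<Sum>k\<in>K. exp (\<omega> * \<tau>) * (\<bar>real k * pi * E k\<bar> * \<bar>ip (W s) (sn k)\<bar> + E k * \<bar>p s * cs k 0 + q s * cs k 1\<bar>))"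
  proof (rule sum_mono)
    fix k
    have "\<bar>forcing W p q k s\<bar> \<le> \<bar>real k * pi\<bar> * \<bar>ip (W s) (sn k)\<bar> + \<bar>p s * cs k 0 + q s * cs k 1\<bar>"
      unfolding forcing_def by (metis (no_types, opaque_lifting) abs_mult abs_minus_cancel abs_triangle_ineq add.assoc)
    then have "E k * \<bar>forcing W p q k s\<bar> \<le> E k * (\<bar>real k * pi\<bar> * \<bar>ip (W s) (sn k)\<bar> + \<bar>p s * cs k 0 + q s * cs k 1\<bar>)"
      using E0[of k] by (intro mult_left_mono) auto
    also have "\<dots> = \<bar>real k * pi * E k\<bar> * \<bar>ip (W s) (sn k)\<bar> + E k * \<bar>p s * cs k 0 + q s * cs k 1\<bar>"
      using E0[of k] by (simp add: abs_mult algebra_simps)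
    finally show "\<bar>exp (- kap k * (t - s)) * forcing W p q k s\<bar>
        \<le> exp (\<omega> * \<tau>) * (\<bar>real k * pi * E k\<bar> * \<bar>ip (W s) (sn k)\<bar> + E k * \<bar>p s * cs k 0 + q s * cs k 1\<bar>)"
      unfolding exp_eq abs_mult using E0[of k] by (simp add: mult.assoc)
  qed
  also have "\<dots> = exp (\<omega> * \<tau>) * ((\<Sum>k\<in>K. \<bar>real k * pi * E k\<bar> * \<bar>ip (W s) (sn k)\<bar>) + (\<Sum>k\<in>K. E k * \<bar>p s * cs k 0 + q s * cs k 1\<bar>))"
    by (simp only: sum_distrib_left[symmetric] sum.distrib)
  also have "\<dots> \<le> exp (\<omega> * \<tau>) * (sqrt (sum mu K) * L * (A * exp (\<omega> * s)) + 3 * sum mu K * L * (A * exp (\<omega> * s)))"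
    using vol bdy by (intro mult_left_mono add_mono) auto
  also have "\<dots> = (exp (\<omega> * \<tau>) * exp (\<omega> * s)) * A * (sqrt (sum mu K) + 3 * sum mu K) * L"
    by (simp add: algebra_simps)
  also have "exp (\<omega> * \<tau>) * exp (\<omega> * s) = exp (\<omega> * t)" by (simp add: \<tau>_def algebra_simps flip: exp_add)
  finally show ?thesis by (simp add: L_def \<tau>_def mult_ac)
qed

text \<open>Kept for a finite set of modes, so that the same estimate also controls the tails of the
  series.\<close>

definition kconst :: "real \<Rightarrow> nat set \<Rightarrow> real" where
  "kconst t K = 8 * t powr (1/8) * (sqrt (sum mu K) + 3 * sum mu K)"

lemma kconst_nonneg [simp]: "kconst t K \<ge> 0"
  unfolding kconst_def by (intro mult_nonneg_nonneg add_nonneg_nonneg real_sqrt_ge_zero sum_nonneg) auto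

text \<open>The sum over the modes is moved inside the time integral, so that Bessel's inequality
  can be used at each time.\<close>

lemma duhamel_estimate:
  fixes W :: "real \<Rightarrow> real \<Rightarrow> real"
  assumes "finite K" "\<omega> \<ge> 1" "t \<ge> 0"
    and m: "\<And>k. (\<lambda>s. ip (W s) (sn k)) \<in> borel_measurable (lebesgue_on {0..t})"
      "p \<in> borel_measurable (lebesgue_on {0..t})" "q \<in> borel_measurable (lebesgue_on {0..t})"
    and b: "AE s in lebesgue_on {0..t}. L2 (W s) \<and> nrm (W s) \<le> A * exp (\<omega> * s) \<and> \<bar>p s\<bar> \<le> A * exp (\<omega> * s) \<and> \<bar>q s\<bar> \<le> A * exp (\<omega> * s)"
  shows "integrable (lebesgue_on {0..t}) (\<lambda>s. exp (- kap k * (t - s)) * forcing W p q k s)"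
    and "(\<Sum>k\<in>K. \<bar>duhamel (forcing W p q k) k t\<bar>) \<le> A * exp (\<omega> * t) * (\<omega> powr (- 1/16) * kconst t K)"
proof -
  have meas: "(\<lambda>s. exp (- kap k * (t - s)) * forcing W p q k s) \<in> borel_measurable (lebesgue_on {0..t})" for k
  proof -
    have "(\<lambda>s. exp (- kap k * (t - s))) \<in> borel_measurable (lebesgue_on {0..t})"
      by (intro borel_imp_lebesgue_on) measurable
    then show ?thesis unfolding forcing_def
      by (intro borel_measurable_times borel_measurable_add m borel_measurable_const)
  qed
  let ?B = "\<lambda>K s. A * exp (\<omega> * t) * (\<omega> powr (- 1/16) * (sqrt (sum mu K) + 3 * sum mu K)) * (t - s) powr (- 7/8)"
  have pw: "AE s in lebesgue_on {0..t}. (\<Sum>k\<in>K. \<bar>exp (- kap k * (t - s)) * forcing W p q k s\<bar>) \<le> ?B K s"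
    if "finite K" for K
    using b AE_lebesgue_on_ne[where a = 0 and b = t and c = t] AE_lebesgue_on_in[of 0 t]
  proof eventually_elim
    case (elim s)
    then show ?case by (intro forcing_pointwise that assms) auto
  qed
  have intB: "integrable (lebesgue_on {0..t}) (?B K)" for K
    using powr_kernel_integral(1)[OF assms(3)] by (rule integrable_mult_right)
  show int: "integrable (lebesgue_on {0..t}) (\<lambda>s. exp (- kap k * (t - s)) * forcing W p q k s)" for k
  proof (rule Bochner_Integration.integrable_bound[OF intB[of "{k}"] meas])
    show "AE s in lebesgue_on {0..t}. norm (exp (- kap k * (t - s)) * forcing W p q k s) \<le> norm (?B {k} s)"
      using pw[of "{k}"] by (auto elim!: eventually_mono)
  qed
  have "(\<Sum>k\<in>K. \<bar>duhamel (forcing W p q k) k t\<bar>)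
      \<le> (\<Sum>k\<in>K. (LINT s|lebesgue_on {0..t}. \<bar>exp (- kap k * (t - s)) * forcing W p q k s\<bar>))"
    unfolding duhamel_def by (intro sum_mono integral_abs_bound)
  also have "\<dots> = (LINT s|lebesgue_on {0..t}. (\<Sum>k\<in>K. \<bar>exp (- kap k * (t - s)) * forcing W p q k s\<bar>))"
    by (rule Bochner_Integration.integral_sum[symmetric]) (intro integrable_abs int)
  also have "\<dots> \<le> (LINT s|lebesgue_on {0..t}. ?B K s)"
    by (intro integral_mono_AE Bochner_Integration.integrable_sum integrable_abs int intB pw assms)
  also have "\<dots> = A * exp (\<omega> * t) * (\<omega> powr (- 1/16) * (sqrt (sum mu K) + 3 * sum mu K)) * (8 * t powr (1/8))"
    using powr_kernel_integral(2)[OF assms(3)] by simp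
  finally show "(\<Sum>k\<in>K. \<bar>duhamel (forcing W p q k) k t\<bar>) \<le> A * exp (\<omega> * t) * (\<omega> powr (- 1/16) * kconst t K)"
    by (simp add: kconst_def mult_ac)
qed

definition ktotal :: "real \<Rightarrow> real" where
  "ktotal T = 8 * T powr (1/8) * (sqrt (suminf mu) + 3 * suminf mu)"

lemma kconst_le_ktotal:
  fixes t :: real
  assumes "finite K" "0 \<le> t" "t \<le> T"
  shows "kconst t K \<le> ktotal T"
proof -
  have "sum mu K \<le> suminf mu" by (rule sum_le_suminf[OF summable_mu assms(1)]) simp
  then show ?thesis unfolding kconst_def ktotal_def using assms
    by (intro mult_mono add_mono powr_mono2 real_sqrt_le_mono) (auto intro!: sum_nonneg add_nonneg_nonneg)
qed

lemma ktotal_nonneg: "T \<ge> 0 \<Longrightarrow> ktotal T \<ge> 0"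
  by (rule order_trans[OF kconst_nonneg kconst_le_ktotal[of "{}" T T]]) simp_all

text \<open>The negative power of \<open>\<omega>\<close> absorbs any constant; it is used once for
  uniqueness and once for the contraction.\<close>

lemma large_weight:
  assumes "\<delta> > 0"
  obtains \<omega> :: real where "\<omega> \<ge> 1" "\<omega> powr (- 1/16) * c \<le> \<delta>"
proof -
  have "((\<lambda>x :: real. x powr (- 1/16) * c) \<longlongrightarrow> 0 * c) at_top"
    by (intro tendsto_intros tendsto_neg_powr filterlim_ident) auto
  then have "\<forall>\<^sub>F x :: real in at_top. x powr (- 1/16) * c < \<delta>"
    by (rule order_tendstoD) (use assms in simp)
  then have "\<forall>\<^sub>F x :: real in at_top. x \<ge> 1 \<and> x powr (- 1/16) * c < \<delta>"
    by (intro eventually_conj eventually_ge_at_top)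
  from eventually_happens'[OF trivial_limit_at_top_linorder this]
  obtain x :: real where "x \<ge> 1" "x powr (- 1/16) * c < \<delta>" by blast
  then show ?thesis using that[of x] by linarith
qed

lemma duhamel_summable:
  fixes W :: "real \<Rightarrow> real \<Rightarrow> real"
  assumes "\<omega> \<ge> 1" "0 \<le> t" "t \<le> T" "A \<ge> 0"
    and m: "\<And>k. (\<lambda>s. ip (W s) (sn k)) \<in> borel_measurable (lebesgue_on {0..t})"
      "p \<in> borel_measurable (lebesgue_on {0..t})" "q \<in> borel_measurable (lebesgue_on {0..t})"
    and b: "AE s in lebesgue_on {0..t}. L2 (W s) \<and> nrm (W s) \<le> A * exp (\<omega> * s) \<and> \<bar>p s\<bar> \<le> A * exp (\<omega> * s) \<and> \<bar>q s\<bar> \<le> A * exp (\<omega> * s)"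
  shows "summable (\<lambda>k. \<bar>duhamel (forcing W p q k) k t\<bar>)"
    and "(\<Sum>k. \<bar>duhamel (forcing W p q k) k t\<bar>) \<le> A * exp (\<omega> * t) * (\<omega> powr (- 1/16) * ktotal T)"
proof -
  have *: "(\<Sum>k\<in>K. \<bar>duhamel (forcing W p q k) k t\<bar>) \<le> A * exp (\<omega> * t) * (\<omega> powr (- 1/16) * ktotal T)" if "finite K" for K
  proof -
    have "(\<Sum>k\<in>K. \<bar>duhamel (forcing W p q k) k t\<bar>) \<le> A * exp (\<omega> * t) * (\<omega> powr (- 1/16) * kconst t K)"
      by (rule duhamel_estimate(2)[OF that assms(1,2) m b])
    also have "\<dots> \<le> A * exp (\<omega> * t) * (\<omega> powr (- 1/16) * ktotal T)"
      using assms by (intro mult_left_mono kconst_le_ktotal that) auto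
    finally show ?thesis .
  qed
  show s: "summable (\<lambda>k. \<bar>duhamel (forcing W p q k) k t\<bar>)"
  proof (rule bounded_imp_summable)
    show "(\<Sum>k\<le>n. \<bar>duhamel (forcing W p q k) k t\<bar>) \<le> A * exp (\<omega> * t) * (\<omega> powr (- 1/16) * ktotal T)" for n
      by (rule *) simp
  qed simp
  show "(\<Sum>k. \<bar>duhamel (forcing W p q k) k t\<bar>) \<le> A * exp (\<omega> * t) * (\<omega> powr (- 1/16) * ktotal T)"
    by (rule suminf_le_const[OF s]) (intro * finite_lessThan)
qed

lemma measurable_lebesgue_on_subset:
  fixes f :: "real \<Rightarrow> real"
  assumes "f \<in> borel_measurable (lebesgue_on {0..T})" "t \<le> T"
  shows "f \<in> borel_measurable (lebesgue_on {0..t})"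
  by (rule measurable_restrict_mono[OF assms(1)]) (use assms(2) in auto)

lemma bounded_imp_weighted:
  fixes W :: "real \<Rightarrow> real \<Rightarrow> real"
  assumes "AE s in lebesgue_on {0..t}. L2 (W s) \<and> nrm (W s) \<le> A \<and> \<bar>p s\<bar> \<le> A \<and> \<bar>q s\<bar> \<le> A"
  shows "AE s in lebesgue_on {0..t}. L2 (W s) \<and> nrm (W s) \<le> \<bar>A\<bar> * exp (1 * s) \<and> \<bar>p s\<bar> \<le> \<bar>A\<bar> * exp (1 * s) \<and> \<bar>q s\<bar> \<le> \<bar>A\<bar> * exp (1 * s)"
  using assms AE_lebesgue_on_in[of 0 t]
proof eventually_elim
  case (elim s)
  have "A \<le> \<bar>A\<bar> * exp (1 * s)" using elim mult_left_mono[of 1 "exp s" "\<bar>A\<bar>"] by simp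
  then show ?case using elim by auto
qed

lemma duhamel_forcing_diff:
  fixes W W' :: "real \<Rightarrow> real \<Rightarrow> real"
  assumes i: "integrable (lebesgue_on {0..t}) (\<lambda>s. exp (- kap k * (t - s)) * forcing W p q k s)"
    and i': "integrable (lebesgue_on {0..t}) (\<lambda>s. exp (- kap k * (t - s)) * forcing W' p' q' k s)"
    and L2: "AE s in lebesgue_on {0..t}. L2 (W s) \<and> L2 (W' s)"
  shows "duhamel (forcing W p q k) k t - duhamel (forcing W' p' q' k) k t
    = duhamel (forcing (\<lambda>s x. W s x - W' s x) (\<lambda>s. p s - p' s) (\<lambda>s. q s - q' s) k) k t"
proof -
  have ae: "AE s in lebesgue_on {0..t}. exp (- kap k * (t - s)) * forcing W p q k s - exp (- kap k * (t - s)) * forcing W' p' q' k s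
      = exp (- kap k * (t - s)) * forcing (\<lambda>s x. W s x - W' s x) (\<lambda>s. p s - p' s) (\<lambda>s. q s - q' s) k s"
    using L2 by eventually_elim (simp add: forcing_def ip_diff_left algebra_simps)
  have "duhamel (forcing W p q k) k t - duhamel (forcing W' p' q' k) k t
      = (LINT s|lebesgue_on {0..t}. exp (- kap k * (t - s)) * forcing W p q k s - exp (- kap k * (t - s)) * forcing W' p' q' k s)"
    unfolding duhamel_def by (rule Bochner_Integration.integral_diff[OF i i', symmetric])
  also have "\<dots> = duhamel (forcing (\<lambda>s x. W s x - W' s x) (\<lambda>s. p s - p' s) (\<lambda>s. q s - q' s) k) k t"
    unfolding duhamel_def by (rule integral_cong_AE_Icc[OF ae])
  finally show ?thesis .
qed

text \<open>A singular Gronwall inequality, by absorption in an exponentially weighted supremum.\<close>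

lemma duhamel_unique:
  fixes W :: "real \<Rightarrow> real \<Rightarrow> real" and D :: "nat \<Rightarrow> real \<Rightarrow> real"
  assumes "T \<ge> 0" "C \<ge> 0" and D: "\<And>k t. t \<in> {0..T} \<Longrightarrow> D k t = duhamel (forcing W p q k) k t"
    and m: "\<And>k. (\<lambda>s. ip (W s) (sn k)) \<in> borel_measurable (lebesgue_on {0..T})"
      "p \<in> borel_measurable (lebesgue_on {0..T})" "q \<in> borel_measurable (lebesgue_on {0..T})"
    and b: "AE s in lebesgue_on {0..T}. L2 (W s) \<and> nrm (W s) \<le> A \<and> \<bar>p s\<bar> \<le> A \<and> \<bar>q s\<bar> \<le> A"
    and bD: "AE s in lebesgue_on {0..T}. nrm (W s) \<le> C * (\<Sum>k. \<bar>D k s\<bar>) \<and> \<bar>p s\<bar> \<le> C * (\<Sum>k. \<bar>D k s\<bar>) \<and> \<bar>q s\<bar> \<le> C * (\<Sum>k. \<bar>D k s\<bar>)"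
    and t: "t \<in> {0..T}"
  shows "D k t = 0"
proof -
  define S where "S t = (\<Sum>k. \<bar>D k t\<bar>)" for t
  have mt: "\<And>k. (\<lambda>s. ip (W s) (sn k)) \<in> borel_measurable (lebesgue_on {0..t})"
      "p \<in> borel_measurable (lebesgue_on {0..t})" "q \<in> borel_measurable (lebesgue_on {0..t})" if "t \<in> {0..T}" for t
    using that by (auto intro: measurable_lebesgue_on_subset[OF m(1)] measurable_lebesgue_on_subset[OF m(2)] measurable_lebesgue_on_subset[OF m(3)])
  have sub: "AE s in lebesgue_on {0..t}. P s" if "AE s in lebesgue_on {0..T}. P s" "t \<in> {0..T}" for t P
    by (rule AE_lebesgue_on_subset[OF that(1)]) (use that(2) in auto)
  have b1: "AE s in lebesgue_on {0..t}. L2 (W s) \<and> nrm (W s) \<le> \<bar>A\<bar> * exp (1 * s) \<and> \<bar>p s\<bar> \<le> \<bar>A\<bar> * exp (1 * s) \<and> \<bar>q s\<bar> \<le> \<bar>A\<bar> * exp (1 * s)"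
    if "t \<in> {0..T}" for t
    by (rule bounded_imp_weighted[OF sub[OF b that]])
  \<comment> \<open>A crude bound with weight \<open>1\<close> shows beforehand that the supremum is
    finite; the absorption argument would prove nothing otherwise.\<close>
  have S: "summable (\<lambda>k. \<bar>D k t\<bar>)" "S t \<le> \<bar>A\<bar> * exp (1 * T) * (1 powr (- 1/16) * ktotal T)" if "t \<in> {0..T}" for t
  proof -
    note e = duhamel_summable[of 1 t T "\<bar>A\<bar>" W p q, OF _ _ _ _ mt[OF that] b1[OF that]]
    show "summable (\<lambda>k. \<bar>D k t\<bar>)" using e(1) that by (simp add: D)
    have "S t \<le> \<bar>A\<bar> * exp (1 * t) * (1 powr (- 1/16) * ktotal T)"
      using e(2) that by (simp add: D S_def)
    also have "\<dots> \<le> \<bar>A\<bar> * exp (1 * T) * (1 powr (- 1/16) * ktotal T)"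
      using that ktotal_nonneg[OF assms(1)] by (intro mult_right_mono mult_left_mono) auto
    finally show "S t \<le> \<bar>A\<bar> * exp (1 * T) * (1 powr (- 1/16) * ktotal T)" .
  qed
  have S0: "S t \<ge> 0" if "t \<in> {0..T}" for t
    unfolding S_def using S(1)[OF that] by (intro suminf_nonneg) auto
  obtain \<omega> :: real where \<omega>: "\<omega> \<ge> 1" "\<omega> powr (- 1/16) * (C * ktotal T) \<le> 1/2"
    using large_weight[of "1/2" "C * ktotal T"] by auto
  define Z where "Z = (\<lambda>t. exp (- \<omega> * t) * S t) ` {0..T}"
  have bdd: "bdd_above Z"
  proof (rule bdd_aboveI)
    fix z assume "z \<in> Z"
    then obtain t where t: "t \<in> {0..T}" "z = exp (- \<omega> * t) * S t" by (auto simp: Z_def)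
    have "z \<le> 1 * S t" unfolding t(2) using t(1) \<omega> S0[OF t(1)] by (intro mult_right_mono) auto
    also have "\<dots> \<le> \<bar>A\<bar> * exp (1 * T) * (1 powr (- 1/16) * ktotal T)" using S(2)[OF t(1)] by simp
    finally show "z \<le> \<bar>A\<bar> * exp (1 * T) * (1 powr (- 1/16) * ktotal T)" .
  qed
  have ne: "Z \<noteq> {}" using assms(1) by (auto simp: Z_def)
  define m where "m = Sup Z"
  have Sm: "S t \<le> m * exp (\<omega> * t)" if "t \<in> {0..T}" for t
  proof -
    have "exp (- \<omega> * t) * S t \<le> m" unfolding m_def by (rule cSup_upper[OF _ bdd]) (use that in \<open>auto simp: Z_def\<close>)
    then have "exp (\<omega> * t) * (exp (- \<omega> * t) * S t) \<le> exp (\<omega> * t) * m" by (intro mult_left_mono) auto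
    moreover have "exp (\<omega> * t) * (exp (- \<omega> * t) * S t) = S t" by (simp add: exp_minus)
    ultimately show ?thesis by (metis mult.commute)
  qed
  have m0: "m \<ge> 0" using order_trans[OF S0[OF t] Sm[OF t]] by (simp add: zero_le_mult_iff)
  have "z \<le> m / 2" if z: "z \<in> Z" for z
  proof -
    obtain t where t: "t \<in> {0..T}" "z = exp (- \<omega> * t) * S t" using z by (auto simp: Z_def)
    have bl: "AE s in lebesgue_on {0..t}. L2 (W s) \<and> nrm (W s) \<le> (C * m) * exp (\<omega> * s) \<and> \<bar>p s\<bar> \<le> (C * m) * exp (\<omega> * s) \<and> \<bar>q s\<bar> \<le> (C * m) * exp (\<omega> * s)"
      using sub[OF b t(1)] sub[OF bD t(1)] AE_lebesgue_on_in[of 0 t]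
    proof eventually_elim
      case (elim s)
      then have "s \<in> {0..T}" using t(1) by auto
      then have "C * (\<Sum>k. \<bar>D k s\<bar>) \<le> (C * m) * exp (\<omega> * s)"
        using Sm[of s] assms(2) by (simp add: S_def mult.assoc mult_left_mono)
      then show ?case using elim by (meson order_trans)
    qed
    have "S t \<le> (C * m) * exp (\<omega> * t) * (\<omega> powr (- 1/16) * ktotal T)"
      using duhamel_summable(2)[of \<omega> t T "C * m" W p q, OF \<omega>(1) _ _ _ mt[OF t(1)] bl] t(1) assms m0
      by (simp add: S_def D)
    then have "z \<le> exp (- \<omega> * t) * ((C * m) * exp (\<omega> * t) * (\<omega> powr (- 1/16) * ktotal T))"
      unfolding t(2) by (intro mult_left_mono) auto
    also have "\<dots> = (exp (- \<omega> * t) * exp (\<omega> * t)) * (m * (\<omega> powr (- 1/16) * (C * ktotal T)))"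
      by (simp add: mult_ac)
    also have "\<dots> = m * (\<omega> powr (- 1/16) * (C * ktotal T))" by (simp flip: exp_add)
    also have "\<dots> \<le> m * (1/2)" using \<omega>(2) m0 by (intro mult_left_mono)
    finally show ?thesis by simp
  qed
  \<comment> \<open>The finite supremum is at most half of itself, by the choice of
    \<open>\<omega>\<close>.\<close>
  then have "m \<le> m / 2" unfolding m_def by (intro cSup_least ne)
  then have "m = 0" using m0 by simp
  then have "S t = 0" using Sm[OF t] S0[OF t] by simp
  then show ?thesis
    using S(1)[OF t] suminf_eq_zero_iff[of "\<lambda>k. \<bar>D k t\<bar>"] by (simp add: S_def)
qed

section \<open>Mild solutions\<close>

lemma ip_continuous_param:
  fixes f :: "'a::metric_space \<Rightarrow> real \<Rightarrow> real"
  assumes f: "continuous_on (U \<times> {0..1}) (\<lambda>(s, x). f s x)" and g: "continuous_on {0..1} g"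
  shows "continuous_on U (\<lambda>s. ip (f s) g)"
proof -
  have c: "continuous_on (U \<times> cbox 0 1) (\<lambda>(s, x). f s x * g x)"
  proof -
    have "continuous_on (U \<times> {0..1}) (\<lambda>z. (case z of (s, x) \<Rightarrow> f s x) * g (snd z))"
      by (intro continuous_intros f continuous_on_compose2[OF g]) auto
    then show ?thesis by (simp add: split_beta)
  qed
  have "ip (f s) g = integral (cbox 0 1) (\<lambda>x. f s x * g x)" if "s \<in> U" for s
  proof -
    have "continuous_on {0..1} (\<lambda>x. (\<lambda>(s, x). f s x * g x) (s, x))"
      by (rule continuous_on_compose2[OF c]) (use that in \<open>auto intro!: continuous_intros\<close>)
    then have "integrable I01 (\<lambda>x. f s x * g x)" by (intro integrable_continuous_Icc) simp
    then show ?thesis unfolding ip_def by (subst lebesgue_integral_eq_integral) auto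
  qed
  moreover have "continuous_on U (\<lambda>s. integral (cbox 0 1) (\<lambda>x. f s x * g x))"
    by (rule integral_continuous_on_param) (use c in simp)
  ultimately show ?thesis by (simp cong: continuous_on_cong)
qed

text \<open>Time-dependent quantities of the solution are continuous only for positive times; the
  missing point is a null set.\<close>

lemma measurable_continuous_Ioc:
  fixes f :: "real \<Rightarrow> real"
  assumes "continuous_on {0<..T} f" "t \<le> T"
  shows "f \<in> borel_measurable (lebesgue_on {0..t})"
proof -
  have "continuous_on {0<..t} f" using assms by (auto intro: continuous_on_subset)
  then have "(\<lambda>x. indicator {0<..t} x *\<^sub>R f x) \<in> borel_measurable borel"
    by (intro borel_measurable_continuous_on_indicator) auto
  from borel_imp_lebesgue_on[OF this] show ?thesis
  proof (rule measurable_01_AE)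
    show "AE s in lebesgue_on {0..t}. indicat_real {0<..t} s *\<^sub>R f s = f s"
      using AE_lebesgue_on_ne[where a = 0 and b = t and c = 0] AE_lebesgue_on_in[of 0 t]
      by eventually_elim auto
  qed
qed

lemma integrable_bounded_Icc:
  fixes f :: "real \<Rightarrow> real"
  assumes "f \<in> borel_measurable (lebesgue_on {a..b})" "AE s in lebesgue_on {a..b}. \<bar>f s\<bar> \<le> B"
  shows "integrable (lebesgue_on {a..b}) f"
proof -
  interpret finite_measure "lebesgue_on {a..b}" by (rule finite_measure_lebesgue_on) simp
  show ?thesis by (rule integrable_const_bound[where B = B]) (use assms in auto)
qed

lemma exp_mult_integrable:
  assumes f: "integrable (lebesgue_on {0..T}) f"
  shows "integrable (lebesgue_on {0..T}) (\<lambda>s. exp (kap k * s) * f s)"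
    and "(\<lambda>s. exp (kap k * s) * f s) integrable_on {0..T}"
proof -
  have e: "(\<lambda>s. exp (kap k * s)) \<in> borel_measurable (lebesgue_on {0..T})"
    by (rule borel_imp_lebesgue_on) measurable
  show i: "integrable (lebesgue_on {0..T}) (\<lambda>s. exp (kap k * s) * f s)"
  proof (rule Bochner_Integration.integrable_bound)
    show "integrable (lebesgue_on {0..T}) (\<lambda>s. exp (kap k * T) * f s)" using f by simp
    show "(\<lambda>s. exp (kap k * s) * f s) \<in> borel_measurable (lebesgue_on {0..T})"
      by (rule borel_measurable_times[OF e borel_measurable_integrable[OF f]])
    show "AE s in lebesgue_on {0..T}. norm (exp (kap k * s) * f s) \<le> norm (exp (kap k * T) * f s)"
      using AE_lebesgue_on_in[of 0 T]
      by eventually_elim (auto simp: abs_mult intro!: mult_right_mono mult_left_mono)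
  qed
  then have "set_integrable lebesgue {0..T} (\<lambda>s. exp (kap k * s) * f s)" by (simp add: set_integrable_Icc)
  then show "(\<lambda>s. exp (kap k * s) * f s) integrable_on {0..T}" by (rule set_lebesgue_integral_eq_integral(1))
qed

text \<open>With the factor \<open>exp (- kap k * t)\<close> taken out, the integrand no longer
  depends on \<open>t\<close>; continuity and the differential equation of the mode follow from
  those of an indefinite integral.\<close>

lemma duhamel_eq:
  assumes "integrable (lebesgue_on {0..T}) f" "t \<in> {0..T}"
  shows "duhamel f k t = exp (- kap k * t) * integral {0..t} (\<lambda>s. exp (kap k * s) * f s)"
proof -
  have S: "set_integrable lebesgue {0..T} (\<lambda>s. exp (kap k * s) * f s)"
    using exp_mult_integrable(1)[OF assms(1)] by (simp add: set_integrable_Icc)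
  have "set_integrable lebesgue {0..t} (\<lambda>s. exp (kap k * s) * f s)"
    by (rule set_integrable_subset[OF S]) (use assms(2) in auto)
  then have it: "integrable (lebesgue_on {0..t}) (\<lambda>s. exp (kap k * s) * f s)" by (simp add: set_integrable_Icc)
  have "duhamel f k t = (LINT s|lebesgue_on {0..t}. exp (- kap k * t) * (exp (kap k * s) * f s))"
    unfolding duhamel_def by (rule Bochner_Integration.integral_cong) (auto simp: algebra_simps simp flip: exp_add)
  also have "\<dots> = exp (- kap k * t) * integral {0..t} (\<lambda>s. exp (kap k * s) * f s)"
    using lebesgue_integral_eq_integral[OF it] by simp
  finally show "duhamel f k t = exp (- kap k * t) * integral {0..t} (\<lambda>s. exp (kap k * s) * f s)" .
qed

lemma duhamel_continuous:
  assumes "integrable (lebesgue_on {0..T}) f"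
  shows "continuous_on {0..T} (duhamel f k)"
proof (rule continuous_on_eq)
  show "continuous_on {0..T} (\<lambda>t. exp (- kap k * t) * integral {0..t} (\<lambda>s. exp (kap k * s) * f s))"
    by (intro continuous_intros indefinite_integral_continuous_1 exp_mult_integrable(2)[OF assms])
  show "exp (- kap k * t) * integral {0..t} (\<lambda>s. exp (kap k * s) * f s) = duhamel f k t" if "t \<in> {0..T}" for t
    using duhamel_eq[OF assms that] by simp
qed

lemma duhamel_DERIV:
  assumes "integrable (lebesgue_on {0..T}) f" "t \<in> {0<..<T}" "continuous_on {0<..T} f"
  shows "(duhamel f k has_real_derivative - kap k * duhamel f k t + f t) (at t)"
proof -
  let ?I = "\<lambda>t. integral {0..t} (\<lambda>s. exp (kap k * s) * f s)"
  have "continuous_on {0<..<T} f" using assms(3) by (rule continuous_on_subset) auto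
  then have "isCont f t" using assms(2) by (simp add: continuous_on_eq_continuous_at)
  then have "continuous (at t within {0..T}) f" by (rule continuous_at_imp_continuous_at_within)
  then have c: "continuous (at t within {0..T}) (\<lambda>s. exp (kap k * s) * f s)"
    by (rule continuous_mult[rotated]) (intro continuous_intros)
  have "(?I has_vector_derivative exp (kap k * t) * f t) (at t within {0..T})"
    using integral_has_vector_derivative_continuous_at[OF exp_mult_integrable(2)[OF assms(1)], where S = "{}"] c assms(2) by simp
  then have I: "(?I has_real_derivative exp (kap k * t) * f t) (at t)"
    using assms(2) by (simp add: has_real_derivative_iff_has_vector_derivative at_within_Icc_at)
  have D: "((\<lambda>t. exp (- kap k * t) * ?I t) has_real_derivative
      exp (- kap k * t) * (exp (kap k * t) * f t) + (- kap k * exp (- kap k * t)) * ?I t) (at t)"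
    by (rule derivative_eq_intros I refl)+ simp
  have e: "exp (- kap k * t) * (exp (kap k * t) * f t) = f t" by (simp add: exp_minus)
  have du: "duhamel f k t = exp (- kap k * t) * ?I t" using assms(2) by (intro duhamel_eq[OF assms(1)]) auto
  have "exp (- kap k * t) * (exp (kap k * t) * f t) + (- kap k * exp (- kap k * t)) * ?I t = - kap k * duhamel f k t + f t"
    unfolding e du by (simp only: mult.assoc add.commute)
  from D[unfolded this] show ?thesis
  proof (rule has_field_derivative_transform_within_open[of _ _ _ "{0<..<T}"])
    show "exp (- kap k * s) * ?I s = duhamel f k s" if "s \<in> {0<..<T}" for s
      using duhamel_eq[OF assms(1), of s k] that by simp
  qed (use assms(2) in auto)
qed

section \<open>Clipping and abstract fluxes\<close>

definition clip :: "real \<Rightarrow> real \<Rightarrow> real \<Rightarrow> real" where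
  "clip a b x = max a (min b x)"

lemma clip_in: "a \<le> b \<Longrightarrow> clip a b x \<in> {a..b}"
  by (auto simp: clip_def)

lemma clip_id [simp]: "x \<in> {a..b} \<Longrightarrow> clip a b x = x"
  by (auto simp: clip_def)

lemma clip_lipschitz: "\<bar>clip a b x - clip a b y\<bar> \<le> \<bar>x - y\<bar>"
  by (auto simp: clip_def max_def min_def)

lemma continuous_on_clip [continuous_intros]:
  fixes f :: "'a::topological_space \<Rightarrow> real"
  shows "continuous_on A f \<Longrightarrow> continuous_on A (\<lambda>x. clip a b (f x))"
  unfolding clip_def by (intro continuous_on_max continuous_on_min continuous_on_const)

text \<open>Fluxes for all real densities, with one constant \<open>C\<close> for all bounds.
  Boundedness and Lipschitz continuity drive the fixed point argument and uniqueness;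
  \<open>V_0\<close> and the sign conditions say that nothing pushes a density that has left
  \<open>[0,1]\<close> further out.\<close>

locale flux =
  fixes T C :: real and V :: "real \<Rightarrow> real \<Rightarrow> real \<Rightarrow> real" and b0 b1 :: "real \<Rightarrow> real \<Rightarrow> real"
    and \<gamma> :: "real \<Rightarrow> real"
  assumes T: "T > 0" and C: "C \<ge> 0"
    and V_cont: "continuous_on UNIV (\<lambda>(s, x, u). V s x u)"
    and V_bdd: "\<bar>V s x u\<bar> \<le> C" and V_lip: "\<bar>V s x u - V s x v\<bar> \<le> C * \<bar>u - v\<bar>"
    and V_0: "u \<le> 0 \<or> u \<ge> 1 \<Longrightarrow> V s x u = 0"
    and b0_cont: "continuous_on UNIV (\<lambda>(s, u). b0 s u)"
    and b0_bdd: "\<bar>b0 s u\<bar> \<le> C" and b0_lip: "\<bar>b0 s u - b0 s v\<bar> \<le> C * \<bar>u - v\<bar>"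
    and b0_sign: "u \<le> 0 \<Longrightarrow> b0 s u \<ge> 0" "u \<ge> 1 \<Longrightarrow> b0 s u \<le> 0"
    and b1_cont: "continuous_on UNIV (\<lambda>(s, u). b1 s u)"
    and b1_bdd: "\<bar>b1 s u\<bar> \<le> C" and b1_lip: "\<bar>b1 s u - b1 s v\<bar> \<le> C * \<bar>u - v\<bar>"
    and b1_sign: "u \<le> 0 \<Longrightarrow> b1 s u \<ge> 0" "u \<ge> 1 \<Longrightarrow> b1 s u \<le> 0"
    and \<gamma>_meas: "\<gamma> \<in> borel_measurable I01" and \<gamma>_01: "x \<in> {0..1} \<Longrightarrow> \<gamma> x \<in> {0..1}"
begin

lemma \<gamma>_AE: "AE x in I01. \<bar>\<gamma> x\<bar> \<le> 1"
proof (rule AE_I2)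
  fix x assume "x \<in> space I01"
  then show "\<bar>\<gamma> x\<bar> \<le> 1" using \<gamma>_01[of x] by auto
qed

lemma L2_\<gamma>: "L2 \<gamma>"
  by (rule L2_bounded[OF \<gamma>_meas \<gamma>_AE])

definition gc :: "nat \<Rightarrow> real" where
  "gc k = ip \<gamma> (cs k)"

lemma gc_le: "\<bar>gc k\<bar> \<le> 1"
proof -
  have "nrm \<gamma> \<le> 1" by (rule nrm_le_bound[OF \<gamma>_meas \<gamma>_AE]) simp
  moreover have "nrm (cs k) = 1" by (simp add: nrm_def ip_cs)
  ultimately show ?thesis using ip_abs_le[OF L2_\<gamma> L2_cs, of k] by (simp add: gc_def)
qed

text \<open>The coefficients of the Neumann heat semigroup applied to \<open>\<gamma>\<close>. At
  time \<open>0\<close> they are merely square summable.\<close>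

definition hc :: "real \<Rightarrow> nat \<Rightarrow> real" where
  "hc t k = exp (- kap k * t) * gc k"

lemma hc_bound:
  assumes "0 < \<delta>" "\<delta> \<le> t" "k \<ge> 1"
  shows "\<bar>hc t k\<bar> \<le> (1 / \<delta>) * (1 / kap k)"
proof -
  have k: "kap k \<ge> 1" using assms kap_ge_1[of k] by simp
  have "kap k * \<delta> \<le> kap k * t" using k assms by (intro mult_left_mono) auto
  also have "\<dots> \<le> exp (kap k * t)" using exp_ge_add_one_self[of "kap k * t"] by linarith
  finally have "1 / exp (kap k * t) \<le> 1 / (kap k * \<delta>)"
    using k assms by (intro divide_left_mono mult_pos_pos) auto
  moreover have "\<bar>hc t k\<bar> \<le> exp (- kap k * t) * 1"
    unfolding hc_def abs_mult using gc_le by (intro mult_mono) auto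
  ultimately show ?thesis by (simp add: exp_minus inverse_eq_divide mult.commute)
qed

lemma hc_summable:
  assumes "t > 0"
  shows "summable (\<lambda>k. \<bar>hc t k\<bar>)"
  by (rule summable_comparison_test'[OF summable_mult[OF summable_inverse_kap, of "1 / t"], of 1])
    (use hc_bound[OF assms order_refl] in simp)

text \<open>The series converges uniformly only for times bounded away from \<open>0\<close>, so
  continuity is first obtained for \<open>t \<ge> \<delta>\<close> and then point by point with
  \<open>\<delta>\<close> half of the time coordinate.\<close>

lemma heat_continuous: "continuous_on ({0<..} \<times> UNIV) (\<lambda>(t, x). cser (hc t) x)"
proof -
  have *: "continuous_on ({\<delta>..} \<times> UNIV) (\<lambda>z. cser (hc (fst z)) (snd z))" if "\<delta> > 0" for \<delta>
  proof (rule uniform_limit_theorem)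
    define M where "M k = (if k = 0 then sqrt 2 else sqrt 2 * ((1 / \<delta>) * (1 / kap k)))" for k
    have "summable M"
      by (rule summable_comparison_test'[OF summable_mult[OF summable_mult[OF summable_inverse_kap, of "1 / \<delta>"], of "sqrt 2"], of 1])
        (use that in \<open>auto simp: M_def\<close>)
    then show "uniform_limit ({\<delta>..} \<times> UNIV) (\<lambda>n z. \<Sum>k<n. hc (fst z) k * cs k (snd z)) (\<lambda>z. cser (hc (fst z)) (snd z)) sequentially"
      unfolding cser_def
    proof (rule Weierstrass_m_test[rotated])
      fix k and z :: "real \<times> real" assume z: "z \<in> {\<delta>..} \<times> UNIV"
      have "\<bar>hc (fst z) k * cs k (snd z)\<bar> \<le> sqrt 2 * \<bar>hc (fst z) k\<bar>" by (rule cser_term_bound)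
      also have "\<dots> \<le> M k"
      proof (cases "k = 0")
        case True
        then show ?thesis using gc_le[of 0] by (simp add: M_def hc_def)
      next
        case False
        then have "\<bar>hc (fst z) k\<bar> \<le> (1 / \<delta>) * (1 / kap k)"
          using z by (intro hc_bound[OF that]) auto
        then have "sqrt 2 * \<bar>hc (fst z) k\<bar> \<le> sqrt 2 * ((1 / \<delta>) * (1 / kap k))" by (rule mult_left_mono) simp
        then show ?thesis using False by (simp add: M_def)
      qed
      finally show "norm (hc (fst z) k * cs k (snd z)) \<le> M k" by simp
    qed
  qed (auto intro!: always_eventually continuous_intros simp: hc_def)
  have "isCont (\<lambda>z. cser (hc (fst z)) (snd z)) z" if "z \<in> {0<..} \<times> UNIV" for z :: "real \<times> real"
  proof -
    have "continuous_on ({fst z / 2<..} \<times> UNIV) (\<lambda>z. cser (hc (fst z)) (snd z))"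
      by (rule continuous_on_subset[OF *[of "fst z / 2"]]) (use that in auto)
    then show ?thesis
      by (rule continuous_on_interior) (use that in \<open>auto simp: interior_open open_Times mem_Times_iff\<close>)
  qed
  then show ?thesis by (simp add: split_beta continuous_at_imp_continuous_on)
qed

definition Wf :: "(real \<Rightarrow> real \<Rightarrow> real) \<Rightarrow> real \<Rightarrow> real \<Rightarrow> real" where
  "Wf u s x = V s x (u s x)"

definition force :: "(real \<Rightarrow> real \<Rightarrow> real) \<Rightarrow> nat \<Rightarrow> real \<Rightarrow> real" where
  "force u = forcing (Wf u) (\<lambda>s. b0 s (u s 0)) (\<lambda>s. b1 s (u s 1))"

lemma force_facts:
  assumes u: "continuous_on ({0<..T} \<times> {0..1}) (\<lambda>(t, x). u t x)"
  shows Wf_continuous: "continuous_on ({0<..T} \<times> {0..1}) (\<lambda>(s, x). Wf u s x)"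
    and "continuous_on {0<..T} (\<lambda>s. ip (Wf u s) (sn k))"
    and "continuous_on {0<..T} (\<lambda>s. b0 s (u s 0))"
    and "continuous_on {0<..T} (\<lambda>s. b1 s (u s 1))"
    and "continuous_on {0<..T} (force u k)"
    and "s \<in> {0<..T} \<Longrightarrow> L2 (Wf u s)"
    and "nrm (Wf u s) \<le> C"
proof -
  have "continuous_on ({0<..T} \<times> {0..1}) (\<lambda>z. (\<lambda>(s, x, u). V s x u) (fst z, snd z, (\<lambda>(t, x). u t x) z))"
    by (intro continuous_on_compose2[OF V_cont] continuous_intros u) auto
  then show W: "continuous_on ({0<..T} \<times> {0..1}) (\<lambda>(s, x). Wf u s x)"
    by (simp add: Wf_def split_beta)
  show i: "continuous_on {0<..T} (\<lambda>s. ip (Wf u s) (sn k))" for k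
    by (intro ip_continuous_param W continuous_intros)
  have ux: "continuous_on {0<..T} (\<lambda>s. (\<lambda>(t, x). u t x) (s, x))" if "x \<in> {0..1}" for x
    by (rule continuous_on_compose2[OF u]) (use that in \<open>auto intro!: continuous_intros\<close>)
  have "continuous_on {0<..T} (\<lambda>s. (\<lambda>(s, u). b0 s u) (s, u s 0))"
    by (intro continuous_on_compose2[OF b0_cont] continuous_intros) (use ux[of 0] in auto)
  then show c0: "continuous_on {0<..T} (\<lambda>s. b0 s (u s 0))" by simp
  have "continuous_on {0<..T} (\<lambda>s. (\<lambda>(s, u). b1 s u) (s, u s 1))"
    by (intro continuous_on_compose2[OF b1_cont] continuous_intros) (use ux[of 1] in auto)
  then show c1: "continuous_on {0<..T} (\<lambda>s. b1 s (u s 1))" by simp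
  show "continuous_on {0<..T} (force u k)"
    unfolding force_def forcing_def[abs_def] by (intro continuous_intros i c0 c1)
  show L: "L2 (Wf u s)" if "s \<in> {0<..T}" for s
  proof (rule L2_continuous)
    have "continuous_on {0..1} (\<lambda>x. (\<lambda>(s, x). Wf u s x) (s, x))"
      by (rule continuous_on_compose2[OF W]) (use that in \<open>auto intro!: continuous_intros\<close>)
    then show "continuous_on {0..1} (Wf u s)" by simp
  qed
  show "nrm (Wf u s) \<le> C"
  proof (cases "Wf u s \<in> borel_measurable I01")
    case True
    then show ?thesis by (rule nrm_le_bound) (auto simp: Wf_def V_bdd C)
  next
    case False
    \<comment> \<open>If the square is not integrable, its integral is the default value
      \<open>0\<close>.\<close>
    have "nrm (Wf u s) = 0 \<or> integrable I01 (\<lambda>x. Wf u s x * Wf u s x)"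
      unfolding nrm_def ip_def by (metis not_integrable_integral_eq real_sqrt_zero)
    moreover have "(nrm (Wf u s))\<^sup>2 \<le> C\<^sup>2" if "integrable I01 (\<lambda>x. Wf u s x * Wf u s x)"
    proof -
      have "ip (Wf u s) (Wf u s) \<le> (LINT x|I01. C\<^sup>2)"
        unfolding ip_def by (rule integral_mono[OF that])
          (use V_bdd in \<open>auto simp: Wf_def power2_eq_square[symmetric] power2_le_iff_abs_le C\<close>)
      then show ?thesis using I01.prob_space by (simp add: nrm_sq)
    qed
    ultimately show ?thesis using C by (metis power2_le_imp_le)
  qed
qed

lemma force_hyps:
  assumes u: "continuous_on ({0<..T} \<times> {0..1}) (\<lambda>(t, x). u t x)" and t: "t \<le> T" and "\<omega> \<ge> 0"
  shows "(\<lambda>s. ip (Wf u s) (sn k)) \<in> borel_measurable (lebesgue_on {0..t})"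
    "(\<lambda>s. b0 s (u s 0)) \<in> borel_measurable (lebesgue_on {0..t})"
    "(\<lambda>s. b1 s (u s 1)) \<in> borel_measurable (lebesgue_on {0..t})"
    and "AE s in lebesgue_on {0..t}. L2 (Wf u s) \<and> nrm (Wf u s) \<le> C * exp (\<omega> * s)
      \<and> \<bar>b0 s (u s 0)\<bar> \<le> C * exp (\<omega> * s) \<and> \<bar>b1 s (u s 1)\<bar> \<le> C * exp (\<omega> * s)"
proof -
  note f = force_facts[OF u]
  show "(\<lambda>s. ip (Wf u s) (sn k)) \<in> borel_measurable (lebesgue_on {0..t})"
    "(\<lambda>s. b0 s (u s 0)) \<in> borel_measurable (lebesgue_on {0..t})"
    "(\<lambda>s. b1 s (u s 1)) \<in> borel_measurable (lebesgue_on {0..t})"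
    by (rule measurable_continuous_Ioc[OF f(2) t] measurable_continuous_Ioc[OF f(3) t] measurable_continuous_Ioc[OF f(4) t])+
  show "AE s in lebesgue_on {0..t}. L2 (Wf u s) \<and> nrm (Wf u s) \<le> C * exp (\<omega> * s)
      \<and> \<bar>b0 s (u s 0)\<bar> \<le> C * exp (\<omega> * s) \<and> \<bar>b1 s (u s 1)\<bar> \<le> C * exp (\<omega> * s)"
    using AE_lebesgue_on_ne[where a = 0 and b = t and c = 0] AE_lebesgue_on_in[of 0 t]
  proof eventually_elim
    case (elim s)
    then have s: "s \<in> {0<..T}" using t by auto
    have "C * 1 \<le> C * exp (\<omega> * s)" using C \<open>\<omega> \<ge> 0\<close> s by (intro mult_left_mono) auto
    then show ?case using f(6)[OF s] f(7)[of s] b0_bdd[of s "u s 0"] b1_bdd[of s "u s 1"] by auto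
  qed
qed

lemma force_bound:
  assumes "continuous_on ({0<..T} \<times> {0..1}) (\<lambda>(t, x). u t x)" "s \<in> {0<..T}"
  shows "\<bar>force u k s\<bar> \<le> (real k * pi + 3) * C"
proof -
  have "\<bar>ip (Wf u s) (sn k)\<bar> \<le> C * 1"
  proof -
    have n: "nrm (sn k) \<le> 1"
      by (cases "k = 0") (simp_all add: nrm_def ip_sn)
    have "\<bar>ip (Wf u s) (sn k)\<bar> \<le> nrm (Wf u s) * nrm (sn k)"
      using force_facts(6)[OF assms] by (rule ip_abs_le) simp
    also have "\<dots> \<le> C * 1" using force_facts(7)[OF assms(1)] n C by (intro mult_mono) auto
    finally show ?thesis .
  qed
  then have X: "\<bar>- (real k * pi) * ip (Wf u s) (sn k)\<bar> \<le> real k * pi * C"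
    by (simp add: abs_mult mult_left_mono)
  have Y: "\<bar>b * cs k x\<bar> \<le> 3/2 * C" if "\<bar>b\<bar> \<le> C" for b x
  proof -
    have "sqrt 2 \<le> 3/2" by (rule real_le_lsqrt) (auto simp: power2_eq_square)
    have "\<bar>b * cs k x\<bar> \<le> C * (3/2)"
      unfolding abs_mult using that C cs_bound[of k x] \<open>sqrt 2 \<le> 3/2\<close> by (intro mult_mono) auto
    then show ?thesis by simp
  qed
  show ?thesis
    unfolding force_def forcing_def distrib_right
    using X Y[OF b0_bdd[of s "u s 0"], of 0] Y[OF b1_bdd[of s "u s 1"], of 1] by linarith
qed

lemma force_integrable:
  assumes "continuous_on ({0<..T} \<times> {0..1}) (\<lambda>(t, x). u t x)"
  shows "integrable (lebesgue_on {0..T}) (force u k)"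
proof (rule integrable_bounded_Icc)
  show "force u k \<in> borel_measurable (lebesgue_on {0..T})"
    by (rule measurable_continuous_Ioc[OF force_facts(5)[OF assms]]) simp
  show "AE s in lebesgue_on {0..T}. \<bar>force u k s\<bar> \<le> (real k * pi + 3) * C"
    using AE_lebesgue_on_ne[where a = 0 and b = T and c = 0] AE_lebesgue_on_in[of 0 T]
    by eventually_elim (intro force_bound[OF assms], auto)
qed

text \<open>The Duhamel estimate with weight \<open>\<omega> = 1\<close>. The last bound is uniform
  in \<open>t\<close> and tends to \<open>0\<close> in \<open>n\<close>, being governed by the tail
  of \<open>mu\<close>.\<close>

lemma duhamel_force:
  assumes u: "continuous_on ({0<..T} \<times> {0..1}) (\<lambda>(t, x). u t x)" and t: "t \<in> {0..T}"
  shows "summable (\<lambda>k. \<bar>duhamel (force u k) k t\<bar>)"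
    and "(\<Sum>k. \<bar>duhamel (force u k) k t\<bar>) \<le> C * exp T * ktotal T"
    and "(\<Sum>k. \<bar>duhamel (force u (k + n)) (k + n) t\<bar>)
      \<le> C * exp T * (8 * T powr (1/8) * (sqrt (\<Sum>k. mu (k + n)) + 3 * (\<Sum>k. mu (k + n))))"
proof -
  have t': "0 \<le> t" "t \<le> T" using t by auto
  note h = force_hyps[OF u t'(2) zero_le_one]
  note e = duhamel_summable[OF order_refl t' C h]
  show s: "summable (\<lambda>k. \<bar>duhamel (force u k) k t\<bar>)" using e(1) by (simp add: force_def)
  have "C * exp (1 * t) * (1 powr (- 1/16) * ktotal T) \<le> C * exp T * ktotal T"
    using t' C ktotal_nonneg[of T] T by (simp add: mult_right_mono mult_left_mono)
  with e(2) show "(\<Sum>k. \<bar>duhamel (force u k) k t\<bar>) \<le> C * exp T * ktotal T" by (simp add: force_def)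
  have smu: "summable (\<lambda>k. mu (k + n))" using summable_mu by (rule summable_ignore_initial_segment)
  show "(\<Sum>k. \<bar>duhamel (force u (k + n)) (k + n) t\<bar>)
      \<le> C * exp T * (8 * T powr (1/8) * (sqrt (\<Sum>k. mu (k + n)) + 3 * (\<Sum>k. mu (k + n))))"
  proof (rule suminf_le_const)
    show "summable (\<lambda>k. \<bar>duhamel (force u (k + n)) (k + n) t\<bar>)"
      using s by (rule summable_ignore_initial_segment)
    fix m
    have "(\<Sum>k<m. \<bar>duhamel (force u (k + n)) (k + n) t\<bar>) = (\<Sum>k\<in>{n..<n+m}. \<bar>duhamel (force u k) k t\<bar>)"
      by (rule sum.reindex_bij_witness[of _ "\<lambda>k. k - n" "\<lambda>k. k + n"]) auto
    also have "\<dots> \<le> C * exp (1 * t) * (1 powr (- 1/16) * kconst t {n..<n+m})"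
      unfolding force_def by (rule duhamel_estimate(2)[OF _ order_refl t'(1) h]) simp
    also have "\<dots> = C * exp t * kconst t {n..<n+m}" by simp
    also have "\<dots> \<le> C * exp T * (8 * T powr (1/8) * (sqrt (\<Sum>k. mu (k + n)) + 3 * (\<Sum>k. mu (k + n))))"
    proof (rule mult_mono)
      have "sum mu {n..<n+m} = (\<Sum>k<m. mu (k + n))"
        by (rule sum.reindex_bij_witness[of _ "\<lambda>k. k + n" "\<lambda>k. k - n"]) auto
      also have "\<dots> \<le> (\<Sum>k. mu (k + n))" by (rule sum_le_suminf[OF smu]) auto
      finally have le: "sum mu {n..<n+m} \<le> (\<Sum>k. mu (k + n))" .
      show "kconst t {n..<n+m} \<le> 8 * T powr (1/8) * (sqrt (\<Sum>k. mu (k + n)) + 3 * (\<Sum>k. mu (k + n)))"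
        unfolding kconst_def using le t'
        by (intro mult_mono add_mono powr_mono2 real_sqrt_le_mono) (auto intro!: sum_nonneg add_nonneg_nonneg)
    qed (use t' C in \<open>auto intro!: mult_left_mono\<close>)
    finally show "(\<Sum>k<m. \<bar>duhamel (force u (k + n)) (k + n) t\<bar>)
      \<le> C * exp T * (8 * T powr (1/8) * (sqrt (\<Sum>k. mu (k + n)) + 3 * (\<Sum>k. mu (k + n))))" .
  qed
qed

text \<open>In contrast to the heat part, the tails are small uniformly down to time
  \<open>0\<close>. Hence the Duhamel part is continuous on the closed time interval and can live in
  a space of bounded continuous functions.\<close>

lemma duhamel_series_continuous:
  assumes u: "continuous_on ({0<..T} \<times> {0..1}) (\<lambda>(t, x). u t x)"
  shows "continuous_on ({0..T} \<times> UNIV) (\<lambda>z. cser (\<lambda>k. duhamel (force u k) k (fst z)) (snd z))"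
proof (rule uniform_limit_theorem)
  let ?S = "\<lambda>n z. \<Sum>k<n. duhamel (force u k) k (fst z) * cs k (snd z)"
  define r where "r n = sqrt 2 * (C * exp T * (8 * T powr (1/8) * (sqrt (\<Sum>k. mu (k + n)) + 3 * (\<Sum>k. mu (k + n)))))" for n
  have "r \<longlonglongrightarrow> sqrt 2 * (C * exp T * (8 * T powr (1/8) * (sqrt 0 + 3 * 0)))"
    unfolding r_def by (intro tendsto_intros tail_tendsto_0[OF summable_mu])
  then have r: "r \<longlonglongrightarrow> 0" by simp
  show "uniform_limit ({0..T} \<times> UNIV) ?S (\<lambda>z. cser (\<lambda>k. duhamel (force u k) k (fst z)) (snd z)) sequentially"
  proof (rule uniform_limitI)
    fix e :: real assume "e > 0"
    then have "\<forall>\<^sub>F n in sequentially. r n < e" using order_tendstoD(2)[OF r] by simp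
    then show "\<forall>\<^sub>F n in sequentially. \<forall>z\<in>{0..T} \<times> UNIV. dist (?S n z) (cser (\<lambda>k. duhamel (force u k) k (fst z)) (snd z)) < e"
    proof eventually_elim
      case (elim n)
      show ?case
      proof
        fix z :: "real \<times> real" assume "z \<in> {0..T} \<times> UNIV"
        then have z: "fst z \<in> {0..T}" by auto
        have "\<bar>cser (\<lambda>k. duhamel (force u k) k (fst z)) (snd z) - ?S n z\<bar> \<le> sqrt 2 * (\<Sum>k. \<bar>duhamel (force u (k + n)) (k + n) (fst z)\<bar>)"
          by (rule cser_tail[OF duhamel_force(1)[OF u z]])
        also have "\<dots> \<le> r n" unfolding r_def by (intro mult_left_mono duhamel_force(3)[OF u z]) simp
        finally show "dist (?S n z) (cser (\<lambda>k. duhamel (force u k) k (fst z)) (snd z)) < e"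
          using elim by (simp add: dist_real_def abs_minus_commute)
      qed
    qed
  qed
  have "continuous_on ({0..T} \<times> UNIV) (\<lambda>z. duhamel (force u k) k (fst z))" for k
    by (rule continuous_on_compose2[OF duhamel_continuous[OF force_integrable[OF u]]]) (auto intro!: continuous_intros)
  then show "\<forall>\<^sub>F n in sequentially. continuous_on ({0..T} \<times> (UNIV :: real set)) (?S n)"
    by (intro always_eventually allI continuous_intros)
qed simp

text \<open>The unknown \<open>z\<close> is the Duhamel part multiplied by
  \<open>exp (- \<omega> * t)\<close>, so that the weighted supremum norm becomes the norm of the
  complete space of bounded continuous functions.\<close>

definition lift :: "real \<Rightarrow> ((real \<times> real) \<Rightarrow>\<^sub>C real) \<Rightarrow> real \<Rightarrow> real \<Rightarrow> real" where
  "lift \<omega> z t x = cser (hc t) x + exp (\<omega> * t) * apply_bcontfun z (t, x)"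

lemma lift_continuous: "continuous_on ({0<..T} \<times> {0..1}) (\<lambda>(t, x). lift \<omega> z t x)"
proof -
  have h: "continuous_on ({0<..T} \<times> {0..1}) (\<lambda>z. cser (hc (fst z)) (snd z))"
    using continuous_on_subset[OF heat_continuous, of "{0<..T} \<times> {0..1}"] by (force simp: split_beta)
  have z: "continuous_on A (\<lambda>y. apply_bcontfun z (fst y, snd y))" for A :: "(real \<times> real) set"
    by simp
  have "continuous_on ({0<..T} \<times> {0..1}) (\<lambda>y. cser (hc (fst y)) (snd y) + exp (\<omega> * fst y) * apply_bcontfun z (fst y, snd y))"
    by (intro continuous_intros h z)
  then show ?thesis by (simp add: lift_def split_beta)
qed

text \<open>The Picard map in the weighted unknown. Clipping the time makes the image a bounded
  continuous function on the whole plane; in space the cosine series is defined everywhere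
  anyway.\<close>

definition pic :: "real \<Rightarrow> ((real \<times> real) \<Rightarrow>\<^sub>C real) \<Rightarrow> (real \<times> real) \<Rightarrow> real" where
  "pic \<omega> z y = exp (- \<omega> * clip 0 T (fst y))
     * cser (\<lambda>k. duhamel (force (lift \<omega> z) k) k (clip 0 T (fst y))) (snd y)"

lemma clip_T: "clip 0 T t \<in> {0..T}"
  using T by (intro clip_in) simp

lemma pic_bcontfun:
  assumes "\<omega> \<ge> 0"
  shows "pic \<omega> z \<in> bcontfun"
proof (rule bcontfun_normI)
  have "continuous_on UNIV (\<lambda>y. (\<lambda>z'. cser (\<lambda>k. duhamel (force (lift \<omega> z) k) k (fst z')) (snd z')) (clip 0 T (fst y), snd y))"
    by (rule continuous_on_compose2[OF duhamel_series_continuous[OF lift_continuous]])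
      (use clip_T in \<open>auto intro!: continuous_intros\<close>)
  then show "continuous_on UNIV (pic \<omega> z)"
    unfolding pic_def[abs_def] by (auto intro!: continuous_intros)
  fix y
  note d = duhamel_force[OF lift_continuous clip_T, of \<omega> z "fst y"]
  have "\<bar>cser (\<lambda>k. duhamel (force (lift \<omega> z) k) k (clip 0 T (fst y))) (snd y)\<bar> \<le> sqrt 2 * (C * exp T * ktotal T)"
    by (rule order_trans[OF cser_bound[OF d(1)] mult_left_mono[OF d(2)]]) simp
  moreover have "exp (- \<omega> * clip 0 T (fst y)) \<le> 1" using assms clip_T[of "fst y"] by simp
  ultimately have "\<bar>pic \<omega> z y\<bar> \<le> 1 * (sqrt 2 * (C * exp T * ktotal T))"
    unfolding pic_def abs_mult by (intro mult_mono) auto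
  then show "norm (pic \<omega> z y) \<le> sqrt 2 * (C * exp T * ktotal T)" by simp
qed

text \<open>The heat parts of two lifts cancel, and \<open>duhamel\<close> is linear in the forcing.
  So the summability estimate applies to the differences of the fluxes, which the Lipschitz bounds
  control by \<open>C * dist z z' * exp (\<omega> * s)\<close>.\<close>

lemma pic_contraction:
  assumes "\<omega> \<ge> 1"
  shows "\<bar>pic \<omega> z y - pic \<omega> z' y\<bar> \<le> \<omega> powr (- 1/16) * (sqrt 2 * (C * ktotal T)) * dist z z'"
proof -
  define t where "t = clip 0 T (fst y)"
  have t: "t \<in> {0..T}" "0 \<le> t" "t \<le> T" using clip_T by (auto simp: t_def)
  define u u' where "u = lift \<omega> z" and "u' = lift \<omega> z'"
  have c: "continuous_on ({0<..T} \<times> {0..1}) (\<lambda>(t, x). u t x)" "continuous_on ({0<..T} \<times> {0..1}) (\<lambda>(t, x). u' t x)"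
    unfolding u_def u'_def by (rule lift_continuous)+
  define W where "W s x = Wf u s x - Wf u' s x" for s x
  define p q where "p s = b0 s (u s 0) - b0 s (u' s 0)" and "q s = b1 s (u s 1) - b1 s (u' s 1)" for s
  have om: "0 \<le> \<omega>" using assms by simp
  note h = force_hyps[OF c(1) t(3) om] and h' = force_hyps[OF c(2) t(3) om]
  have udiff: "\<bar>u s x - u' s x\<bar> \<le> exp (\<omega> * s) * dist z z'" for s x
  proof -
    have "u s x - u' s x = exp (\<omega> * s) * (apply_bcontfun z (s, x) - apply_bcontfun z' (s, x))"
      by (simp add: u_def u'_def lift_def algebra_simps)
    also have "\<bar>\<dots>\<bar> = exp (\<omega> * s) * dist (apply_bcontfun z (s, x)) (apply_bcontfun z' (s, x))"
      by (simp add: abs_mult dist_real_def)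
    also have "\<dots> \<le> exp (\<omega> * s) * dist z z'" by (intro mult_left_mono dist_bounded) auto
    finally show ?thesis .
  qed
  have cd: "C * \<bar>u s x - u' s x\<bar> \<le> (C * dist z z') * exp (\<omega> * s)" for s x
    using mult_left_mono[OF udiff[of s x] C] by (simp add: mult_ac)
  have W_AE: "AE s in lebesgue_on {0..t}. L2 (Wf u s) \<and> L2 (Wf u' s)"
    using h(4) h'(4) by eventually_elim simp
  have ipW: "ip (W s) (sn k) = ip (Wf u s) (sn k) - ip (Wf u' s) (sn k)" if "L2 (Wf u s) \<and> L2 (Wf u' s)" for s k
    unfolding W_def using that by (simp add: ip_diff_left)
  have m: "(\<lambda>s. ip (W s) (sn k)) \<in> borel_measurable (lebesgue_on {0..t})" for k
  proof (rule measurable_01_AE[OF borel_measurable_diff[OF h(1) h'(1)]])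
    show "AE s in lebesgue_on {0..t}. ip (Wf u s) (sn k) - ip (Wf u' s) (sn k) = ip (W s) (sn k)"
      using W_AE by eventually_elim (simp add: ipW)
  qed
  have mp: "p \<in> borel_measurable (lebesgue_on {0..t})" "q \<in> borel_measurable (lebesgue_on {0..t})"
    unfolding p_def q_def by (intro borel_measurable_diff h(2,3) h'(2,3))+
  have b: "AE s in lebesgue_on {0..t}. L2 (W s) \<and> nrm (W s) \<le> (C * dist z z') * exp (\<omega> * s)
      \<and> \<bar>p s\<bar> \<le> (C * dist z z') * exp (\<omega> * s) \<and> \<bar>q s\<bar> \<le> (C * dist z z') * exp (\<omega> * s)"
    using W_AE
  proof eventually_elim
    case (elim s)
    then have L: "L2 (W s)" unfolding W_def by (intro L2_diff) auto
    have "nrm (W s) \<le> (C * dist z z') * exp (\<omega> * s)"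
    proof (rule nrm_le_bound[OF L2_measurable[OF L]])
      show "AE x in I01. \<bar>W s x\<bar> \<le> (C * dist z z') * exp (\<omega> * s)"
        unfolding W_def Wf_def by (intro AE_I2 order_trans[OF V_lip cd])
      show "0 \<le> (C * dist z z') * exp (\<omega> * s)" using C by simp
    qed
    then show ?case using L unfolding p_def q_def
      by (auto intro: order_trans[OF b0_lip cd] order_trans[OF b1_lip cd])
  qed
  have lin: "duhamel (force u k) k t - duhamel (force u' k) k t = duhamel (forcing W p q k) k t" for k
    unfolding force_def W_def[abs_def] p_def[abs_def] q_def[abs_def]
    by (rule duhamel_forcing_diff[OF duhamel_estimate(1)[OF finite.emptyI assms t(2) h]
          duhamel_estimate(1)[OF finite.emptyI assms t(2) h'] W_AE])
  note su = duhamel_force(1)[OF c(1) t(1)] and su' = duhamel_force(1)[OF c(2) t(1)]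
  have s: "summable (\<lambda>k. \<bar>duhamel (forcing W p q k) k t\<bar>)"
    and e: "(\<Sum>k. \<bar>duhamel (forcing W p q k) k t\<bar>) \<le> (C * dist z z') * exp (\<omega> * t) * (\<omega> powr (- 1/16) * ktotal T)"
    using duhamel_summable[OF assms t(2,3) _ m mp b] C by auto
  have "cser (\<lambda>k. duhamel (force u k) k t) (snd y) - cser (\<lambda>k. duhamel (force u' k) k t) (snd y)
      = cser (\<lambda>k. duhamel (forcing W p q k) k t) (snd y)"
    using sums_unique2[OF sums_diff[OF cser_sums[OF su] cser_sums[OF su']] cser_sums[OF s, of "snd y", unfolded lin[symmetric] left_diff_distrib]]
    by (simp add: lin)
  then have "pic \<omega> z y - pic \<omega> z' y = exp (- \<omega> * t) * cser (\<lambda>k. duhamel (forcing W p q k) k t) (snd y)"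
    by (simp add: pic_def t_def[symmetric] u_def[symmetric] u'_def[symmetric] right_diff_distrib[symmetric])
  also have "\<bar>\<dots>\<bar> \<le> exp (- \<omega> * t) * (sqrt 2 * ((C * dist z z') * exp (\<omega> * t) * (\<omega> powr (- 1/16) * ktotal T)))"
    unfolding abs_mult using order_trans[OF cser_bound[OF s] mult_left_mono[OF e]] by (intro mult_mono) auto
  also have "\<dots> = (exp (- \<omega> * t) * exp (\<omega> * t)) * (\<omega> powr (- 1/16) * (sqrt 2 * (C * ktotal T)) * dist z z')"
    by (simp only: mult_ac)
  also have "exp (- \<omega> * t) * exp (\<omega> * t) = 1" by (simp flip: exp_add)
  finally show ?thesis by simp
qed

text \<open>Banach's fixed point theorem with \<open>\<omega>\<close> so large that the contraction
  factor is \<open>1/2\<close>; multiplying the fixed point by \<open>exp (\<omega> * t)\<close> and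
  adding the heat part gives the solution.\<close>

theorem mild_solution_exists:
  "\<exists>u. continuous_on ({0<..T} \<times> {0..1}) (\<lambda>(t, x). u t x) \<and>
     (\<forall>t\<in>{0<..T}. summable (\<lambda>k. \<bar>hc t k + duhamel (force u k) k t\<bar>) \<and>
        (\<forall>x. u t x = cser (\<lambda>k. hc t k + duhamel (force u k) k t) x))"
proof -
  obtain \<omega> :: real where \<omega>: "\<omega> \<ge> 1" "\<omega> powr (- 1/16) * (sqrt 2 * (C * ktotal T)) \<le> 1/2"
    using large_weight[of "1/2" "sqrt 2 * (C * ktotal T)"] by auto
  have ap: "apply_bcontfun (Bcontfun (pic \<omega> z)) = pic \<omega> z" for z
    using \<omega> by (intro Bcontfun_inverse pic_bcontfun) simp
  have "\<exists>!z. Bcontfun (pic \<omega> z) = z"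
  proof (rule banach_fix_type[of "1/2"])
    show "\<forall>z z'. dist (Bcontfun (pic \<omega> z)) (Bcontfun (pic \<omega> z')) \<le> 1/2 * dist z z'"
    proof (intro allI dist_bound)
      fix z z' y
      have "dist (apply_bcontfun (Bcontfun (pic \<omega> z)) y) (apply_bcontfun (Bcontfun (pic \<omega> z')) y) = \<bar>pic \<omega> z y - pic \<omega> z' y\<bar>"
        by (simp add: ap dist_real_def)
      also have "\<dots> \<le> \<omega> powr (- 1/16) * (sqrt 2 * (C * ktotal T)) * dist z z'" by (rule pic_contraction[OF \<omega>(1)])
      also have "\<dots> \<le> 1/2 * dist z z'" by (intro mult_right_mono \<omega>(2)) simp
      finally show "dist (apply_bcontfun (Bcontfun (pic \<omega> z)) y) (apply_bcontfun (Bcontfun (pic \<omega> z')) y) \<le> 1/2 * dist z z'" .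
    qed
  qed auto
  then obtain z where z: "Bcontfun (pic \<omega> z) = z" by blast
  define u where "u = lift \<omega> z"
  have c: "continuous_on ({0<..T} \<times> {0..1}) (\<lambda>(t, x). u t x)" unfolding u_def by (rule lift_continuous)
  have "summable (\<lambda>k. \<bar>hc t k + duhamel (force u k) k t\<bar>) \<and> (\<forall>x. u t x = cser (\<lambda>k. hc t k + duhamel (force u k) k t) x)"
    if t: "t \<in> {0<..T}" for t
  proof -
    have t': "t \<in> {0..T}" "t > 0" "clip 0 T t = t" using t by auto
    note sd = duhamel_force(1)[OF c t'(1)] and sh = hc_summable[OF t'(2)]
    have s: "summable (\<lambda>k. \<bar>hc t k + duhamel (force u k) k t\<bar>)"
      by (rule summable_comparison_test'[OF summable_add[OF sh sd], of 0]) (auto simp: abs_triangle_ineq)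
    moreover have "u t x = cser (\<lambda>k. hc t k + duhamel (force u k) k t) x" for x
    proof -
      have "apply_bcontfun z (t, x) = pic \<omega> z (t, x)" using ap[of z] unfolding z by simp
      then have "exp (\<omega> * t) * apply_bcontfun z (t, x) = (exp (\<omega> * t) * exp (- \<omega> * t)) * cser (\<lambda>k. duhamel (force u k) k t) x"
        by (simp add: pic_def t'(3) u_def[symmetric])
      also have "exp (\<omega> * t) * exp (- \<omega> * t) = 1" by (simp flip: exp_add)
      finally have e: "exp (\<omega> * t) * apply_bcontfun z (t, x) = cser (\<lambda>k. duhamel (force u k) k t) x" by simp
      have "u t x = cser (hc t) x + exp (\<omega> * t) * apply_bcontfun z (t, x)" by (simp only: u_def lift_def)
      also have "\<dots> = cser (hc t) x + cser (\<lambda>k. duhamel (force u k) k t) x" unfolding e ..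
      also have "\<dots> = cser (\<lambda>k. hc t k + duhamel (force u k) k t) x"
        using sums_unique2[OF sums_add[OF cser_sums[OF sh] cser_sums[OF sd]] cser_sums[OF s, of x, unfolded distrib_right]] by simp
      finally show ?thesis .
    qed
    ultimately show ?thesis by blast
  qed
  with c show ?thesis by blast
qed

end

section \<open>Energy estimate\<close>

text \<open>Tonelli for nonnegative terms: the sum has finite integral, hence is finite almost
  everywhere.\<close>

lemma summable_AE_of_integrals:
  fixes h :: "nat \<Rightarrow> 'a \<Rightarrow> real"
  assumes i: "\<And>k. integrable M (h k)" and nn: "\<And>k x. 0 \<le> h k x"
    and K: "\<And>n. (\<Sum>k<n. LINT x|M. h k x) \<le> K"
  shows "AE x in M. summable (\<lambda>k. h k x)" "integrable M (\<lambda>x. \<Sum>k. h k x)"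
proof -
  have [measurable]: "h k \<in> borel_measurable M" for k using i by (rule borel_measurable_integrable)
  have "(\<integral>\<^sup>+x. (\<Sum>k. ennreal (h k x)) \<partial>M) = (\<Sum>k. \<integral>\<^sup>+x. ennreal (h k x) \<partial>M)"
    by (rule nn_integral_suminf) auto
  also have "\<dots> = (\<Sum>k. ennreal (LINT x|M. h k x))"
    by (intro suminf_cong nn_integral_eq_integral i) (auto simp: nn)
  also have "\<dots> \<le> ennreal K"
  proof (rule suminf_le_const)
    show "(\<Sum>k<n. ennreal (LINT x|M. h k x)) \<le> ennreal K" for n
      using K[of n] nn by (subst sum_ennreal) (auto intro!: ennreal_leI)
  qed auto
  finally have fin: "(\<integral>\<^sup>+x. (\<Sum>k. ennreal (h k x)) \<partial>M) < \<infinity>" by (rule order_le_less_trans) simp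
  then have "AE x in M. (\<Sum>k. ennreal (h k x)) \<noteq> \<infinity>"
    by (intro nn_integral_PInf_AE) auto
  then show s: "AE x in M. summable (\<lambda>k. h k x)"
  proof eventually_elim
    case (elim x)
    show ?case by (rule summable_suminf_not_top) (use elim nn in auto)
  qed
  have "(\<integral>\<^sup>+x. ennreal (norm (\<Sum>k. h k x)) \<partial>M) = (\<integral>\<^sup>+x. (\<Sum>k. ennreal (h k x)) \<partial>M)"
  proof (rule nn_integral_cong_AE)
    show "AE x in M. ennreal (norm (\<Sum>k. h k x)) = (\<Sum>k. ennreal (h k x))"
      using s
    proof eventually_elim
      case (elim x)
      have "(\<Sum>k. ennreal (h k x)) = ennreal (\<Sum>k. h k x)"
        by (rule suminf_ennreal2[OF nn elim])
      moreover have "(\<Sum>k. h k x) \<ge> 0" by (rule suminf_nonneg[OF elim nn])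
      ultimately show ?case by simp
    qed
  qed
  then show "integrable M (\<lambda>x. \<Sum>k. h k x)"
    using fin by (intro integrableI_bounded) auto
qed

lemma sn_fourier_converges:
  assumes "L2 f"
  shows "(\<lambda>n. nrm (\<lambda>x. (\<Sum>k<n. ip f (sn k) * sn k x) - f x)) \<longlonglongrightarrow> 0"
proof (rule LIMSEQ_imp_Suc)
  have "(\<Sum>k<Suc n. ip f (sn k) * sn k x) = (\<Sum>k<n. ip f (sn (Suc k)) * sn (Suc k) x)" for n x
    by (subst sum.lessThan_Suc_shift) simp
  then show "(\<lambda>n. nrm (\<lambda>x. (\<Sum>k<Suc n. ip f (sn k) * sn k x) - f x)) \<longlonglongrightarrow> 0"
    using sinb.fourier_converges[OF assms] by simp
qed

lemma sn_fourier_bound: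
  assumes "L2 f"
  shows "nrm (\<lambda>x. (\<Sum>k<n. ip f (sn k) * sn k x) - f x) \<le> 2 * nrm f"
proof -
  have S: "L2 (\<lambda>x. \<Sum>k<n. ip f (sn k) * sn k x)" by (intro L2_sum L2_cmult L2_sn) simp
  have "ip (\<lambda>x. \<Sum>k<n. ip f (sn k) * sn k x) (\<lambda>x. \<Sum>k<n. ip f (sn k) * sn k x) \<le> ip f f"
  proof (cases n)
    case 0
    then show ?thesis by (simp add: ip_def)
  next
    case (Suc m)
    have eq: "(\<Sum>k<n. ip f (sn k) * sn k x) = (\<Sum>k<m. ip f (sn (Suc k)) * sn (Suc k) x)" for x
      unfolding Suc by (subst sum.lessThan_Suc_shift) simp
    show ?thesis unfolding eq sinb.ip_partial_self[OF finite_lessThan] by (rule sinb.bessel[OF assms finite_lessThan])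
  qed
  then have "nrm (\<lambda>x. \<Sum>k<n. ip f (sn k) * sn k x) \<le> nrm f" unfolding nrm_def by simp
  moreover have "nrm (\<lambda>x. (\<Sum>k<n. ip f (sn k) * sn k x) - f x)
      \<le> nrm (\<lambda>x. (\<Sum>k<n. ip f (sn k) * sn k x) - 0) + nrm (\<lambda>x. 0 - f x)"
    by (rule nrm_diff_triangle[OF S _ assms]) (simp add: L2_iff)
  ultimately show ?thesis using nrm_minus_commute[of "\<lambda>_. 0" f] by simp
qed

locale mild = flux +
  fixes u :: "real \<Rightarrow> real \<Rightarrow> real"
  assumes u_cont: "continuous_on ({0<..T} \<times> {0..1}) (\<lambda>(t, x). u t x)"
    and u_sum: "t \<in> {0<..T} \<Longrightarrow> summable (\<lambda>k. \<bar>hc t k + duhamel (force u k) k t\<bar>)"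
    and u_eq: "t \<in> {0<..T} \<Longrightarrow> u t x = cser (\<lambda>k. hc t k + duhamel (force u k) k t) x"
begin

definition a :: "real \<Rightarrow> nat \<Rightarrow> real" where
  "a t k = hc t k + duhamel (force u k) k t"

text \<open>Each single coefficient is continuous down to time \<open>0\<close>, although the
  solution itself need not be.\<close>

lemma a_cont: "continuous_on {0..T} (\<lambda>t. a t k)"
  unfolding a_def hc_def by (intro continuous_intros duhamel_continuous force_integrable u_cont)

lemma a_0: "a 0 k = gc k"
  using duhamel_eq[OF force_integrable[OF u_cont], of 0 k] T by (simp add: a_def hc_def)

lemma a_DERIV:
  assumes "t \<in> {0<..<T}"
  shows "((\<lambda>t. a t k) has_real_derivative - kap k * a t k + force u k t) (at t)"
proof -
  have "((\<lambda>t. hc t k) has_real_derivative - kap k * hc t k) (at t)"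
    unfolding hc_def by (auto intro!: derivative_eq_intros)
  from DERIV_add[OF this duhamel_DERIV[OF force_integrable[OF u_cont] assms force_facts(5)[OF u_cont], of k k]]
  show ?thesis unfolding a_def by (simp add: algebra_simps)
qed

lemma a_summable: "t \<in> {0<..T} \<Longrightarrow> summable (\<lambda>k. \<bar>a t k\<bar>)"
  using u_sum by (simp add: a_def)

lemma u_cser: "t \<in> {0<..T} \<Longrightarrow> u t = cser (a t)"
  using u_eq by (auto simp: a_def[abs_def])

lemma u_facts:
  assumes "t \<in> {0<..T}"
  shows "continuous_on A (u t)" "L2 (u t)" "ip (u t) (cs k) = a t k"
  using cser_coeff[OF a_summable[OF assms]] cser_continuous[OF a_summable[OF assms]]
  by (simp_all add: u_cser[OF assms])

lemma continuous_times_force_integrable: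
  assumes "continuous_on {0..T} h" "t \<le> T"
  shows "integrable (lebesgue_on {0..t}) (\<lambda>s. h s * force u k s)"
proof -
  obtain B where B: "B > 0" "\<And>s. s \<in> {0..T} \<Longrightarrow> \<bar>h s\<bar> \<le> B" using continuous_on_bounded_01[OF assms(1)] by metis
  show ?thesis
  proof (rule integrable_bounded_Icc)
    have "continuous_on {0<..T} (\<lambda>s. h s * force u k s)"
      by (intro continuous_intros force_facts(5)[OF u_cont] continuous_on_subset[OF assms(1)]) auto
    then show "(\<lambda>s. h s * force u k s) \<in> borel_measurable (lebesgue_on {0..t})"
      by (rule measurable_continuous_Ioc[OF _ assms(2)])
    show "AE s in lebesgue_on {0..t}. \<bar>h s * force u k s\<bar> \<le> B * ((real k * pi + 3) * C)"
      using AE_lebesgue_on_ne[where a = 0 and b = t and c = 0] AE_lebesgue_on_in[of 0 t]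
    proof eventually_elim
      case (elim s)
      then have "s \<in> {0..T}" "s \<in> {0<..T}" using assms(2) by auto
      then show ?case unfolding abs_mult using B force_bound[OF u_cont, of s k] by (intro mult_mono) auto
    qed
  qed
qed

lemma continuous_Icc_integrable: "continuous_on {0..T} h \<Longrightarrow> t \<le> T \<Longrightarrow> integrable (lebesgue_on {0..t}) (h :: real \<Rightarrow> real)"
  by (rule integrable_continuous_Icc) (auto intro: continuous_on_subset)

text \<open>Division by \<open>kap k\<close> turns the flux part into squared sine coefficients,
  summable by Bessel, and leaves a multiple of \<open>1 / kap k\<close> from the boundary, also
  summable. The constant is \<open>18 = 2 * 3 * 3\<close>, where \<open>3 * C\<close> bounds the
  boundary part via \<open>sqrt 2 \<le> 3/2\<close>.\<close>

lemma force_sq: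
  assumes "k > 0" "s \<in> {0<..T}"
  shows "(force u k s)\<^sup>2 / kap k \<le> 2 * (ip (Wf u s) (sn k))\<^sup>2 + 18 * C\<^sup>2 * (1 / kap k)"
proof -
  have k: "kap k \<ge> 1" using kap_ge_1[OF assms(1)] .
  define X Y where "X = - (real k * pi) * ip (Wf u s) (sn k)" and "Y = b0 s (u s 0) * cs k 0 + b1 s (u s 1) * cs k 1"
  have r: "sqrt 2 \<le> 3/2" by (rule real_le_lsqrt) (auto simp: power2_eq_square)
  have "\<bar>b * cs k x\<bar> \<le> C * (3/2)" if "\<bar>b\<bar> \<le> C" for b x
    unfolding abs_mult using that C order_trans[OF cs_bound r] by (intro mult_mono) auto
  from this[OF b0_bdd[of s "u s 0"], of 0] this[OF b1_bdd[of s "u s 1"], of 1]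
  have "\<bar>Y\<bar> \<le> 3 * C" unfolding Y_def by linarith
  from power_mono[OF this, of 2] have Y: "Y\<^sup>2 \<le> (3 * C)\<^sup>2" by simp
  have X: "X\<^sup>2 = kap k * (ip (Wf u s) (sn k))\<^sup>2" by (simp add: X_def kap_def power_mult_distrib)
  have "(X + Y)\<^sup>2 \<le> 2 * X\<^sup>2 + 2 * Y\<^sup>2" using sum_squares_bound[of X Y] by (simp add: power2_sum)
  also have "\<dots> \<le> 2 * (kap k * (ip (Wf u s) (sn k))\<^sup>2) + 18 * C\<^sup>2"
    using X Y by (simp add: power_mult_distrib)
  finally have "(X + Y)\<^sup>2 \<le> 2 * (kap k * (ip (Wf u s) (sn k))\<^sup>2) + 18 * C\<^sup>2" .
  moreover have "force u k s = X + Y" by (simp add: force_def forcing_def X_def Y_def)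
  ultimately have "(force u k s)\<^sup>2 \<le> 2 * (kap k * (ip (Wf u s) (sn k))\<^sup>2) + 18 * C\<^sup>2" by simp
  then have "(force u k s)\<^sup>2 / kap k \<le> (2 * (kap k * (ip (Wf u s) (sn k))\<^sup>2) + 18 * C\<^sup>2) / kap k"
    using k by (intro divide_right_mono) auto
  also have "\<dots> = 2 * (ip (Wf u s) (sn k))\<^sup>2 + 18 * C\<^sup>2 * (1 / kap k)" using k by (simp add: field_simps)
  finally show ?thesis .
qed

lemma ipW_sq_integrable: "integrable (lebesgue_on {0..T}) (\<lambda>s. (ip (Wf u s) (sn k))\<^sup>2)"
proof (rule integrable_bounded_Icc)
  have "continuous_on {0<..T} (\<lambda>s. (ip (Wf u s) (sn k))\<^sup>2)"
    by (intro continuous_intros force_facts(2)[OF u_cont])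
  then show "(\<lambda>s. (ip (Wf u s) (sn k))\<^sup>2) \<in> borel_measurable (lebesgue_on {0..T})"
    by (rule measurable_continuous_Ioc) simp
  show "AE s in lebesgue_on {0..T}. \<bar>(ip (Wf u s) (sn k))\<^sup>2\<bar> \<le> C\<^sup>2"
    using AE_lebesgue_on_ne[where a = 0 and b = T and c = 0] AE_lebesgue_on_in[of 0 T]
  proof eventually_elim
    case (elim s)
    then have s: "s \<in> {0<..T}" by auto
    have "(\<Sum>k\<in>{k}. (ip (Wf u s) (sn k))\<^sup>2) \<le> (nrm (Wf u s))\<^sup>2"
      unfolding nrm_sq by (rule sn_bessel[OF force_facts(6)[OF u_cont s]]) simp
    also have "\<dots> \<le> C\<^sup>2" using force_facts(7)[OF u_cont, of s] by (intro power_mono) auto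
    finally show ?case by simp
  qed
qed

text \<open>The mode equation gives the derivative \<open>- 2 * kap k * a^2 + 2 * a * f\<close> of
  \<open>a^2\<close>. Young's inequality \<open>2 * a * f \<le> kap k * a^2 + f^2 / kap k\<close>
  spends half of the dissipation on the forcing.\<close>

lemma energy_mode:
  "(LINT s|lebesgue_on {0..T}. kap k * (a s k)\<^sup>2)
    \<le> (gc k)\<^sup>2 + 2 * (LINT s|lebesgue_on {0..T}. (ip (Wf u s) (sn k))\<^sup>2) + T * (18 * C\<^sup>2) * (1 / kap k)"
proof (cases "k = 0")
  case False
  have k: "kap k \<ge> 1" using kap_ge_1[of k] False by simp
  have ia: "integrable (lebesgue_on {0..T}) (\<lambda>s. kap k * (a s k)\<^sup>2)"
    by (intro continuous_Icc_integrable continuous_intros a_cont) simp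
  have i1: "integrable (lebesgue_on {0..T}) (\<lambda>s. - 2 * kap k * (a s k)\<^sup>2 + 2 * a s k * force u k s)"
    by (intro Bochner_Integration.integrable_add continuous_times_force_integrable continuous_Icc_integrable continuous_intros a_cont) auto
  have "(LINT s|lebesgue_on {0..T}. - 2 * kap k * (a s k)\<^sup>2 + 2 * a s k * force u k s) = (a T k)\<^sup>2 - (a 0 k)\<^sup>2"
  proof (rule FTC_Icc[OF _ _ _ i1])
    show "continuous_on {0..T} (\<lambda>s. (a s k)\<^sup>2)" by (intro continuous_intros a_cont)
    fix s assume "s \<in> {0<..<T}"
    from DERIV_power[OF a_DERIV[OF this, of k], of 2]
    show "((\<lambda>s. (a s k)\<^sup>2) has_real_derivative - 2 * kap k * (a s k)\<^sup>2 + 2 * a s k * force u k s) (at s)"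
      by (simp add: algebra_simps power2_eq_square)
  qed (use T in simp)
  then have eq: "(LINT s|lebesgue_on {0..T}. - 2 * kap k * (a s k)\<^sup>2 + 2 * a s k * force u k s) \<ge> - (gc k)\<^sup>2"
    by (simp add: a_0)
  have i2: "integrable (lebesgue_on {0..T}) (\<lambda>s. - (kap k * (a s k)\<^sup>2) + (2 * (ip (Wf u s) (sn k))\<^sup>2 + 18 * C\<^sup>2 * (1 / kap k)))"
    by (intro Bochner_Integration.integrable_add Bochner_Integration.integrable_minus ia integrable_mult_right ipW_sq_integrable
        continuous_Icc_integrable continuous_intros) simp
  have "(LINT s|lebesgue_on {0..T}. - 2 * kap k * (a s k)\<^sup>2 + 2 * a s k * force u k s)
      \<le> (LINT s|lebesgue_on {0..T}. - (kap k * (a s k)\<^sup>2) + (2 * (ip (Wf u s) (sn k))\<^sup>2 + 18 * C\<^sup>2 * (1 / kap k)))"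
  proof (rule integral_mono_AE[OF i1 i2])
    show "AE s in lebesgue_on {0..T}. - 2 * kap k * (a s k)\<^sup>2 + 2 * a s k * force u k s
        \<le> - (kap k * (a s k)\<^sup>2) + (2 * (ip (Wf u s) (sn k))\<^sup>2 + 18 * C\<^sup>2 * (1 / kap k))"
      using AE_lebesgue_on_ne[where a = 0 and b = T and c = 0] AE_lebesgue_on_in[of 0 T]
    proof eventually_elim
      case (elim s)
      then have s: "s \<in> {0<..T}" by auto
      have "0 \<le> (kap k * a s k - force u k s)\<^sup>2 / kap k" using k by simp
      also have "\<dots> = kap k * (a s k)\<^sup>2 - 2 * a s k * force u k s + (force u k s)\<^sup>2 / kap k"
        using k by (simp add: power2_diff field_simps power2_eq_square)
      finally show ?case using force_sq[OF _ s, of k] False by simp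
    qed
  qed
  also have "\<dots> = - (LINT s|lebesgue_on {0..T}. kap k * (a s k)\<^sup>2) + (2 * (LINT s|lebesgue_on {0..T}. (ip (Wf u s) (sn k))\<^sup>2) + T * (18 * C\<^sup>2 * (1 / kap k)))"
  proof -
    have c: "integrable (lebesgue_on {0..T}) (\<lambda>s. 18 * C\<^sup>2 * (1 / kap k))"
      by (intro continuous_Icc_integrable continuous_intros) simp
    have "(LINT s|lebesgue_on {0..T}. 18 * C\<^sup>2 * (1 / kap k)) = T * (18 * C\<^sup>2 * (1 / kap k))"
      using T by (simp add: measure_restrict_space)
    then show ?thesis
      using Bochner_Integration.integral_add[OF Bochner_Integration.integrable_minus[OF ia] Bochner_Integration.integrable_add[OF integrable_mult_right[OF ipW_sq_integrable[of k], of 2] c]]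
        Bochner_Integration.integral_add[OF integrable_mult_right[OF ipW_sq_integrable[of k], of 2] c]
      by simp
  qed
  finally show ?thesis using eq by (simp add: mult.assoc)
qed (simp add: integral_nonneg_AE)

text \<open>By Parseval in the sine basis the square norm of the gradient, and \<open>E\<close>
  below is the norm; this holds at almost every time, namely where the series converges.\<close>

definition G :: "real \<Rightarrow> real" where
  "G s = (\<Sum>k. kap k * (a s k)\<^sup>2)"

text \<open>Summing the mode estimates: Bessel for the initial datum, Bessel at each time for the
  flux, and summability of \<open>1 / kap k\<close> for the boundary.\<close>

lemma energy:
  "AE s in lebesgue_on {0..T}. summable (\<lambda>k. kap k * (a s k)\<^sup>2)" "integrable (lebesgue_on {0..T}) G"
proof -
  have K: "(\<Sum>k<n. LINT s|lebesgue_on {0..T}. kap k * (a s k)\<^sup>2)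
      \<le> ip \<gamma> \<gamma> + 2 * (T * C\<^sup>2) + T * (18 * C\<^sup>2) * (\<Sum>k. 1 / kap k)" for n
  proof -
    have "(\<Sum>k<n. LINT s|lebesgue_on {0..T}. kap k * (a s k)\<^sup>2)
      \<le> (\<Sum>k<n. (gc k)\<^sup>2 + 2 * (LINT s|lebesgue_on {0..T}. (ip (Wf u s) (sn k))\<^sup>2) + T * (18 * C\<^sup>2) * (1 / kap k))"
      by (intro sum_mono energy_mode)
    also have "\<dots> = (\<Sum>k<n. (gc k)\<^sup>2) + 2 * (\<Sum>k<n. LINT s|lebesgue_on {0..T}. (ip (Wf u s) (sn k))\<^sup>2) + T * (18 * C\<^sup>2) * (\<Sum>k<n. 1 / kap k)"
      by (simp only: sum.distrib sum_distrib_left)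
    also have "\<dots> \<le> ip \<gamma> \<gamma> + 2 * (T * C\<^sup>2) + T * (18 * C\<^sup>2) * (\<Sum>k. 1 / kap k)"
    proof (intro add_mono mult_left_mono)
      show "(\<Sum>k<n. (gc k)\<^sup>2) \<le> ip \<gamma> \<gamma>" unfolding gc_def by (rule cosb.bessel[OF L2_\<gamma>]) simp
      show "(\<Sum>k<n. 1 / kap k) \<le> (\<Sum>k. 1 / kap k)" by (rule sum_le_suminf[OF summable_inverse_kap]) auto
      have "(\<Sum>k<n. LINT s|lebesgue_on {0..T}. (ip (Wf u s) (sn k))\<^sup>2) = (LINT s|lebesgue_on {0..T}. (\<Sum>k<n. (ip (Wf u s) (sn k))\<^sup>2))"
        by (rule Bochner_Integration.integral_sum[symmetric]) (rule ipW_sq_integrable)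
      also have "\<dots> \<le> (LINT s|lebesgue_on {0..T}. C\<^sup>2)"
      proof (rule integral_mono_AE)
        show "integrable (lebesgue_on {0..T}) (\<lambda>s. \<Sum>k<n. (ip (Wf u s) (sn k))\<^sup>2)"
          by (intro Bochner_Integration.integrable_sum ipW_sq_integrable)
        show "integrable (lebesgue_on {0..T}) (\<lambda>s. C\<^sup>2)" by (intro continuous_Icc_integrable continuous_intros) simp
        show "AE s in lebesgue_on {0..T}. (\<Sum>k<n. (ip (Wf u s) (sn k))\<^sup>2) \<le> C\<^sup>2"
          using AE_lebesgue_on_ne[where a = 0 and b = T and c = 0] AE_lebesgue_on_in[of 0 T]
        proof eventually_elim
          case (elim s)
          then have s: "s \<in> {0<..T}" by auto
          have "(\<Sum>k<n. (ip (Wf u s) (sn k))\<^sup>2) \<le> (nrm (Wf u s))\<^sup>2"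
            unfolding nrm_sq by (rule sn_bessel[OF force_facts(6)[OF u_cont s]]) simp
          also have "\<dots> \<le> C\<^sup>2" using force_facts(7)[OF u_cont, of s] by (intro power_mono) auto
          finally show ?case .
        qed
      qed
      also have "\<dots> = T * C\<^sup>2" using T by (simp add: measure_restrict_space)
      finally show "(\<Sum>k<n. LINT s|lebesgue_on {0..T}. (ip (Wf u s) (sn k))\<^sup>2) \<le> T * C\<^sup>2" .
    qed (use T in auto)
    finally show ?thesis .
  qed
  have i: "integrable (lebesgue_on {0..T}) (\<lambda>s. kap k * (a s k)\<^sup>2)" for k
    by (intro continuous_Icc_integrable continuous_intros a_cont) simp
  show "AE s in lebesgue_on {0..T}. summable (\<lambda>k. kap k * (a s k)\<^sup>2)"
    by (rule summable_AE_of_integrals(1)[OF i _ K]) simp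
  show "integrable (lebesgue_on {0..T}) G"
    unfolding G_def[abs_def] by (rule summable_AE_of_integrals(2)[OF i _ K]) simp
qed

definition E :: "real \<Rightarrow> real" where
  "E s = sqrt (G s)"

lemma energy_H1:
  "AE s in lebesgue_on {0..T}. s \<in> {0<..T} \<and> H1 (u s) \<and> nrm (weak_grad (u s)) = E s \<and> (E s)\<^sup>2 = G s
     \<and> grad_coeff (a s) (weak_grad (u s))"
  using energy(1) AE_lebesgue_on_ne[where a = 0 and b = T and c = 0] AE_lebesgue_on_in[of 0 T]
proof eventually_elim
  case (elim s)
  then have s: "s \<in> {0<..T}" by auto
  have c: "(\<lambda>k. ip (u s) (cs k)) = a s" using u_facts(3)[OF s] by auto
  have H: "H1 (u s)" by (rule H1_I[OF u_facts(2)[OF s]]) (use elim in \<open>simp add: u_facts(3)[OF s]\<close>)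
  have g: "grad_coeff (a s) (weak_grad (u s))" using weak_grad_coeff[OF H] unfolding c .
  then have w: "L2 (weak_grad (u s))" "\<And>k. ip (weak_grad (u s)) (sn k) = - (real k * pi) * a s k"
    by (auto simp: grad_coeff_def)
  have "(\<lambda>k. kap k * (a s k)\<^sup>2) sums ip (weak_grad (u s)) (weak_grad (u s))"
    using sn_parseval[OF w(1) w(1)] by (simp add: w(2) kap_def power2_eq_square mult_ac)
  then have G: "G s = ip (weak_grad (u s)) (weak_grad (u s))" unfolding G_def by (rule sums_unique[symmetric])
  show ?case using s H g G by (simp add: E_def nrm_def)
qed

lemma E_nonneg [simp]: "AE s in lebesgue_on {0..T}. E s \<ge> 0"
  using energy_H1 by (rule eventually_mono) (metis nrm_nonneg)

lemma E_integrable: "integrable (lebesgue_on {0..T}) E"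
proof (rule Bochner_Integration.integrable_bound)
  show "integrable (lebesgue_on {0..T}) (\<lambda>s. 1 + G s)"
    by (intro Bochner_Integration.integrable_add energy(2) continuous_Icc_integrable continuous_intros) simp
  have [measurable]: "G \<in> borel_measurable (lebesgue_on {0..T})" using energy(2) by (rule borel_measurable_integrable)
  show "E \<in> borel_measurable (lebesgue_on {0..T})" unfolding E_def[abs_def] by measurable
  show "AE s in lebesgue_on {0..T}. norm (E s) \<le> norm (1 + G s)"
    using energy_H1 E_nonneg
  proof eventually_elim
    case (elim s)
    have "0 \<le> (E s - 1)\<^sup>2" by simp
    then have "2 * E s \<le> 1 + G s" using elim by (simp add: power2_diff)
    then show ?case using elim by simp
  qed
qed

end

section \<open>The solution stays between zero and one\<close>

subsection \<open>A convex penalty\<close>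

text \<open>
  Of order \<open>v\<^sup>3\<close> at \<open>0\<close>, hence twice continuously differentiable, but with globally Lipschitz first and
  second derivatives.
\<close>

definition pen :: "real \<Rightarrow> real" where
  "pen v = (max 0 v) ^ 3 / (1 + max 0 v)"

text \<open>For \<open>m = max 0 v\<close> the penalty equals
  \<open>m^2 - m + 1 - 1 / (1 + m)\<close>; this is its derivative, with the value \<open>0\<close>
  for \<open>v \<le> 0\<close>.\<close>

definition pen' :: "real \<Rightarrow> real" where
  "pen' v = 2 * max 0 v - 1 + (1 / (1 + max 0 v))\<^sup>2"

definition pen'' :: "real \<Rightarrow> real" where
  "pen'' v = 2 - 2 * (1 / (1 + max 0 v)) ^ 3"

lemma DERIV_quadratic_bound:
  fixes f :: "real \<Rightarrow> real"
  assumes "\<And>v. \<bar>f v\<bar> \<le> K * v\<^sup>2"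
  shows "(f has_real_derivative 0) (at 0)"
proof -
  have f0: "f 0 = 0" using assms[of 0] by simp
  have "((\<lambda>h. K * \<bar>h\<bar>) \<longlongrightarrow> K * \<bar>0\<bar>) (at (0::real))" by (intro tendsto_intros)
  then have "((\<lambda>h. K * \<bar>h\<bar>) \<longlongrightarrow> 0) (at (0::real))" by simp
  then have "((\<lambda>h. f h / h) \<longlongrightarrow> 0) (at 0)"
  proof (rule Lim_null_comparison[rotated])
    have "norm (f h / h) \<le> K * \<bar>h\<bar>" if "h \<noteq> 0" for h
    proof -
      have "\<bar>f h\<bar> \<le> K * \<bar>h\<bar> * \<bar>h\<bar>" using assms[of h] by (simp add: power2_eq_square mult.assoc)
      then show ?thesis using that by (simp add: divide_le_eq)
    qed
    then show "\<forall>\<^sub>F h in at 0. norm (f h / h) \<le> K * \<bar>h\<bar>"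
      by (simp add: eventually_at_filter)
  qed
  then show ?thesis by (simp add: DERIV_def f0)
qed

lemma pen_bounds: "0 \<le> pen v" "pen v \<le> v\<^sup>2" "v > 0 \<Longrightarrow> pen v > 0"
proof -
  define m where "m = max 0 v"
  have m: "m \<ge> 0" "m\<^sup>2 \<le> v\<^sup>2" by (auto simp: m_def max_def)
  show "0 \<le> pen v" using m by (simp add: pen_def m_def[symmetric])
  have "pen v = m\<^sup>2 * (m / (1 + m))" by (simp add: pen_def m_def[symmetric] power3_eq_cube power2_eq_square)
  also have "\<dots> \<le> m\<^sup>2 * 1" using m by (intro mult_left_mono) auto
  finally show "pen v \<le> v\<^sup>2" using m by simp
  show "v > 0 \<Longrightarrow> pen v > 0" by (simp add: pen_def)
qed

lemma pen'_eq: "pen' v = (max 0 v)\<^sup>2 * (2 * max 0 v + 3) / (1 + max 0 v)\<^sup>2"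
proof -
  define m where "m = max 0 v"
  have "1 + m > 0" by (simp add: m_def max_def)
  then have "2 * m - 1 + (1 / (1 + m))\<^sup>2 = ((2 * m - 1) * (1 + m)\<^sup>2 + 1) / (1 + m)\<^sup>2"
    by (simp add: add_divide_distrib power_divide)
  also have "(2 * m - 1) * (1 + m)\<^sup>2 + 1 = m\<^sup>2 * (2 * m + 3)"
    by (simp add: power2_eq_square algebra_simps)
  finally show ?thesis by (simp add: pen'_def m_def)
qed

lemma pen'_nonneg: "0 \<le> pen' v"
  unfolding pen'_eq by (intro divide_nonneg_nonneg mult_nonneg_nonneg) auto

lemma pen'_le: "pen' v \<le> 3 * v\<^sup>2"
proof -
  define m where "m = max 0 v"
  have m: "m \<ge> 0" "m\<^sup>2 \<le> v\<^sup>2" by (auto simp: m_def max_def)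
  have "2 * m + 3 \<le> 3 * (1 + m)\<^sup>2" using m by (simp add: power2_sum)
  then have "(2 * m + 3) / (1 + m)\<^sup>2 \<le> 3" using m by (simp add: divide_le_eq)
  then have "m\<^sup>2 * ((2 * m + 3) / (1 + m)\<^sup>2) \<le> m\<^sup>2 * 3" by (intro mult_left_mono) auto
  then show ?thesis using m by (simp add: pen'_eq m_def[symmetric])
qed

lemma DERIV_pen: "(pen has_real_derivative pen' v) (at v)"
proof -
  consider "v < 0" | "v = 0" | "v > 0" by linarith
  then show ?thesis
  proof cases
    case 1
    have "((\<lambda>_. 0) has_real_derivative 0) (at v)" by simp
    then have "(pen has_real_derivative 0) (at v)"
      by (rule has_field_derivative_transform_within_open[of _ _ _ "{..<0}"]) (use 1 in \<open>auto simp: pen_def\<close>)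
    then show ?thesis using 1 by (simp add: pen'_def)
  next
    case 2
    have "(pen has_real_derivative 0) (at 0)"
      by (rule DERIV_quadratic_bound[where K = 1]) (use pen_bounds in simp)
    then show ?thesis using 2 by (simp add: pen'_def)
  next
    case 3
    have "((\<lambda>v. v ^ 3 / (1 + v)) has_real_derivative ((3 * v\<^sup>2) * (1 + v) - v ^ 3 * 1) / ((1 + v) * (1 + v))) (at v)"
      by (rule derivative_eq_intros refl | use 3 in simp)+
    moreover have "((3 * v\<^sup>2) * (1 + v) - v ^ 3 * 1) / ((1 + v) * (1 + v)) = pen' v"
      using 3 by (simp add: pen'_eq power2_eq_square power3_eq_cube algebra_simps)
    ultimately have "((\<lambda>v. v ^ 3 / (1 + v)) has_real_derivative pen' v) (at v)" by simp
    then show ?thesis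
      by (rule has_field_derivative_transform_within_open[of _ _ _ "{0<..}"]) (use 3 in \<open>auto simp: pen_def\<close>)
  qed
qed

lemma DERIV_pen': "(pen' has_real_derivative pen'' v) (at v)"
proof -
  consider "v < 0" | "v = 0" | "v > 0" by linarith
  then show ?thesis
  proof cases
    case 1
    have "((\<lambda>_. 0) has_real_derivative 0) (at v)" by simp
    then have "(pen' has_real_derivative 0) (at v)"
      by (rule has_field_derivative_transform_within_open[of _ _ _ "{..<0}"]) (use 1 in \<open>auto simp: pen'_def\<close>)
    then show ?thesis using 1 by (simp add: pen''_def)
  next
    case 2
    have "(pen' has_real_derivative 0) (at 0)"
      by (rule DERIV_quadratic_bound[where K = 3]) (use pen'_le pen'_nonneg in simp)
    then show ?thesis using 2 by (simp add: pen''_def)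
  next
    case 3
    have "((\<lambda>v. 2 * v - 1 + (1 / (1 + v))\<^sup>2) has_real_derivative 2 + 2 * (1 / (1 + v)) * (- 1 / ((1 + v) * (1 + v)))) (at v)"
      by (rule derivative_eq_intros refl | use 3 in simp)+
    moreover have "2 + 2 * (1 / (1 + v)) * (- 1 / ((1 + v) * (1 + v))) = pen'' v"
      using 3 by (simp add: pen''_def power3_eq_cube)
    ultimately have "((\<lambda>v. 2 * v - 1 + (1 / (1 + v))\<^sup>2) has_real_derivative pen'' v) (at v)" by simp
    then show ?thesis
      by (rule has_field_derivative_transform_within_open[of _ _ _ "{0<..}"]) (use 3 in \<open>auto simp: pen'_def\<close>)
  qed
qed

lemma pen''_bounds: "0 \<le> pen'' v" "pen'' v \<le> 2" "v \<le> 0 \<Longrightarrow> pen'' v = 0"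
proof -
  define x where "x = 1 / (1 + max 0 v)"
  have x: "0 \<le> x" "x \<le> 1" by (auto simp: x_def)
  then have "x ^ 3 \<le> 1" "0 \<le> x ^ 3" by (auto intro: power_le_one)
  then show "0 \<le> pen'' v" "pen'' v \<le> 2" by (auto simp: pen''_def x_def[symmetric])
  show "v \<le> 0 \<Longrightarrow> pen'' v = 0" by (simp add: pen''_def)
qed

lemma abs_add_le: "\<bar>x\<bar> \<le> A \<Longrightarrow> \<bar>y\<bar> \<le> B \<Longrightarrow> \<bar>x + y\<bar> \<le> A + B" for x y :: real
  by linarith

text \<open>Both derivatives are polynomials in \<open>m = max 0 v\<close> and
  \<open>1 / (1 + m)\<close>. The latter lies in \<open>[0,1]\<close>, and both depend on
  \<open>v\<close> with Lipschitz constant \<open>1\<close>.\<close>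

lemma pen_lipschitz: "\<bar>pen' v - pen' w\<bar> \<le> 4 * \<bar>v - w\<bar>" "\<bar>pen'' v - pen'' w\<bar> \<le> 6 * \<bar>v - w\<bar>"
proof -
  define m n where "m = max 0 v" and "n = max 0 w"
  define x y where "x = 1 / (1 + m)" and "y = 1 / (1 + n)"
  have m: "m \<ge> 0" "n \<ge> 0" and mn: "\<bar>m - n\<bar> \<le> \<bar>v - w\<bar>" by (auto simp: m_def n_def)
  have x: "0 \<le> x" "x \<le> 1" "0 \<le> y" "y \<le> 1" using m by (auto simp: x_def y_def)
  have "x - y = (n - m) * (x * y)" using m by (simp add: x_def y_def field_simps)
  then have "\<bar>x - y\<bar> = \<bar>m - n\<bar> * (x * y)" using x by (simp add: abs_mult abs_minus_commute[of n m])
  also have "\<dots> \<le> \<bar>m - n\<bar> * 1" using x by (intro mult_left_mono mult_le_one) auto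
  finally have xy: "\<bar>x - y\<bar> \<le> \<bar>v - w\<bar>" using mn by simp
  have "x\<^sup>2 - y\<^sup>2 = (x - y) * (x + y)" by (simp add: power2_eq_square algebra_simps)
  then have "\<bar>x\<^sup>2 - y\<^sup>2\<bar> \<le> \<bar>x - y\<bar> * 2" using x by (simp add: abs_mult mult_left_mono)
  then have "\<bar>x\<^sup>2 - y\<^sup>2\<bar> \<le> 2 * \<bar>v - w\<bar>" using xy by simp
  moreover have "\<bar>2 * (m - n)\<bar> \<le> 2 * \<bar>v - w\<bar>" unfolding abs_mult using mn by simp
  ultimately have "\<bar>2 * (m - n) + (x\<^sup>2 - y\<^sup>2)\<bar> \<le> 2 * \<bar>v - w\<bar> + 2 * \<bar>v - w\<bar>" by (intro abs_add_le)
  then have "\<bar>(2 * m - 1 + x\<^sup>2) - (2 * n - 1 + y\<^sup>2)\<bar> \<le> 4 * \<bar>v - w\<bar>" by (simp add: algebra_simps)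
  then show "\<bar>pen' v - pen' w\<bar> \<le> 4 * \<bar>v - w\<bar>"
    by (simp add: pen'_def m_def[symmetric] n_def[symmetric] x_def y_def)
  have "x ^ 3 - y ^ 3 = (x - y) * (x * x + x * y + y * y)" by (simp add: power3_eq_cube algebra_simps)
  moreover have "x * x + x * y + y * y \<le> 3"
    using x mult_le_one[of x x] mult_le_one[of x y] mult_le_one[of y y] by linarith
  ultimately have "\<bar>x ^ 3 - y ^ 3\<bar> \<le> \<bar>x - y\<bar> * 3" using x by (simp add: abs_mult mult_left_mono)
  then have "\<bar>x ^ 3 - y ^ 3\<bar> \<le> 3 * \<bar>v - w\<bar>" using xy by simp
  then have "\<bar>(- 2) * (x ^ 3 - y ^ 3)\<bar> \<le> 6 * \<bar>v - w\<bar>" unfolding abs_mult by simp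
  then have "\<bar>(2 - 2 * x ^ 3) - (2 - 2 * y ^ 3)\<bar> \<le> 6 * \<bar>v - w\<bar>" by (simp add: algebra_simps)
  then show "\<bar>pen'' v - pen'' w\<bar> \<le> 6 * \<bar>v - w\<bar>"
    by (simp add: pen''_def m_def[symmetric] n_def[symmetric] x_def y_def)
qed

definition phi :: "real \<Rightarrow> real" where "phi v = pen (- v) + pen (v - 1)"
definition phi' :: "real \<Rightarrow> real" where "phi' v = - pen' (- v) + pen' (v - 1)"
definition phi'' :: "real \<Rightarrow> real" where "phi'' v = pen'' (- v) + pen'' (v - 1)"

lemma DERIV_phi: "(phi has_real_derivative phi' v) (at v within A)"
  and DERIV_phi': "(phi' has_real_derivative phi'' v) (at v within A)"
proof -
  have "(phi has_real_derivative phi' v) (at v)"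
    unfolding phi_def[abs_def] phi'_def
    by (rule derivative_eq_intros DERIV_chain2[OF DERIV_pen] refl)+ simp
  then show "(phi has_real_derivative phi' v) (at v within A)" by (rule has_field_derivative_at_within)
  have "(phi' has_real_derivative phi'' v) (at v)"
    unfolding phi'_def[abs_def] phi''_def
    by (rule derivative_eq_intros DERIV_chain2[OF DERIV_pen'] refl)+ simp
  then show "(phi' has_real_derivative phi'' v) (at v within A)" by (rule has_field_derivative_at_within)
qed

text \<open>The comparison with \<open>(v - g)\<^sup>2\<close> makes the initial penalty of the
  partial sums small, the signs and zeros of the derivatives match those of the fluxes, and the
  Lipschitz bounds convert truncation errors of the solution into errors of the penalty.\<close>

lemma phi_facts:
  shows "0 \<le> phi v" and "phi v = 0 \<Longrightarrow> v \<in> {0..1}" and "g \<in> {0..1} \<Longrightarrow> phi v \<le> (v - g)\<^sup>2"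
    and "0 \<le> phi'' v" "phi'' v \<le> 4" "v \<in> {0..1} \<Longrightarrow> phi'' v = 0"
    and "v \<le> 0 \<Longrightarrow> phi' v \<le> 0" "v \<ge> 1 \<Longrightarrow> phi' v \<ge> 0" "v \<in> {0..1} \<Longrightarrow> phi' v = 0"
    and "\<bar>phi' v - phi' w\<bar> \<le> 8 * \<bar>v - w\<bar>" "\<bar>phi'' v - phi'' w\<bar> \<le> 12 * \<bar>v - w\<bar>"
proof -
  show "0 \<le> phi v" unfolding phi_def by (intro add_nonneg_nonneg pen_bounds)
  show "phi v = 0 \<Longrightarrow> v \<in> {0..1}"
    using pen_bounds(1)[of "- v"] pen_bounds(1)[of "v - 1"] pen_bounds(3)[of "- v"] pen_bounds(3)[of "v - 1"]
    unfolding phi_def by (cases "v < 0"; cases "v > 1") auto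
  have z: "pen v = 0" "pen' v = 0" if "v \<le> 0" for v using that by (auto simp: pen_def pen'_def)
  show "phi v \<le> (v - g)\<^sup>2" if g: "g \<in> {0..1}"
  proof -
    consider "v < 0" | "v \<in> {0..1}" | "v > 1" by fastforce
    then show ?thesis
    proof cases
      case 1
      have "phi v \<le> (- v)\<^sup>2" using z[of "v - 1"] 1 pen_bounds(2)[of "- v"] by (simp add: phi_def)
      also have "\<dots> \<le> (g - v)\<^sup>2" using 1 g by (intro power_mono) auto
      finally show ?thesis by (simp add: power2_commute)
    next
      case 2
      then show ?thesis using z[of "- v"] z[of "v - 1"] by (simp add: phi_def)
    next
      case 3
      have "phi v \<le> (v - 1)\<^sup>2" using z[of "- v"] 3 pen_bounds(2)[of "v - 1"] by (simp add: phi_def)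
      also have "\<dots> \<le> (v - g)\<^sup>2" using 3 g by (intro power_mono) auto
      finally show ?thesis .
    qed
  qed
  show "0 \<le> phi'' v" "phi'' v \<le> 4" "v \<in> {0..1} \<Longrightarrow> phi'' v = 0"
    using pen''_bounds[of "- v"] pen''_bounds[of "v - 1"] by (auto simp: phi''_def)
  show "v \<le> 0 \<Longrightarrow> phi' v \<le> 0" "v \<ge> 1 \<Longrightarrow> phi' v \<ge> 0" "v \<in> {0..1} \<Longrightarrow> phi' v = 0"
    using z[of "- v"] z[of "v - 1"] pen'_nonneg[of "- v"] pen'_nonneg[of "v - 1"] by (auto simp: phi'_def)
  show "\<bar>phi' v - phi' w\<bar> \<le> 8 * \<bar>v - w\<bar>"
  proof -
    have "\<bar>- (pen' (- v) - pen' (- w))\<bar> \<le> 4 * \<bar>v - w\<bar>"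
      using pen_lipschitz(1)[of "- v" "- w"] by (simp add: abs_minus_commute)
    moreover have "\<bar>pen' (v - 1) - pen' (w - 1)\<bar> \<le> 4 * \<bar>v - w\<bar>"
      using pen_lipschitz(1)[of "v - 1" "w - 1"] by simp
    ultimately have "\<bar>- (pen' (- v) - pen' (- w)) + (pen' (v - 1) - pen' (w - 1))\<bar> \<le> 4 * \<bar>v - w\<bar> + 4 * \<bar>v - w\<bar>"
      by (rule abs_add_le)
    then show ?thesis unfolding phi'_def by (simp add: algebra_simps)
  qed
  show "\<bar>phi'' v - phi'' w\<bar> \<le> 12 * \<bar>v - w\<bar>"
  proof -
    have "\<bar>pen'' (- v) - pen'' (- w)\<bar> \<le> 6 * \<bar>v - w\<bar>"
      using pen_lipschitz(2)[of "- v" "- w"] by (simp add: abs_minus_commute)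
    moreover have "\<bar>pen'' (v - 1) - pen'' (w - 1)\<bar> \<le> 6 * \<bar>v - w\<bar>"
      using pen_lipschitz(2)[of "v - 1" "w - 1"] by simp
    ultimately have "\<bar>(pen'' (- v) - pen'' (- w)) + (pen'' (v - 1) - pen'' (w - 1))\<bar> \<le> 6 * \<bar>v - w\<bar> + 6 * \<bar>v - w\<bar>"
      by (rule abs_add_le)
    then show ?thesis unfolding phi''_def by (simp add: algebra_simps)
  qed
qed

lemma continuous_on_phi [continuous_intros]:
  fixes f :: "'a::metric_space \<Rightarrow> real"
  shows "continuous_on A f \<Longrightarrow> continuous_on A (\<lambda>x. phi (f x))"
    "continuous_on A f \<Longrightarrow> continuous_on A (\<lambda>x. phi' (f x))"
    "continuous_on A f \<Longrightarrow> continuous_on A (\<lambda>x. phi'' (f x))"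
proof -
  have "continuous_on UNIV phi" "continuous_on UNIV phi'"
    by (rule continuous_on_DERIV, rule DERIV_phi DERIV_phi')+
  moreover have "continuous_on UNIV phi''"
    unfolding phi''_def[abs_def] pen''_def by (intro continuous_intros) (auto simp: max_def)
  ultimately show "continuous_on A f \<Longrightarrow> continuous_on A (\<lambda>x. phi (f x))"
    "continuous_on A f \<Longrightarrow> continuous_on A (\<lambda>x. phi' (f x))"
    "continuous_on A f \<Longrightarrow> continuous_on A (\<lambda>x. phi'' (f x))"
    by (auto intro: continuous_on_compose2)
qed

subsection \<open>Propagation of the bounds\<close>

lemma nrm_mult_le:
  assumes "c \<in> borel_measurable I01" "L2 g" "\<And>x. x \<in> {0..1} \<Longrightarrow> \<bar>c x\<bar> \<le> B" "B \<ge> 0"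
  shows "nrm (\<lambda>x. c x * g x) \<le> B * nrm g"
proof -
  have b: "AE x in I01. \<bar>c x\<bar> \<le> B" by (rule AE_I2) (use assms(3) in simp)
  have L: "L2 (\<lambda>x. c x * g x)" using L2_mult_bounded[OF assms(2,1) b] by (simp add: mult.commute)
  have "(nrm (\<lambda>x. c x * g x))\<^sup>2 \<le> (LINT x|I01. B\<^sup>2 * (g x)\<^sup>2)"
    unfolding nrm_sq_integral
  proof (rule integral_mono)
    show "integrable I01 (\<lambda>x. (c x * g x)\<^sup>2)" using L by (simp add: L2_iff)
    show "integrable I01 (\<lambda>x. B\<^sup>2 * (g x)\<^sup>2)" using assms(2) by (simp add: L2_iff)
    fix x assume "x \<in> space I01"
    then have "(c x)\<^sup>2 \<le> B\<^sup>2" using power_mono[OF assms(3)[of x], of 2] by simp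
    then show "(c x * g x)\<^sup>2 \<le> B\<^sup>2 * (g x)\<^sup>2" unfolding power_mult_distrib by (rule mult_right_mono) simp
  qed
  also have "\<dots> = (B * nrm g)\<^sup>2" by (simp add: power_mult_distrib nrm_sq_integral)
  finally show ?thesis by (rule power2_le_imp_le) (simp add: assms(4))
qed

lemma sn_partial_bound:
  assumes "L2 f"
  shows "nrm (\<lambda>x. \<Sum>k<n. ip f (sn k) * sn k x) \<le> nrm f"
proof (cases n)
  case 0
  then show ?thesis by (simp add: nrm_def ip_def)
next
  case (Suc m)
  have eq: "(\<Sum>k<n. ip f (sn k) * sn k x) = (\<Sum>k<m. ip f (sn (Suc k)) * sn (Suc k) x)" for x
    unfolding Suc by (subst sum.lessThan_Suc_shift) simp
  show ?thesis unfolding eq nrm_def sinb.ip_partial_self[OF finite_lessThan]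
    by (rule real_sqrt_le_mono, rule sinb.bessel[OF assms finite_lessThan])
qed

context mild
begin

text \<open>
  \<open>Dn\<close> is the time derivative of the penalty \<open>\<integral>phi (un N s x) dx\<close> of the partial sums.  For the full
  solution it would be nonpositive, because \<open>phi'' \<ge> 0\<close>, \<open>V\<close> vanishes where \<open>phi''\<close> does not, and \<open>b0\<close>, \<open>b1\<close>
  point inwards; \<open>tau\<close> and \<open>om\<close> measure the errors made by truncating \<open>u\<close> and the flux \<open>Wf\<close>.
\<close>

definition un :: "nat \<Rightarrow> real \<Rightarrow> real \<Rightarrow> real" where
  "un N t x = (\<Sum>k<N. a t k * cs k x)"

definition gn :: "nat \<Rightarrow> real \<Rightarrow> real \<Rightarrow> real" where
  "gn N t x = (\<Sum>k<N. a t k * (- (real k * pi) * sn k x))"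

definition Dn :: "nat \<Rightarrow> real \<Rightarrow> real" where
  "Dn N s = (\<Sum>k<N. (- kap k * a s k + force u k s) * ip (\<lambda>x. phi' (un N s x)) (cs k))"

definition tau :: "nat \<Rightarrow> real" where
  "tau N = sqrt (\<Sum>k. 1 / kap (k + N))"

definition om :: "nat \<Rightarrow> real \<Rightarrow> real" where
  "om N s = nrm (\<lambda>x. (\<Sum>k<N. ip (Wf u s) (sn k) * sn k x) - Wf u s x)"

lemma tau_nonneg [simp]: "tau N \<ge> 0"
  unfolding tau_def by (intro real_sqrt_ge_zero suminf_nonneg) (auto intro: summable_ignore_initial_segment[OF summable_inverse_kap])

lemma tau_tendsto: "tau \<longlonglongrightarrow> 0"
  using tendsto_real_sqrt[OF tail_tendsto_0[OF summable_inverse_kap]] by (simp add: tau_def[abs_def])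

lemma un_cont: "continuous_on ({0..T} \<times> A) (\<lambda>z. un N (fst z) (snd z))"
  unfolding un_def by (intro continuous_intros continuous_on_compose2[OF a_cont]) auto

lemma un_cont_x: "continuous_on A (un N s)"
  unfolding un_def[abs_def] by (intro continuous_intros)

lemma gn_cont_x: "continuous_on A (gn N s)"
  unfolding gn_def[abs_def] by (intro continuous_intros)

lemma DERIV_un: "(un N s has_real_derivative gn N s x) (at x)"
  unfolding un_def[abs_def] gn_def by (intro DERIV_sum DERIV_cmult DERIV_cs)

lemma phi'_coeff: "grad_coeff (\<lambda>k. ip (\<lambda>x. phi' (un N s x)) (cs k)) (\<lambda>x. phi'' (un N s x) * gn N s x)"
  by (rule grad_coeff_C1)
    (auto intro!: continuous_intros un_cont_x gn_cont_x DERIV_chain2[OF DERIV_phi' DERIV_un])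

text \<open>Every error carries a factor \<open>tau N\<close> or \<open>om N s\<close>; the other
  factors are at most quadratic in the norm of the gradient, hence integrable in time by the energy
  estimate. \<open>N > 0\<close> keeps mode \<open>0\<close>, which the gradient does not control,
  out of the tails.\<close>

lemma Dn_le:
  assumes s: "s \<in> {0<..T}" and w: "grad_coeff (a s) w" and N: "N > 0"
  shows "Dn N s \<le> tau N * (12 * sqrt 2 * C * (nrm w)\<^sup>2 + 24 * sqrt 2 * C * nrm w) + 4 * nrm w * om N s"
proof -
  define W where "W = Wf u s"
  define g where "g = gn N s"
  define px where "px x = phi'' (un N s x) * g x" for x
  define p where "p k = ip (\<lambda>x. phi' (un N s x)) (cs k)" for k
  define v where "v k = ip W (sn k)" for k
  \<comment> \<open>\<open>r\<close> bounds the distance between the partial sum and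
    \<open>u s\<close> uniformly in space. The tail estimate for \<open>grad_coeff\<close> makes it
    small with \<open>tau N\<close>.\<close>
  define r where "r = sqrt 2 * (\<Sum>k. \<bar>a s (k + N)\<bar>)"
  have LW: "L2 W" and nW: "nrm W \<le> C" using force_facts(6)[OF u_cont s] force_facts(7)[OF u_cont] by (auto simp: W_def)
  have Lg: "L2 g" unfolding g_def by (intro L2_continuous gn_cont_x)
  have gp: "grad_coeff p px" unfolding p_def px_def g_def by (rule phi'_coeff)
  then have Lpx: "L2 px" and ppx: "\<And>k. ip px (sn k) = - (real k * pi) * p k" by (auto simp: grad_coeff_def)
  have w': "L2 w" "\<And>k. ip w (sn k) = - (real k * pi) * a s k" using w by (auto simp: grad_coeff_def)
  have phi''_m: "(\<lambda>x. phi'' (un N s x)) \<in> borel_measurable I01"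
    by (intro continuous_on_measurable_01 continuous_intros un_cont_x)
  have geq: "g = (\<lambda>x. \<Sum>k<N. ip w (sn k) * sn k x)"
    unfolding g_def gn_def[abs_def] w'(2) by (rule ext, rule sum.cong) auto
  have ng: "nrm g \<le> nrm w" unfolding geq by (rule sn_partial_bound[OF w'(1)])
  have "nrm px \<le> 4 * nrm g" unfolding px_def
    by (rule nrm_mult_le[OF phi''_m Lg]) (use phi_facts(4,5) in auto)
  then have npx: "nrm px \<le> 4 * nrm w" using ng by linarith
  have r: "r \<le> sqrt 2 * (nrm w * tau N)"
    unfolding r_def tau_def by (intro mult_left_mono grad_coeff_tail[OF w N]) simp
  have r0: "r \<ge> 0" unfolding r_def
    by (intro mult_nonneg_nonneg suminf_nonneg) (auto intro: summable_ignore_initial_segment[OF a_summable[OF s]])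
  have ur: "\<bar>un N s x - u s x\<bar> \<le> r" for x
    using cser_tail[OF a_summable[OF s], of x N] unfolding r_def un_def u_cser[OF s] by (simp add: abs_minus_commute)
  \<comment> \<open>Truncation costs nothing here: the sum is minus the integral of
    \<open>phi'' (un N s x) * (gn N s x)\<^sup>2\<close>.\<close>
  have diffusion: "(\<Sum>k<N. - kap k * a s k * p k) \<le> 0"
  proof -
    have "(\<Sum>k<N. - kap k * a s k * p k) = (\<Sum>k<N. - (ip w (sn k) * ip px (sn k)))"
      by (rule sum.cong) (auto simp: ppx w'(2) kap_def power2_eq_square)
    also have "\<dots> = - ip px g"
      unfolding geq sum_negf by (subst ip_sum_right) (auto intro: Lpx L2_cmult)
    finally have e: "(\<Sum>k<N. - kap k * a s k * p k) = - ip px g" .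
    have "ip px g = (LINT x|I01. phi'' (un N s x) * (g x)\<^sup>2)"
      unfolding ip_def px_def by (simp add: power2_eq_square mult.assoc)
    moreover have "(LINT x|I01. phi'' (un N s x) * (g x)\<^sup>2) \<ge> 0"
      using phi_facts(4) by (intro integral_nonneg_AE AE_I2) simp
    ultimately show ?thesis using e by linarith
  qed
  \<comment> \<open>The sum pairs the derivative \<open>px\<close> of \<open>phi' (un N s x)\<close>
    with the sine partial sum \<open>?Q\<close> of the flux; replacing \<open>?Q\<close> by
    \<open>W\<close> costs \<open>om N s\<close>.\<close>
  have drift: "(\<Sum>k<N. - (real k * pi) * v k * p k) \<le> 12 * r * C * nrm w + 4 * nrm w * om N s"
  proof -
    let ?Q = "\<lambda>x. \<Sum>k<N. v k * sn k x"
    have LQ: "L2 ?Q" by (intro L2_sum L2_cmult L2_sn) simp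
    have "(\<Sum>k<N. - (real k * pi) * v k * p k) = (\<Sum>k<N. v k * ip px (sn k))"
      by (rule sum.cong) (auto simp: ppx)
    also have "\<dots> = ip px ?Q" by (subst ip_sum_right) (auto intro: Lpx L2_cmult)
    also have "\<dots> = ip px W + ip px (\<lambda>x. ?Q x - W x)" using Lpx LQ LW by (simp add: ip_diff_right)
    finally have e: "(\<Sum>k<N. - (real k * pi) * v k * p k) = ip px W + ip px (\<lambda>x. ?Q x - W x)" .
    have "ip px W = ip (\<lambda>x. (phi'' (un N s x) - phi'' (u s x)) * W x) g"
    proof -
      \<comment> \<open>Subtracting this zero leaves a difference of second derivatives, at most
        \<open>12 * r\<close>; this is the purpose of the Lipschitz bound for
        \<open>phi''\<close>.\<close>
      have "phi'' (u s x) * W x = 0" for x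
        using phi_facts(6)[of "u s x"] V_0[of "u s x" s x] by (cases "u s x \<in> {0..1}") (auto simp: W_def Wf_def)
      then have "px x * W x = (phi'' (un N s x) - phi'' (u s x)) * W x * g x" for x
        by (simp add: px_def left_diff_distrib)
      then show ?thesis unfolding ip_def by (simp only:)
    qed
    also have "\<dots> \<le> (12 * r * C) * nrm w"
    proof -
      have c: "continuous_on {0..1} (\<lambda>x. phi'' (un N s x) - phi'' (u s x))"
        by (intro continuous_intros un_cont_x u_facts(1)[OF s])
      have b: "\<bar>phi'' (un N s x) - phi'' (u s x)\<bar> \<le> 12 * r" for x
        using phi_facts(11)[of "un N s x" "u s x"] ur[of x] by simp
      have m: "(\<lambda>x. phi'' (un N s x) - phi'' (u s x)) \<in> borel_measurable I01" by (rule continuous_on_measurable_01[OF c])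
      have L: "L2 (\<lambda>x. (phi'' (un N s x) - phi'' (u s x)) * W x)"
        using L2_mult_bounded[OF LW m, of "12 * r"] b by (simp add: mult.commute)
      have "ip (\<lambda>x. (phi'' (un N s x) - phi'' (u s x)) * W x) g \<le> nrm (\<lambda>x. (phi'' (un N s x) - phi'' (u s x)) * W x) * nrm g"
        using ip_abs_le[OF L Lg] by linarith
      also have "\<dots> \<le> (12 * r * C) * nrm w"
      proof (intro mult_mono ng)
        have "nrm (\<lambda>x. (phi'' (un N s x) - phi'' (u s x)) * W x) \<le> (12 * r) * nrm W"
          by (rule nrm_mult_le[OF m LW]) (use b r0 in auto)
        also have "\<dots> \<le> 12 * r * C" using nW r0 by (intro mult_left_mono) auto
        finally show "nrm (\<lambda>x. (phi'' (un N s x) - phi'' (u s x)) * W x) \<le> 12 * r * C" .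
      qed (use r0 C in auto)
      finally show ?thesis .
    qed
    finally have e1: "ip px W \<le> (12 * r * C) * nrm w" .
    have e2: "ip px (\<lambda>x. ?Q x - W x) \<le> 4 * nrm w * om N s"
    proof -
      have "ip px (\<lambda>x. ?Q x - W x) \<le> nrm px * nrm (\<lambda>x. ?Q x - W x)"
        using ip_abs_le[OF Lpx L2_diff[OF LQ LW]] by linarith
      also have "\<dots> \<le> (4 * nrm w) * om N s"
        unfolding om_def v_def W_def by (intro mult_right_mono) (use npx in auto)
      finally show ?thesis .
    qed
    show ?thesis using e e1 e2 by linarith
  qed
  \<comment> \<open>Two replacements at an end point: the partial series of
    \<open>phi' (un N s x)\<close> by its sum, and the sum by \<open>phi' (u s x)\<close>. The
    product of the latter with an inward current is nonpositive.\<close>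
  have bdy: "b * (\<Sum>k<N. p k * cs k x) \<le> C * (4 * sqrt 2 * nrm w * tau N) + 8 * C * r"
    if b: "\<bar>b\<bar> \<le> C" and bs: "u s x \<le> 0 \<Longrightarrow> b \<ge> 0" "u s x \<ge> 1 \<Longrightarrow> b \<le> 0" and x: "x \<in> {0..1}" for b x
  proof -
    have ps: "summable (\<lambda>k. \<bar>p k\<bar>)" by (rule grad_coeff_summable(1)[OF gp])
    have pe: "cser p x = phi' (un N s x)"
      using cser_eq[of "\<lambda>x. phi' (un N s x)" x] ps x unfolding p_def by (auto intro!: continuous_intros un_cont_x)
    have "\<bar>(\<Sum>k<N. p k * cs k x) - phi' (un N s x)\<bar> \<le> sqrt 2 * (\<Sum>k. \<bar>p (k + N)\<bar>)"
      using cser_tail[OF ps, of x N] unfolding pe by (simp add: abs_minus_commute)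
    also have "\<dots> \<le> sqrt 2 * (nrm px * tau N)"
      unfolding tau_def by (intro mult_left_mono grad_coeff_tail[OF gp N]) simp
    also have "\<dots> \<le> sqrt 2 * ((4 * nrm w) * tau N)" by (intro mult_left_mono mult_right_mono npx) auto
    finally have e1: "\<bar>(\<Sum>k<N. p k * cs k x) - phi' (un N s x)\<bar> \<le> 4 * sqrt 2 * nrm w * tau N" by simp
    have e2: "\<bar>phi' (un N s x) - phi' (u s x)\<bar> \<le> 8 * r"
      using phi_facts(10)[of "un N s x" "u s x"] ur[of x] by simp
    have e3: "b * phi' (u s x) \<le> 0"
    proof -
      consider "u s x \<le> 0" | "u s x \<ge> 1" | "u s x \<in> {0..1}" by fastforce
      then show ?thesis
        using bs phi_facts(7-9)[of "u s x"] by cases (auto intro: mult_nonneg_nonpos mult_nonpos_nonneg)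
    qed
    have "b * (\<Sum>k<N. p k * cs k x) = b * ((\<Sum>k<N. p k * cs k x) - phi' (un N s x)) + b * (phi' (un N s x) - phi' (u s x)) + b * phi' (u s x)"
      by (simp add: algebra_simps)
    moreover have "b * ((\<Sum>k<N. p k * cs k x) - phi' (un N s x)) \<le> C * (4 * sqrt 2 * nrm w * tau N)"
      by (rule order_trans[OF abs_ge_self], unfold abs_mult, intro mult_mono b e1) (use C in auto)
    moreover have "b * (phi' (un N s x) - phi' (u s x)) \<le> C * (8 * r)"
      by (rule order_trans[OF abs_ge_self], unfold abs_mult, intro mult_mono b e2) (use C in auto)
    ultimately show ?thesis using e3 by linarith
  qed
  have "Dn N s = (\<Sum>k<N. - kap k * a s k * p k) + (\<Sum>k<N. - (real k * pi) * v k * p k)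
      + b0 s (u s 0) * (\<Sum>k<N. p k * cs k 0) + b1 s (u s 1) * (\<Sum>k<N. p k * cs k 1)"
    unfolding Dn_def p_def[symmetric] force_def forcing_def sum_distrib_left sum.distrib[symmetric]
    by (rule sum.cong) (auto simp: v_def W_def algebra_simps)
  also have "\<dots> \<le> 0 + (12 * r * C * nrm w + 4 * nrm w * om N s)
      + (C * (4 * sqrt 2 * nrm w * tau N) + 8 * C * r) + (C * (4 * sqrt 2 * nrm w * tau N) + 8 * C * r)"
    by (intro add_mono diffusion drift bdy) (auto intro: b0_bdd b0_sign b1_bdd b1_sign)
  also have "\<dots> = r * (12 * C * nrm w + 16 * C) + (8 * sqrt 2 * C * nrm w * tau N + 4 * nrm w * om N s)"
    by (simp add: algebra_simps)
  also have "\<dots> \<le> (sqrt 2 * (nrm w * tau N)) * (12 * C * nrm w + 16 * C) + (8 * sqrt 2 * C * nrm w * tau N + 4 * nrm w * om N s)"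
    by (intro add_right_mono mult_right_mono r) (simp add: C)
  also have "\<dots> = tau N * (12 * sqrt 2 * C * (nrm w)\<^sup>2 + 24 * sqrt 2 * C * nrm w) + 4 * nrm w * om N s"
    by (simp add: algebra_simps power2_eq_square)
  finally show ?thesis .
qed

lemma om_measurable: "t \<le> T \<Longrightarrow> om N \<in> borel_measurable (lebesgue_on {0..t})"
proof (rule measurable_continuous_Ioc)
  let ?f = "\<lambda>s x. ((\<Sum>k<N. ip (Wf u s) (sn k) * sn k x) - Wf u s x)\<^sup>2"
  have c: "continuous_on ({0<..T} \<times> {0..1}) (\<lambda>z. Wf u (fst z) (snd z))"
    using Wf_continuous[OF u_cont] by (simp add: split_beta)
  have "continuous_on ({0<..T} \<times> {0..1}) (\<lambda>z. ((\<Sum>k<N. ip (Wf u (fst z)) (sn k) * sn k (snd z)) - Wf u (fst z) (snd z))\<^sup>2)"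
    by (intro continuous_intros c continuous_on_compose2[OF force_facts(2)[OF u_cont]]) auto
  then have "continuous_on {0<..T} (\<lambda>s. ip (?f s) (\<lambda>_. 1))"
    by (intro ip_continuous_param continuous_intros) (simp add: split_beta)
  then have "continuous_on {0<..T} (\<lambda>s. sqrt (ip (?f s) (\<lambda>_. 1)))" by (intro continuous_intros)
  moreover have "om N s = sqrt (ip (?f s) (\<lambda>_. 1))" for s
    by (simp add: om_def nrm_def ip_def power2_eq_square)
  ultimately show "continuous_on {0<..T} (om N)" by (simp cong: continuous_on_cong)
qed

definition Phi :: "nat \<Rightarrow> real \<Rightarrow> real" where
  "Phi N t = (LINT x|I01. phi (un N t x))"

text \<open>Finitely many modes, each differentiable in time, so the Leibniz rule applies.\<close>

lemma Phi_DERIV: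
  assumes t: "t \<in> {0<..<T}"
  shows "(Phi N has_real_derivative Dn N t) (at t)"
proof -
  let ?U = "{0<..<T}"
  let ?fx = "\<lambda>t x. phi' (un N t x) * (\<Sum>k<N. (- kap k * a t k + force u k t) * cs k x)"
  have L: "((\<lambda>t. integral (cbox 0 1) (\<lambda>x. phi (un N t x))) has_field_derivative integral (cbox 0 1) (?fx t)) (at t within ?U)"
  proof (rule leibniz_rule_field_derivative)
    fix s x assume s: "s \<in> ?U"
    have "((\<lambda>t. un N t x) has_real_derivative (\<Sum>k<N. (- kap k * a s k + force u k s) * cs k x)) (at s within ?U)"
      unfolding un_def by (intro DERIV_sum DERIV_cmult_right has_field_derivative_at_within[OF a_DERIV[OF s]])
    then show "((\<lambda>t. phi (un N t x)) has_real_derivative ?fx s x) (at s within ?U)"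
      by (rule DERIV_chain2[OF DERIV_phi])
  next
    fix s assume "s \<in> ?U"
    show "(\<lambda>x. phi (un N s x)) integrable_on cbox 0 1"
      by (intro integrable_continuous continuous_intros un_cont_x)
  next
    have c: "continuous_on (?U \<times> cbox 0 1) (\<lambda>z. a (fst z) k)" for k
      by (rule continuous_on_compose2[OF a_cont]) (auto intro!: continuous_intros)
    have f: "continuous_on (?U \<times> cbox 0 1) (\<lambda>z. force u k (fst z))" for k
      by (rule continuous_on_compose2[OF force_facts(5)[OF u_cont]]) (auto intro!: continuous_intros)
    have "continuous_on (?U \<times> cbox 0 1) (\<lambda>z. phi' (un N (fst z) (snd z)) * (\<Sum>k<N. (- kap k * a (fst z) k + force u k (fst z)) * cs k (snd z)))"
      by (intro continuous_intros c f continuous_on_subset[OF un_cont]) auto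
    then show "continuous_on (?U \<times> cbox 0 1) (\<lambda>(t, x). ?fx t x)" by (simp add: split_beta)
  qed (use t in auto)
  have conv: "integral (cbox 0 1) h = (LINT x|I01. h x)" if "continuous_on {0..1} h" for h :: "real \<Rightarrow> real"
    using lebesgue_integral_eq_integral[OF integrable_continuous_Icc[OF that]] by simp
  have "integral (cbox 0 1) (\<lambda>x. phi (un N s x)) = Phi N s" for s
    unfolding Phi_def by (rule conv) (intro continuous_intros un_cont_x)
  moreover have "integral (cbox 0 1) (?fx t) = Dn N t"
  proof -
    have "integral (cbox 0 1) (?fx t) = ip (\<lambda>x. phi' (un N t x)) (\<lambda>x. \<Sum>k<N. (- kap k * a t k + force u k t) * cs k x)"
      unfolding ip_def by (rule conv) (intro continuous_intros un_cont_x)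
    also have "\<dots> = Dn N t" unfolding Dn_def
      by (subst ip_sum_right) (auto intro!: L2_continuous continuous_intros un_cont_x)
    finally show ?thesis .
  qed
  ultimately have "(Phi N has_real_derivative Dn N t) (at t within ?U)" using L by simp
  then show ?thesis using t by (simp add: at_within_open[OF _ open_greaterThanLessThan])
qed

lemma phi'_coeff_cont: "continuous_on {0..T} (\<lambda>s. ip (\<lambda>x. phi' (un N s x)) (cs k))"
proof (rule ip_continuous_param)
  show "continuous_on ({0..T} \<times> {0..1}) (\<lambda>(s, x). phi' (un N s x))"
    unfolding split_beta by (intro continuous_intros un_cont)
qed (intro continuous_intros)

lemma Dn_integrable:
  assumes "t \<le> T"
  shows "integrable (lebesgue_on {0..t}) (Dn N)"
proof -
  have "integrable (lebesgue_on {0..t}) (\<lambda>s. \<Sum>k<N. (- kap k * a s k * ip (\<lambda>x. phi' (un N s x)) (cs k)) + ip (\<lambda>x. phi' (un N s x)) (cs k) * force u k s)"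
    by (intro Bochner_Integration.integrable_sum Bochner_Integration.integrable_add continuous_times_force_integrable
        continuous_Icc_integrable[OF _ assms] assms continuous_intros a_cont phi'_coeff_cont)
  then show ?thesis unfolding Dn_def[abs_def] by (simp add: algebra_simps)
qed

lemma Phi_cont: "continuous_on {0..T} (Phi N)"
proof -
  have "continuous_on {0..T} (\<lambda>s. ip (\<lambda>x. phi (un N s x)) (\<lambda>_. 1))"
  proof (rule ip_continuous_param)
    show "continuous_on ({0..T} \<times> {0..1}) (\<lambda>(s, x). phi (un N s x))"
      unfolding split_beta by (intro continuous_intros un_cont)
  qed (intro continuous_intros)
  then show ?thesis by (simp add: Phi_def[abs_def] ip_def)
qed

text \<open>As \<open>\<gamma>\<close> takes values in \<open>[0,1]\<close>, the initial penalty is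
  at most the squared distance between \<open>\<gamma>\<close> and its partial cosine sum.\<close>

lemma Phi_0_tendsto: "(\<lambda>N. Phi N 0) \<longlonglongrightarrow> 0"
proof (rule Lim_null_comparison)
  have "(\<lambda>N. (nrm (\<lambda>x. (\<Sum>k<N. gc k * cs k x) - \<gamma> x))\<^sup>2) \<longlonglongrightarrow> 0\<^sup>2"
    unfolding gc_def by (intro tendsto_intros cosb.fourier_converges L2_\<gamma>)
  then show "(\<lambda>N. (nrm (\<lambda>x. (\<Sum>k<N. gc k * cs k x) - \<gamma> x))\<^sup>2) \<longlonglongrightarrow> 0" by simp
  have "norm (Phi N 0) \<le> (nrm (\<lambda>x. (\<Sum>k<N. gc k * cs k x) - \<gamma> x))\<^sup>2" for N
  proof -
    have L: "L2 (\<lambda>x. un N 0 x - \<gamma> x)" by (intro L2_diff L2_\<gamma> L2_continuous un_cont_x)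
    have "Phi N 0 \<le> (LINT x|I01. (un N 0 x - \<gamma> x)\<^sup>2)"
      unfolding Phi_def
    proof (rule integral_mono)
      show "integrable I01 (\<lambda>x. phi (un N 0 x))" by (intro integrable_continuous_Icc continuous_intros un_cont_x)
      show "integrable I01 (\<lambda>x. (un N 0 x - \<gamma> x)\<^sup>2)" using L by (simp add: L2_iff)
      show "phi (un N 0 x) \<le> (un N 0 x - \<gamma> x)\<^sup>2" if "x \<in> space I01" for x
        using that by (intro phi_facts(3) \<gamma>_01) simp
    qed
    also have "\<dots> = (nrm (\<lambda>x. (\<Sum>k<N. gc k * cs k x) - \<gamma> x))\<^sup>2"
      unfolding nrm_sq_integral by (simp add: un_def a_0)
    finally have "Phi N 0 \<le> (nrm (\<lambda>x. (\<Sum>k<N. gc k * cs k x) - \<gamma> x))\<^sup>2" .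
    moreover have "Phi N 0 \<ge> 0" unfolding Phi_def using phi_facts(1) by (intro integral_nonneg_AE AE_I2) simp
    ultimately show ?thesis by simp
  qed
  then show "\<forall>\<^sub>F N in sequentially. norm (Phi N 0) \<le> (nrm (\<lambda>x. (\<Sum>k<N. gc k * cs k x) - \<gamma> x))\<^sup>2" by simp
qed

lemma Phi_tendsto:
  assumes t: "t \<in> {0<..T}"
  shows "(\<lambda>N. Phi N t) \<longlonglongrightarrow> (LINT x|I01. phi (u t x))"
  unfolding Phi_def
proof (rule integral_dominated_convergence)
  define B where "B = sqrt 2 * (\<Sum>k. \<bar>a t k\<bar>)"
  show "integrable I01 (\<lambda>x. B\<^sup>2)" by simp
  show "(\<lambda>x. phi (u t x)) \<in> borel_measurable I01" "\<And>N. (\<lambda>x. phi (un N t x)) \<in> borel_measurable I01"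
    by (intro continuous_on_measurable_01 continuous_intros un_cont_x u_facts(1)[OF t])+
  have c: "continuous_on UNIV phi" by (intro continuous_intros)
  have "(\<lambda>N. phi (un N t x)) \<longlonglongrightarrow> phi (u t x)" for x
  proof -
    have "(\<lambda>N. un N t x) \<longlonglongrightarrow> u t x"
      using cser_sums[OF a_summable[OF t], of x] unfolding un_def u_cser[OF t] sums_def .
    moreover have "isCont phi (u t x)" using c by (simp add: continuous_on_eq_continuous_at)
    ultimately show ?thesis by (rule isCont_tendsto_compose[rotated])
  qed
  then show "AE x in I01. (\<lambda>N. phi (un N t x)) \<longlonglongrightarrow> phi (u t x)" by simp
  have "norm (phi (un N t x)) \<le> B\<^sup>2" for N x
  proof -
    have "\<bar>un N t x\<bar> \<le> (\<Sum>k<N. sqrt 2 * \<bar>a t k\<bar>)"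
      unfolding un_def by (rule order_trans[OF sum_abs], rule sum_mono, rule cser_term_bound)
    also have "\<dots> \<le> B" unfolding B_def sum_distrib_left[symmetric]
      by (intro mult_left_mono sum_le_suminf a_summable[OF t]) auto
    finally have "\<bar>un N t x\<bar> \<le> B" .
    then have "(un N t x)\<^sup>2 \<le> B\<^sup>2" using power_mono[of "\<bar>un N t x\<bar>" B 2] by simp
    then show ?thesis using phi_facts(1)[of "un N t x"] phi_facts(3)[of 0 "un N t x"] by simp
  qed
  then show "AE x in I01. norm (phi (un N t x)) \<le> B\<^sup>2" for N by simp
qed

text \<open>In contrast to \<open>tau\<close>, no rate uniform in time is at hand for
  \<open>om\<close>; convergence of the sine series at each time and the dominating function
  \<open>8 * C * E s\<close> suffice.\<close>

lemma om_integral_tendsto: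
  assumes t: "t \<in> {0<..T}"
  shows "(\<lambda>N. LINT s|lebesgue_on {0..t}. 4 * E s * om N s) \<longlonglongrightarrow> 0"
    and "integrable (lebesgue_on {0..t}) (\<lambda>s. 4 * E s * om N s)"
proof -
  have tT: "t \<le> T" and sub: "{0..t} \<subseteq> {0..T}" using t by auto
  have [measurable]: "E \<in> borel_measurable (lebesgue_on {0..t})" "om N \<in> borel_measurable (lebesgue_on {0..t})" for N
    using measurable_lebesgue_on_subset[OF borel_measurable_integrable[OF E_integrable] tT] om_measurable[OF tT] by auto
  have iE: "integrable (lebesgue_on {0..t}) E"
  proof -
    have "set_integrable lebesgue {0..T} E" using E_integrable by (simp add: set_integrable_Icc)
    then have "set_integrable lebesgue {0..t} E" by (rule set_integrable_subset) (use sub in auto)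
    then show ?thesis by (simp add: set_integrable_Icc)
  qed
  have good: "AE s in lebesgue_on {0..t}. E s \<ge> 0 \<and> s \<in> {0<..T}"
    using AE_lebesgue_on_subset[OF energy_H1 sub] by eventually_elim (metis nrm_nonneg)
  have bnd: "AE s in lebesgue_on {0..t}. norm (4 * E s * om N s) \<le> 8 * C * E s" for N
    using good
  proof eventually_elim
    case (elim s)
    then have "om N s \<le> 2 * nrm (Wf u s)" unfolding om_def by (intro sn_fourier_bound force_facts(6)[OF u_cont]) simp
    also have "\<dots> \<le> 2 * C" using force_facts(7)[OF u_cont, of s] by simp
    finally have "om N s \<le> 2 * C" .
    moreover have "0 \<le> om N s" by (simp add: om_def)
    ultimately show ?case using elim mult_left_mono[of "om N s" "2 * C" "4 * E s"] by (simp add: abs_mult mult_ac)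
  qed
  have i8: "integrable (lebesgue_on {0..t}) (\<lambda>s. 8 * C * E s)" using iE by simp
  show "integrable (lebesgue_on {0..t}) (\<lambda>s. 4 * E s * om N s)"
  proof (rule Bochner_Integration.integrable_bound[OF i8])
    show "AE s in lebesgue_on {0..t}. norm (4 * E s * om N s) \<le> norm (8 * C * E s)"
      using bnd[of N] by eventually_elim simp
  qed measurable
  have "(\<lambda>N. LINT s|lebesgue_on {0..t}. 4 * E s * om N s) \<longlonglongrightarrow> (LINT s|lebesgue_on {0..t}. 0)"
  proof (rule integral_dominated_convergence[OF _ _ i8])
    show "AE s in lebesgue_on {0..t}. (\<lambda>N. 4 * E s * om N s) \<longlonglongrightarrow> 0"
      using good
    proof eventually_elim
      case (elim s)
      have "(\<lambda>N. om N s) \<longlonglongrightarrow> 0" unfolding om_def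
        by (rule sn_fourier_converges) (use force_facts(6)[OF u_cont] elim in simp)
      then show ?case by (rule tendsto_mult_right_zero)
    qed
  qed (use bnd in auto)
  then show "(\<lambda>N. LINT s|lebesgue_on {0..t}. 4 * E s * om N s) \<longlonglongrightarrow> 0" by simp
qed

text \<open>The bound for \<open>Dn\<close> is integrated in time and \<open>N\<close> tends to
  infinity. The limit penalty is then an integral of a nonnegative continuous function that is at
  most \<open>0\<close>.\<close>

theorem u_01:
  assumes t: "t \<in> {0<..T}" and x: "x \<in> {0..1}"
  shows "u t x \<in> {0..1}"
proof -
  have tT: "t \<le> T" and sub: "{0..t} \<subseteq> {0..T}" using t by auto
  have restrict: "integrable (lebesgue_on {0..t}) f" if "integrable (lebesgue_on {0..T}) f" for f :: "real \<Rightarrow> real"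
  proof -
    have "set_integrable lebesgue {0..T} f" using that by (simp add: set_integrable_Icc)
    then have "set_integrable lebesgue {0..t} f" by (rule set_integrable_subset) (use sub in auto)
    then show ?thesis by (simp add: set_integrable_Icc)
  qed
  define R where "R s = 12 * sqrt 2 * C * G s + 24 * sqrt 2 * C * E s" for s
  have iR: "integrable (lebesgue_on {0..t}) R"
    unfolding R_def by (intro Bochner_Integration.integrable_add integrable_mult_right restrict energy(2) E_integrable)
  define K where "K = (LINT s|lebesgue_on {0..t}. R s)"
  have le: "Phi N t \<le> Phi N 0 + (tau N * K + (LINT s|lebesgue_on {0..t}. 4 * E s * om N s))" if N: "N > 0" for N
  proof -
    have "(LINT s|lebesgue_on {0..t}. Dn N s) = Phi N t - Phi N 0"
      by (rule FTC_Icc[OF _ continuous_on_subset[OF Phi_cont sub] Phi_DERIV Dn_integrable[OF tT]]) (use t in auto)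
    then have "Phi N t - Phi N 0 = (LINT s|lebesgue_on {0..t}. Dn N s)" by simp
    also have "\<dots> \<le> (LINT s|lebesgue_on {0..t}. tau N * R s + 4 * E s * om N s)"
    proof (rule integral_mono_AE[OF Dn_integrable[OF tT]])
      show "integrable (lebesgue_on {0..t}) (\<lambda>s. tau N * R s + 4 * E s * om N s)"
        by (intro Bochner_Integration.integrable_add integrable_mult_right iR om_integral_tendsto(2)[OF t])
      show "AE s in lebesgue_on {0..t}. Dn N s \<le> tau N * R s + 4 * E s * om N s"
        using AE_lebesgue_on_subset[OF energy_H1 sub]
      proof eventually_elim
        case (elim s)
        then have "Dn N s \<le> tau N * (12 * sqrt 2 * C * (E s)\<^sup>2 + 24 * sqrt 2 * C * E s) + 4 * E s * om N s"
          using Dn_le[of s "weak_grad (u s)" N] N by simp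
        then show ?case using elim by (simp add: R_def)
      qed
    qed
    also have "\<dots> = tau N * K + (LINT s|lebesgue_on {0..t}. 4 * E s * om N s)"
      unfolding K_def using iR om_integral_tendsto(2)[OF t]
      by (subst Bochner_Integration.integral_add) auto
    finally show ?thesis by simp
  qed
  have "(LINT x|I01. phi (u t x)) \<le> 0"
  proof (rule LIMSEQ_le)
    show "(\<lambda>N. Phi N t) \<longlonglongrightarrow> (LINT x|I01. phi (u t x))" by (rule Phi_tendsto[OF t])
    have "(\<lambda>N. Phi N 0 + (tau N * K + (LINT s|lebesgue_on {0..t}. 4 * E s * om N s))) \<longlonglongrightarrow> 0 + (0 * K + 0)"
      by (intro tendsto_intros Phi_0_tendsto tau_tendsto om_integral_tendsto(1)[OF t])
    then show "(\<lambda>N. Phi N 0 + (tau N * K + (LINT s|lebesgue_on {0..t}. 4 * E s * om N s))) \<longlonglongrightarrow> 0" by simp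
    show "\<exists>M. \<forall>N\<ge>M. Phi N t \<le> Phi N 0 + (tau N * K + (LINT s|lebesgue_on {0..t}. 4 * E s * om N s))"
      using le by (intro exI[of _ 1]) auto
  qed
  moreover have c: "continuous_on {0..1} (\<lambda>x. phi (u t x))" by (intro continuous_intros u_facts(1)[OF t])
  moreover have "(LINT x|I01. phi (u t x)) \<ge> 0" using phi_facts(1) by (intro integral_nonneg_AE AE_I2) simp
  ultimately have "AE x in I01. phi (u t x) = 0"
    using integral_nonneg_eq_0_iff_AE[of I01 "\<lambda>x. phi (u t x)"] integrable_continuous_Icc[OF c] phi_facts(1) by simp
  from continuous_AE_eq[OF c continuous_on_const _ this x] have "phi (u t x) = 0" by simp
  then show ?thesis by (rule phi_facts(2))
qed

end

section \<open>Mild solutions are weak solutions\<close>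

text \<open>\<open>dt\<close> and \<open>dx\<close> are defined by \<open>deriv\<close> and are
  known to be derivatives only in the open cylinder; this names the continuous extensions, with
  which all integrals are computed.\<close>

definition test_data :: "real \<Rightarrow> (real \<Rightarrow> real \<Rightarrow> real) \<Rightarrow> (real \<Rightarrow> real \<Rightarrow> real) \<Rightarrow> (real \<Rightarrow> real \<Rightarrow> real) \<Rightarrow> bool" where
  "test_data T G Gt Gx \<longleftrightarrow>
     continuous_on (Omega T) (\<lambda>(t, x). G t x) \<and> continuous_on (Omega T) (\<lambda>(t, x). Gt t x)
     \<and> continuous_on (Omega T) (\<lambda>(t, x). Gx t x)
     \<and> (\<forall>t\<in>{0<..<T}. \<forall>x\<in>{0<..<1}. ((\<lambda>s. G s x) has_real_derivative Gt t x) (at t))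
     \<and> (\<forall>t\<in>{0<..<T}. \<forall>x\<in>{0<..<1}. ((\<lambda>y. G t y) has_real_derivative Gx t x) (at x))"

lemma C_mn_test_data:
  assumes "C_mn T 1 2 G"
  obtains Gt Gx where "test_data T G Gt Gx"
proof -
  obtain Dt Dx where *: "Dt 0 = G" "Dx 0 = G"
    "\<forall>i\<le>1. continuous_on (Omega T) (\<lambda>(t, x). Dt i t x)"
    "\<forall>j\<le>2. continuous_on (Omega T) (\<lambda>(t, x). Dx j t x)"
    "\<forall>i<1. \<forall>t\<in>{0<..<T}. \<forall>x\<in>{0<..<1}. ((\<lambda>s. Dt i s x) has_real_derivative Dt (Suc i) t x) (at t)"
    "\<forall>j<2. \<forall>t\<in>{0<..<T}. \<forall>x\<in>{0<..<1}. ((\<lambda>y. Dx j t y) has_real_derivative Dx (Suc j) t x) (at x)"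
    using assms unfolding C_mn_def by (elim exE conjE) (rule that; assumption)
  have "test_data T G (Dt 1) (Dx 1)"
    unfolding test_data_def
    using *(3)[rule_format, of 0] *(3)[rule_format, of 1] *(4)[rule_format, of 1] *(5)[rule_format, of 0] *(6)[rule_format, of 0] *(1,2)
    by simp
  then show ?thesis by (rule that)
qed

lemma test_data_deriv:
  assumes "test_data T G Gt Gx" "t \<in> {0<..<T}" "x \<in> {0<..<1}"
  shows "dt G t x = Gt t x" "dx G t x = Gx t x"
  using assms by (auto simp: test_data_def dt_def dx_def intro!: DERIV_imp_deriv)

lemma continuous_Omega_slice:
  assumes "continuous_on (Omega T) (\<lambda>(t, x). f t x)" "t \<in> {0..T}"
  shows "continuous_on {0..1} (f t)"
proof -
  have "continuous_on {0..1} (\<lambda>x. (\<lambda>(t, x). f t x) (t, x))"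
    by (rule continuous_on_compose2[OF assms(1)]) (use assms(2) in \<open>auto simp: Omega_def intro!: continuous_intros\<close>)
  then show ?thesis by simp
qed

lemma continuous_Omega_slice':
  assumes "continuous_on (Omega T) (\<lambda>(t, x). f t x)" "x \<in> {0..1}"
  shows "continuous_on {0..T} (\<lambda>t. f t x)"
proof -
  have "continuous_on {0..T} (\<lambda>t. (\<lambda>(t, x). f t x) (t, x))"
    by (rule continuous_on_compose2[OF assms(1)]) (use assms(2) in \<open>auto simp: Omega_def intro!: continuous_intros\<close>)
  then show ?thesis by simp
qed

lemma compact_Omega: "compact (Omega T)"
  unfolding Omega_def by (intro compact_Times compact_Icc)

lemma continuous_Omega_bounded:
  assumes "continuous_on (Omega T) (\<lambda>(t, x). f t x)"
  obtains B :: real where "B \<ge> 0" "\<And>t x. t \<in> {0..T} \<Longrightarrow> x \<in> {0..1} \<Longrightarrow> \<bar>f t x\<bar> \<le> B"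
proof -
  have "bounded ((\<lambda>(t, x). f t x) ` Omega T)"
    by (intro compact_imp_bounded compact_continuous_image assms compact_Omega)
  then obtain B where B: "B > 0" "\<forall>y\<in>(\<lambda>(t, x). f t x) ` Omega T. norm y \<le> B" unfolding bounded_pos by blast
  show ?thesis
  proof (rule that[of B])
    show "\<bar>f t x\<bar> \<le> B" if "t \<in> {0..T}" "x \<in> {0..1}" for t x
      using B(2)[rule_format, of "f t x"] that by (force simp: Omega_def)
  qed (use B in simp)
qed

lemma test_coeff_cont:
  assumes "continuous_on (Omega T) (\<lambda>(t, x). f t x)"
  shows "continuous_on {0..T} (\<lambda>s. ip (f s) (cs k))"
  by (rule ip_continuous_param) (use assms in \<open>auto simp: Omega_def intro!: continuous_intros\<close>)

text \<open>The time derivative is given only at interior points. So \<open>G s x - G 0 x\<close> is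
  written as a time integral of \<open>Gt\<close> for almost every \<open>x\<close>, the integrals
  are exchanged, and the resulting indefinite integral is differentiated.\<close>

lemma test_coeff_DERIV:
  assumes td: "test_data T G Gt Gx" and t: "t \<in> {0<..<T}"
  shows "((\<lambda>s. ip (G s) (cs k)) has_real_derivative ip (Gt t) (cs k)) (at t)"
proof -
  have c: "continuous_on (Omega T) (\<lambda>(t, x). G t x)" "continuous_on (Omega T) (\<lambda>(t, x). Gt t x)"
    using td by (auto simp: test_data_def)
  let ?h = "\<lambda>r. ip (Gt r) (cs k)"
  have hc: "continuous_on {0..T} ?h" by (rule test_coeff_cont[OF c(2)])
  have eq: "ip (G s) (cs k) = ip (G 0) (cs k) + integral {0..s} ?h" if s: "s \<in> {0..T}" for s
  proof -
    have sub: "{0..s} \<times> {0..1} \<subseteq> Omega T" using s by (auto simp: Omega_def)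
    have f: "continuous_on (cbox (0, 0) (s, 1)) (\<lambda>(r, x). Gt r x * cs k x)"
    proof -
      have "continuous_on ({0..s} \<times> {0..1}) (\<lambda>z. (\<lambda>(t, x). Gt t x) z * cs k (snd z))"
        by (intro continuous_intros continuous_on_subset[OF c(2) sub])
      then show ?thesis by (simp add: cbox_Pair_eq split_beta)
    qed
    have I: "continuous_on {0..1} (\<lambda>x. integral (cbox 0 s) (\<lambda>r. Gt r x))"
    proof (rule integral_continuous_on_param)
      have "continuous_on ({0..1} \<times> cbox 0 s) (\<lambda>z. (\<lambda>(t, x). Gt t x) (snd z, fst z))"
        by (rule continuous_on_compose2[OF c(2)]) (use s in \<open>auto intro!: continuous_intros simp: Omega_def\<close>)
      then show "continuous_on ({0..1} \<times> cbox 0 s) (\<lambda>(x, r). Gt r x)" by (simp add: split_beta)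
    qed
    have L: "L2 (G s)" "L2 (G 0)" using s by (auto intro!: L2_continuous continuous_Omega_slice[OF c(1)])
    have "ip (G s) (cs k) - ip (G 0) (cs k) = ip (\<lambda>x. G s x - G 0 x) (cs k)"
      using L by (simp add: ip_diff_left)
    also have "\<dots> = ip (\<lambda>x. integral (cbox 0 s) (\<lambda>r. Gt r x)) (cs k)"
    proof (rule ip_cong_AE)
      show "(\<lambda>x. G s x - G 0 x) \<in> borel_measurable I01" using L2_diff[OF L] by (rule L2_measurable)
      show "(\<lambda>x. integral (cbox 0 s) (\<lambda>r. Gt r x)) \<in> borel_measurable I01" by (rule continuous_on_measurable_01[OF I])
      show "cs k \<in> borel_measurable I01" by (rule L2_measurable) simp
      show "AE x in I01. G s x - G 0 x = integral (cbox 0 s) (\<lambda>r. Gt r x)"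
        using AE_I01_interior
      proof eventually_elim
        case (elim x)
        have "((\<lambda>r. Gt r x) has_integral (G s x - G 0 x)) {0..s}"
        proof (rule fundamental_theorem_of_calculus_interior)
          show "continuous_on {0..s} (\<lambda>r. G r x)"
            by (rule continuous_on_subset[OF continuous_Omega_slice'[OF c(1)]]) (use elim s in auto)
          fix r assume "r \<in> {0<..<s}"
          then have "((\<lambda>r. G r x) has_real_derivative Gt r x) (at r)"
            using td elim s by (auto simp: test_data_def)
          then show "((\<lambda>r. G r x) has_vector_derivative Gt r x) (at r)"
            by (simp add: has_real_derivative_iff_has_vector_derivative)
        qed (use s in simp)
        then show ?case by (simp add: integral_unique)
      qed
    qed
    also have "\<dots> = integral (cbox 0 1) (\<lambda>x. integral (cbox 0 s) (\<lambda>r. Gt r x * cs k x))"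
    proof -
      have "continuous_on {0..1} (\<lambda>x. integral (cbox 0 s) (\<lambda>r. Gt r x) * cs k x)" by (intro continuous_intros I)
      then show ?thesis unfolding ip_def
        using lebesgue_integral_eq_integral[OF integrable_continuous_Icc] by simp
    qed
    also have "\<dots> = integral (cbox 0 s) (\<lambda>r. integral (cbox 0 1) (\<lambda>x. Gt r x * cs k x))"
      by (rule integral_swap_continuous[symmetric, OF f])
    also have "\<dots> = integral {0..s} ?h"
    proof -
      have "integral (cbox 0 1) (\<lambda>x. Gt r x * cs k x) = ?h r" if "r \<in> {0..s}" for r
      proof -
        have "continuous_on {0..1} (\<lambda>x. Gt r x * cs k x)"
          by (intro continuous_intros continuous_Omega_slice[OF c(2)]) (use that s in auto)
        then show ?thesis unfolding ip_def
          using lebesgue_integral_eq_integral[OF integrable_continuous_Icc] by simp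
      qed
      then have "integral {0..s} (\<lambda>r. integral (cbox 0 1) (\<lambda>x. Gt r x * cs k x)) = integral {0..s} ?h"
        by (rule integral_cong)
      then show ?thesis by simp
    qed
    finally show ?thesis by simp
  qed
  have "((\<lambda>s. integral {0..s} ?h) has_vector_derivative ?h t) (at t within {0..T})"
    by (rule integral_has_vector_derivative[OF hc]) (use t in auto)
  then have "((\<lambda>s. integral {0..s} ?h) has_real_derivative ?h t) (at t)"
    using t by (simp add: has_real_derivative_iff_has_vector_derivative at_within_Icc_at)
  then have "((\<lambda>s. ip (G 0) (cs k) + integral {0..s} ?h) has_real_derivative ?h t) (at t)"
    by (auto intro!: derivative_eq_intros)
  then show ?thesis
  proof (rule has_field_derivative_transform_within_open[of _ _ _ "{0<..<T}"])
    show "ip (G 0) (cs k) + integral {0..s} ?h = ip (G s) (cs k)" if "s \<in> {0<..<T}" for s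
      using eq[of s] that by simp
  qed (use t in auto)
qed

lemma sn_partial_ip_bound:
  assumes "L2 f" "L2 g"
  shows "\<bar>\<Sum>k<N. ip f (sn k) * ip g (sn k)\<bar> \<le> nrm f * nrm g"
proof -
  have "\<bar>\<Sum>k<N. ip f (sn k) * ip g (sn k)\<bar> \<le> (\<Sum>k<N. \<bar>ip f (sn k)\<bar> * \<bar>ip g (sn k)\<bar>)"
    using sum_abs[of "\<lambda>k. ip f (sn k) * ip g (sn k)" "{..<N}"] by (simp add: abs_mult)
  also have "\<dots> \<le> L2_set (\<lambda>k. ip f (sn k)) {..<N} * L2_set (\<lambda>k. ip g (sn k)) {..<N}" by (rule L2_set_mult_ineq)
  also have "\<dots> \<le> nrm f * nrm g"
    unfolding L2_set_def nrm_def by (intro mult_mono real_sqrt_le_mono sn_bessel assms) (auto intro!: sum_nonneg)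
  finally show ?thesis .
qed

lemma cs_partial_ip_bound:
  assumes "L2 f" "L2 g"
  shows "\<bar>\<Sum>k<N. ip f (cs k) * ip g (cs k)\<bar> \<le> nrm f * nrm g"
proof -
  have "\<bar>\<Sum>k<N. ip f (cs k) * ip g (cs k)\<bar> \<le> (\<Sum>k<N. \<bar>ip f (cs k)\<bar> * \<bar>ip g (cs k)\<bar>)"
    using sum_abs[of "\<lambda>k. ip f (cs k) * ip g (cs k)" "{..<N}"] by (simp add: abs_mult)
  also have "\<dots> \<le> L2_set (\<lambda>k. ip f (cs k)) {..<N} * L2_set (\<lambda>k. ip g (cs k)) {..<N}" by (rule L2_set_mult_ineq)
  also have "\<dots> \<le> nrm f * nrm g"
    unfolding L2_set_def nrm_def by (intro mult_mono real_sqrt_le_mono cosb.bessel assms) (auto intro!: sum_nonneg)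
  finally show ?thesis .
qed

lemma AE_limit_measurable:
  fixes h :: "nat \<Rightarrow> real \<Rightarrow> real"
  assumes "\<And>N. h N \<in> borel_measurable (lebesgue_on {a..b})" "AE s in lebesgue_on {a..b}. (\<lambda>N. h N s) \<longlonglongrightarrow> g s"
  shows "g \<in> borel_measurable (lebesgue_on {a..b})"
proof (rule measurable_01_AE)
  show "(\<lambda>s. lim (\<lambda>N. h N s)) \<in> borel_measurable (lebesgue_on {a..b})"
    using assms(1) by measurable
  show "AE s in lebesgue_on {a..b}. lim (\<lambda>N. h N s) = g s"
    using assms(2) by eventually_elim (rule limI)
qed

lemma dominated_limit:
  fixes h :: "nat \<Rightarrow> real \<Rightarrow> real"
  assumes m: "\<And>N. h N \<in> borel_measurable (lebesgue_on {a..b})" and l: "AE s in lebesgue_on {a..b}. (\<lambda>N. h N s) \<longlonglongrightarrow> g s"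
    and b: "\<And>N. AE s in lebesgue_on {a..b}. \<bar>h N s\<bar> \<le> w s" and w: "integrable (lebesgue_on {a..b}) w"
  shows "integrable (lebesgue_on {a..b}) (h N)" "integrable (lebesgue_on {a..b}) g"
    "(\<lambda>N. LINT s|lebesgue_on {a..b}. h N s) \<longlonglongrightarrow> (LINT s|lebesgue_on {a..b}. g s)"
proof -
  have g: "g \<in> borel_measurable (lebesgue_on {a..b})" by (rule AE_limit_measurable[OF m l])
  have b': "\<And>N. AE s in lebesgue_on {a..b}. norm (h N s) \<le> w s" using b by simp
  show "integrable (lebesgue_on {a..b}) (h N)"
    by (rule integrable_dominated_convergence2[OF g m w l b'])
  show "integrable (lebesgue_on {a..b}) g"
    by (rule integrable_dominated_convergence[OF g m w l b'])
  show "(\<lambda>N. LINT s|lebesgue_on {a..b}. h N s) \<longlonglongrightarrow> (LINT s|lebesgue_on {a..b}. g s)"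
    by (rule integral_dominated_convergence[OF g m w l b'])
qed

context mild
begin

lemma nrm_u_le:
  assumes t: "t \<in> {0<..T}"
  shows "nrm (u t) \<le> 1"
proof (rule nrm_le_bound[OF L2_measurable[OF u_facts(2)[OF t]]])
  show "AE x in I01. \<bar>u t x\<bar> \<le> 1"
  proof (rule AE_I2)
    fix x assume "x \<in> space I01"
    then show "\<bar>u t x\<bar> \<le> 1" using u_01[OF t, of x] by auto
  qed
qed simp

text \<open>The product rule for the coefficient of the solution times that of the test function is
  integrated in time and summed over the modes below \<open>N\<close>. Each of the four resulting
  sums converges by Parseval or, at the end points, by absolute convergence, with integrable bounds
  independent of \<open>N\<close>.\<close>

theorem mild_weak_formulation:
  assumes td: "test_data T Q Qt Qx" and t: "t \<in> {0<..T}"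
  shows "ip (u t) (Q t) - ip \<gamma> (Q 0) - (LINT s|lebesgue_on {0..t}. ip (u s) (Qt s))
      = (LINT s|lebesgue_on {0..t}. - ip (weak_grad (u s)) (Qx s) + ip (Wf u s) (Qx s))
        + (LINT s|lebesgue_on {0..t}. b0 s (u s 0) * Q s 0 + b1 s (u s 1) * Q s 1)"
proof -
  have tT: "t \<le> T" and sub: "{0..t} \<subseteq> {0..T}" using t by auto
  have c: "continuous_on (Omega T) (\<lambda>(t, x). Q t x)" "continuous_on (Omega T) (\<lambda>(t, x). Qt t x)"
    "continuous_on (Omega T) (\<lambda>(t, x). Qx t x)" using td by (auto simp: test_data_def)
  obtain Bg where Bg: "Bg \<ge> 0" "\<And>t x. t \<in> {0..T} \<Longrightarrow> x \<in> {0..1} \<Longrightarrow> \<bar>Q t x\<bar> \<le> Bg" using continuous_Omega_bounded[OF c(1)] by metis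
  obtain Bt where Bt: "Bt \<ge> 0" "\<And>t x. t \<in> {0..T} \<Longrightarrow> x \<in> {0..1} \<Longrightarrow> \<bar>Qt t x\<bar> \<le> Bt" using continuous_Omega_bounded[OF c(2)] by metis
  obtain Bx where Bx: "Bx \<ge> 0" "\<And>t x. t \<in> {0..T} \<Longrightarrow> x \<in> {0..1} \<Longrightarrow> \<bar>Qx t x\<bar> \<le> Bx" using continuous_Omega_bounded[OF c(3)] by metis
  define g gt where "g k s = ip (Q s) (cs k)" and "gt k s = ip (Qt s) (cs k)" for k s
  have gc_cont: "continuous_on {0..T} (g k)" "continuous_on {0..T} (gt k)" for k
    unfolding g_def gt_def by (intro test_coeff_cont c)+
  have LG: "L2 (Q s)" "L2 (Qt s)" "L2 (Qx s)" if "s \<in> {0..T}" for s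
    using that by (auto intro!: L2_continuous continuous_Omega_slice[OF c(1)] continuous_Omega_slice[OF c(2)] continuous_Omega_slice[OF c(3)])
  have nGt: "nrm (Qt s) \<le> Bt" and nGx: "nrm (Qx s) \<le> Bx" and nG: "nrm (Q s) \<le> Bg" if "s \<in> {0..T}" for s
    by (rule nrm_le_bound[OF L2_measurable[OF LG(2)[OF that]] AE_I2 Bt(1)] nrm_le_bound[OF L2_measurable[OF LG(3)[OF that]] AE_I2 Bx(1)]
      nrm_le_bound[OF L2_measurable[OF LG(1)[OF that]] AE_I2 Bg(1)], use Bt(2)[OF that] Bx(2)[OF that] Bg(2)[OF that] in simp)+
  have gcoef: "grad_coeff (\<lambda>k. g k s) (Qx s)" if "s \<in> {0<..<T}" for s
    unfolding g_def
    by (rule grad_coeff_C1) (use that td continuous_Omega_slice[OF c(1), of s] continuous_Omega_slice[OF c(3), of s] in \<open>auto simp: test_data_def\<close>)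
  define A where "A N s = (\<Sum>k<N. a s k * gt k s)" for N s
  define B where "B N s = (\<Sum>k<N. - kap k * a s k * g k s)" for N s
  define D where "D N s = (\<Sum>k<N. - (real k * pi) * ip (Wf u s) (sn k) * g k s)" for N s
  define Z where "Z N s = b0 s (u s 0) * (\<Sum>k<N. g k s * cs k 0) + b1 s (u s 1) * (\<Sum>k<N. g k s * cs k 1)" for N s
  have good: "AE s in lebesgue_on {0..t}. s \<in> {0<..<T} \<and> s \<in> {0<..T} \<and> s \<in> {0..T} \<and> H1 (u s) \<and> nrm (weak_grad (u s)) = E s
     \<and> grad_coeff (a s) (weak_grad (u s)) \<and> grad_coeff (\<lambda>k. g k s) (Qx s)"
    using AE_lebesgue_on_subset[OF energy_H1 sub] AE_lebesgue_on_ne[where a = 0 and b = t and c = T]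
  proof eventually_elim
    case (elim s)
    then have "s \<in> {0<..<T}" by auto
    then show ?case using elim gcoef by auto
  qed
  have co: "continuous_on {0<..t} (g k)" "continuous_on {0<..t} (gt k)" "continuous_on {0<..t} (\<lambda>s. a s k)"
     "continuous_on {0<..t} (\<lambda>s. ip (Wf u s) (sn k))" "continuous_on {0<..t} (\<lambda>s. b0 s (u s 0))" "continuous_on {0<..t} (\<lambda>s. b1 s (u s 1))" for k
    by (rule continuous_on_subset[OF gc_cont(1)] continuous_on_subset[OF gc_cont(2)] continuous_on_subset[OF a_cont]
      continuous_on_subset[OF force_facts(2)[OF u_cont]] continuous_on_subset[OF force_facts(3)[OF u_cont]] continuous_on_subset[OF force_facts(4)[OF u_cont]];
      use tT in auto)+
  have m: "A N \<in> borel_measurable (lebesgue_on {0..t})" "B N \<in> borel_measurable (lebesgue_on {0..t})"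
    "D N \<in> borel_measurable (lebesgue_on {0..t})" "Z N \<in> borel_measurable (lebesgue_on {0..t})" for N
    unfolding A_def B_def D_def Z_def
    by (rule measurable_continuous_Ioc[OF _ order_refl], intro continuous_intros co)+
  have iE: "integrable (lebesgue_on {0..t}) E"
  proof -
    have "set_integrable lebesgue {0..T} E" using E_integrable by (simp add: set_integrable_Icc)
    then have "set_integrable lebesgue {0..t} E" by (rule set_integrable_subset) (use sub in auto)
    then show ?thesis by (simp add: set_integrable_Icc)
  qed
  have ic: "integrable (lebesgue_on {0..t}) (\<lambda>_. K)" for K :: real
    by (rule integrable_continuous_Icc) (intro continuous_intros)
  note nu = nrm_u_le
  have hA: "AE s in lebesgue_on {0..t}. (\<lambda>N. A N s) \<longlonglongrightarrow> ip (u s) (Qt s)"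
    using good
  proof eventually_elim
    case (elim s)
    then have s: "s \<in> {0<..T}" "s \<in> {0..T}" by auto
    show ?case using cosb.parseval[OF u_facts(2)[OF s(1)] LG(2)[OF s(2)]]
      unfolding A_def gt_def sums_def u_facts(3)[OF s(1)] .
  qed
  have hA': "AE s in lebesgue_on {0..t}. \<bar>A N s\<bar> \<le> 1 * Bt" for N
    using good
  proof eventually_elim
    case (elim s)
    then have s: "s \<in> {0<..T}" "s \<in> {0..T}" by auto
    have "\<bar>A N s\<bar> \<le> nrm (u s) * nrm (Qt s)"
      using cs_partial_ip_bound[OF u_facts(2)[OF s(1)] LG(2)[OF s(2)], of N] unfolding A_def gt_def u_facts(3)[OF s(1)] .
    also have "\<dots> \<le> 1 * Bt" using nu[OF s(1)] nGt[OF s(2)] by (intro mult_mono) auto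
    finally show ?case .
  qed
  note limA = dominated_limit[where h = A, OF m(1) hA hA' ic]
  \<comment> \<open>The factor \<open>kap k\<close> is shared out: \<open>real k * pi\<close> goes
    to the solution and to the test function, which yields two sine coefficients of
    gradients.\<close>
  have eqB: "AE s in lebesgue_on {0..t}. \<forall>N. B N s = - (\<Sum>k<N. ip (weak_grad (u s)) (sn k) * ip (Qx s) (sn k))"
    using good
  proof eventually_elim
    case (elim s)
    then have "\<And>k. ip (weak_grad (u s)) (sn k) = - (real k * pi) * a s k" "\<And>k. ip (Qx s) (sn k) = - (real k * pi) * g k s"
      by (auto simp: grad_coeff_def)
    then show ?case by (auto simp: B_def kap_def power2_eq_square sum_negf[symmetric] mult_ac intro!: sum.cong)
  qed
  have hB: "AE s in lebesgue_on {0..t}. (\<lambda>N. B N s) \<longlonglongrightarrow> - ip (weak_grad (u s)) (Qx s)"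
    using good eqB
  proof eventually_elim
    case (elim s)
    have "(\<lambda>N. - (\<Sum>k<N. ip (weak_grad (u s)) (sn k) * ip (Qx s) (sn k))) \<longlonglongrightarrow> - ip (weak_grad (u s)) (Qx s)"
      using sn_parseval[of "weak_grad (u s)" "Qx s"] elim(1) unfolding sums_def grad_coeff_def by (intro tendsto_minus) auto
    then show ?case using elim(2) by simp
  qed
  have hB': "AE s in lebesgue_on {0..t}. \<bar>B N s\<bar> \<le> E s * Bx" for N
    using good eqB
  proof eventually_elim
    case (elim s)
    have "\<bar>B N s\<bar> \<le> nrm (weak_grad (u s)) * nrm (Qx s)"
      using sn_partial_ip_bound[of "weak_grad (u s)" "Qx s" N] elim by (auto simp: grad_coeff_def)
    also have "\<dots> \<le> nrm (weak_grad (u s)) * Bx"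
      using nGx[of s] elim nrm_nonneg[of "weak_grad (u s)"] by (intro mult_left_mono) auto
    finally show ?case using elim by simp
  qed
  note limB = dominated_limit[where h = B, OF m(2) hB hB' integrable_mult_left[OF iE]]
  have eqD: "AE s in lebesgue_on {0..t}. \<forall>N. D N s = (\<Sum>k<N. ip (Wf u s) (sn k) * ip (Qx s) (sn k))"
    using good
  proof eventually_elim
    case (elim s)
    then have "\<And>k. ip (Qx s) (sn k) = - (real k * pi) * g k s" by (auto simp: grad_coeff_def)
    then show ?case by (auto simp: D_def mult_ac intro!: sum.cong)
  qed
  have hD: "AE s in lebesgue_on {0..t}. (\<lambda>N. D N s) \<longlonglongrightarrow> ip (Wf u s) (Qx s)"
    using good eqD
  proof eventually_elim
    case (elim s)
    then have s: "s \<in> {0<..T}" "s \<in> {0..T}" by auto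
    show ?case using sn_parseval[OF force_facts(6)[OF u_cont s(1)] LG(3)[OF s(2)]] elim(2) unfolding sums_def by simp
  qed
  have hD': "AE s in lebesgue_on {0..t}. \<bar>D N s\<bar> \<le> C * Bx" for N
    using good eqD
  proof eventually_elim
    case (elim s)
    then have s: "s \<in> {0<..T}" "s \<in> {0..T}" by auto
    have "\<bar>D N s\<bar> \<le> nrm (Wf u s) * nrm (Qx s)"
      using sn_partial_ip_bound[OF force_facts(6)[OF u_cont s(1)] LG(3)[OF s(2)], of N] elim by simp
    also have "\<dots> \<le> C * Bx" using nGx[OF s(2)] force_facts(7)[OF u_cont, of s] C by (intro mult_mono) auto
    finally show ?case .
  qed
  note limD = dominated_limit[where h = D, OF m(3) hD hD' ic]
  \<comment> \<open>A bound for the absolute sums of the coefficients of \<open>Q s\<close>, uniform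
    in \<open>s\<close> and in the number of modes, which dominates the boundary series.\<close>
  define K where "K = Bg + Bx * sqrt (\<Sum>k. 1 / kap k)"
  have Kb: "(\<Sum>k<N. \<bar>g k s\<bar>) \<le> K" if "s \<in> {0..T}" "grad_coeff (\<lambda>k. g k s) (Qx s)" for N s
  proof -
    have "\<bar>g 0 s\<bar> \<le> nrm (Q s) * nrm (cs 0)" unfolding g_def by (rule ip_abs_le) (use LG[OF that(1)] in auto)
    also have "\<dots> \<le> Bg" using nG[OF that(1)] by (simp add: nrm_def[of "cs 0"] ip_cs)
    finally have "\<bar>g 0 s\<bar> \<le> Bg" .
    moreover have "nrm (Qx s) * sqrt (\<Sum>k. 1 / kap k) \<le> Bx * sqrt (\<Sum>k. 1 / kap k)"
      using nGx[OF that(1)] suminf_nonneg[OF summable_inverse_kap] by (intro mult_right_mono) auto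
    ultimately show ?thesis using grad_coeff_summable(2)[OF that(2), of N] by (simp add: K_def)
  qed
  have gser: "(\<lambda>N. \<Sum>k<N. g k s * cs k x) \<longlonglongrightarrow> Q s x" if "s \<in> {0..T}" "grad_coeff (\<lambda>k. g k s) (Qx s)" "x \<in> {0..1}" for s x
  proof -
    have sm: "summable (\<lambda>k. \<bar>g k s\<bar>)" by (rule grad_coeff_summable(1)[OF that(2)])
    have "cser (\<lambda>k. g k s) x = Q s x"
      using cser_eq[OF continuous_Omega_slice[OF c(1) that(1)], of x] sm that(3) unfolding g_def by simp
    then show ?thesis using cser_sums[OF sm, of x] unfolding sums_def by simp
  qed
  have gsb: "\<bar>b * (\<Sum>k<N. g k s * cs k x)\<bar> \<le> C * (sqrt 2 * K)" if "s \<in> {0..T}" "grad_coeff (\<lambda>k. g k s) (Qx s)" "\<bar>b\<bar> \<le> C" for s x b N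
  proof -
    have "\<bar>\<Sum>k<N. g k s * cs k x\<bar> \<le> (\<Sum>k<N. sqrt 2 * \<bar>g k s\<bar>)"
      by (rule order_trans[OF sum_abs], rule sum_mono, rule cser_term_bound)
    also have "\<dots> \<le> sqrt 2 * K" unfolding sum_distrib_left[symmetric] using Kb[OF that(1,2)] by (intro mult_left_mono) auto
    finally show ?thesis unfolding abs_mult using that(3) C by (intro mult_mono) auto
  qed
  have hZ: "AE s in lebesgue_on {0..t}. (\<lambda>N. Z N s) \<longlonglongrightarrow> b0 s (u s 0) * Q s 0 + b1 s (u s 1) * Q s 1"
    using good unfolding Z_def by eventually_elim (intro tendsto_intros gser, auto)
  have hZ': "AE s in lebesgue_on {0..t}. \<bar>Z N s\<bar> \<le> C * (sqrt 2 * K) + C * (sqrt 2 * K)" for N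
    using good unfolding Z_def by eventually_elim (intro abs_add_le gsb b0_bdd b1_bdd, auto)
  note limZ = dominated_limit[where h = Z, OF m(4) hZ hZ' ic]
  have N_eq: "(\<Sum>k<N. a t k * g k t) - (\<Sum>k<N. gc k * g k 0)
      = (LINT s|lebesgue_on {0..t}. A N s) + ((LINT s|lebesgue_on {0..t}. B N s) + ((LINT s|lebesgue_on {0..t}. D N s) + (LINT s|lebesgue_on {0..t}. Z N s)))" for N
  proof -
    let ?h = "\<lambda>k s. a s k * gt k s + (- kap k * a s k + force u k s) * g k s"
    have hi: "integrable (lebesgue_on {0..t}) (?h k)" for k
    proof -
      have "integrable (lebesgue_on {0..t}) (\<lambda>s. a s k * gt k s + - kap k * a s k * g k s + g k s * force u k s)"
        by (intro Bochner_Integration.integrable_add continuous_times_force_integrable continuous_Icc_integrable gc_cont a_cont tT continuous_intros)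
      then show ?thesis by (simp add: algebra_simps)
    qed
    have mode: "a t k * g k t - gc k * g k 0 = (LINT s|lebesgue_on {0..t}. ?h k s)" for k
    proof -
      have "(LINT s|lebesgue_on {0..t}. ?h k s) = a t k * g k t - a 0 k * g k 0"
      proof (rule FTC_Icc[OF _ _ _ hi])
        show "continuous_on {0..t} (\<lambda>s. a s k * g k s)"
          by (intro continuous_intros continuous_on_subset[OF a_cont sub] continuous_on_subset[OF gc_cont(1) sub])
        fix s assume "s \<in> {0<..<t}"
        then have s: "s \<in> {0<..<T}" using tT by auto
        have "(g k has_real_derivative gt k s) (at s)"
          unfolding g_def[abs_def] gt_def by (rule test_coeff_DERIV[OF td s])
        from DERIV_mult'[OF a_DERIV[OF s, of k] this]
        show "((\<lambda>s. a s k * g k s) has_real_derivative ?h k s) (at s)" by (simp add: mult.commute)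
      qed (use t in simp)
      then show ?thesis by (simp add: a_0)
    qed
    have "(\<Sum>k<N. a t k * g k t) - (\<Sum>k<N. gc k * g k 0) = (\<Sum>k<N. LINT s|lebesgue_on {0..t}. ?h k s)"
      unfolding sum_subtractf[symmetric] mode ..
    also have "\<dots> = (LINT s|lebesgue_on {0..t}. (\<Sum>k<N. ?h k s))"
      by (rule Bochner_Integration.integral_sum[symmetric, OF hi])
    also have "\<dots> = (LINT s|lebesgue_on {0..t}. A N s + (B N s + (D N s + Z N s)))"
    proof (rule Bochner_Integration.integral_cong[OF refl])
      fix s
      show "(\<Sum>k<N. ?h k s) = A N s + (B N s + (D N s + Z N s))"
        unfolding A_def B_def D_def Z_def force_def forcing_def sum_distrib_left sum.distrib[symmetric]
        by (rule sum.cong) (auto simp: algebra_simps)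
    qed
    also have "\<dots> = (LINT s|lebesgue_on {0..t}. A N s) + ((LINT s|lebesgue_on {0..t}. B N s) + ((LINT s|lebesgue_on {0..t}. D N s) + (LINT s|lebesgue_on {0..t}. Z N s)))"
      by (simp add: Bochner_Integration.integral_add limA(1) limB(1) limD(1) limZ(1) Bochner_Integration.integrable_add)
    finally show ?thesis .
  qed
  have "(\<lambda>N. (\<Sum>k<N. a t k * g k t) - (\<Sum>k<N. gc k * g k 0)) \<longlonglongrightarrow> ip (u t) (Q t) - ip \<gamma> (Q 0)"
  proof (rule tendsto_diff)
    show "(\<lambda>N. \<Sum>k<N. a t k * g k t) \<longlonglongrightarrow> ip (u t) (Q t)"
      using cosb.parseval[OF u_facts(2)[OF t] LG(1)[of t]] t unfolding sums_def u_facts(3)[OF t] g_def by auto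
    show "(\<lambda>N. \<Sum>k<N. gc k * g k 0) \<longlonglongrightarrow> ip \<gamma> (Q 0)"
      using cosb.parseval[OF L2_\<gamma> LG(1)[of 0]] T unfolding sums_def gc_def g_def by auto
  qed
  moreover have "(\<lambda>N. (\<Sum>k<N. a t k * g k t) - (\<Sum>k<N. gc k * g k 0)) \<longlonglongrightarrow>
      (LINT s|lebesgue_on {0..t}. ip (u s) (Qt s)) + ((LINT s|lebesgue_on {0..t}. - ip (weak_grad (u s)) (Qx s))
       + ((LINT s|lebesgue_on {0..t}. ip (Wf u s) (Qx s)) + (LINT s|lebesgue_on {0..t}. b0 s (u s 0) * Q s 0 + b1 s (u s 1) * Q s 1)))"
    unfolding N_eq by (intro tendsto_add limA(3) limB(3) limD(3) limZ(3))
  ultimately have "ip (u t) (Q t) - ip \<gamma> (Q 0) =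
      (LINT s|lebesgue_on {0..t}. ip (u s) (Qt s)) + ((LINT s|lebesgue_on {0..t}. - ip (weak_grad (u s)) (Qx s))
       + ((LINT s|lebesgue_on {0..t}. ip (Wf u s) (Qx s)) + (LINT s|lebesgue_on {0..t}. b0 s (u s 0) * Q s 0 + b1 s (u s 1) * Q s 1)))"
    by (rule LIMSEQ_unique)
  moreover have "(LINT s|lebesgue_on {0..t}. - ip (weak_grad (u s)) (Qx s) + ip (Wf u s) (Qx s))
      = (LINT s|lebesgue_on {0..t}. - ip (weak_grad (u s)) (Qx s)) + (LINT s|lebesgue_on {0..t}. ip (Wf u s) (Qx s))"
    by (rule Bochner_Integration.integral_add[OF limB(2) limD(2)])
  ultimately show ?thesis by linarith
qed

text \<open>The mild solution is constrained only at positive times, whereas the weak formulation at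
  \<open>t = 0\<close> asks for the initial datum.\<close>

definition rho :: "real \<Rightarrow> real \<Rightarrow> real" where
  "rho t = (if t = 0 then \<gamma> else u t)"

lemma rho_pos: "t \<in> {0<..T} \<Longrightarrow> rho t = u t"
  by (auto simp: rho_def)

lemma rho_01: "t \<in> {0..T} \<Longrightarrow> x \<in> {0..1} \<Longrightarrow> rho t x \<in> {0..1}"
  using u_01[of t x] \<gamma>_01[of x] by (cases "t = 0") (auto simp: rho_def)

text \<open>The line of initial times is a null set in the plane, and off it the solution is
  continuous.\<close>

lemma rho_measurable: "(\<lambda>(t, x). rho t x) \<in> borel_measurable (lebesgue_on (Omega T))"
proof -
  have O: "Omega T \<in> sets lebesgue" using compact_Omega by (intro lmeasurable_compact fmeasurableD)
  have S: "{0<..T} \<times> {0..1::real} \<in> sets borel"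
  proof -
    have "{0<..T} \<times> {0..1::real} \<in> sets (borel \<Otimes>\<^sub>M borel)" by (intro pair_measureI) auto
    then show ?thesis unfolding borel_prod .
  qed
  have "(\<lambda>z. indicator ({0<..T} \<times> {0..1}) z *\<^sub>R (\<lambda>(t, x). u t x) z) \<in> borel_measurable borel"
    by (rule borel_measurable_continuous_on_indicator[OF S u_cont])
  then have "(\<lambda>z. indicator ({0<..T} \<times> {0..1}) z *\<^sub>R (\<lambda>(t, x). u t x) z) \<in> borel_measurable lebesgue"
    by (simp add: measurable_completion)
  moreover have "AE z in lebesgue. indicator ({0<..T} \<times> {0..1}) z *\<^sub>R (\<lambda>(t, x). u t x) z = indicator (Omega T) z *\<^sub>R (\<lambda>(t, x). rho t x) z"
  proof -
    have "negligible {z :: real \<times> real. (1, 0) \<bullet> z = 0}" by (rule negligible_hyperplane) (simp add: zero_prod_def)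
    then have "AE z in lebesgue. z \<notin> {z :: real \<times> real. (1, 0) \<bullet> z = 0}"
      by (intro AE_not_in) (simp add: negligible_iff_null_sets)
    then show ?thesis
    proof eventually_elim
      case (elim z)
      then have "fst z \<noteq> 0" by (cases z) simp
      then show ?case by (cases z) (auto simp: indicator_def Omega_def rho_def)
    qed
  qed
  ultimately have "(\<lambda>z. indicator (Omega T) z *\<^sub>R (\<lambda>(t, x). rho t x) z) \<in> borel_measurable lebesgue"
    by (rule borel_measurable_AE)
  then show ?thesis using O by (subst borel_measurable_restrict_space_iff) auto
qed

lemma rho_AE: "AE t in lebesgue_on {0..T}. t \<in> {0<..T} \<and> rho t = u t \<and> H1 (rho t)"
  using energy_H1 by eventually_elim (auto simp: rho_pos)

text \<open>By Parseval the distance is an almost everywhere limit of continuous functions of the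
  coefficients.\<close>

lemma rho_H1_norm_measurable:
  assumes f: "H1 f"
  shows "(\<lambda>t. H1_norm (\<lambda>x. rho t x - f x)) \<in> borel_measurable (lebesgue_on {0..T})"
proof (rule AE_limit_measurable)
  show "(\<lambda>t. sqrt (\<Sum>k<N. (1 + kap k) * (a t k - ip f (cs k))\<^sup>2)) \<in> borel_measurable (lebesgue_on {0..T})" for N
    by (intro continuous_imp_measurable_on_sets_lebesgue continuous_intros a_cont) simp
  show "AE t in lebesgue_on {0..T}. (\<lambda>N. sqrt (\<Sum>k<N. (1 + kap k) * (a t k - ip f (cs k))\<^sup>2)) \<longlonglongrightarrow> H1_norm (\<lambda>x. rho t x - f x)"
    using rho_AE
  proof eventually_elim
    case (elim t)
    then have t: "t \<in> {0<..T}" by simp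
    have H: "H1 (\<lambda>x. rho t x - f x)" using elim f by (intro H1_diff f) blast
    have "ip (\<lambda>x. rho t x - f x) (cs k) = a t k - ip f (cs k)" for k
      using elim H1_D(1)[OF f] u_facts[OF t] by (simp add: ip_diff_left)
    then have "(\<lambda>N. \<Sum>k<N. (1 + kap k) * (a t k - ip f (cs k))\<^sup>2) \<longlonglongrightarrow> (H1_norm (\<lambda>x. rho t x - f x))\<^sup>2"
      using H1_norm_sq[OF H] unfolding sums_def by simp
    then have "(\<lambda>N. sqrt (\<Sum>k<N. (1 + kap k) * (a t k - ip f (cs k))\<^sup>2)) \<longlonglongrightarrow> sqrt ((H1_norm (\<lambda>x. rho t x - f x))\<^sup>2)"
      by (rule tendsto_real_sqrt)
    moreover have "H1_norm (\<lambda>x. rho t x - f x) \<ge> 0"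
      unfolding H1_norm_def LINT_01 by (intro real_sqrt_ge_zero add_nonneg_nonneg integral_nonneg_AE) auto
    ultimately show ?case by simp
  qed
qed

lemma H1_zero: "H1 (\<lambda>_. 0)"
proof -
  have "L2 (\<lambda>_. 0)" "ip (\<lambda>_. 0) g = 0" for g by (simp_all add: L2_iff ip_def)
  then show ?thesis by (intro H1_I) simp_all
qed

theorem rho_L2_H1: "L2_H1 T rho"
  unfolding L2_H1_def
proof (intro conjI allI impI rho_measurable rho_H1_norm_measurable)
  show "AE t in lebesgue_on {0..T}. H1 (rho t)" using rho_AE by eventually_elim blast
  have "integrable (lebesgue_on {0..T}) (\<lambda>t. (H1_norm (rho t))\<^sup>2)"
  proof (rule Bochner_Integration.integrable_bound)
    show "integrable (lebesgue_on {0..T}) (\<lambda>t. 1 + G t)"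
      by (intro Bochner_Integration.integrable_add energy(2) continuous_Icc_integrable continuous_intros) simp
    have "(\<lambda>t. H1_norm (rho t)) \<in> borel_measurable (lebesgue_on {0..T})"
      using rho_H1_norm_measurable[OF H1_zero] by simp
    then show "(\<lambda>t. (H1_norm (rho t))\<^sup>2) \<in> borel_measurable (lebesgue_on {0..T})"
      by (rule borel_measurable_power)
    show "AE t in lebesgue_on {0..T}. norm ((H1_norm (rho t))\<^sup>2) \<le> norm (1 + G t)"
      using rho_AE energy_H1
    proof eventually_elim
      case (elim t)
      then have t: "t \<in> {0<..T}" by simp
      have "nrm (u t) \<le> 1" by (rule nrm_u_le[OF t])
      then have "(nrm (u t))\<^sup>2 \<le> 1" by (simp add: power_le_one)
      moreover have "(H1_norm (rho t))\<^sup>2 = (nrm (rho t))\<^sup>2 + (nrm (weak_grad (rho t)))\<^sup>2"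
        unfolding H1_norm_def LINT_01 nrm_sq_integral[symmetric] by simp
      ultimately have le: "(H1_norm (rho t))\<^sup>2 \<le> 1 + G t" using elim by simp
      have n: "0 \<le> (H1_norm (rho t))\<^sup>2" by (rule zero_le_power2)
      show ?case unfolding real_norm_def abs_of_nonneg[OF n] by (rule order_trans[OF le abs_ge_self])
    qed
  qed
  then show "set_integrable lebesgue {0..T} (\<lambda>t. (H1_norm (rho t))\<^sup>2)" by (simp add: set_integrable_Icc)
qed

end

section \<open>Uniqueness\<close>

text \<open>A solution of the backward heat equation. It is smooth on the whole plane, so its
  derivatives are their own continuous extensions to the closed cylinder.\<close>

lemma C_mn_cos_test:
  fixes t :: real and k :: nat
  defines "G \<equiv> \<lambda>s x. exp (kap k * (s - t)) * cs k x"
  shows "C_mn T 1 2 G"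
    and "test_data T G (\<lambda>s x. kap k * G s x) (\<lambda>s x. exp (kap k * (s - t)) * (- (real k * pi) * sn k x))"
proof -
  define Gx where "Gx s x = exp (kap k * (s - t)) * (- (real k * pi) * sn k x)" for s x
  have c: "continuous_on A (\<lambda>(s, x). G s x)" "continuous_on A (\<lambda>(s, x). Gx s x)" for A
    unfolding G_def Gx_def split_beta by (intro continuous_intros)+
  have c': "continuous_on A (\<lambda>(s, x). K * G s x)" for A K
    using c(1)[of A] unfolding split_beta by (intro continuous_intros)
  have dt: "((\<lambda>s. G s x) has_real_derivative kap k * G s x) (at s)" for s x
    unfolding G_def by (auto intro!: derivative_eq_intros)
  have dx: "(G s has_real_derivative Gx s x) (at x)" for s x
    unfolding G_def[abs_def] Gx_def by (intro DERIV_cmult DERIV_cs)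
  have dxx: "(Gx s has_real_derivative - kap k * G s x) (at x)" for s x
  proof -
    have "((\<lambda>x. exp (kap k * (s - t)) * (- (real k * pi) * sn k x)) has_real_derivative
      exp (kap k * (s - t)) * (- (real k * pi) * (real k * pi * cs k x))) (at x)"
      by (intro DERIV_cmult DERIV_sn)
    then show ?thesis by (simp add: Gx_def[abs_def] G_def kap_def power2_eq_square mult_ac)
  qed
  show "test_data T G (\<lambda>s x. kap k * G s x) (\<lambda>s x. exp (kap k * (s - t)) * (- (real k * pi) * sn k x))"
    unfolding test_data_def Gx_def[symmetric] using c c' dt dx by blast
  show "C_mn T 1 2 G"
  proof -
    let ?Dt = "\<lambda>i :: nat. if i = 0 then G else (\<lambda>s x. kap k * G s x)"
    let ?Dx = "\<lambda>j :: nat. if j = 0 then G else if j = 1 then Gx else (\<lambda>s x. - kap k * G s x)"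
    have 0: "?Dt 0 = G" "?Dx 0 = G" by simp_all
    have 1: "continuous_on (Omega T) (\<lambda>(t, x). ?Dt i t x)" for i using c c' by (cases "i = 0") simp_all
    have 2: "continuous_on (Omega T) (\<lambda>(t, x). ?Dx j t x)" for j
      using c c'[of "Omega T" "- kap k"] by (cases "j = 0"; cases "j = 1") simp_all
    have 3: "((\<lambda>s. ?Dt i s x) has_real_derivative ?Dt (Suc i) t x) (at t)" if "i < 1" for i t x
      using that dt by simp
    have 4: "((\<lambda>y. ?Dx j t y) has_real_derivative ?Dx (Suc j) t x) (at x)" if "j < 2" for j t x
      using that dx[of t x] dxx[of t x] by (cases "j = 0") (auto simp: less_2_cases_iff)
    show "C_mn T 1 2 G"
      unfolding C_mn_def by (rule exI[of _ ?Dt], rule exI[of _ ?Dx]) (use 0 1 2 3 4 in blast)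
  qed
qed

context flux
begin

definition profile :: "(real \<Rightarrow> real \<Rightarrow> real) \<Rightarrow> bool" where
  "profile \<rho> \<longleftrightarrow>
     (\<lambda>(t, x). \<rho> t x) \<in> borel_measurable (lebesgue_on (Omega T)) \<and>
     (AE (t, x) in lebesgue_on (Omega T). 0 \<le> \<rho> t x \<and> \<rho> t x \<le> 1) \<and>
     (AE t in lebesgue_on {0..T}. H1 (\<rho> t))"

text \<open>The working form of the weak formulation: space and time integrals exchanged, and the
  extensions \<open>Gt\<close> and \<open>Gx\<close> in place of \<open>deriv\<close>.\<close>

definition weak_sol :: "(real \<Rightarrow> real \<Rightarrow> real) \<Rightarrow> bool" where
  "weak_sol \<rho> \<longleftrightarrow> profile \<rho> \<and>
     (\<forall>t\<in>{0..T}. \<forall>G Gt Gx. C_mn T 1 2 G \<longrightarrow> test_data T G Gt Gx \<longrightarrow>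
        ip (\<rho> t) (G t) - ip \<gamma> (G 0) - (LINT s|lebesgue_on {0..t}. ip (\<rho> s) (Gt s))
        = (LINT s|lebesgue_on {0..t}. - ip (weak_grad (\<rho> s)) (Gx s) + ip (Wf \<rho> s) (Gx s))
          + (LINT s|lebesgue_on {0..t}. b0 s (H1_value (\<rho> s) 0) * G s 0 + b1 s (H1_value (\<rho> s) 1) * G s 1))"

text \<open>The continuous representative of \<open>\<rho> s\<close> whenever
  \<open>\<rho> s\<close> is in \<open>H1\<close>; its end point values are the traces.\<close>

definition rep :: "(real \<Rightarrow> real \<Rightarrow> real) \<Rightarrow> real \<Rightarrow> real \<Rightarrow> real" where
  "rep \<rho> s = cser (\<lambda>k. ip (\<rho> s) (cs k))"

lemma measurable_fst_Omega: "fst \<in> borel_measurable (lebesgue_on (Omega T))"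
  and measurable_snd_Omega: "snd \<in> borel_measurable (lebesgue_on (Omega T))"
proof -
  have O: "Omega T \<in> sets lebesgue" using compact_Omega by (intro lmeasurable_compact fmeasurableD)
  show "fst \<in> borel_measurable (lebesgue_on (Omega T))" "snd \<in> borel_measurable (lebesgue_on (Omega T))"
    by (intro continuous_imp_measurable_on_sets_lebesgue O continuous_intros)+
qed

text \<open>Joint measurability gives measurable coefficients in time by Fubini; the
  \<open>H1\<close> property gives a continuous representative, whose values inherit the bounds at
  every point and not only almost everywhere.\<close>

lemma profile_facts:
  assumes "profile \<rho>"
  shows "AE s in lebesgue_on {0..T}. H1 (\<rho> s) \<and> (AE x in I01. \<rho> s x = rep \<rho> s x)
     \<and> (\<forall>x\<in>{0..1}. rep \<rho> s x \<in> {0..1} \<and> H1_value (\<rho> s) x = rep \<rho> s x)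
     \<and> Wf \<rho> s \<in> borel_measurable I01 \<and> L2 (Wf \<rho> s) \<and> nrm (Wf \<rho> s) \<le> C"
    and "(\<lambda>s. ip (Wf \<rho> s) (sn k)) \<in> borel_measurable (lebesgue_on {0..T})"
    and "(\<lambda>s. ip (\<rho> s) (cs k)) \<in> borel_measurable (lebesgue_on {0..T})"
proof -
  have m: "(\<lambda>(t, x). \<rho> t x) \<in> borel_measurable (lebesgue_on (Omega T))"
    and b: "AE (t, x) in lebesgue_on (Omega T). 0 \<le> \<rho> t x \<and> \<rho> t x \<le> 1"
    and H: "AE t in lebesgue_on {0..T}. H1 (\<rho> t)"
    using assms by (auto simp: profile_def)
  have r1: "AE (t, x) in lebesgue_on (Omega T). \<bar>\<rho> t x\<bar> \<le> 1" using b by (rule eventually_mono) auto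
  have "(\<lambda>(s, x, u). V s x u) \<in> borel_measurable borel" by (rule borel_measurable_continuous_onI[OF V_cont])
  moreover have "(\<lambda>z. (fst z, snd z, (\<lambda>(t, x). \<rho> t x) z)) \<in> borel_measurable (lebesgue_on (Omega T))"
    by (intro borel_measurable_Pair m measurable_fst_Omega measurable_snd_Omega)
  ultimately have "(\<lambda>z. (\<lambda>(s, x, u). V s x u) (fst z, snd z, (\<lambda>(t, x). \<rho> t x) z)) \<in> borel_measurable (lebesgue_on (Omega T))"
    by (rule measurable_compose[rotated])
  then have Vm: "(\<lambda>(s, x). Wf \<rho> s x) \<in> borel_measurable (lebesgue_on (Omega T))"
    by (simp add: split_beta Wf_def)
  have Vb: "AE (s, x) in lebesgue_on (Omega T). \<bar>Wf \<rho> s x\<bar> \<le> C"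
    by (rule AE_I2) (auto simp: Wf_def V_bdd)
  have snm: "(\<lambda>z. sn k (snd z)) \<in> borel_measurable (lebesgue_on (Omega T))" for k
    by (rule measurable_compose[OF measurable_snd_Omega borel_measurable_continuous_onI]) (intro continuous_intros)
  have csm: "(\<lambda>z. cs k (snd z)) \<in> borel_measurable (lebesgue_on (Omega T))" for k
    by (rule measurable_compose[OF measurable_snd_Omega borel_measurable_continuous_onI]) (intro continuous_intros)
  show "(\<lambda>s. ip (Wf \<rho> s) (sn k)) \<in> borel_measurable (lebesgue_on {0..T})"
    unfolding ip_def
  proof (rule fubini_Omega(2)[where C = "C * sqrt 2"])
    show "(\<lambda>(s, x). Wf \<rho> s x * sn k x) \<in> borel_measurable (lebesgue_on (Omega T))"
      using borel_measurable_times[OF Vm snm[of k]] by (simp add: split_beta)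
    show "AE (s, x) in lebesgue_on (Omega T). \<bar>Wf \<rho> s x * sn k x\<bar> \<le> C * sqrt 2"
      by (rule AE_I2) (auto simp: Wf_def abs_mult intro!: mult_mono V_bdd sn_bound C)
  qed (use C in simp)
  show "(\<lambda>s. ip (\<rho> s) (cs k)) \<in> borel_measurable (lebesgue_on {0..T})"
    unfolding ip_def
  proof (rule fubini_Omega(2)[where C = "1 * sqrt 2"])
    show "(\<lambda>(s, x). \<rho> s x * cs k x) \<in> borel_measurable (lebesgue_on (Omega T))"
      using borel_measurable_times[OF m csm[of k]] by (simp add: split_beta)
    show "AE (s, x) in lebesgue_on (Omega T). \<bar>\<rho> s x * cs k x\<bar> \<le> 1 * sqrt 2"
      using r1
    proof (rule eventually_mono, clarify)
      fix s x assume "\<bar>\<rho> s x\<bar> \<le> 1"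
      then show "\<bar>\<rho> s x * cs k x\<bar> \<le> 1 * sqrt 2" unfolding abs_mult by (intro mult_mono cs_bound) auto
    qed
  qed simp
  \<comment> \<open>Centering at \<open>1/2\<close> brings the two-sided bound into the symmetric
    form of \<open>fubini_Omega\<close>.\<close>
  have b': "AE s in lebesgue_on {0..T}. AE x in I01. \<bar>\<rho> s x - 1/2\<bar> \<le> 1/2"
  proof -
    have "(\<lambda>(t, x). \<rho> t x - 1/2) \<in> borel_measurable (lebesgue_on (Omega T))"
      using borel_measurable_diff[OF m borel_measurable_const[of "1/2"]] by (simp add: split_beta)
    moreover have "AE (t, x) in lebesgue_on (Omega T). \<bar>\<rho> t x - 1/2\<bar> \<le> 1/2"
      using b
    proof (rule eventually_mono, clarify)
      fix t x assume "0 \<le> \<rho> t x" "\<rho> t x \<le> 1"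
      then show "\<bar>\<rho> t x - 1/2\<bar> \<le> 1/2" unfolding abs_le_iff by linarith
    qed
    ultimately show ?thesis using fubini_Omega(1)[of "\<lambda>t x. \<rho> t x - 1/2" T "1/2"] by (auto elim!: eventually_mono)
  qed
  show "AE s in lebesgue_on {0..T}. H1 (\<rho> s) \<and> (AE x in I01. \<rho> s x = rep \<rho> s x)
     \<and> (\<forall>x\<in>{0..1}. rep \<rho> s x \<in> {0..1} \<and> H1_value (\<rho> s) x = rep \<rho> s x)
     \<and> Wf \<rho> s \<in> borel_measurable I01 \<and> L2 (Wf \<rho> s) \<and> nrm (Wf \<rho> s) \<le> C"
    using H b' fubini_Omega(1)[OF Vm Vb C]
  proof eventually_elim
    case (elim s)
    note h = H1_D[OF elim(1)]
    have r: "AE x in I01. \<rho> s x = rep \<rho> s x" using h(5) by (simp add: rep_def)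
    have rc: "continuous_on {0..1} (rep \<rho> s)" unfolding rep_def by (rule cser_continuous[OF h(4)])
    \<comment> \<open>The representative agrees almost everywhere with its own clamp; both are
      continuous, hence equal on the whole closed interval, end points included.\<close>
    have "AE x in I01. rep \<rho> s x = max 0 (min 1 (rep \<rho> s x))"
      using r elim(2)
    proof eventually_elim
      case (elim x)
      then have "0 \<le> \<rho> s x" "\<rho> s x \<le> 1" unfolding abs_le_iff by linarith+
      then show ?case using elim by simp
    qed
    moreover have "continuous_on {0..1} (\<lambda>x. max 0 (min 1 (rep \<rho> s x)))"
      by (intro continuous_on_max continuous_on_min continuous_on_const rc)
    ultimately have r01: "rep \<rho> s x = max 0 (min 1 (rep \<rho> s x))" if "x \<in> {0..1}" for x
      using continuous_AE_eq[OF rc _ zero_less_one, of "\<lambda>x. max 0 (min 1 (rep \<rho> s x))"] that by blast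
    have W: "Wf \<rho> s \<in> borel_measurable I01" "AE x in I01. \<bar>Wf \<rho> s x\<bar> \<le> C" using elim(3) by auto
    have "rep \<rho> s x \<in> {0..1} \<and> H1_value (\<rho> s) x = rep \<rho> s x" if "x \<in> {0..1}" for x
      using r01[OF that] H1_value_cser[OF elim(1) that] by (auto simp: rep_def max_def min_def split: if_splits)
    then show ?case using elim(1) r W L2_bounded[OF W] nrm_le_bound[OF W C] by blast
  qed
qed

definition wforce :: "(real \<Rightarrow> real \<Rightarrow> real) \<Rightarrow> nat \<Rightarrow> real \<Rightarrow> real" where
  "wforce \<rho> = forcing (Wf \<rho>) (\<lambda>s. b0 s (H1_value (\<rho> s) 0)) (\<lambda>s. b1 s (H1_value (\<rho> s) 1))"

text \<open>A trace is the sum of the cosine series at a point, thus a limit of measurable functions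
  of time.\<close>

lemma profile_trace_measurable:
  assumes "profile \<rho>"
  shows "x \<in> {0..1} \<Longrightarrow> (\<lambda>s. H1_value (\<rho> s) x) \<in> borel_measurable (lebesgue_on {0..T})"
    and "(\<lambda>s. b0 s (H1_value (\<rho> s) 0)) \<in> borel_measurable (lebesgue_on {0..T})"
    and "(\<lambda>s. b1 s (H1_value (\<rho> s) 1)) \<in> borel_measurable (lebesgue_on {0..T})"
proof -
  show tr: "(\<lambda>s. H1_value (\<rho> s) x) \<in> borel_measurable (lebesgue_on {0..T})" if x: "x \<in> {0..1}" for x
  proof (rule AE_limit_measurable)
    show "(\<lambda>s. \<Sum>k<N. ip (\<rho> s) (cs k) * cs k x) \<in> borel_measurable (lebesgue_on {0..T})" for N
      by (intro borel_measurable_sum borel_measurable_times borel_measurable_const profile_facts(3)[OF assms])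
    show "AE s in lebesgue_on {0..T}. (\<lambda>N. \<Sum>k<N. ip (\<rho> s) (cs k) * cs k x) \<longlonglongrightarrow> H1_value (\<rho> s) x"
      using profile_facts(1)[OF assms]
    proof eventually_elim
      case (elim s)
      then have "H1 (\<rho> s)" by blast
      from cser_sums[OF H1_D(4)[OF this], of x] H1_value_cser[OF this x] show ?case by (simp add: sums_def)
    qed
  qed
  have id: "(\<lambda>s. s) \<in> borel_measurable (lebesgue_on {0..T})" by (rule borel_imp_lebesgue_on) simp
  have "(\<lambda>s. (\<lambda>(s, u). b0 s u) (s, H1_value (\<rho> s) 0)) \<in> borel_measurable (lebesgue_on {0..T})"
    by (rule measurable_compose[OF borel_measurable_Pair[OF id tr] borel_measurable_continuous_onI[OF b0_cont]]) simp
  then show "(\<lambda>s. b0 s (H1_value (\<rho> s) 0)) \<in> borel_measurable (lebesgue_on {0..T})" by simp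
  have "(\<lambda>s. (\<lambda>(s, u). b1 s u) (s, H1_value (\<rho> s) 1)) \<in> borel_measurable (lebesgue_on {0..T})"
    by (rule measurable_compose[OF borel_measurable_Pair[OF id tr] borel_measurable_continuous_onI[OF b1_cont]]) simp
  then show "(\<lambda>s. b1 s (H1_value (\<rho> s) 1)) \<in> borel_measurable (lebesgue_on {0..T})" by simp
qed

text \<open>Testing with \<open>exp (- kap k * (t - s)) * cs k x\<close> cancels the diffusion against the time derivative.\<close>

lemma weak_sol_coeff:
  assumes ws: "weak_sol \<rho>" and t: "t \<in> {0..T}"
  shows "ip (\<rho> t) (cs k) = hc t k + duhamel (wforce \<rho> k) k t"
proof -
  have pr: "profile \<rho>" using ws by (simp add: weak_sol_def)
  define e where "e s = exp (kap k * (s - t))" for s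
  define G where "G s x = e s * cs k x" for s x
  define Gx where "Gx s x = e s * (- (real k * pi) * sn k x)" for s x
  define P where "P s = e s * (- (real k * pi) * ip (Wf \<rho> s) (sn k))" for s
  define Z where "Z s = b0 s (H1_value (\<rho> s) 0) * G s 0 + b1 s (H1_value (\<rho> s) 1) * G s 1" for s
  define Q where "Q s = kap k * (e s * ip (\<rho> s) (cs k))" for s
  have sub: "{0..t} \<subseteq> {0..T}" using t by auto
  note good = AE_lebesgue_on_subset[OF profile_facts(1)[OF pr] sub]
  have em: "e \<in> borel_measurable (lebesgue_on {0..t})"
    unfolding e_def[abs_def] by (rule borel_imp_lebesgue_on) measurable
  have e1: "\<bar>e s\<bar> \<le> 1" if "s \<le> t" for s
    using that mult_nonneg_nonpos[of "kap k" "s - t"] by (simp add: e_def)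
  have mt: "(\<lambda>s. ip (Wf \<rho> s) (sn k)) \<in> borel_measurable (lebesgue_on {0..t})"
    "(\<lambda>s. ip (\<rho> s) (cs k)) \<in> borel_measurable (lebesgue_on {0..t})"
    "(\<lambda>s. b0 s (H1_value (\<rho> s) 0)) \<in> borel_measurable (lebesgue_on {0..t})"
    "(\<lambda>s. b1 s (H1_value (\<rho> s) 1)) \<in> borel_measurable (lebesgue_on {0..t})"
    using t by (auto intro: measurable_lebesgue_on_subset[OF profile_facts(2)[OF pr]] measurable_lebesgue_on_subset[OF profile_facts(3)[OF pr]]
       measurable_lebesgue_on_subset[OF profile_trace_measurable(2)[OF pr]] measurable_lebesgue_on_subset[OF profile_trace_measurable(3)[OF pr]])
  have nc: "nrm (cs k) = 1" by (simp add: nrm_def ip_cs)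
  have ns: "nrm (sn k) \<le> 1" by (cases "k = 0") (simp_all add: nrm_def ip_sn)
  have iP: "integrable (lebesgue_on {0..t}) P"
  proof (rule integrable_bounded_Icc)
    show "P \<in> borel_measurable (lebesgue_on {0..t})"
      unfolding P_def[abs_def] by (intro borel_measurable_times em mt borel_measurable_const)
    show "AE s in lebesgue_on {0..t}. \<bar>P s\<bar> \<le> 1 * ((real k * pi) * (C * 1))"
      using good AE_lebesgue_on_in[of 0 t]
    proof eventually_elim
      case (elim s)
      have "\<bar>ip (Wf \<rho> s) (sn k)\<bar> \<le> nrm (Wf \<rho> s) * nrm (sn k)" using elim by (intro ip_abs_le) auto
      also have "\<dots> \<le> C * 1" using elim ns C by (intro mult_mono) auto
      finally have "\<bar>- (real k * pi) * ip (Wf \<rho> s) (sn k)\<bar> \<le> (real k * pi) * (C * 1)"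
        unfolding abs_mult by (intro mult_mono) auto
      then show ?case unfolding P_def abs_mult[of "e s"] using e1[of s] elim(2) by (intro mult_mono) auto
    qed
  qed
  have iQ: "integrable (lebesgue_on {0..t}) Q"
  proof (rule integrable_bounded_Icc)
    show "Q \<in> borel_measurable (lebesgue_on {0..t})"
      unfolding Q_def[abs_def] by (intro borel_measurable_times em mt borel_measurable_const)
    show "AE s in lebesgue_on {0..t}. \<bar>Q s\<bar> \<le> kap k * (1 * (1 * 1))"
      using good AE_lebesgue_on_in[of 0 t]
    proof eventually_elim
      case (elim s)
      then have L: "L2 (\<rho> s)" using H1_D(1) by blast
      have ae: "AE x in I01. \<bar>\<rho> s x\<bar> \<le> 1"
      proof -
        have "AE x in I01. \<rho> s x = rep \<rho> s x" using elim by blast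
        moreover have "AE x in I01. x \<in> {0..1}" by (rule AE_I2) simp
        ultimately show ?thesis
        proof eventually_elim
          case e: (elim x)
          then have "rep \<rho> s x \<in> {0..1}" using elim by blast
          then show ?case using e by auto
        qed
      qed
      have "\<bar>ip (\<rho> s) (cs k)\<bar> \<le> nrm (\<rho> s) * nrm (cs k)" by (rule ip_abs_le[OF L]) simp
      also have "\<dots> \<le> 1 * 1" unfolding nc using nrm_le_bound[OF L2_measurable[OF L] ae] by simp
      finally have "\<bar>e s * ip (\<rho> s) (cs k)\<bar> \<le> 1 * (1 * 1)"
        unfolding abs_mult using e1[of s] elim(2) by (intro mult_mono) auto
      then show ?case unfolding Q_def abs_mult[of "kap k"] by (intro mult_mono) auto
    qed
  qed
  have iZ: "integrable (lebesgue_on {0..t}) Z"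
  proof (rule integrable_bounded_Icc)
    show "Z \<in> borel_measurable (lebesgue_on {0..t})"
      unfolding Z_def[abs_def] G_def by (intro borel_measurable_add borel_measurable_times em mt borel_measurable_const)
    show "AE s in lebesgue_on {0..t}. \<bar>Z s\<bar> \<le> C * (1 * sqrt 2) + C * (1 * sqrt 2)"
      using AE_lebesgue_on_in[of 0 t]
    proof eventually_elim
      case (elim s)
      then have "\<bar>G s x\<bar> \<le> 1 * sqrt 2" for x
        unfolding G_def abs_mult using e1[of s] cs_bound[of k x] by (intro mult_mono) auto
      then have "\<bar>b * G s x\<bar> \<le> C * (1 * sqrt 2)" if "\<bar>b\<bar> \<le> C" for b x
        unfolding abs_mult using that C by (intro mult_mono) auto
      then show ?case unfolding Z_def by (intro abs_add_le) (auto simp: b0_bdd b1_bdd)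
    qed
  qed
  note test = C_mn_cos_test[of T k t, folded e_def, folded G_def, folded Gx_def]
  have id: "ip (\<rho> t) (G t) - ip \<gamma> (G 0) - (LINT s|lebesgue_on {0..t}. ip (\<rho> s) (\<lambda>x. kap k * G s x))
        = (LINT s|lebesgue_on {0..t}. - ip (weak_grad (\<rho> s)) (Gx s) + ip (Wf \<rho> s) (Gx s))
          + (LINT s|lebesgue_on {0..t}. Z s)"
    using ws[unfolded weak_sol_def] t test unfolding Z_def by blast
  have ipG: "ip f (G s) = e s * ip f (cs k)" for f s unfolding G_def[abs_def] by simp
  have ipGx: "ip f (Gx s) = e s * (- (real k * pi) * ip f (sn k))" for f s unfolding Gx_def[abs_def] by (simp only: ip_cmult_right)
  have et: "e t = 1" and e0: "e 0 = exp (- kap k * t)" by (simp_all add: e_def)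
  have "(LINT s|lebesgue_on {0..t}. - ip (weak_grad (\<rho> s)) (Gx s) + ip (Wf \<rho> s) (Gx s)) = (LINT s|lebesgue_on {0..t}. - Q s + P s)"
  proof -
    have ae: "AE s in lebesgue_on {0..t}. - Q s + P s = - ip (weak_grad (\<rho> s)) (Gx s) + ip (Wf \<rho> s) (Gx s)"
      using good
    proof eventually_elim
      case (elim s)
      then have "H1 (\<rho> s)" by blast
      from H1_D(3)[OF this, of k] show ?case
        unfolding ipGx P_def Q_def by (simp add: kap_def power2_eq_square mult_ac)
    qed
    have m: "(\<lambda>s. - Q s + P s) \<in> borel_measurable (lebesgue_on {0..t})"
      using iP iQ by (intro borel_measurable_add borel_measurable_uminus borel_measurable_integrable)
    show ?thesis by (rule integral_cong_AE[OF m measurable_01_AE[OF m ae] ae, symmetric])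
  qed
  also have "\<dots> = - (LINT s|lebesgue_on {0..t}. Q s) + (LINT s|lebesgue_on {0..t}. P s)"
    using iP iQ by simp
  \<comment> \<open>The integral of \<open>Q\<close> occurs on both sides, from the time derivative
    of the test function and from the gradient, and cancels.\<close>
  finally have id2: "ip (\<rho> t) (cs k) - exp (- kap k * t) * gc k = (LINT s|lebesgue_on {0..t}. P s) + (LINT s|lebesgue_on {0..t}. Z s)"
    using id unfolding ipG ip_cmult_right et e0 gc_def Q_def[symmetric] by simp
  have "(LINT s|lebesgue_on {0..t}. P s) + (LINT s|lebesgue_on {0..t}. Z s) = (LINT s|lebesgue_on {0..t}. P s + Z s)"
    by (rule Bochner_Integration.integral_add[OF iP iZ, symmetric])
  also have "\<dots> = duhamel (wforce \<rho> k) k t"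
    unfolding duhamel_def
  proof (rule Bochner_Integration.integral_cong[OF refl])
    fix s
    have "exp (- kap k * (t - s)) = e s" by (simp add: e_def algebra_simps)
    then show "P s + Z s = exp (- kap k * (t - s)) * wforce \<rho> k s"
      unfolding wforce_def forcing_def P_def Z_def G_def by (simp add: algebra_simps)
  qed
  finally show ?thesis using id2 by (simp add: hc_def)
qed

text \<open>The coefficient differences \<open>D\<close> satisfy a Duhamel formula whose fluxes are,
  by the Lipschitz bounds, controlled by the absolute sum of \<open>D\<close> itself; the Gronwall
  argument forces \<open>D\<close> to vanish, and equal coefficients mean equality almost
  everywhere.\<close>

theorem weak_sol_unique:
  assumes "weak_sol \<rho>" "weak_sol \<rho>'"
  shows "AE t in lebesgue_on {0..T}. AE x in I01. \<rho>' t x = \<rho> t x"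
proof -
  have pr: "profile \<rho>" "profile \<rho>'" using assms by (simp_all add: weak_sol_def)
  define D where "D k t = ip (\<rho> t) (cs k) - ip (\<rho>' t) (cs k)" for k t
  define W where "W s x = Wf \<rho> s x - Wf \<rho>' s x" for s x
  define p where "p s = b0 s (H1_value (\<rho> s) 0) - b0 s (H1_value (\<rho>' s) 0)" for s
  define q where "q s = b1 s (H1_value (\<rho> s) 1) - b1 s (H1_value (\<rho>' s) 1)" for s
  note g = profile_facts[OF pr(1)] and g' = profile_facts[OF pr(2)]
  note tr = profile_trace_measurable[OF pr(1)] and tr' = profile_trace_measurable[OF pr(2)]
  have bnd: "AE s in lebesgue_on {0..t}. L2 (Wf \<rho> s) \<and> nrm (Wf \<rho> s) \<le> C \<and> \<bar>b0 s (H1_value (\<rho> s) 0)\<bar> \<le> C \<and> \<bar>b1 s (H1_value (\<rho> s) 1)\<bar> \<le> C"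
    if "profile \<rho>" "t \<in> {0..T}" for \<rho> t
    using AE_lebesgue_on_subset[OF profile_facts(1)[OF that(1)], of 0 t] that(2)
    by (auto elim!: eventually_mono simp: b0_bdd b1_bdd)
  have D: "D k t = duhamel (forcing W p q k) k t" if t: "t \<in> {0..T}" for k t
  proof -
    have tT: "t \<le> T" "0 \<le> t" using t by auto
    note ms = measurable_lebesgue_on_subset[OF _ tT(1)]
    have "D k t = duhamel (wforce \<rho> k) k t - duhamel (wforce \<rho>' k) k t"
      unfolding D_def weak_sol_coeff[OF assms(1) t] weak_sol_coeff[OF assms(2) t] by simp
    also have "\<dots> = duhamel (forcing W p q k) k t"
      unfolding wforce_def W_def[abs_def] p_def[abs_def] q_def[abs_def]
    proof (rule duhamel_forcing_diff[OF duhamel_estimate(1)[OF finite.emptyI order_refl tT(2) ms[OF g(2)] ms[OF tr(2)] ms[OF tr(3)] bounded_imp_weighted[OF bnd[OF pr(1) t]]]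
            duhamel_estimate(1)[OF finite.emptyI order_refl tT(2) ms[OF g'(2)] ms[OF tr'(2)] ms[OF tr'(3)] bounded_imp_weighted[OF bnd[OF pr(2) t]]]])
      show "AE s in lebesgue_on {0..t}. L2 (Wf \<rho> s) \<and> L2 (Wf \<rho>' s)"
        using bnd[OF pr(1) t] bnd[OF pr(2) t] by eventually_elim blast
    qed
    finally show ?thesis .
  qed
  have ipW: "AE s in lebesgue_on {0..T}. ip (Wf \<rho> s) (sn k) - ip (Wf \<rho>' s) (sn k) = ip (W s) (sn k)" for k
    using g(1) g'(1) by eventually_elim (simp add: W_def[abs_def] ip_diff_left)
  have m: "(\<lambda>s. ip (W s) (sn k)) \<in> borel_measurable (lebesgue_on {0..T})" for k
    by (rule measurable_01_AE[OF borel_measurable_diff[OF g(2) g'(2)] ipW])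
  have mp: "p \<in> borel_measurable (lebesgue_on {0..T})" "q \<in> borel_measurable (lebesgue_on {0..T})"
    unfolding p_def[abs_def] q_def[abs_def] by (intro borel_measurable_diff tr tr')+
  define S where "S s = (\<Sum>k. \<bar>D k s\<bar>)" for s
  have fin: "AE s in lebesgue_on {0..T}. L2 (W s) \<and> nrm (W s) \<le> (C * sqrt 2) * S s \<and> \<bar>p s\<bar> \<le> (C * sqrt 2) * S s \<and> \<bar>q s\<bar> \<le> (C * sqrt 2) * S s"
    using g(1) g'(1)
  proof eventually_elim
    case (elim s)
    then have H: "H1 (\<rho> s)" "H1 (\<rho>' s)" by auto
    note h = H1_D(4)[OF H(1)] and h' = H1_D(4)[OF H(2)]
    have sD: "summable (\<lambda>k. \<bar>D k s\<bar>)"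
      by (rule summable_comparison_test'[OF summable_add[OF h h'], of 0]) (simp add: D_def abs_triangle_ineq4)
    \<comment> \<open>The difference of the representatives is the series of \<open>D\<close>, so
      the absolute sum of \<open>D\<close> bounds it at every point, in particular at the end points
      where the boundary currents are evaluated.\<close>
    have rd: "rep \<rho> s x - rep \<rho>' s x = cser (\<lambda>k. D k s) x" for x
      using sums_unique2[OF sums_diff[OF cser_sums[OF h] cser_sums[OF h']] cser_sums[OF sD, of x, unfolded D_def left_diff_distrib]]
      by (simp add: rep_def D_def)
    have rb: "C * \<bar>rep \<rho> s x - rep \<rho>' s x\<bar> \<le> (C * sqrt 2) * S s" for x
      using mult_left_mono[OF cser_bound[OF sD, of x] C] unfolding rd S_def by simp
    have L: "L2 (W s)" unfolding W_def[abs_def] by (rule L2_diff) (use elim in auto)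
    have S0: "0 \<le> S s" unfolding S_def by (rule suminf_nonneg[OF sD]) simp
    have "nrm (W s) \<le> (C * sqrt 2) * S s"
    proof (rule nrm_le_bound[OF L2_measurable[OF L]])
      have "AE x in I01. \<rho> s x = rep \<rho> s x" "AE x in I01. \<rho>' s x = rep \<rho>' s x" using elim by blast+
      then show "AE x in I01. \<bar>W s x\<bar> \<le> (C * sqrt 2) * S s"
      proof eventually_elim
        case (elim x)
        then have "\<bar>W s x\<bar> \<le> C * \<bar>rep \<rho> s x - rep \<rho>' s x\<bar>" unfolding W_def Wf_def using V_lip by simp
        then show ?case using rb[of x] by (rule order_trans)
      qed
    qed (use C S0 in simp)
    moreover have "H1_value (\<rho> s) x = rep \<rho> s x" "H1_value (\<rho>' s) x = rep \<rho>' s x" if "x \<in> {0..1}" for x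
      using elim that by blast+
    then have "\<bar>p s\<bar> \<le> (C * sqrt 2) * S s" "\<bar>q s\<bar> \<le> (C * sqrt 2) * S s"
      unfolding p_def q_def using order_trans[OF b0_lip rb[of 0]] order_trans[OF b1_lip rb[of 1]] by simp_all
    ultimately show ?case using L by blast
  qed
  have bA: "AE s in lebesgue_on {0..T}. L2 (W s) \<and> nrm (W s) \<le> 2 * C \<and> \<bar>p s\<bar> \<le> 2 * C \<and> \<bar>q s\<bar> \<le> 2 * C"
    using g(1) g'(1)
  proof eventually_elim
    case (elim s)
    then have L: "L2 (Wf \<rho> s)" "L2 (Wf \<rho>' s)" by auto
    have L0: "L2 (\<lambda>_. 0)" by (simp add: L2_iff)
    have "nrm (W s) \<le> nrm (\<lambda>x. Wf \<rho> s x - 0) + nrm (\<lambda>x. 0 - Wf \<rho>' s x)"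
      unfolding W_def[abs_def] by (rule nrm_diff_triangle[OF L(1) L0 L(2)])
    also have "\<dots> \<le> 2 * C" using elim nrm_minus_commute[of "\<lambda>_. 0" "Wf \<rho>' s"] by simp
    finally have n: "nrm (W s) \<le> 2 * C" .
    have ab: "\<bar>x - y\<bar> \<le> 2 * C" if "\<bar>x\<bar> \<le> C" "\<bar>y\<bar> \<le> C" for x y using that by linarith
    show ?case using n L2_diff[OF L] unfolding W_def[abs_def] p_def q_def
      by (auto intro: ab b0_bdd b1_bdd)
  qed
  have "D k t = 0" if "t \<in> {0..T}" for k t
  proof (rule duhamel_unique[of T "C * sqrt 2" D W p q "2 * C" t k, OF _ _ D m mp bA _ that])
    show "AE s in lebesgue_on {0..T}. nrm (W s) \<le> C * sqrt 2 * (\<Sum>k. \<bar>D k s\<bar>) \<and> \<bar>p s\<bar> \<le> C * sqrt 2 * (\<Sum>k. \<bar>D k s\<bar>) \<and> \<bar>q s\<bar> \<le> C * sqrt 2 * (\<Sum>k. \<bar>D k s\<bar>)"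
      using fin unfolding S_def by eventually_elim simp
  qed (use T C in auto)
  then have eq: "ip (\<rho>' t) (cs k) = ip (\<rho> t) (cs k)" if "t \<in> {0..T}" for t k using that by (simp add: D_def)
  show ?thesis
    using g(1) g'(1) AE_lebesgue_on_in[of 0 T]
  proof eventually_elim
    case (elim t)
    then have "L2 (\<rho> t)" "L2 (\<rho>' t)" using H1_D(1) by blast+
    then show ?case using cosb.eq_AE[of "\<rho>' t" "\<rho> t"] eq elim(3) by blast
  qed
qed

end

text \<open>At \<open>t = 0\<close> the time integrals run over a null set and the identity reduces
  to the initial condition. At positive times the solution is continuous in space, so its traces are
  its point values.\<close>

lemma (in mild) rho_weak_sol: "weak_sol rho"
  unfolding weak_sol_def profile_def
proof (intro conjI ballI allI impI)
  show "(\<lambda>(t, x). rho t x) \<in> borel_measurable (lebesgue_on (Omega T))" by (rule rho_measurable)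
  show "AE (t, x) in lebesgue_on (Omega T). 0 \<le> rho t x \<and> rho t x \<le> 1"
  proof (rule AE_I2)
    fix z assume "z \<in> space (lebesgue_on (Omega T))"
    then have "fst z \<in> {0..T}" "snd z \<in> {0..1}" by (auto simp: Omega_def)
    then show "case z of (t, x) \<Rightarrow> 0 \<le> rho t x \<and> rho t x \<le> 1" using rho_01[of "fst z" "snd z"] by (auto simp: split_beta)
  qed
  show "AE t in lebesgue_on {0..T}. H1 (rho t)" using rho_AE by eventually_elim blast
  fix t Q Qt Qx assume t: "t \<in> {0..T}" and td: "test_data T Q Qt Qx"
  show "ip (rho t) (Q t) - ip \<gamma> (Q 0) - (LINT s|lebesgue_on {0..t}. ip (rho s) (Qt s))
        = (LINT s|lebesgue_on {0..t}. - ip (weak_grad (rho s)) (Qx s) + ip (Wf rho s) (Qx s))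
          + (LINT s|lebesgue_on {0..t}. b0 s (H1_value (rho s) 0) * Q s 0 + b1 s (H1_value (rho s) 1) * Q s 1)"
  proof (cases "t = 0")
    case True
    have z: "(LINT s|lebesgue_on {0..0}. f s) = 0" for f :: "real \<Rightarrow> real"
    proof (rule integral_eq_zero_AE)
      show "AE s in lebesgue_on {0..0::real}. f s = 0"
        using AE_lebesgue_on_ne[where a = 0 and b = 0 and c = 0] AE_lebesgue_on_in[of 0 0] by eventually_elim simp
    qed
    show ?thesis unfolding True z by (simp add: rho_def)
  next
    case False
    then have t': "t \<in> {0<..T}" using t by auto
    have ae: "AE s in lebesgue_on {0..t}. rho s = u s \<and> Wf rho s = Wf u s \<and> H1_value (u s) 0 = u s 0 \<and> H1_value (u s) 1 = u s 1"
    proof (rule eventually_mono[OF AE_lebesgue_on_subset[OF rho_AE, of 0 t]])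
      fix s assume s: "s \<in> {0<..T} \<and> rho s = u s \<and> H1 (rho s)"
      then have H: "H1 (u s)" by metis
      have "H1_value (u s) x = u s x" if "x \<in> {0..1}" for x
        by (rule H1_value_eq) (use s that u_facts(1)[of s] in auto)
      then show "rho s = u s \<and> Wf rho s = Wf u s \<and> H1_value (u s) 0 = u s 0 \<and> H1_value (u s) 1 = u s 1"
        using s by (auto simp: Wf_def[abs_def])
    qed (use t in auto)
    have "(LINT s|lebesgue_on {0..t}. ip (rho s) (Qt s)) = (LINT s|lebesgue_on {0..t}. ip (u s) (Qt s))"
      "(LINT s|lebesgue_on {0..t}. - ip (weak_grad (rho s)) (Qx s) + ip (Wf rho s) (Qx s))
       = (LINT s|lebesgue_on {0..t}. - ip (weak_grad (u s)) (Qx s) + ip (Wf u s) (Qx s))"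
      "(LINT s|lebesgue_on {0..t}. b0 s (H1_value (rho s) 0) * Q s 0 + b1 s (H1_value (rho s) 1) * Q s 1)
       = (LINT s|lebesgue_on {0..t}. b0 s (u s 0) * Q s 0 + b1 s (u s 1) * Q s 1)"
      by (rule integral_cong_AE_Icc; use ae in eventually_elim; simp)+
    then show ?thesis using mild_weak_formulation[OF td t'] rho_pos[OF t'] by simp
  qed
qed

section \<open>The boundary driven equation\<close>

lemma mobility_bound:
  assumes "a \<in> {0..1}" shows "\<bar>mobility a\<bar> \<le> 1"
proof -
  have "\<bar>a\<bar> * \<bar>1 - a\<bar> \<le> 1 * 1" using assms by (intro mult_mono) auto
  then show ?thesis by (simp add: mobility_def abs_mult)
qed

lemma mobility_lipschitz:
  assumes "a \<in> {0..1}" "b \<in> {0..1}" shows "\<bar>mobility a - mobility b\<bar> \<le> \<bar>a - b\<bar>"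
proof -
  have "mobility a - mobility b = (1 - a - b) * (a - b)" by (simp add: mobility_def algebra_simps)
  moreover have "\<bar>1 - a - b\<bar> * \<bar>a - b\<bar> \<le> 1 * \<bar>a - b\<bar>" using assms by (intro mult_right_mono) (auto simp: abs_le_iff)
  ultimately show ?thesis by (simp add: abs_mult)
qed

lemma integrable_mult_continuous:
  assumes f: "integrable I01 f" and g: "continuous_on {0..1} (g :: real \<Rightarrow> real)"
  shows "integrable I01 (\<lambda>x. f x * g x)"
proof -
  obtain B where B: "\<And>x. x \<in> {0..1} \<Longrightarrow> \<bar>g x\<bar> \<le> B" using continuous_on_bounded_01[OF g] by metis
  show ?thesis
  proof (rule Bochner_Integration.integrable_bound)
    show "integrable I01 (\<lambda>x. B * f x)" using f by simp
    show "(\<lambda>x. f x * g x) \<in> borel_measurable I01"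
      by (intro borel_measurable_times borel_measurable_integrable f continuous_on_measurable_01 g)
    show "AE x in I01. norm (f x * g x) \<le> norm (B * f x)"
    proof (rule AE_I2)
      fix x assume "x \<in> space I01"
      then have "\<bar>g x\<bar> \<le> \<bar>B\<bar>" using B[of x] by auto
      then show "norm (f x * g x) \<le> norm (B * f x)"
        using mult_right_mono[of "\<bar>g x\<bar>" "\<bar>B\<bar>" "\<bar>f x\<bar>"] by (simp add: abs_mult mult.commute)
    qed
  qed
qed

text \<open>\<open>HD\<close> is the continuous extension of the space derivative of
  \<open>H\<close> to the closed cylinder; it is what makes the flux continuous up to the
  boundary.\<close>

locale boundary_driven =
  fixes T \<alpha> \<beta> :: real and l :: nat and Rm Rp :: "config \<Rightarrow> config \<Rightarrow> real"
    and \<gamma> :: "real \<Rightarrow> real" and H HD :: "real \<Rightarrow> real \<Rightarrow> real"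
  assumes T: "T > 0"
    and Rm: "\<And>\<eta> \<xi>. \<eta> \<in> configs l \<Longrightarrow> \<xi> \<in> configs l \<Longrightarrow> Rm \<eta> \<xi> \<ge> 0"
    and Rp: "\<And>\<eta> \<xi>. \<eta> \<in> configs l \<Longrightarrow> \<xi> \<in> configs l \<Longrightarrow> Rp \<eta> \<xi> \<ge> 0"
    and \<gamma>_meas: "\<gamma> \<in> borel_measurable I01" and \<gamma>_01: "\<And>x. x \<in> {0..1} \<Longrightarrow> \<gamma> x \<in> {0..1}"
    and H: "continuous_on (Omega T) (\<lambda>(t, x). H t x)" and HD: "continuous_on (Omega T) (\<lambda>(t, x). HD t x)"
    and H_deriv: "\<And>t x. t \<in> {0<..<T} \<Longrightarrow> x \<in> {0<..<1} \<Longrightarrow> (H t has_real_derivative HD t x) (at x)"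
    and \<alpha>: "\<alpha> \<ge> 0" and \<beta>: "\<beta> \<ge> 0"
begin

text \<open>
  The coefficients are extended to the whole space by clipping, so that they are globally bounded
  and Lipschitz; on values in \<open>[0,1]\<close> the extension changes nothing.
\<close>

definition V :: "real \<Rightarrow> real \<Rightarrow> real \<Rightarrow> real" where
  "V s x u = 2 * \<alpha> * mobility (clip 0 1 u) * HD (clip 0 T s) (clip 0 1 x)"

definition bdry :: "(config \<Rightarrow> config \<Rightarrow> real) \<Rightarrow> real \<Rightarrow> real \<Rightarrow> real \<Rightarrow> real" where
  "bdry R x s u = bflux l R \<alpha> \<beta> (clip 0 1 u) (H (clip 0 T s) x)"

lemma continuous_clip_Omega:
  fixes h :: "real \<Rightarrow> real \<Rightarrow> real"
  assumes "continuous_on (Omega T) (\<lambda>(t, x). h t x)" "continuous_on A f" "continuous_on A g" "\<And>z. z \<in> A \<Longrightarrow> g z \<in> {0..1}"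
  shows "continuous_on A (\<lambda>z. h (clip 0 T (f z)) (g z))"
proof -
  have "continuous_on A (\<lambda>z. (\<lambda>(t, x). h t x) (clip 0 T (f z), g z))"
  proof (rule continuous_on_compose2[OF assms(1)])
    show "continuous_on A (\<lambda>z. (clip 0 T (f z), g z))" by (intro continuous_intros assms)
    show "(\<lambda>z. (clip 0 T (f z), g z)) ` A \<subseteq> Omega T" using assms(4) clip_in[of 0 T] T by (auto simp: Omega_def)
  qed
  then show ?thesis by simp
qed

text \<open>\<open>H\<close> is bounded on the compact cylinder, which confines the argument
  \<open>M\<close> of the currents to a bounded range. The constant is the sum of those of the bulk
  flux and of the two currents.\<close>

lemma flux_exists: "\<exists>C. flux T C V (bdry Rm 0) (bdry Rp 1) \<gamma>"
proof -
  obtain K where K: "K \<ge> 0" "\<And>t x. t \<in> {0..T} \<Longrightarrow> x \<in> {0..1} \<Longrightarrow> \<bar>H t x\<bar> \<le> K"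
    using continuous_Omega_bounded[OF H] by blast
  obtain L where L: "L \<ge> 0" "\<And>t x. t \<in> {0..T} \<Longrightarrow> x \<in> {0..1} \<Longrightarrow> \<bar>HD t x\<bar> \<le> L"
    using continuous_Omega_bounded[OF HD] by blast
  obtain Bm where Bm: "Bm \<ge> 0"
    "\<And>a b M. a \<in> {0..1} \<Longrightarrow> b \<in> {0..1} \<Longrightarrow> \<bar>M\<bar> \<le> K \<Longrightarrow> \<bar>bflux l Rm \<alpha> \<beta> a M - bflux l Rm \<alpha> \<beta> b M\<bar> \<le> Bm * \<bar>a - b\<bar>"
    "\<And>a M. a \<in> {0..1} \<Longrightarrow> \<bar>M\<bar> \<le> K \<Longrightarrow> \<bar>bflux l Rm \<alpha> \<beta> a M\<bar> \<le> Bm"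
    using bflux_lipschitz[OF \<alpha> \<beta>] by blast
  obtain Bp where Bp: "Bp \<ge> 0"
    "\<And>a b M. a \<in> {0..1} \<Longrightarrow> b \<in> {0..1} \<Longrightarrow> \<bar>M\<bar> \<le> K \<Longrightarrow> \<bar>bflux l Rp \<alpha> \<beta> a M - bflux l Rp \<alpha> \<beta> b M\<bar> \<le> Bp * \<bar>a - b\<bar>"
    "\<And>a M. a \<in> {0..1} \<Longrightarrow> \<bar>M\<bar> \<le> K \<Longrightarrow> \<bar>bflux l Rp \<alpha> \<beta> a M\<bar> \<le> Bp"
    using bflux_lipschitz[OF \<alpha> \<beta>] by blast
  define C where "C = 2 * \<alpha> * L + Bm + Bp"
  have C: "C \<ge> 0" "2 * \<alpha> * L \<le> C" "Bm \<le> C" "Bp \<le> C" using \<alpha> L(1) Bm(1) Bp(1) by (auto simp: C_def)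
  have cs01: "clip 0 T s \<in> {0..T}" "clip 0 1 x \<in> {0..1}" for s x :: real
    using clip_in[of 0 T s] clip_in[of 0 1 x] T by auto
  have end01: "(0::real) \<in> {0..1}" "(1::real) \<in> {0..1}" by auto
  have lip: "B * \<bar>clip 0 1 u - clip 0 1 v\<bar> \<le> C * \<bar>u - v\<bar>" if "B \<le> C" for B u v
    using that C(1) by (intro mult_mono clip_lipschitz) auto
  have ends: "u \<le> 0 \<Longrightarrow> clip 0 1 u = 0" "u \<ge> 1 \<Longrightarrow> clip 0 1 u = 1" for u by (auto simp: clip_def)
  have V_bdd: "\<bar>V s x u\<bar> \<le> C" for s x u
  proof -
    have "\<bar>2 * \<alpha>\<bar> * \<bar>mobility (clip 0 1 u)\<bar> * \<bar>HD (clip 0 T s) (clip 0 1 x)\<bar> \<le> 2 * \<alpha> * 1 * L"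
      using \<alpha> L by (intro mult_mono mobility_bound L(2) cs01 mult_nonneg_nonneg) auto
    then show ?thesis using C(2) by (simp add: V_def abs_mult)
  qed
  have V_lip: "\<bar>V s x u - V s x v\<bar> \<le> C * \<bar>u - v\<bar>" for s x u v
  proof -
    have "\<bar>V s x u - V s x v\<bar> = \<bar>2 * \<alpha>\<bar> * \<bar>HD (clip 0 T s) (clip 0 1 x)\<bar> * \<bar>mobility (clip 0 1 u) - mobility (clip 0 1 v)\<bar>"
      unfolding V_def abs_mult[symmetric] by (simp add: algebra_simps)
    also have "\<dots> \<le> 2 * \<alpha> * L * \<bar>clip 0 1 u - clip 0 1 v\<bar>"
      using \<alpha> L by (intro mult_mono mobility_lipschitz L(2) cs01 mult_nonneg_nonneg) auto
    also have "\<dots> \<le> C * \<bar>u - v\<bar>" by (rule lip[OF C(2)])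
    finally show ?thesis .
  qed
  have b_bdd: "\<bar>bdry Rm 0 s u\<bar> \<le> C" "\<bar>bdry Rp 1 s u\<bar> \<le> C" for s u
    unfolding bdry_def
    by (rule order_trans[OF Bm(3)[OF cs01(2) K(2)[OF cs01(1) end01(1)]] C(3)]
             order_trans[OF Bp(3)[OF cs01(2) K(2)[OF cs01(1) end01(2)]] C(4)])+
  have b_lip: "\<bar>bdry Rm 0 s u - bdry Rm 0 s v\<bar> \<le> C * \<bar>u - v\<bar>" "\<bar>bdry Rp 1 s u - bdry Rp 1 s v\<bar> \<le> C * \<bar>u - v\<bar>" for s u v
    unfolding bdry_def
    by (rule order_trans[OF Bm(2)[OF cs01(2) cs01(2) K(2)[OF cs01(1) end01(1)]] lip[OF C(3)]]
             order_trans[OF Bp(2)[OF cs01(2) cs01(2) K(2)[OF cs01(1) end01(2)]] lip[OF C(4)]])+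
  have V_0: "V s x u = 0" if "u \<le> 0 \<or> u \<ge> 1" for s x u
    using that ends[of u] by (auto simp: V_def mobility_def)
  have sign: "u \<le> 0 \<Longrightarrow> bdry R x s u \<ge> 0" "u \<ge> 1 \<Longrightarrow> bdry R x s u \<le> 0"
    if "\<And>\<eta> \<xi>. \<eta> \<in> configs l \<Longrightarrow> \<xi> \<in> configs l \<Longrightarrow> R \<eta> \<xi> \<ge> 0" for R x s u
    using bflux_sign[OF \<alpha> \<beta> that] ends[of u] by (auto simp: bdry_def)
  have V_cont: "continuous_on UNIV (\<lambda>(s, x, u). V s x u)"
    unfolding V_def mobility_def split_beta
    by (intro continuous_intros continuous_clip_Omega[OF HD] cs01)
  have b_cont: "continuous_on UNIV (\<lambda>(s, u). bdry R x s u)" if "x \<in> {0..1}" for R x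
    unfolding bdry_def split_beta
    by (intro continuous_intros continuous_clip_Omega[OF H] that)
  show ?thesis
    by (rule exI[of _ C], rule flux.intro)
      (intro T C(1) V_bdd V_lip b_bdd b_lip V_0 V_cont \<gamma>_meas \<gamma>_01 sign[OF Rm] sign[OF Rp] b_cont end01; assumption)+
qed

text \<open>The two formulations differ in the derivatives of the test function and of
  \<open>H\<close>, in the order of integration, and in the clipping. The derivatives agree in the
  interior, the orders by Fubini, and the clipping is void because density and traces lie in
  \<open>[0,1]\<close>; each difference thus lives on null sets.\<close>

lemma weak_solution_iff:
  assumes fl: "flux T C V (bdry Rm 0) (bdry Rp 1) \<gamma>"
  shows "weak_solution T l Rm Rp \<alpha> \<beta> \<gamma> H \<rho> \<longleftrightarrow>
    L2_H1 T \<rho> \<and> (\<forall>t\<in>{0..T}. integrable I01 (\<rho> t)) \<and> flux.weak_sol T V (bdry Rm 0) (bdry Rp 1) \<gamma> \<rho>"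
proof -
  interpret flux T C V "bdry Rm 0" "bdry Rp 1" \<gamma> by (rule fl)
  let ?lhs = "\<lambda>t G. LINT x:{0..1}|lebesgue. \<rho> t x * G t x - \<gamma> x * G 0 x - (LINT s:{0..t}|lebesgue. \<rho> s x * dt G s x)"
  let ?bulk = "\<lambda>t G. LINT s:{0..t}|lebesgue. (LINT x:{0..1}|lebesgue.
             - weak_grad (\<rho> s) x * dx G s x + 2 * \<alpha> * mobility (\<rho> s x) * dx H s x * dx G s x)"
  let ?bdry = "\<lambda>t G :: real \<Rightarrow> real \<Rightarrow> real. LINT s:{0..t}|lebesgue.
             (\<beta> * bdry_F l Rm (H1_value (\<rho> s) 0) + \<alpha> * bdry_p l Rm (H1_value (\<rho> s) 0) (H s 0)) * G s 0
           + (\<beta> * bdry_F l Rp (H1_value (\<rho> s) 1) + \<alpha> * bdry_p l Rp (H1_value (\<rho> s) 1) (H s 1)) * G s 1"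
  have eqs: "?lhs t G = ip (\<rho> t) (G t) - ip \<gamma> (G 0) - (LINT s|lebesgue_on {0..t}. ip (\<rho> s) (Gt s))"
      "?bulk t G = (LINT s|lebesgue_on {0..t}. - ip (weak_grad (\<rho> s)) (Gx s) + ip (Wf \<rho> s) (Gx s))"
      "?bdry t G = (LINT s|lebesgue_on {0..t}. bdry Rm 0 s (H1_value (\<rho> s) 0) * G s 0 + bdry Rp 1 s (H1_value (\<rho> s) 1) * G s 1)"
    if pr: "profile \<rho>" and int: "\<forall>t\<in>{0..T}. integrable I01 (\<rho> t)" and t: "t \<in> {0..T}" and td: "test_data T G Gt Gx"
    for t G Gt Gx
  proof -
    have cG: "continuous_on (Omega T) (\<lambda>(t, x). G t x)" "continuous_on (Omega T) (\<lambda>(t, x). Gt t x)"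
      "continuous_on (Omega T) (\<lambda>(t, x). Gx t x)" using td by (auto simp: test_data_def)
    have ts: "0 \<in> {0..T}" "{0..t} \<subseteq> {0..T}" using t by auto
    have inner: "AE s in lebesgue_on {0..t}. s \<in> {0<..<T} \<and> s \<in> {0..t}"
      using AE_lebesgue_on_ne[where a = 0 and b = t and c = 0] AE_lebesgue_on_ne[where a = 0 and b = t and c = T]
        AE_lebesgue_on_in[of 0 t] by eventually_elim (use t in auto)
    note good = AE_lebesgue_on_subset[OF profile_facts(1)[OF pr] ts(2)]
    obtain B where B: "B \<ge> 0" "\<And>t x. t \<in> {0..T} \<Longrightarrow> x \<in> {0..1} \<Longrightarrow> \<bar>Gt t x\<bar> \<le> B"
      using continuous_Omega_bounded[OF cG(2)] by blast
    have O: "Omega T \<in> sets lebesgue" using compact_Omega by (intro lmeasurable_compact fmeasurableD)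
    have m: "(\<lambda>(s, x). \<rho> s x * Gt s x) \<in> borel_measurable (lebesgue_on (Omega T))"
      using borel_measurable_times[OF _ continuous_imp_measurable_on_sets_lebesgue[OF cG(2) O], of "\<lambda>(t, x). \<rho> t x"] pr
      by (simp add: profile_def split_beta)
    have b: "AE (s, x) in lebesgue_on (Omega T). \<bar>\<rho> s x * Gt s x\<bar> \<le> 1 * B"
    proof -
      have "AE z in lebesgue_on (Omega T). z \<in> Omega T" by (rule AE_I2) simp
      moreover have "AE (t, x) in lebesgue_on (Omega T). 0 \<le> \<rho> t x \<and> \<rho> t x \<le> 1" using pr by (simp add: profile_def)
      ultimately show ?thesis
      proof eventually_elim
        case (elim z)
        then obtain s x where z: "z = (s, x)" "s \<in> {0..T}" "x \<in> {0..1}" "0 \<le> \<rho> s x" "\<rho> s x \<le> 1" by (auto simp: Omega_def)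
        have "\<bar>\<rho> s x\<bar> * \<bar>Gt s x\<bar> \<le> 1 * B" using z B by (intro mult_mono) auto
        then show ?case by (simp add: z(1) abs_mult)
      qed
    qed
    have B1: "0 \<le> 1 * B" using B(1) by simp
    note fub = fubini_Omega(3)[OF m b B1 t] fubini_Omega(4)[OF m b B1 t]
    have "?lhs t G = (LINT x|I01. \<rho> t x * G t x - \<gamma> x * G 0 x - (LINT s|lebesgue_on {0..t}. \<rho> s x * Gt s x))"
      unfolding LINT_01 LINT_Icc
    proof (rule integral_cong_AE_Icc)
      show "AE x in I01. \<rho> t x * G t x - \<gamma> x * G 0 x - (LINT s|lebesgue_on {0..t}. \<rho> s x * dt G s x)
          = \<rho> t x * G t x - \<gamma> x * G 0 x - (LINT s|lebesgue_on {0..t}. \<rho> s x * Gt s x)"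
        using AE_I01_interior
      proof eventually_elim
        case (elim x)
        have "(LINT s|lebesgue_on {0..t}. \<rho> s x * dt G s x) = (LINT s|lebesgue_on {0..t}. \<rho> s x * Gt s x)"
        proof (rule integral_cong_AE_Icc)
          show "AE s in lebesgue_on {0..t}. \<rho> s x * dt G s x = \<rho> s x * Gt s x"
            using inner by eventually_elim (use test_data_deriv(1)[OF td _ elim] in simp)
        qed
        then show ?case by simp
      qed
    qed
    also have "\<dots> = (LINT x|I01. \<rho> t x * G t x) - (LINT x|I01. \<gamma> x * G 0 x) - (LINT x|I01. LINT s|lebesgue_on {0..t}. \<rho> s x * Gt s x)"
    proof -
      \<comment> \<open>Splitting the integral needs \<open>\<rho> t\<close> integrable at this very
        time, not only at almost every one.\<close>
      have i: "integrable I01 (\<lambda>x. \<rho> t x * G t x)" "integrable I01 (\<lambda>x. \<gamma> x * G 0 x)"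
        using int t L2_integrable[OF L2_\<gamma>]
        by (auto intro!: integrable_mult_continuous continuous_Omega_slice[OF cG(1)] ts)
      show ?thesis using i fub(1) by simp
    qed
    finally show "?lhs t G = ip (\<rho> t) (G t) - ip \<gamma> (G 0) - (LINT s|lebesgue_on {0..t}. ip (\<rho> s) (Gt s))"
      unfolding fub(2) ip_def .
    show "?bulk t G = (LINT s|lebesgue_on {0..t}. - ip (weak_grad (\<rho> s)) (Gx s) + ip (Wf \<rho> s) (Gx s))"
      unfolding LINT_01 LINT_Icc
    proof (rule integral_cong_AE_Icc)
      show "AE s in lebesgue_on {0..t}. (LINT x|I01. - weak_grad (\<rho> s) x * dx G s x + 2 * \<alpha> * mobility (\<rho> s x) * dx H s x * dx G s x)
         = - ip (weak_grad (\<rho> s)) (Gx s) + ip (Wf \<rho> s) (Gx s)"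
        using good inner
      proof eventually_elim
        case (elim s)
        then have s: "s \<in> {0<..<T}" "s \<in> {0..T}" and L: "L2 (weak_grad (\<rho> s))" "L2 (Wf \<rho> s)" using H1_D(2)[of "\<rho> s"] by auto
        have LG: "L2 (Gx s)" by (rule L2_continuous[OF continuous_Omega_slice[OF cG(3) s(2)]])
        have "AE x in I01. \<rho> s x = rep \<rho> s x" using elim by blast
        then have ae: "AE x in I01. - weak_grad (\<rho> s) x * dx G s x + 2 * \<alpha> * mobility (\<rho> s x) * dx H s x * dx G s x
            = - (weak_grad (\<rho> s) x * Gx s x) + Wf \<rho> s x * Gx s x"
          using AE_I01_interior
        proof eventually_elim
          case e: (elim x)
          then have x: "x \<in> {0..1}" by auto
          then have "\<rho> s x \<in> {0..1}" using e(1) elim by metis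
          then have "Wf \<rho> s x = 2 * \<alpha> * mobility (\<rho> s x) * HD s x" using x s(2) by (simp add: Wf_def V_def)
          moreover have "dx H s x = HD s x" unfolding dx_def by (rule DERIV_imp_deriv[OF H_deriv[OF s(1) e(2)]])
          ultimately show ?case using test_data_deriv(2)[OF td s(1) e(2)] by simp
        qed
        show ?case
          unfolding integral_cong_AE_Icc[OF ae] ip_def
          using L2_mult_integrable[OF L(1) LG] L2_mult_integrable[OF L(2) LG] by simp
      qed
    qed
    show "?bdry t G = (LINT s|lebesgue_on {0..t}. bdry Rm 0 s (H1_value (\<rho> s) 0) * G s 0 + bdry Rp 1 s (H1_value (\<rho> s) 1) * G s 1)"
      unfolding LINT_Icc
    proof (rule integral_cong_AE_Icc)
      show "AE s in lebesgue_on {0..t}. (\<beta> * bdry_F l Rm (H1_value (\<rho> s) 0) + \<alpha> * bdry_p l Rm (H1_value (\<rho> s) 0) (H s 0)) * G s 0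
           + (\<beta> * bdry_F l Rp (H1_value (\<rho> s) 1) + \<alpha> * bdry_p l Rp (H1_value (\<rho> s) 1) (H s 1)) * G s 1
          = bdry Rm 0 s (H1_value (\<rho> s) 0) * G s 0 + bdry Rp 1 s (H1_value (\<rho> s) 1) * G s 1"
        using good inner
      proof eventually_elim
        case (elim s)
        then have s: "s \<in> {0..T}" by auto
        have "H1_value (\<rho> s) x \<in> {0..1}" if "x \<in> {0..1}" for x using elim that by metis
        then have v: "H1_value (\<rho> s) 0 \<in> {0..1}" "H1_value (\<rho> s) 1 \<in> {0..1}" by auto
        show ?case unfolding bflux_eq[OF v(1)] bflux_eq[OF v(2)] bdry_def clip_id[OF v(1)] clip_id[OF v(2)] clip_id[OF s] ..
      qed
    qed
  qed
  have pr: "profile \<rho> \<longleftrightarrow> (AE (t, x) in lebesgue_on (Omega T). 0 \<le> \<rho> t x \<and> \<rho> t x \<le> 1)" if "L2_H1 T \<rho>"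
    using that by (auto simp: profile_def L2_H1_def)
  show ?thesis
  proof (intro iffI conjI)
    assume w: "weak_solution T l Rm Rp \<alpha> \<beta> \<gamma> H \<rho>"
    then show h: "L2_H1 T \<rho>" and i: "\<forall>t\<in>{0..T}. integrable I01 (\<rho> t)"
      unfolding weak_solution_def set_integrable_01 by blast+
    have p: "profile \<rho>" using w unfolding pr[OF h] weak_solution_def by blast
    show "weak_sol \<rho>"
      unfolding weak_sol_def
    proof (intro conjI p ballI allI impI)
      fix t G Gt Gx assume G: "t \<in> {0..T}" "C_mn T 1 2 G" "test_data T G Gt Gx"
      have "?lhs t G = ?bulk t G + ?bdry t G" using w G(1,2) unfolding weak_solution_def by blast
      then show "ip (\<rho> t) (G t) - ip \<gamma> (G 0) - (LINT s|lebesgue_on {0..t}. ip (\<rho> s) (Gt s))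
        = (LINT s|lebesgue_on {0..t}. - ip (weak_grad (\<rho> s)) (Gx s) + ip (Wf \<rho> s) (Gx s))
          + (LINT s|lebesgue_on {0..t}. bdry Rm 0 s (H1_value (\<rho> s) 0) * G s 0 + bdry Rp 1 s (H1_value (\<rho> s) 1) * G s 1)"
        unfolding eqs[OF p i G(1,3)] .
    qed
  next
    assume a: "L2_H1 T \<rho> \<and> (\<forall>t\<in>{0..T}. integrable I01 (\<rho> t)) \<and> weak_sol \<rho>"
    then have p: "profile \<rho>" by (simp add: weak_sol_def)
    show "weak_solution T l Rm Rp \<alpha> \<beta> \<gamma> H \<rho>"
      unfolding weak_solution_def
    proof (intro conjI ballI allI impI)
      show "L2_H1 T \<rho>" using a by blast
      show "AE (t, x) in lebesgue_on (Omega T). 0 \<le> \<rho> t x \<and> \<rho> t x \<le> 1" using p by (simp add: profile_def)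
      show "set_integrable lebesgue {0..1} (\<rho> t)" if "t \<in> {0..T}" for t using a that unfolding set_integrable_01 by blast
      fix t G assume G: "t \<in> {0..T}" "C_mn T 1 2 G"
      obtain Gt Gx where td: "test_data T G Gt Gx" using C_mn_test_data[OF G(2)] .
      have i: "\<forall>t\<in>{0..T}. integrable I01 (\<rho> t)" using a by blast
      show "?lhs t G = ?bulk t G + ?bdry t G"
        unfolding eqs[OF p i G(1) td] using a G td unfolding weak_sol_def by blast
    qed
  qed
qed

end

theorem theoremC1:
  fixes T \<alpha> \<beta> :: real and l :: nat
    and Rm Rp :: "config \<Rightarrow> config \<Rightarrow> real"
    and \<gamma> :: "real \<Rightarrow> real" and H :: "real \<Rightarrow> real \<Rightarrow> real"
  assumes "T > 0"
    and "\<And>\<eta> \<xi>. \<eta> \<in> configs l \<Longrightarrow> \<xi> \<in> configs l \<Longrightarrow> Rm \<eta> \<xi> \<ge> 0"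
    and "\<And>\<eta> \<xi>. \<eta> \<in> configs l \<Longrightarrow> \<xi> \<in> configs l \<Longrightarrow> Rp \<eta> \<xi> \<ge> 0"
    and "\<gamma> \<in> borel_measurable (lebesgue_on {0..1})"
    and "\<And>x. x \<in> {0..1} \<Longrightarrow> \<gamma> x \<in> {0..1}"
    and "C_mn T 0 1 H"
    and "\<alpha> \<ge> 0" and "\<beta> \<ge> 0"
  shows "\<exists>\<rho>. weak_solution T l Rm Rp \<alpha> \<beta> \<gamma> H \<rho> \<and>
           (\<forall>\<rho>'. weak_solution T l Rm Rp \<alpha> \<beta> \<gamma> H \<rho>' \<longrightarrow>
              (AE t in lebesgue_on {0..T}. AE x in lebesgue_on {0..1}. \<rho>' t x = \<rho> t x))"
proof -
  obtain Dx where Dx: "Dx 0 = H" "\<forall>j\<le>1. continuous_on (Omega T) (\<lambda>(t, x). Dx j t x)"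
    "\<forall>j<1. \<forall>t\<in>{0<..<T}. \<forall>x\<in>{0<..<1}. ((\<lambda>y. Dx j t y) has_real_derivative Dx (Suc j) t x) (at x)"
    using assms(6) unfolding C_mn_def by (elim exE conjE) (rule that; assumption)
  interpret boundary_driven T \<alpha> \<beta> l Rm Rp \<gamma> H "Dx 1"
    using assms(1-5,7,8) Dx(2)[rule_format, of 0] Dx(2)[rule_format, of 1] Dx(3)[rule_format, of 0] Dx(1)
    by unfold_locales simp_all
  obtain C where fl: "flux T C V (bdry Rm 0) (bdry Rp 1) \<gamma>" using flux_exists by blast
  interpret F: flux T C V "bdry Rm 0" "bdry Rp 1" \<gamma> by (rule fl)
  obtain u where u: "continuous_on ({0<..T} \<times> {0..1}) (\<lambda>(t, x). u t x)"
    "\<forall>t\<in>{0<..T}. summable (\<lambda>k. \<bar>F.hc t k + duhamel (F.force u k) k t\<bar>) \<and>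
        (\<forall>x. u t x = cser (\<lambda>k. F.hc t k + duhamel (F.force u k) k t) x)"
    using F.mild_solution_exists by blast
  interpret M: mild T C V "bdry Rm 0" "bdry Rp 1" \<gamma> u
    using u by unfold_locales blast+
  have "integrable I01 (M.rho t)" if "t \<in> {0..T}" for t
    using L2_integrable[OF F.L2_\<gamma>] L2_integrable[OF M.u_facts(2)[of t]] that
    by (cases "t = 0") (auto simp: M.rho_def)
  then have "weak_solution T l Rm Rp \<alpha> \<beta> \<gamma> H M.rho"
    unfolding weak_solution_iff[OF fl] using M.rho_L2_H1 M.rho_weak_sol by blast
  moreover from this have "AE t in lebesgue_on {0..T}. AE x in lebesgue_on {0..1}. \<rho>' t x = M.rho t x"
    if "weak_solution T l Rm Rp \<alpha> \<beta> \<gamma> H \<rho>'" for \<rho>'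
    using that F.weak_sol_unique unfolding weak_solution_iff[OF fl] by blast
  ultimately show ?thesis by blast
qed

end
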